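(* For all $(\xi,\eta)\in(\mathbb{Z}/2\mathbb{Z})^2\times(\mathbb{Z}/2\mathbb{Z})$ the family of operators $\mathbf{A}_{\xi,\lambda}^{\eta,\nu}:\pi_{\xi,\lambda}\to\tau_{(\xi_2,\eta,\xi_1),(\lambda_2,\nu,\lambda_1)}$ depends holomorphically on $(\lambda,\nu)\in\mathbb{C}^2\times\mathbb{C}$.
   Context: For $\varepsilon\in\mathbb{Z}/2\mathbb{Z}$, $\mu\in\mathbb{C}$, $x\in\mathbb{R}^\times$ put $|x|_\varepsilon^\mu=\operatorname{sgn}(x)^\varepsilon|x|^\mu$; $[\varepsilon]\in\{0,1\}$ denotes the representative of $\varepsilon$. Let $G=\mathrm{GL}(2n,\mathbb{R})$ and $H=\mathrm{GL}(2n-1,\mathbb{R})\subseteq G$ (upper left corner). $\pi_{\xi,\lambda}$ is the left regular representation of $G$ on the space of $f\in C^\infty(G)$ with $f\big(g\begin{pmatrix}g_1&*\\ 0&g_2\end{pmatrix}\big)=|\det g_1|_{\xi_1}^{-\lambda_1-\frac n2}|\det g_2|_{\xi_2}^{-\lambda_2+\frac n2}f(g)$, $g_1,g_2\in\mathrm{GL}(n,\mathbb{R})$. $\tau_{\eta,\nu}$ ($\eta\in(\mathbb{Z}/2\mathbb{Z})^3,\nu\in\mathbb{C}^3$) is the left regular representation of $H$ on the space of $f\in C^\infty(H)$ with $f(hp)=|\det p_1|_{\eta_1}^{-\nu_1-\frac n2}|p_2|_{\eta_2}^{-\nu_2}|\det p_3|_{\eta_3}^{-\nu_3+\frac n2}f(h)$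 for block upper triangular $p\in H$ with diagonal blocks $p_1\in\mathrm{GL}(n-1,\mathbb{R})$, $p_2\in\mathrm{GL}(1,\mathbb{R})$, $p_3\in\mathrm{GL}(n-1,\mathbb{R})$. Define $$A_{\xi,\lambda}^{\eta,\nu}f(h)=\int_{\mathbb{R}^{n\times n}}|\det X|_{\xi_1+\eta}^{\lambda_1-\nu-\frac n2}\,|{\det}_{n-1}(X)|_{\eta+\xi_2}^{\nu-\lambda_2-\frac n2}\,f\Big(h\begin{pmatrix}I_n&0\\ X&I_n\end{pmatrix}\Big)dX,\qquad {\det}_{n-1}(X)=\det(X_{ij})_{1\le i,j\le n-1},$$ which converges for $\operatorname{Re}(\lambda_1-\nu)>\frac{n-2}2$, $\operatorname{Re}(\nu-\lambda_2)>\frac{n-2}2$ and is known to extend meromorphically to all $(\lambda,\nu)\in\mathbb{C}^2\times\mathbb{C}$, and set $\mathbf{A}_{\xi,\lambda}^{\eta,\nu}=n_{\mathbf{A}}(\xi,\lambda,\eta,\nu)^{-1}A_{\xi,\lambda}^{\eta,\nu}$ with $$n_{\mathbf{A}}(\xi,\lambda,\eta,\nu)=\Gamma\big(\tfrac{\lambda_1-\nu+1-\frac n2+[\xi_1+\eta]}{2}\big)\Gamma\big(\tfrac{\nu-\lambda_2+1-\frac n2+[\xi_2+\eta]}{2}\big)\prod_{i=2}^n\Gamma\big(\tfrac{\lambda_1-\lambda_2+i-n+[\xi_1+\xi_2]}{2}\big).$$ Meromorphic/holomorphic dependence is understood in the compact picture: restriction to $O(2n)$ resp. $O(2n-1)$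 identifies the representation spaces with function spaces independent of $(\lambda,\nu)$. *)

theory Defs
  imports "HOL-Analysis.Analysis" "HOL-Library.Z2"
begin

section \<open>Index types\<close>

text \<open>
  Throughout \<open>n = CARD('n)\<close>, so that \<open>n \<ge> 1\<close> is arbitrary.  Matrices in \<open>GL(2n)\<close> are indexed by
  \<open>'n + 'n\<close> (the two diagonal blocks of size \<open>n\<close>).  The order on \<open>'n\<close> is only used to single out
  the last index of a block; matrices in \<open>GL(2n-1)\<close> are indexed by \<open>'n + 'n\<close> without its last index.
\<close>

definition last_idx :: "'n::{finite,linorder}" where
  "last_idx = Max UNIV"

typedef (overloaded) ('n::"{finite,linorder}") corner = "UNIV - {Inr last_idx :: 'n + 'n}"
  by blast

instance corner :: ("{finite,linorder}") finite
proof
  have "finite (Rep_corner ` (UNIV :: 'a corner set))"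
    by (rule finite)
  then show "finite (UNIV :: 'a corner set)"
    by (rule finite_imageD) (simp add: inj_on_def Rep_corner_inject)
qed

lemma card_corner: "CARD('n::{finite,linorder} corner) = 2 * CARD('n) - 1"
proof -
  have "CARD('n corner) = card (UNIV - {Inr last_idx :: 'n + 'n})"
    by (rule type_definition.card[OF type_definition_corner])
  then show ?thesis
    by (simp add: card_UNIV_sum card_Diff_singleton)
qed

definition corner_block :: "'n::{finite,linorder} corner \<Rightarrow> nat" where
  "corner_block i =
     (case Rep_corner i of Inl j \<Rightarrow> (if j = last_idx then 1 else 0) | Inr j \<Rightarrow> 2)"

definition embed_corner ::
    "real^('n::{finite,linorder} corner)^('n corner) \<Rightarrow> real^('n + 'n)^('n + 'n)" where
  "embed_corner h = (\<chi> i j.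
     if i = Inr last_idx \<or> j = Inr last_idx then (if i = j then 1 else 0)
     else h $ Abs_corner i $ Abs_corner j)"

definition block_matrix ::
    "real^'n^'n \<Rightarrow> real^'n^'n \<Rightarrow> real^'n^'n \<Rightarrow> real^'n^'n \<Rightarrow> real^('n + 'n)^('n + 'n)" where
  "block_matrix A B C D = (\<chi> i j.
     (case i of
        Inl a \<Rightarrow> (case j of Inl b \<Rightarrow> A $ a $ b | Inr b \<Rightarrow> B $ a $ b)
      | Inr a \<Rightarrow> (case j of Inl b \<Rightarrow> C $ a $ b | Inr b \<Rightarrow> D $ a $ b)))"

text \<open>
  The determinant of the submatrix with row and column indices in \<open>S\<close>, by the formula defining
  \<^const>\<open>det\<close>.  It is \<open>1\<close> for empty \<open>S\<close>, which is the convention for blocks of size \<open>0\<close>.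
\<close>

definition principal_minor :: "'m::finite set \<Rightarrow> real^'m^'m \<Rightarrow> real" where
  "principal_minor S A =
     (\<Sum>p\<in>{p. p permutes S}. of_int (sign p) * (\<Prod>i\<in>S. A $ i $ p i))"

lemma principal_minor_UNIV: "principal_minor UNIV A = det A"
  by (simp add: principal_minor_def det_def)

definition sgn_powr :: "bit \<Rightarrow> complex \<Rightarrow> real \<Rightarrow> complex" where
  "sgn_powr e m x = of_real (sgn x) ^ of_bit e * of_real \<bar>x\<bar> powr m"


section \<open>Smooth functions\<close>

primrec C_k_on :: "nat \<Rightarrow> 'a::real_normed_vector set \<Rightarrow> ('a \<Rightarrow> 'b::real_normed_vector) \<Rightarrow> bool" where
  "C_k_on 0 S f \<longleftrightarrow> continuous_on S f"
| "C_k_on (Suc k) S f \<longleftrightarrow>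
     (\<forall>x\<in>S. f differentiable (at x)) \<and> (\<forall>v. C_k_on k S (\<lambda>x. frechet_derivative f (at x) v))"

abbreviation GL :: "(real^'m^'m) set" where
  "GL \<equiv> {g. invertible g}"

text \<open>
  \<open>C\<^sup>\<infinity>(GL(m))\<close>; the value \<open>0\<close> off the open set \<open>GL(m)\<close> makes a total function determined by its
  restriction to \<open>GL(m)\<close>.
\<close>

definition smooth_GL :: "(real^'m^'m \<Rightarrow> complex) set" where
  "smooth_GL = {f. (\<forall>k. C_k_on k GL f) \<and> (\<forall>g. \<not> invertible g \<longrightarrow> f g = 0)}"

text \<open>
  The left-invariant vector field of \<open>Y\<close>.  At \<open>k \<in> O(m)\<close> and for skew-symmetric \<open>Y\<close> the result depends
  on the restriction of \<open>f\<close> to \<open>O(m)\<close> only; iterating these fields and taking suprema over \<open>O(m)\<close>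
  yields the seminorms defining the topology of \<open>C\<^sup>\<infinity>(O(m))\<close>.
\<close>

definition lie_deriv :: "real^'m^'m \<Rightarrow> (real^'m^'m \<Rightarrow> complex) \<Rightarrow> real^'m^'m \<Rightarrow> complex" where
  "lie_deriv Y f = (\<lambda>g. frechet_derivative f (at g) (g ** Y))"

definition smooth_limit_O ::
    "('z \<Rightarrow> real^'m^'m \<Rightarrow> complex) \<Rightarrow> (real^'m^'m \<Rightarrow> complex) \<Rightarrow> 'z filter \<Rightarrow> bool" where
  "smooth_limit_O F f \<F> \<longleftrightarrow>
     (\<forall>Ys. (\<forall>Y\<in>set Ys. transpose Y = - Y) \<longrightarrow>
        uniform_limit {k. orthogonal_matrix k}
          (\<lambda>z. foldr lie_deriv Ys (F z)) (foldr lie_deriv Ys f) \<F>)"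

text \<open>
  Complex Frechet differentiability on \<open>\<complex>\<^sup>2 \<times> \<complex>\<close> of \<open>z \<mapsto> F z|\<^bsub>O(m)\<^esub> \<in> C\<^sup>\<infinity>(O(m))\<close>; the partial
  derivatives are represented by smooth functions on \<open>GL(m)\<close>.
\<close>

definition holomorphic_smooth_O ::
    "((complex \<times> complex) \<times> complex \<Rightarrow> real^'m^'m \<Rightarrow> complex) \<Rightarrow> bool" where
  "holomorphic_smooth_O F \<longleftrightarrow>
     (\<forall>z. \<exists>d1\<in>smooth_GL. \<exists>d2\<in>smooth_GL. \<exists>d3\<in>smooth_GL.
        smooth_limit_O
          (\<lambda>w h. (F (z + w) h - F z h
                   - (fst (fst w) * d1 h + snd (fst w) * d2 h + snd w * d3 h)) / of_real (norm w))
          (\<lambda>h. 0) (at 0))"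


section \<open>The representations\<close>

definition left_reg :: "real^'m^'m \<Rightarrow> (real^'m^'m \<Rightarrow> complex) \<Rightarrow> (real^'m^'m \<Rightarrow> complex)" where
  "left_reg g f = (\<lambda>x. f (matrix_inv g ** x))"

definition pi_space ::
    "bit \<times> bit \<Rightarrow> complex \<times> complex \<Rightarrow> (real^('n::{finite,linorder} + 'n)^('n + 'n) \<Rightarrow> complex) set" where
  "pi_space = (\<lambda>(\<xi>1, \<xi>2) (l1, l2). {f \<in> smooth_GL.
     \<forall>g g1 g2 b. invertible g \<and> invertible g1 \<and> invertible g2 \<longrightarrow>
       f (g ** block_matrix g1 b 0 g2) =
         sgn_powr \<xi>1 (- l1 - of_nat CARD('n) / 2) (det g1) *
         sgn_powr \<xi>2 (- l2 + of_nat CARD('n) / 2) (det g2) * f g})"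

definition tau_space ::
    "bit \<times> bit \<times> bit \<Rightarrow> complex \<times> complex \<times> complex \<Rightarrow>
     (real^('n::{finite,linorder} corner)^('n corner) \<Rightarrow> complex) set" where
  "tau_space = (\<lambda>(\<eta>1, \<eta>2, \<eta>3) (\<nu>1, \<nu>2, \<nu>3). {f \<in> smooth_GL.
     \<forall>h p. invertible h \<and> invertible p \<and>
           (\<forall>i j. corner_block j < corner_block i \<longrightarrow> p $ i $ j = 0) \<longrightarrow>
       f (h ** p) =
         sgn_powr \<eta>1 (- \<nu>1 - of_nat CARD('n) / 2) (principal_minor {i. corner_block i = 0} p) *
         sgn_powr \<eta>2 (- \<nu>2) (principal_minor {i. corner_block i = 1} p) *
         sgn_powr \<eta>3 (- \<nu>3 + of_nat CARD('n) / 2) (principal_minor {i. corner_block i = 2} p) * f h})"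

text \<open>Continuous linear \<open>H\<close>-intertwining operators \<open>\<pi>\<^bsub>\<xi>,\<lambda>\<^esub> \<rightarrow> \<tau>\<^bsub>\<eta>,\<nu>\<^esub>\<close>.  The spaces carry the Frechet
  topology of the compact picture, so sequential continuity is continuity.\<close>

definition intertwining_operator ::
    "bit \<times> bit \<Rightarrow> complex \<times> complex \<Rightarrow> bit \<times> bit \<times> bit \<Rightarrow> complex \<times> complex \<times> complex \<Rightarrow>
     ((real^('n::{finite,linorder} + 'n)^('n + 'n) \<Rightarrow> complex) \<Rightarrow>
      (real^('n corner)^('n corner) \<Rightarrow> complex)) \<Rightarrow> bool" where
  "intertwining_operator \<xi> l \<eta> v T \<longleftrightarrow>
     (\<forall>f\<in>pi_space \<xi> l. T f \<in> tau_space \<eta> v) \<and>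
     (\<forall>f\<in>pi_space \<xi> l. \<forall>g\<in>pi_space \<xi> l. \<forall>a b.
        T (\<lambda>x. a * f x + b * g x) = (\<lambda>h. a * T f h + b * T g h)) \<and>
     (\<forall>f\<in>pi_space \<xi> l. \<forall>h\<in>GL. T (left_reg (embed_corner h) f) = left_reg h (T f)) \<and>
     (\<forall>F. \<forall>f\<in>pi_space \<xi> l. (\<forall>j. F j \<in> pi_space \<xi> l) \<longrightarrow>
        smooth_limit_O F f sequentially \<longrightarrow> smooth_limit_O (\<lambda>j. T (F j)) (T f) sequentially)"

text \<open>
  Holomorphic dependence in the compact picture: a family \<open>f\<close> of elements of the spaces
  \<open>\<pi>\<^bsub>\<xi>,\<lambda>\<^esub>\<close> having the same restriction \<open>\<phi>\<close> to \<open>O(2n)\<close> for all \<open>\<lambda>\<close> is one fixed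
  vector of the compact picture, and it has to be mapped to a holomorphic function with values
  in \<open>C\<^sup>\<infinity>(O(2n-1))\<close>.
\<close>

definition holomorphic_operator_family ::
    "bit \<times> bit \<Rightarrow>
     ((complex \<times> complex) \<Rightarrow> complex \<Rightarrow>
      (real^('n::{finite,linorder} + 'n)^('n + 'n) \<Rightarrow> complex) \<Rightarrow>
      (real^('n corner)^('n corner) \<Rightarrow> complex)) \<Rightarrow> bool" where
  "holomorphic_operator_family \<xi> T \<longleftrightarrow>
     (\<forall>\<phi> f. (\<forall>l. f l \<in> pi_space \<xi> l \<and> (\<forall>k. orthogonal_matrix k \<longrightarrow> f l k = \<phi> k)) \<longrightarrow>
        holomorphic_smooth_O (\<lambda>(l, v). T l v (f l)))"


section \<open>The family of operators\<close>

definition A_integrand ::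
    "bit \<times> bit \<Rightarrow> complex \<times> complex \<Rightarrow> bit \<Rightarrow> complex \<Rightarrow>
     (real^('n::{finite,linorder} + 'n)^('n + 'n) \<Rightarrow> complex) \<Rightarrow>
     real^('n corner)^('n corner) \<Rightarrow> real^('n::{finite,linorder})^('n::{finite,linorder}) \<Rightarrow> complex" where
  "A_integrand = (\<lambda>(\<xi>1, \<xi>2) (l1, l2) \<eta> \<nu> f h X.
     sgn_powr (\<xi>1 + \<eta>) (l1 - \<nu> - of_nat CARD('n) / 2) (det X) *
     sgn_powr (\<eta> + \<xi>2) (\<nu> - l2 - of_nat CARD('n) / 2) (principal_minor (- {last_idx}) X) *
     f (embed_corner h ** block_matrix (mat 1) 0 X (mat 1)))"

definition A_int ::
    "bit \<times> bit \<Rightarrow> complex \<times> complex \<Rightarrow> bit \<Rightarrow> complex \<Rightarrow>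
     (real^('n::{finite,linorder} + 'n)^('n + 'n) \<Rightarrow> complex) \<Rightarrow>
     real^('n corner)^('n corner) \<Rightarrow> complex" where
  "A_int \<xi> l \<eta> v f h = (LINT X|lborel. A_integrand \<xi> l \<eta> v f h X)"

definition n_A :: "nat \<Rightarrow> bit \<times> bit \<Rightarrow> complex \<times> complex \<Rightarrow> bit \<Rightarrow> complex \<Rightarrow> complex" where
  "n_A n = (\<lambda>(\<xi>1, \<xi>2) (l1, l2) \<eta> \<nu>.
     Gamma ((l1 - \<nu> + 1 - of_nat n / 2 + of_bit (\<xi>1 + \<eta>)) / 2) *
     Gamma ((\<nu> - l2 + 1 - of_nat n / 2 + of_bit (\<xi>2 + \<eta>)) / 2) *
     (\<Prod>i=2..n. Gamma ((l1 - l2 + of_nat i - of_nat n + of_bit (\<xi>1 + \<xi>2)) / 2)))"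

text \<open>
  \<open>T\<close> is the normalized integral \<open>n\<^sub>A\<^sup>-\<^sup>1 A\<close> where the integral converges.  That domain is open and
  nonempty in \<open>\<complex>\<^sup>2 \<times> \<complex>\<close> and \<open>n\<^sub>A\<close> has neither zeros nor poles on it, so this fixes an
  analytic continuation uniquely.
\<close>

definition extends_normalized_A ::
    "bit \<times> bit \<Rightarrow> bit \<Rightarrow>
     ((complex \<times> complex) \<Rightarrow> complex \<Rightarrow>
      (real^('n::{finite,linorder} + 'n)^('n + 'n) \<Rightarrow> complex) \<Rightarrow>
      (real^('n corner)^('n corner) \<Rightarrow> complex)) \<Rightarrow> bool" where
  "extends_normalized_A \<xi> \<eta> T \<longleftrightarrow>
     (\<forall>l1 l2 \<nu>. Re (l1 - \<nu>) > (real CARD('n) - 2) / 2 \<and> Re (\<nu> - l2) > (real CARD('n) - 2) / 2 \<longrightarrow>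
        (\<forall>f\<in>pi_space \<xi> (l1, l2). \<forall>h\<in>GL.
           integrable lborel (A_integrand \<xi> (l1, l2) \<eta> \<nu> f h) \<and>
           T (l1, l2) \<nu> f h =
             inverse (n_A CARD('n) \<xi> (l1, l2) \<eta> \<nu>) * A_int \<xi> (l1, l2) \<eta> \<nu> f h))"

end

theory Submission
  imports Defs "HOL-Complex_Analysis.Complex_Analysis"
begin

text \<open>
 The kernel of the operator is a product of powers of \<open>det X\<close> and of a minor of \<open>X\<close>. The proof
 replaces it by a product of powers of single coordinates, for which analytic continuation is a
 one-variable matter.

 Let \<open>Y = X^(-1)\<close>. By the equivariance of \<open>f\<close> the integral becomes \<open>\<integral> |Y_nn|^b f(h g_Y) dY\<close> with \<open>g_Y = (Y, -1; 1, 0)\<close>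
 and \<open>b = \<nu> - l2 - n/2\<close> (\<open>A_integrand_Y\<close>). In this coordinate the parabolic subgroup of \<open>H\<close> acts
 affinely, which gives the equivariance of the integral (\<open>Yfun_equivariance\<close>).

 Next the integral is thickened. Let \<open>\<omega>\<close> be a cutoff function on \<open>GL(2n)\<close>, left invariant under
 \<open>O(2n)\<close>, and let \<open>q\<close> run through the block upper triangular matrices with lower triangular upper left
 block. By Gram-Schmidt every element of \<open>GL(2n)\<close> is the product of an orthogonal matrix and such a \<open>q\<close>, so the integral of \<open>\<omega>(g q)\<close> against a
 left Haar measure in \<open>q\<close> does not depend on \<open>g\<close> (\<open>omt_nn_integral_invariant\<close>). Since \<open>f\<close> transforms
 by a character under \<open>q\<close>, the \<open>Y\<close>-integral is a constant times an integral over the matrices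
 \<open>g_Y q = (A, B; D, E)\<close> with \<open>D\<close> lower triangular, and in these coordinates the kernel is a product of
 powers of \<open>A_nn\<close> and of the diagonal entries of \<open>D\<close> (\<open>quad_integral\<close>). Their exponents are those in the
 gamma factors of the normalization.

 The one-variable distributions \<open>|s|^m / \<Gamma>((m+1)/2)\<close> and \<open>sgn(s)|s|^m / \<Gamma>((m+2)/2)\<close> are entire in \<open>m\<close>.
 Applied one coordinate after the other to the smooth, compactly supported integrand they define the
 operators for all parameters, jointly smooth in parameters and \<open>h\<close> and complex differentiable in the
 parameters (\<open>Jfl_smooth\<close>, \<open>Jfl_clin\<close>). Equivariance continues analytically (\<open>Jop_equivariance\<close>).
 Continuity and holomorphy hold in the topology of \<open>C^\<infinity>\<close> because the same estimates
 apply to families tending to zero (\<open>Aop_continuous\<close>, \<open>difference_quotient_null\<close>).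
\<close>

no_notation fps_nth (infixl "$" 75)

section \<open>Smoothness and convergence of all derivatives\<close>

abbreviation dird :: "'a::real_normed_vector => ('a => 'b::real_normed_vector) => 'a => 'b" where
 "dird v f \<equiv> (%x. frechet_derivative f (at x) v)"

lemma dird_eq: "(f has_derivative f') (at x) ==> dird v f x = f' v"
 using frechet_derivative_at by metis

lemma dird_has_derivative: "f differentiable (at x) ==> (f has_derivative (%v. dird v f x)) (at x)"
 using frechet_derivative_works by blast

definition null_loc :: "'i filter => 'a::real_normed_vector set => ('i => 'a => 'b::real_normed_vector) => bool" where
 "null_loc F S \<Phi> \<longleftrightarrow> (\<forall>i. continuous_on S (\<Phi> i)) &
  (\<forall>K. compact K & K \<subseteq> S --> uniform_limit K \<Phi> (%_. 0) F)"

text \<open>A family tends to zero along \<open>F\<close> together with its derivatives of order up to \<open>k\<close>,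
locally uniformly. For the trivial filter this is plain \<open>C^k\<close> smoothness, so one induction serves both
smoothness and convergence.\<close>

primrec C_null :: "nat => 'i filter => 'a::real_normed_vector set => ('i => 'a => 'b::real_normed_vector) => bool" where
 "C_null 0 F S \<Phi> \<longleftrightarrow> null_loc F S \<Phi>"
| "C_null (Suc k) F S \<Phi> \<longleftrightarrow> null_loc F S \<Phi> & (\<forall>i. \<forall>x\<in>S. \<Phi> i differentiable (at x)) &
  (\<forall>v. C_null k F S (%i. dird v (\<Phi> i)))"

lemma C_null_loc: "C_null k F S \<Phi> ==> null_loc F S \<Phi>"
 by (cases k) auto

lemma C_null_SucD: "C_null (Suc k) F S \<Phi> ==> C_null k F S \<Phi>"
proof (induction k arbitrary: \<Phi>)
 case (Suc k)
 then show ?case by (metis C_null.simps(2))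
qed auto

lemma null_loc_bot [simp]: "null_loc bot S \<Phi> \<longleftrightarrow> (\<forall>i. continuous_on S (\<Phi> i))"
 by (simp add: null_loc_def uniform_limit_iff)

lemma C_k_on_continuous: "C_k_on k S f ==> continuous_on S f"
 by (cases k) (auto intro!: continuous_at_imp_continuous_on differentiable_imp_continuous_within)

lemma C_k_on_iff_C_null: "C_k_on k S f \<longleftrightarrow> C_null k bot S (%_::'i. f)"
proof (induction k arbitrary: f)
 case (Suc k)
 then show ?case using C_k_on_continuous[of "Suc k" S f] by auto
qed auto

lemma C_k_on_SucD: "C_k_on (Suc k) S f ==> C_k_on k S f"
 unfolding C_k_on_iff_C_null[where 'i=unit] by (rule C_null_SucD)

lemma C_null_has_derivative:
 assumes "C_null (Suc k) F S \<Phi>" "x \<in> S"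
 shows "(\<Phi> i has_derivative (%v. dird v (\<Phi> i) x)) (at x)"
 using assms by (auto intro!: dird_has_derivative)

lemma C_k_has_derivative:
 assumes "C_k_on (Suc k) S f" "x \<in> S"
 shows "(f has_derivative (%v. dird v f x)) (at x)"
 using assms by (auto intro!: dird_has_derivative)

lemma null_loc_cong:
 assumes "!!i x. x \<in> S ==> \<Phi> i x = \<Psi> i x" "null_loc F S \<Phi>"
 shows "null_loc F S \<Psi>"
 unfolding null_loc_def
proof (intro conjI allI impI)
 fix i show "continuous_on S (\<Psi> i)"
  using assms unfolding null_loc_def by (metis (mono_tags, lifting) continuous_on_cong)
next
 fix K assume "compact K & K \<subseteq> S"
 then have "uniform_limit K \<Phi> (%_. 0) F" using assms unfolding null_loc_def by blast
 then show "uniform_limit K \<Psi> (%_. 0) F"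
  by (rule uniform_limit_cong'[THEN iffD1, rotated -1]) (use assms \<open>compact K & K \<subseteq> S\<close> in auto)
qed

lemma C_null_SucI:
 assumes S: "open S" and 0: "null_loc F S \<Phi>"
  and d: "!!i x. x \<in> S ==> (\<Phi> i has_derivative \<Phi>' i x) (at x)"
  and k: "!!v. C_null k F S (%i x. \<Phi>' i x v)"
  and cong: "!!\<Phi> \<Psi> :: 'i => 'a::real_normed_vector => 'b::real_normed_vector. (!!i x. x \<in> S ==> \<Phi> i x = \<Psi> i x) ==> C_null k F S \<Phi> ==> C_null k F S \<Psi>"
 shows "C_null (Suc k) F S (\<Phi> :: 'i => 'a => 'b)"
proof -
 have "C_null k F S (%i. dird v (\<Phi> i))" for v
  by (rule cong[OF _ k[of v]]) (simp add: dird_eq[OF d])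
 then show ?thesis using 0 d by (auto simp: differentiable_def)
qed

lemma C_null_cong:
 fixes \<Phi> \<Psi> :: "'i => 'a::real_normed_vector => 'b::real_normed_vector"
 assumes S: "open S" and "!!i x. x \<in> S ==> \<Phi> i x = \<Psi> i x" "C_null k F S \<Phi>"
 shows "C_null k F S \<Psi>"
 using assms(2,3)
proof (induction k arbitrary: \<Phi> \<Psi>)
 case 0
 then show ?case using null_loc_cong[of S \<Phi> \<Psi> F] by auto
next
 case (Suc k)
 have d: "(\<Psi> i has_derivative (%v. dird v (\<Phi> i) x)) (at x)" if "x \<in> S" for i x
  by (rule has_derivative_transform_within_open[OF C_null_has_derivative[OF Suc.prems(2) that] S that])
   (use Suc.prems in auto)
 show ?case
 proof (rule C_null_SucI[OF S _ d])
  show "null_loc F S \<Psi>" using null_loc_cong[OF Suc.prems(1) C_null_loc[OF Suc.prems(2)]] by blast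
  show "C_null k F S (%i. dird v (\<Phi> i))" for v using Suc.prems(2) by simp
  show "C_null k F S \<Psi>'" if "!!i x. x \<in> S ==> \<Phi>' i x = \<Psi>' i x" "C_null k F S \<Phi>'" for \<Phi>' \<Psi>' :: "'i => 'a => 'b"
   by (rule Suc.IH[OF _ that(2)]) (use that in auto)
 qed
qed

lemma C_null_Suc_intro:
 fixes \<Phi> :: "'i => 'a::real_normed_vector => 'b::real_normed_vector"
 assumes S: "open S" and 0: "null_loc F S \<Phi>"
  and d: "!!i x. x \<in> S ==> (\<Phi> i has_derivative \<Phi>' i x) (at x)"
  and k: "!!v. C_null k F S (%i x. \<Phi>' i x v)"
 shows "C_null (Suc k) F S \<Phi>"
 by (rule C_null_SucI[OF S 0 d k C_null_cong[OF S]]) auto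

lemma C_k_on_cong:
 assumes S: "open S" and "!!x. x \<in> S ==> f x = g x" "C_k_on k S f"
 shows "C_k_on k S g"
 unfolding C_k_on_iff_C_null[where 'i=unit]
 by (rule C_null_cong[OF S _ assms(3)[unfolded C_k_on_iff_C_null[where 'i=unit]]]) (rule assms(2))

lemma C_k_on_SucI:
 assumes "open S" "!!x. x \<in> S ==> (f has_derivative f' x) (at x)" "!!v. C_k_on k S (%x. f' x v)"
 shows "C_k_on (Suc k) S f"
proof -
 have "C_k_on k S (dird v f)" for v
  by (rule C_k_on_cong[OF assms(1) _ assms(3)[of v]]) (simp add: dird_eq[OF assms(2)])
 then show ?thesis using assms(2) by (auto simp: differentiable_def)
qed

lemma null_loc_subset: "T \<subseteq> S ==> null_loc F S \<Phi> ==> null_loc F T \<Phi>"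
 unfolding null_loc_def by (meson continuous_on_subset order_trans)

lemma C_null_subset: "T \<subseteq> S ==> C_null k F S \<Phi> ==> C_null k F T \<Phi>"
 by (induction k arbitrary: \<Phi>) (auto intro: null_loc_subset)

lemma C_k_on_subset: "T \<subseteq> S ==> C_k_on k S f ==> C_k_on k T f"
 unfolding C_k_on_iff_C_null[where 'i=unit] by (rule C_null_subset)

lemma null_loc_add:
 assumes "null_loc F S \<Phi>" "null_loc F S \<Psi>"
 shows "null_loc F S (%i x. \<Phi> i x + \<Psi> i x)"
 using assms unfolding null_loc_def
 by (auto intro!: continuous_intros uniform_limit_add[where l="%_. 0" and m="%_. 0", simplified])

lemma C_null_add:
 assumes S: "open S"
 shows "C_null k F S \<Phi> ==> C_null k F S \<Psi> ==> C_null k F S (%i x. \<Phi> i x + \<Psi> i x)"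
proof (induction k arbitrary: \<Phi> \<Psi>)
 case 0
 then show ?case by (auto intro: null_loc_add)
next
 case (Suc k)
 show ?case
 proof (rule C_null_Suc_intro[OF S])
  show "null_loc F S (%i x. \<Phi> i x + \<Psi> i x)" using Suc.prems by (blast intro: null_loc_add C_null_loc)
  show "((%x. \<Phi> i x + \<Psi> i x) has_derivative (%v. dird v (\<Phi> i) x + dird v (\<Psi> i) x)) (at x)"
   if "x \<in> S" for i x
   using C_null_has_derivative[OF Suc.prems(1) that] C_null_has_derivative[OF Suc.prems(2) that]
   by (intro has_derivative_add)
 qed (use Suc in auto)
qed

lemma null_loc_0: "null_loc F S (%_ _. 0)"
 by (auto simp: null_loc_def uniform_limit_iff)

lemma C_null_0: "C_null k F S (%_ _. 0)"
proof (induction k)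
 case (Suc k)
 have "frechet_derivative (%x::'b. 0::'c) (at x) v = 0" for x v
  by (rule dird_eq) (rule has_derivative_const)
 then show ?case using Suc by (simp add: null_loc_0)
qed (simp add: null_loc_0)

lemma C_null_sum:
 assumes S: "open S"
 shows "(!!j. j \<in> I ==> C_null k F S (\<Phi> j)) ==> C_null k F S (%i x. \<Sum>j\<in>I. \<Phi> j i x)"
 by (induction I rule: infinite_finite_induct) (auto intro: C_null_add[OF S] C_null_0)

lemma null_loc_prod:
 assumes p: "bounded_bilinear pr" and g: "continuous_on S g" and "null_loc F S \<Phi>"
 shows "null_loc F S (%i x. pr (g x) (\<Phi> i x))"
 unfolding null_loc_def
proof (intro conjI allI impI)
 fix i show "continuous_on S (%x. pr (g x) (\<Phi> i x))"
  using assms by (auto intro!: bounded_bilinear.continuous_on[OF p] simp: null_loc_def)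
next
 fix K assume K: "compact K & K \<subseteq> S"
 have b: "bounded (g ` K)"
  using K g by (meson compact_continuous_image compact_imp_bounded continuous_on_subset)
 have "uniform_limit K (%i x. pr (g x) (\<Phi> i x)) (%x. pr (g x) 0) F"
  by (rule bounded_bilinear.bounded_uniform_limit[OF p uniform_limit_const _ _ b])
   (use assms K in "auto simp: null_loc_def image_constant_conv")
 then show "uniform_limit K (%i x. pr (g x) (\<Phi> i x)) (%_. 0) F"
  by (simp add: bounded_bilinear.zero_right[OF p])
qed

lemma C_null_prod:
 assumes S: "open S" and p: "bounded_bilinear pr"
 shows "C_k_on k S g ==> C_null k F S \<Phi> ==> C_null k F S (%i x. pr (g x) (\<Phi> i x))"
proof (induction k arbitrary: g \<Phi>)
 case 0
 then show ?case by (auto intro: null_loc_prod[OF p])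
next
 case (Suc k)
 show ?case
 proof (rule C_null_Suc_intro[OF S])
  show "null_loc F S (%i x. pr (g x) (\<Phi> i x))"
   by (rule null_loc_prod[OF p C_k_on_continuous[OF Suc.prems(1)] C_null_loc[OF Suc.prems(2)]])
  show "((%x. pr (g x) (\<Phi> i x)) has_derivative
     (%v. pr (g x) (dird v (\<Phi> i) x) + pr (dird v g x) (\<Phi> i x))) (at x)"
   if "x \<in> S" for i x
   by (rule bounded_bilinear.FDERIV[OF p C_k_has_derivative[OF Suc.prems(1) that] C_null_has_derivative[OF Suc.prems(2) that]])
  show "C_null k F S (%i x. pr (g x) (dird v (\<Phi> i) x) + pr (dird v g x) (\<Phi> i x))" for v
   using Suc.prems
   by (intro C_null_add[OF S] Suc.IH) (auto intro: C_k_on_SucD C_null_SucD)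
 qed
qed

lemma null_loc_compose:
 assumes "null_loc F T \<Phi>" "continuous_on S \<phi>" "\<phi> ` S \<subseteq> T"
 shows "null_loc F S (%i x. \<Phi> i (\<phi> x))"
 unfolding null_loc_def
proof (intro conjI allI impI)
 fix i show "continuous_on S (%x. \<Phi> i (\<phi> x))"
  by (rule continuous_on_compose2[OF _ assms(2,3)]) (use assms in "auto simp: null_loc_def")
next
 fix K assume K: "compact K & K \<subseteq> S"
 then have "compact (\<phi> ` K)" "\<phi> ` K \<subseteq> T"
  using assms by (auto intro: compact_continuous_image continuous_on_subset)
 then have "uniform_limit (\<phi> ` K) \<Phi> (%_. 0) F" using assms by (auto simp: null_loc_def)
 then show "uniform_limit K (%i x. \<Phi> i (\<phi> x)) (%_. 0) F"
  by (simp add: uniform_limit_iff)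
qed

lemma C_null_linear_fixed:
 assumes S: "open S" and L: "bounded_linear L" and f: "C_k_on k S f"
 shows "C_k_on k S (%x. L (f x))"
 using f
proof (induction k arbitrary: f)
 case 0
 then show ?case using L by (auto intro: bounded_linear.continuous_on)
next
 case (Suc k)
 show ?case
  by (rule C_k_on_SucI[OF S bounded_linear.has_derivative[OF L C_k_has_derivative[OF Suc.prems]]])
   (use Suc in auto)
qed

lemma derivative_euclidean_expand:
 fixes f :: "'a::euclidean_space => 'b::real_normed_vector"
 assumes "f differentiable (at x)"
 shows "dird v f x = (\<Sum>b\<in>Basis. (v \<bullet> b) *\<^sub>R dird b f x)"
proof -
 interpret bounded_linear "%v. dird v f x"
  using dird_has_derivative[OF assms] by (rule has_derivative_bounded_linear)
 show ?thesis
  by (subst euclidean_representation[of v, symmetric]) (simp only: sum scaleR)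
qed

lemma C_null_compose:
 fixes \<phi> :: "'a::euclidean_space => 'c::euclidean_space"
 assumes S: "open S" and T: "open T" and ST: "\<phi> ` S \<subseteq> T"
 shows "C_k_on k S \<phi> ==> C_null k F T \<Phi> ==> C_null k F S (%i x. \<Phi> i (\<phi> x))"
proof (induction k arbitrary: \<Phi>)
 case 0
 then show ?case using ST by (auto intro: null_loc_compose)
next
 case (Suc k)
 show ?case
 proof (rule C_null_Suc_intro[OF S])
  show "null_loc F S (%i x. \<Phi> i (\<phi> x))"
   by (rule null_loc_compose[OF C_null_loc[OF Suc.prems(2)] C_k_on_continuous[OF Suc.prems(1)] ST])
  show "((%x. \<Phi> i (\<phi> x)) has_derivative (%v. \<Sum>b\<in>Basis. (dird v \<phi> x \<bullet> b) *\<^sub>R dird b (\<Phi> i) (\<phi> x))) (at x)"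
   if "x \<in> S" for i x
  proof -
   have d: "\<Phi> i differentiable at (\<phi> x)" using Suc.prems(2) ST that by auto
   have "((%x. \<Phi> i (\<phi> x)) has_derivative (%v. dird (dird v \<phi> x) (\<Phi> i) (\<phi> x))) (at x)"
    by (rule has_derivative_compose[OF C_k_has_derivative[OF Suc.prems(1) that] dird_has_derivative[OF d]])
   then show ?thesis by (subst (asm) derivative_euclidean_expand[OF d])
  qed
  show "C_null k F S (%i x. \<Sum>b\<in>Basis. (dird v \<phi> x \<bullet> b) *\<^sub>R dird b (\<Phi> i) (\<phi> x))" for v
   by (intro C_null_sum[OF S] C_null_prod[OF S bounded_bilinear_scaleR]
     C_null_linear_fixed[OF S bounded_linear_inner_left] Suc.IH)
    (use Suc.prems in "auto intro: C_k_on_SucD C_null_SucD")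
 qed
qed

lemma null_loc_open_cover:
 fixes S :: "'a::euclidean_space set"
 assumes "open S" and cov: "!!x. x \<in> S ==> \<exists>U. open U & x \<in> U & null_loc F U \<Phi>"
 shows "null_loc F S \<Phi>"
 unfolding null_loc_def
proof (intro conjI allI impI)
 fix i show "continuous_on S (\<Phi> i)"
 proof (rule continuous_at_imp_continuous_on, intro ballI)
  fix x assume "x \<in> S"
  then obtain U where "open U" "x \<in> U" "null_loc F U \<Phi>" using cov by blast
  then show "isCont (\<Phi> i) x"
   unfolding null_loc_def by (metis continuous_on_eq_continuous_at)
 qed
next
 fix K assume K: "compact K & K \<subseteq> S"
 have "\<exists>e>0. uniform_limit (cball x e) \<Phi> (%_. 0) F" if "x \<in> K" for x
 proof -
  have "x \<in> S" using that K by blast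
  then obtain U where U: "open U" "x \<in> U" "null_loc F U \<Phi>" using cov by blast
  then obtain e where "e > 0" "cball x e \<subseteq> U" by (meson open_contains_cball)
  then show ?thesis using U unfolding null_loc_def by (meson compact_cball)
 qed
 then obtain e where e: "!!x. x \<in> K ==> e x > 0 & uniform_limit (cball x (e x)) \<Phi> (%_. 0) F" by metis
 have "K \<subseteq> (\<Union>x\<in>K. ball x (e x))" using e by force
 then obtain C where C: "C \<subseteq> K" "finite C" "K \<subseteq> (\<Union>x\<in>C. ball x (e x))"
  using K compactE_image[of K K "%x. ball x (e x)"] by (metis open_ball)
 have "uniform_limit (\<Union>x\<in>C. cball x (e x)) \<Phi> (%_. 0) F"
  unfolding uniform_limit_iff
 proof (intro allI impI)
  fix d :: real assume "d > 0"
  then have "\<forall>x\<in>C. \<forall>\<^sub>F n in F. \<forall>y\<in>cball x (e x). dist (\<Phi> n y) 0 < d"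
   using C e unfolding uniform_limit_iff by blast
  then have "\<forall>\<^sub>F n in F. \<forall>x\<in>C. \<forall>y\<in>cball x (e x). dist (\<Phi> n y) 0 < d"
   by (rule eventually_ball_finite[OF C(2)])
  then show "\<forall>\<^sub>F n in F. \<forall>y\<in>\<Union>x\<in>C. cball x (e x). dist (\<Phi> n y) 0 < d"
   by (rule eventually_mono) blast
 qed
 then show "uniform_limit K \<Phi> (%_. 0) F"
  by (rule uniform_limit_on_subset) (use C(3) in force)
qed

lemma C_null_open_cover:
 fixes S :: "'a::euclidean_space set"
 assumes "open S"
 shows "(!!x. x \<in> S ==> \<exists>U. open U & x \<in> U & C_null k F U \<Phi>) ==> C_null k F S \<Phi>"
proof (induction k arbitrary: \<Phi>)
 case 0
 then show ?case using null_loc_open_cover[OF assms] by auto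
next
 case (Suc k)
 have "null_loc F S \<Phi>" using Suc.prems by (intro null_loc_open_cover[OF assms]) (meson C_null_loc)
 moreover have "\<Phi> i differentiable at x" if "x \<in> S" for i x
  using Suc.prems[OF that] by auto
 moreover have "C_null k F S (%i. dird v (\<Phi> i))" for v
 proof (rule Suc.IH)
  fix x assume "x \<in> S"
  then show "\<exists>U. open U & x \<in> U & C_null k F U (%i. dird v (\<Phi> i))"
   using Suc.prems[of x] by auto
 qed
 ultimately show ?case by auto
qed

section \<open>Integrals depending on parameters\<close>

lemma continuous_on_weight:
 assumes "continuous_on (\<Omega> \<times> T) (%(m, t). w m t)" and mu: "continuous_on S \<mu>" "\<mu> ` S \<subseteq> \<Omega>"
 shows "continuous_on (S \<times> T) (%(q, t). w (\<mu> q) t)"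
proof -
 have "continuous_on (S \<times> T) (%x. (%(m, t). w m t) (\<mu> (fst x), snd x))"
 proof (rule continuous_on_compose2[OF assms(1)])
  show "continuous_on (S \<times> T) (%x. (\<mu> (fst x), snd x))"
   by (intro continuous_intros continuous_on_compose2[OF mu(1)]) auto
 qed (use mu in auto)
 then show ?thesis by (simp add: case_prod_unfold)
qed

lemma null_loc_integral:
 fixes \<Theta> :: "'i => 'a::euclidean_space \<times> real => complex"
 assumes w: "continuous_on (\<Omega> \<times> {c..d}) (%(m, t). w m t)"
  and mu: "continuous_on S \<mu>" "\<mu> ` S \<subseteq> \<Omega>" and Th: "null_loc F (S \<times> UNIV) \<Theta>"
 shows "null_loc F S (%i q. integral {c..d} (%t. w (\<mu> q) t * \<Theta> i (q, t)))"
 unfolding null_loc_def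
proof (intro conjI allI impI)
 have cw: "continuous_on (S \<times> {c..d}) (%(q, t). w (\<mu> q) t)"
  by (rule continuous_on_weight[OF w mu])
 have cT: "continuous_on (S \<times> {c..d}) (\<Theta> i)" for i
  using Th unfolding null_loc_def by (meson continuous_on_subset Sigma_mono order_refl subset_UNIV)
 fix i show "continuous_on S (%q. integral {c..d} (%t. w (\<mu> q) t * \<Theta> i (q, t)))"
  unfolding interval_cbox
  by (rule integral_continuous_on_param)
   (use continuous_on_mult[OF cw cT[of i]] in "simp add: case_prod_unfold")
next
 fix K assume K: "compact K & K \<subseteq> S"
 have cw: "continuous_on (S \<times> {c..d}) (%(q, t). w (\<mu> q) t)"
  by (rule continuous_on_weight[OF w mu])
 have cT: "continuous_on (S \<times> {c..d}) (\<Theta> i)" for i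
  using Th unfolding null_loc_def by (meson continuous_on_subset Sigma_mono order_refl subset_UNIV)
 have comp: "compact (K \<times> {c..d})" using K by (auto intro: compact_Times)
 have "bounded ((%(q, t). w (\<mu> q) t) ` (K \<times> {c..d}))"
  by (intro compact_imp_bounded compact_continuous_image comp continuous_on_subset[OF cw]) (use K in auto)
 then obtain B where B: "B > 0" "!!q t. q \<in> K ==> t \<in> {c..d} ==> cmod (w (\<mu> q) t) <= B"
  unfolding bounded_pos by fast
 have u: "uniform_limit (K \<times> {c..d}) \<Theta> (%_. 0) F"
  using Th comp K unfolding null_loc_def by (meson Sigma_mono subset_UNIV)
 show "uniform_limit K (%i q. integral {c..d} (%t. w (\<mu> q) t * \<Theta> i (q, t))) (%_. 0) F"
  unfolding uniform_limit_iff
 proof (intro allI impI)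
  fix e :: real assume "e > 0"
  define e' where "e' = e / (2 * B * (\<bar>d - c\<bar> + 1))"
  have e': "e' > 0" using \<open>e > 0\<close> B by (simp add: e'_def)
  have "eventually (%i. \<forall>x\<in>K \<times> {c..d}. dist (\<Theta> i x) 0 < e') F"
   using u e' unfolding uniform_limit_iff by blast
  then show "\<forall>\<^sub>F n in F. \<forall>q\<in>K. dist (integral {c..d} (%t. w (\<mu> q) t * \<Theta> n (q, t))) 0 < e"
  proof (rule eventually_mono, intro ballI)
   fix n q assume n: "\<forall>x\<in>K \<times> {c..d}. dist (\<Theta> n x) 0 < e'" and q: "q \<in> K"
   have "continuous_on {c..d} (%t. (%(q,t). w (\<mu> q) t * \<Theta> n (q, t)) (q, t))"
    by (rule continuous_on_compose2[where t="S \<times> {c..d}"])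
     (use continuous_on_mult[OF cw cT[of n]] K q in "auto simp: case_prod_unfold intro!: continuous_intros")
   then have "(%t. w (\<mu> q) t * \<Theta> n (q, t)) integrable_on {c..d}"
    by (simp add: integrable_continuous_real)
   then have "norm (integral {c..d} (%t. w (\<mu> q) t * \<Theta> n (q, t))) <= integral {c..d} (%t. B * e')"
   proof (rule integral_norm_bound_integral)
    fix t assume "t \<in> {c..d}"
    then show "cmod (w (\<mu> q) t * \<Theta> n (q, t)) <= B * e'"
     using B n q by (auto simp: norm_mult intro!: mult_mono) (meson atLeastAtMost_iff less_imp_le)
   qed auto
   also have "... <= (\<bar>d - c\<bar> + 1) * (B * e')"
    using B e' by (cases "c <= d") (auto intro!: mult_right_mono)
   also have "... = e / 2"
   proof -
    have "X * (B * (e / (2 * B * X))) = e / 2" if "X > 0" for X using that B by simp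
    from this[of "\<bar>d - c\<bar> + 1"] show ?thesis by (simp add: e'_def)
   qed
   also have "... < e" using \<open>e > 0\<close> by simp
   finally show "dist (integral {c..d} (%t. w (\<mu> q) t * \<Theta> n (q, t))) 0 < e" by simp
  qed
 qed
qed

lemma has_derivative_integral_param:
 fixes f :: "'a::euclidean_space => real => complex"
 assumes S: "open S" "q \<in> S"
  and d: "!!q t. q \<in> S ==> t \<in> {c..d} ==> ((%q. f q t) has_derivative f' q t) (at q)"
  and cf: "continuous_on (S \<times> {c..d}) (%(q, t). f q t)"
  and cf': "!!v. continuous_on (S \<times> {c..d}) (%(q, t). f' q t v)"
 shows "((%q. integral {c..d} (f q)) has_derivative (%v. integral {c..d} (%t. f' q t v))) (at q)"
proof -
 obtain e where e: "e > 0" "ball q e \<subseteq> S" using S openE by blast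
 define U where "U = ball q e"
 define fx where "fx q t = Blinfun (f' q t)" for q t
 have bl: "blinfun_apply (fx q t) = f' q t" if "q \<in> S" "t \<in> {c..d}" for q t
  using that d[OF that] by (auto simp: fx_def bounded_linear_Blinfun_apply has_derivative_bounded_linear)
 have cfx: "continuous_on (U \<times> {c..d}) (%(q, t). fx q t)"
 proof (rule continuous_on_blinfun_componentwise)
  fix v :: 'a
  have "continuous_on (U \<times> {c..d}) (%(q, t). f' q t v)"
   by (rule continuous_on_subset[OF cf']) (use e in "auto simp: U_def")
  then show "continuous_on (U \<times> {c..d}) (%x. blinfun_apply (case x of (q, t) => fx q t) v)"
   by (rule continuous_on_eq) (use e bl in "auto simp: U_def")
 qed
 have "((%q. integral (cbox c d) (f q)) has_derivative integral (cbox c d) (fx q)) (at q within U)"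
 proof (rule leibniz_rule)
  show "((%q. f q t) has_derivative blinfun_apply (fx x t)) (at x within U)" if "x \<in> U" "t \<in> cbox c d" for x t
  proof -
   have "x \<in> S" "t \<in> {c..d}" using that e by (auto simp: U_def)
   then show ?thesis using d bl has_derivative_at_withinI by metis
  qed
  show "f x integrable_on cbox c d" if "x \<in> U" for x
  proof -
   have "continuous_on {c..d} (%t. (%(q,t). f q t) (x, t))"
    by (rule continuous_on_compose2[OF cf]) (use that e in "auto simp: U_def intro!: continuous_intros")
   then show ?thesis by (simp add: integrable_continuous_real)
  qed
 qed (use cfx e in "auto simp: U_def")
 then have 1: "((%q. integral {c..d} (f q)) has_derivative integral {c..d} (fx q)) (at q)"
  using e by (simp add: U_def at_within_open[of q "ball q e"])
 have "continuous_on {c..d} (%t. (%(q,t). fx q t) (q, t))"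
  by (rule continuous_on_compose2[OF cfx]) (use e in "auto simp: U_def intro!: continuous_intros")
 then have int: "fx q integrable_on {c..d}" by (simp add: integrable_continuous_real)
 have "blinfun_apply (integral {c..d} (fx q)) v = integral {c..d} (%t. f' q t v)" for v
 proof -
  have "integral {c..d} ((%f. blinfun_apply f v) o fx q) = blinfun_apply (integral {c..d} (fx q)) v"
   by (rule integral_linear[OF int]) (auto intro!: bounded_linear_intros)
  moreover have "integral {c..d} ((%f. blinfun_apply f v) o fx q) = integral {c..d} (%t. f' q t v)"
   by (rule integral_cong) (simp add: bl S)
  ultimately show ?thesis by simp
 qed
 then have "blinfun_apply (integral {c..d} (fx q)) = (%v. integral {c..d} (%t. f' q t v))" by blast
 then show ?thesis using 1 by simp
qed

lemma has_derivative_weighted_integral: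
 fixes \<Theta> :: "'a::euclidean_space \<times> real => complex"
 assumes S: "open S" and w: "!!j. continuous_on (\<Omega> \<times> {c..d}) (%(m, t). w j m t)"
  and dw: "!!j m t. m \<in> \<Omega> ==> t \<in> {c..d} ==> ((%m. w j m t) has_field_derivative w (Suc j) m t) (at m)"
  and mu: "\<mu> ` S \<subseteq> \<Omega>" and mk: "C_k_on (Suc k) S \<mu>" and Th: "C_k_on (Suc k) (S \<times> UNIV) \<Theta>" and q: "q \<in> S"
 shows "((%q. integral {c..d} (%t. w j (\<mu> q) t * \<Theta> (q, t))) has_derivative
  (%v. dird v \<mu> q * integral {c..d} (%t. w (Suc j) (\<mu> q) t * \<Theta> (q, t)) +
    integral {c..d} (%t. w j (\<mu> q) t * dird (v, 0) \<Theta> (q, t)))) (at q)"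
proof -
 have S': "open (S \<times> (UNIV::real set))" using S by (simp add: open_Times)
 have cmu: "continuous_on S \<mu>" using mk by (rule C_k_on_continuous)
 have cw: "continuous_on (S \<times> {c..d}) (%(q, t). w j (\<mu> q) t)" for j
  by (rule continuous_on_weight[OF w cmu mu])
 have sub: "S \<times> {c..d} \<subseteq> S \<times> UNIV" by auto
 have cT: "continuous_on (S \<times> {c..d}) \<Theta>"
  by (rule continuous_on_subset[OF C_k_on_continuous[OF Th] sub])
 have cD: "continuous_on (S \<times> {c..d}) (dird v \<Theta>)" for v
  by (rule continuous_on_subset[OF _ sub], rule C_k_on_continuous[of k]) (use Th in "simp del: split_paired_All")
 have cdmu: "continuous_on (S \<times> {c..d}) (%(q, t). dird v \<mu> q)" for v
 proof -
  have "continuous_on S (dird v \<mu>)" by (rule C_k_on_continuous[of k]) (use mk in auto)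
  then show ?thesis unfolding case_prod_unfold
   by (rule continuous_on_compose2) (auto intro!: continuous_intros)
 qed
 have "((%q. integral {c..d} (%t. w j (\<mu> q) t * \<Theta> (q, t))) has_derivative
  (%v. integral {c..d} (%t. w j (\<mu> q) t * dird (v, 0) \<Theta> (q, t) + (w (Suc j) (\<mu> q) t * dird v \<mu> q) * \<Theta> (q, t)))) (at q)"
 proof (rule has_derivative_integral_param[OF S q])
  fix q t assume qt: "q \<in> S" "t \<in> {c..d}"
  have T: "(\<Theta> has_derivative (%v. dird v \<Theta> (q, t))) (at (q, t))"
   by (rule C_k_has_derivative[OF Th]) (use qt in auto)
  have T1: "((%q. \<Theta> (q, t)) has_derivative (%v. dird (v, 0) \<Theta> (q, t))) (at q)"
   by (rule has_derivative_compose[where f="%q. (q, t)" and g=\<Theta>, OF _ T]) (auto intro!: derivative_eq_intros)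
  have "((%m. w j m t) has_derivative (*) (w (Suc j) (\<mu> q) t)) (at (\<mu> q))"
   using dw[of "\<mu> q" t j] qt mu by (auto simp: has_field_derivative_def)
  then have W: "((%q. w j (\<mu> q) t) has_derivative (%v. w (Suc j) (\<mu> q) t * dird v \<mu> q)) (at q)"
   by (rule has_derivative_compose[OF C_k_has_derivative[OF mk qt(1)]])
  show "((%q. w j (\<mu> q) t * \<Theta> (q, t)) has_derivative
   (%v. w j (\<mu> q) t * dird (v, 0) \<Theta> (q, t) + (w (Suc j) (\<mu> q) t * dird v \<mu> q) * \<Theta> (q, t))) (at q)"
   by (rule has_derivative_mult[OF W T1])
 next
  show "continuous_on (S \<times> {c..d}) (%(q, t). w j (\<mu> q) t * \<Theta> (q, t))"
   using continuous_on_mult[OF cw cT] by (simp add: case_prod_unfold)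
  show "continuous_on (S \<times> {c..d})
     (%(q, t). w j (\<mu> q) t * dird (v, 0) \<Theta> (q, t) + w (Suc j) (\<mu> q) t * dird v \<mu> q * \<Theta> (q, t))" for v
   using continuous_on_add[OF continuous_on_mult[OF cw[of j] cD[of "(v,0)"]] continuous_on_mult[OF continuous_on_mult[OF cw[of "Suc j"] cdmu[of v]] cT]]
   by (simp add: case_prod_unfold)
 qed
 moreover have "integral {c..d} (%t. w j (\<mu> q) t * dird (v, 0) \<Theta> (q, t) + (w (Suc j) (\<mu> q) t * dird v \<mu> q) * \<Theta> (q, t))
  = dird v \<mu> q * integral {c..d} (%t. w (Suc j) (\<mu> q) t * \<Theta> (q, t)) +
    integral {c..d} (%t. w j (\<mu> q) t * dird (v, 0) \<Theta> (q, t))" for v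
 proof -
  have i: "(%t. w j (\<mu> q) t * g (q, t)) integrable_on {c..d}" if "continuous_on (S \<times> {c..d}) g" for g j
  proof -
   have "continuous_on {c..d} (%t. (%(q,t). w j (\<mu> q) t * g (q, t)) (q, t))"
    by (rule continuous_on_compose2[where t="S \<times> {c..d}"])
     (use continuous_on_mult[OF cw that] q in "auto simp: case_prod_unfold intro!: continuous_intros")
   then show ?thesis by (simp add: integrable_continuous_real)
  qed
  have "integral {c..d} (%t. w j (\<mu> q) t * dird (v, 0) \<Theta> (q, t) + (w (Suc j) (\<mu> q) t * dird v \<mu> q) * \<Theta> (q, t))
   = integral {c..d} (%t. w j (\<mu> q) t * dird (v, 0) \<Theta> (q, t) + dird v \<mu> q * (w (Suc j) (\<mu> q) t * \<Theta> (q, t)))"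
   by (rule integral_cong) (simp add: mult_ac)
  also have "... = integral {c..d} (%t. w j (\<mu> q) t * dird (v, 0) \<Theta> (q, t)) + integral {c..d} (%t. dird v \<mu> q * (w (Suc j) (\<mu> q) t * \<Theta> (q, t)))"
   by (rule Henstock_Kurzweil_Integration.integral_add)
    (use i[OF cD] integrable_on_mult_right[OF i[OF cT]] in auto)
  finally show ?thesis by (simp add: add.commute)
 qed
 ultimately show ?thesis by simp
qed

text \<open>The derivative in the exponent of a weight raises the power of the logarithm, so the weights
form a sequence closed under differentiation and the induction on \<open>k\<close> runs over all of them at
once.\<close>

lemma C_null_weighted_integral:
 fixes \<Theta> :: "'i => 'a::euclidean_space \<times> real => complex"
 assumes S: "open S" and w: "!!j. continuous_on (\<Omega> \<times> {c..d}) (%(m, t). w j m t)"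
  and dw: "!!j m t. m \<in> \<Omega> ==> t \<in> {c..d} ==> ((%m. w j m t) has_field_derivative w (Suc j) m t) (at m)"
  and mu: "\<mu> ` S \<subseteq> \<Omega>"
 shows "C_k_on k S \<mu> ==> C_null k F (S \<times> UNIV) \<Theta> ==>
  C_null k F S (%i q. integral {c..d} (%t. w j (\<mu> q) t * \<Theta> i (q, t)))"
proof (induction k arbitrary: \<Theta> j)
 case 0
 then show ?case using null_loc_integral[OF w _ mu] by (auto dest: C_k_on_continuous)
next
 case (Suc k)
 have S': "open (S \<times> (UNIV::real set))" using S by (simp add: open_Times)
 have Ck: "C_k_on 1 (S \<times> UNIV) (\<Theta> i)" for i
 proof -
  have "continuous_on (S \<times> UNIV) (dird v (\<Theta> i))" for v
   using Suc.prems(2) C_null_loc[of k F "S \<times> UNIV" "%i. dird v (\<Theta> i)"] by (simp add: null_loc_def del: split_paired_All)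
  then show ?thesis using Suc.prems(2) by auto
 qed
 have Cm: "C_k_on 1 S \<mu>"
  using Suc.prems(1) by (auto intro: C_k_on_continuous)
 show ?case
 proof (rule C_null_Suc_intro[OF S])
  show "null_loc F S (%i q. integral {c..d} (%t. w j (\<mu> q) t * \<Theta> i (q, t)))"
   by (rule null_loc_integral[OF w C_k_on_continuous[OF Suc.prems(1)] mu C_null_loc[OF Suc.prems(2)]])
  show "C_null k F S (%i q. dird v \<mu> q * integral {c..d} (%t. w (Suc j) (\<mu> q) t * \<Theta> i (q, t)) +
    integral {c..d} (%t. w j (\<mu> q) t * dird (v, 0) (\<Theta> i) (q, t)))" for v
   by (intro C_null_add[OF S] C_null_prod[OF S bounded_bilinear_mult] Suc.IH)
    (use Suc.prems in "auto intro: C_k_on_SucD C_null_SucD")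
  show "((%q. integral {c..d} (%t. w j (\<mu> q) t * \<Theta> i (q, t))) has_derivative
   (%v. dird v \<mu> x * integral {c..d} (%t. w (Suc j) (\<mu> x) t * \<Theta> i (x, t)) +
    integral {c..d} (%t. w j (\<mu> x) t * dird (v, 0) (\<Theta> i) (x, t)))) (at x)" if "x \<in> S" for i x
   by (rule has_derivative_weighted_integral[where k=0 and w=w and j=j and \<Omega>=\<Omega>, OF S w dw mu])
    (use Cm Ck[of i] that in "simp_all del: C_k_on.simps split_paired_All")
 qed
qed

section \<open>Smooth maps\<close>

named_theorems smooth_intros
declare open_UNIV [smooth_intros]

definition smooth :: "'a::real_normed_vector set => ('a => 'b::real_normed_vector) => bool" where
 "smooth S f \<longleftrightarrow> (\<forall>k. C_k_on k S f)"

lemma smoothI: "(!!k. C_k_on k S f) ==> smooth S f"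
 by (simp add: smooth_def)

lemma smoothD: "smooth S f ==> C_k_on k S f"
 by (simp add: smooth_def)

lemma smooth_dird: "smooth S f ==> smooth S (dird v f)"
 unfolding smooth_def by (metis C_k_on.simps(2))

lemma smooth_has_derivative:
 "smooth S f ==> x \<in> S ==> (f has_derivative (%v. dird v f x)) (at x)"
 by (rule C_k_has_derivative) (rule smoothD)

lemma smooth_differentiable: "smooth S f ==> x \<in> S ==> f differentiable (at x)"
 using smooth_has_derivative differentiable_def by blast

lemma smooth_continuous: "smooth S f ==> continuous_on S f"
 using C_k_on_continuous smoothD by blast

lemma smooth_SucI:
 assumes "open S" "!!x. x \<in> S ==> (f has_derivative f' x) (at x)" "!!v. smooth S (%x. f' x v)"
 shows "smooth S f"
proof (rule smoothI)
 fix k show "C_k_on k S f"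
  by (rule C_k_on_SucD, rule C_k_on_SucI[OF assms(1,2)]) (auto intro: smoothD assms(3))
qed

lemma smooth_cong: "open S ==> (!!x. x \<in> S ==> f x = g x) ==> smooth S f ==> smooth S g"
 unfolding smooth_def by (metis C_k_on_cong)

lemma smooth_subset: "T \<subseteq> S ==> smooth S f ==> smooth T f"
 unfolding smooth_def by (metis C_k_on_subset)

lemma smooth_const [smooth_intros]: "smooth S (%_. c)"
proof (rule smoothI)
 fix k show "C_k_on k S (%_. c)"
 proof (induction k arbitrary: c)
  case (Suc k)
  have "dird v (%_. c) = (%_. 0)" for v :: 'a
   by (rule ext, rule dird_eq) (rule has_derivative_const)
  then show ?case using Suc by simp
 qed auto
qed

lemma smooth_id [smooth_intros]: assumes "open S" shows "smooth S (%x. x)"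
 by (rule smooth_SucI[OF assms has_derivative_ident]) (rule smooth_const)

lemma smooth_linear: "open S ==> bounded_linear L ==> smooth S f ==> smooth S (%x. L (f x))"
 unfolding smooth_def by (metis C_null_linear_fixed)

lemma smooth_bounded_linear: "open S ==> bounded_linear L ==> smooth S L"
 using smooth_linear[OF _ _ smooth_id] by blast

lemma smooth_add [smooth_intros]: "open S ==> smooth S f ==> smooth S g ==> smooth S (%x. f x + g x)"
 using C_null_add[of S _ bot "%_::unit. f" "%_. g"]
 by (simp add: smooth_def C_k_on_iff_C_null[where 'i=unit])

lemma smooth_bilinear:
 "open S ==> bounded_bilinear pr ==> smooth S f ==> smooth S g ==> smooth S (%x. pr (f x) (g x))"
 using C_null_prod[of S pr _ f bot "%_::unit. g"]
 by (simp add: smooth_def C_k_on_iff_C_null[where 'i=unit and f=g] C_k_on_iff_C_null[where 'i=unit and f="%x. pr (f x) (g x)"])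

lemmas smooth_scaleR = smooth_bilinear[OF _ bounded_bilinear_scaleR]
lemmas smooth_mult [smooth_intros] = smooth_bilinear[OF _ bounded_bilinear_mult]
lemmas smooth_inner [smooth_intros] = smooth_bilinear[OF _ bounded_bilinear_inner]

lemma smooth_minus [smooth_intros]: "open S ==> smooth S f ==> smooth S (%x. - f x)"
 by (rule smooth_linear[OF _ bounded_linear_minus[OF bounded_linear_ident]])

lemma smooth_diff [smooth_intros]: "open S ==> smooth S f ==> smooth S g ==> smooth S (%x. f x - g x)"
 using smooth_add[of S f "%x. - g x"] smooth_minus[of S g] by simp

lemma smooth_sum [smooth_intros]: "open S ==> (!!i. i \<in> I ==> smooth S (f i)) ==> smooth S (%x. \<Sum>i\<in>I. f i x)"
 by (induction I rule: infinite_finite_induct) (auto intro: smooth_add smooth_const)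

lemma smooth_prod [smooth_intros]:
 fixes f :: "'i => 'a::real_normed_vector => 'b::real_normed_field"
 shows "open S ==> (!!i. i \<in> I ==> smooth S (f i)) ==> smooth S (%x. \<Prod>i\<in>I. f i x)"
 by (induction I rule: infinite_finite_induct) (auto intro: smooth_mult smooth_const)

lemma smooth_power [smooth_intros]:
 fixes f :: "'a::real_normed_vector => 'b::real_normed_field"
 shows "open S ==> smooth S f ==> smooth S (%x. f x ^ n)"
 by (induction n) (auto intro: smooth_mult smooth_const)

lemma C_null_compose_smooth:
 fixes \<phi> :: "'a::euclidean_space => 'c::euclidean_space"
 assumes "open S" "open T" "\<phi> ` S \<subseteq> T" "smooth S \<phi>" "C_null k F T \<Phi>"
 shows "C_null k F S (%i x. \<Phi> i (\<phi> x))"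
 using C_null_compose[OF assms(1-3)] assms(4,5) smoothD by blast

lemma smooth_compose:
 fixes g :: "'a::euclidean_space => 'c::euclidean_space"
 assumes "open S" "open T" "g ` S \<subseteq> T" "smooth S g" "smooth T f"
 shows "smooth S (%x. f (g x))"
proof (rule smoothI)
 fix k
 show "C_k_on k S (%x. f (g x))"
  using C_null_compose_smooth[OF assms(1-4), of k bot "%_::unit. f"] smoothD[OF assms(5), of k]
  by (simp add: C_k_on_iff_C_null[where 'i=unit and f=f] C_k_on_iff_C_null[where 'i=unit and f="%x. f (g x)"])
qed

lemma smooth_open_cover:
 fixes S :: "'a::euclidean_space set"
 assumes "open S" and "!!x. x \<in> S ==> \<exists>U. open U & x \<in> U & smooth U f"
 shows "smooth S f"
proof (rule smoothI)
 fix k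
 show "C_k_on k S f"
  unfolding C_k_on_iff_C_null[where 'i=unit]
  by (rule C_null_open_cover[OF assms(1)])
   (use assms(2) smoothD in "force simp: C_k_on_iff_C_null[where 'i=unit, symmetric]")
qed

lemma smooth_euclidean:
 fixes f :: "'a::real_normed_vector => 'b::euclidean_space"
 assumes "open S" "!!b. b \<in> Basis ==> smooth S (%x. f x \<bullet> b)"
 shows "smooth S f"
proof -
 have "smooth S (%x. \<Sum>b\<in>Basis. (f x \<bullet> b) *\<^sub>R b)"
  by (intro smooth_sum smooth_scaleR assms smooth_const)
 then show ?thesis by (simp add: euclidean_representation)
qed

lemma smooth_Pair [smooth_intros]:
 assumes S: "open S" and "smooth S f" "smooth S g"
 shows "smooth S (%x. (f x, g x))"
proof -
 have 1: "bounded_linear (%y. (y, 0))" "bounded_linear (%y. (0, y))"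
  by (intro bounded_linear_Pair bounded_linear_ident bounded_linear_zero)+
 show ?thesis
  using smooth_add[OF S smooth_linear[OF S 1(1) assms(2)] smooth_linear[OF S 1(2) assms(3)]] by simp
qed

lemma smooth_vec [smooth_intros]:
 fixes f :: "'a::real_normed_vector => 'n::finite => 'b::euclidean_space"
 assumes "open S" "!!i. smooth S (%x. f x i)"
 shows "smooth S (%x. \<chi> i. f x i)"
proof (rule smooth_euclidean[OF assms(1)])
 fix b :: "'b^'n" assume "b \<in> Basis"
 then obtain i c where b: "b = axis i c" by (auto simp: Basis_vec_def)
 have "smooth S (%x. f x i \<bullet> c)"
  by (intro smooth_inner smooth_const assms)
 then show "smooth S (%x. (\<chi> i. f x i) \<bullet> b)"
  by (simp add: b inner_axis)
qed

lemma smooth_vec_nth [smooth_intros]: "open S ==> smooth S f ==> smooth S (%x. f x $ i)"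
 by (rule smooth_linear[OF _ bounded_linear_vec_nth])

lemma smooth_det [smooth_intros]:
 fixes f :: "'a::real_normed_vector => real^'n^'n"
 assumes "open S" "smooth S f"
 shows "smooth S (%x. det (f x))"
 unfolding det_def
 by (intro smooth_intros assms)

lemma smooth_matrix_mult [smooth_intros]:
 fixes f :: "'a::real_normed_vector => real^'n^'m" and g :: "'a => real^'k^'n"
 assumes "open S" "smooth S f" "smooth S g"
 shows "smooth S (%x. f x ** g x)"
 unfolding matrix_matrix_mult_def
 by (intro smooth_intros assms)

lemma smooth_transpose [smooth_intros]:
 fixes f :: "'a::real_normed_vector => real^'n^'m"
 assumes "open S" "smooth S f"
 shows "smooth S (%x. transpose (f x))"
 unfolding transpose_def
 by (intro smooth_vec smooth_vec_nth assms)

lemma smooth_of_real [smooth_intros]: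
 "open S ==> smooth S f ==> smooth S (%x. of_real (f x) :: 'b::{real_normed_algebra_1})"
 by (rule smooth_linear[OF _ bounded_linear_of_real])

lemma smooth_holomorphic:
 assumes "f holomorphic_on S" "open S"
 shows "smooth S f"
proof (rule smoothI)
 fix k
 have "C_k_on k S ((deriv ^^ j) f)" for j
 proof (induction k arbitrary: j)
  case 0
  then show ?case using assms by (auto intro!: holomorphic_on_imp_continuous_on holomorphic_higher_deriv)
 next
  case (Suc k)
  show ?case
  proof (rule C_k_on_SucI[OF assms(2)])
   fix z assume "z \<in> S"
   then have "((deriv ^^ j) f has_field_derivative (deriv ^^ Suc j) f z) (at z)"
    using holomorphic_derivI[OF holomorphic_higher_deriv[OF assms, of j] assms(2)] by simp
   then show "((deriv ^^ j) f has_derivative (%v. (deriv ^^ Suc j) f z * v)) (at z)"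
    by (simp add: has_field_derivative_def)
  next
   fix v show "C_k_on k S (%z. (deriv ^^ Suc j) f z * v)"
    by (rule C_null_linear_fixed[OF assms(2) bounded_linear_mult_left Suc.IH])
  qed
 qed
 from this[of 0] show "C_k_on k S f" by simp
qed

lemma smooth_inverse_real: "smooth {x::real. x ~= 0} inverse"
proof (rule smoothI)
 have o: "open {x::real. x ~= 0}" by (simp add: open_Collect_neq)
 fix k
 show "C_k_on k {x::real. x ~= 0} inverse"
 proof (induction k)
  case 0
  then show ?case by (auto intro!: continuous_intros)
 next
  case (Suc k)
  show ?case
  proof (rule C_k_on_SucI[OF o])
   fix x :: real assume "x \<in> {x. x ~= 0}"
   then show "(inverse has_derivative (%v. - (inverse x * inverse x) * v)) (at x)"
    by (auto intro!: derivative_eq_intros)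
  next
   fix v
   have "C_k_on k {x::real. x ~= 0} (%x. inverse x * inverse x)"
    using C_null_prod[OF o bounded_bilinear_mult Suc.IH, of bot "%_::unit. inverse"] Suc.IH
    by (simp add: C_k_on_iff_C_null[where 'i=unit])
   from C_null_linear_fixed[OF o _ this, of "%y. - y * v"]
   show "C_k_on k {x::real. x ~= 0} (%x. - (inverse x * inverse x) * v)"
    by (simp add: bounded_linear_mult_left bounded_linear_minus bounded_linear_compose[of "%y. - y" "%y. y * v"] bounded_linear_ident)
  qed
 qed
qed

lemma smooth_ln: "smooth {x::real. x > 0} ln"
proof (rule smooth_SucI)
 show o: "open {x::real. x > 0}" by (simp add: open_Collect_less)
 show "(ln has_derivative (%v. inverse x * v)) (at x)" if "x \<in> {x::real. x > 0}" for x
  using that DERIV_ln[of x] by (simp add: has_field_derivative_def)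
 show "smooth {x::real. x > 0} (%x. inverse x * v)" for v
  by (intro smooth_mult o smooth_const smooth_subset[OF _ smooth_inverse_real]) auto
qed

lemma smooth_exp_real: "smooth (UNIV::real set) exp"
proof (rule smoothI)
 fix k show "C_k_on k (UNIV::real set) exp"
 proof (induction k)
  case (Suc k)
  show ?case
  proof (rule C_k_on_SucI)
   show "(exp has_derivative (%v. exp x * v)) (at x)" for x :: real
    using DERIV_exp[of x] by (simp add: has_field_derivative_def)
   show "C_k_on k (UNIV::real set) (%x. exp x * v)" for v :: real
    by (rule C_null_linear_fixed[OF _ bounded_linear_mult_left Suc.IH]) auto
  qed auto
 qed (auto intro!: continuous_intros)
qed

lemma smooth_inverse:
 fixes f :: "'a::euclidean_space => real"
 assumes "open S" "smooth S f" "!!x. x \<in> S ==> f x ~= 0"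
 shows "smooth S (%x. inverse (f x))"
 by (rule smooth_compose[OF assms(1) _ _ assms(2) smooth_inverse_real])
  (use assms(3) in "auto simp: open_Collect_neq")

lemma smooth_ln_compose:
 fixes f :: "'a::euclidean_space => real"
 assumes "open S" "smooth S f" "!!x. x \<in> S ==> f x > 0"
 shows "smooth S (%x. ln (f x))"
 by (rule smooth_compose[OF assms(1) _ _ assms(2) smooth_ln])
  (use assms(3) in "auto simp: open_Collect_less")

lemma smooth_norm:
 fixes f :: "'a::euclidean_space => 'b::euclidean_space"
 assumes "open S" "smooth S f" "!!x. x \<in> S ==> f x ~= 0"
 shows "smooth S (%x. norm (f x))"
proof (rule smooth_cong[OF assms(1)])
 show "exp (ln (f x \<bullet> f x) * (1/2)) = norm (f x)" if "x \<in> S" for x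
 proof -
  have "f x \<bullet> f x > 0" using assms(3)[OF that] by simp
  then have "exp (ln (f x \<bullet> f x) * (1/2)) = sqrt (f x \<bullet> f x)"
   by (simp add: powr_half_sqrt[symmetric] powr_def mult.commute)
  then show ?thesis by (simp add: norm_eq_sqrt_inner)
 qed
 have "smooth S (%x. ln (f x \<bullet> f x) * (1 / 2))"
  by (intro smooth_mult smooth_const smooth_ln_compose smooth_inner assms(1,2)) (use assms(3) in auto)
 then show "smooth S (%x. exp (ln (f x \<bullet> f x) * (1 / 2)))"
  by (intro smooth_compose[OF assms(1) _ _ _ smooth_exp_real]) auto
qed

section \<open>Symmetry of second derivatives\<close>

lemma dird_linear_comp:
 assumes "(f has_derivative f') (at (x + t *\<^sub>R v))"
 shows "((%t. f (x + t *\<^sub>R v)) has_vector_derivative f' v) (at t within T)"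
proof -
 have "((%t. f (x + t *\<^sub>R v)) has_derivative (%s. f' (s *\<^sub>R v))) (at t within T)"
  by (rule has_derivative_compose[of "%t. x + t *\<^sub>R v" _ _ _ f, OF _ assms]) (auto intro!: derivative_eq_intros)
 then show ?thesis
  unfolding has_vector_derivative_def
  by (simp add: linear_cmul[OF has_derivative_linear[OF assms]])
qed

text \<open>Differentiate \<open>f(x + s u + t v) - f(x + t v) = \<integral> D_u f\<close> under the
integral sign with respect to \<open>t\<close>, then with respect to \<open>s\<close> at \<open>0\<close>.\<close>

lemma dird_symmetric:
 fixes f :: "'a::euclidean_space => complex"
 assumes S: "open S" and f: "C_k_on 2 S f" and x: "x \<in> S"
 shows "dird u (dird v f) x = dird v (dird u f) x"
proof -
 have f1: "(f has_derivative (%w. dird w f y)) (at y)" if "y \<in> S" for y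
  using f that by (intro C_k_has_derivative[of 1 S]) (auto simp: numeral_2_eq_2)
 have f2: "(dird w f has_derivative (%w'. dird w' (dird w f) y)) (at y)" if "y \<in> S" for y w
  using f that by (intro C_k_has_derivative[of 0 S]) (auto simp: numeral_2_eq_2)
 have c1: "continuous_on S (dird w f)" for w
  using f by (intro C_k_on_continuous[of 1]) (auto simp: numeral_2_eq_2)
 have c2: "continuous_on S (dird w (dird w' f))" for w w'
  using f by (intro C_k_on_continuous[of 0]) (auto simp: numeral_2_eq_2)
 obtain e where e: "e > 0" "ball x e \<subseteq> S" using S x openE by blast
 define d where "d = e / (2 * (norm u + norm v + 1))"
 have d: "d > 0" using e by (simp add: d_def add_nonneg_pos)
 have in_S: "x + r *\<^sub>R u + t *\<^sub>R v \<in> S" if "\<bar>r\<bar> <= d" "\<bar>t\<bar> <= d" for r t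
 proof -
  have "norm (r *\<^sub>R u + t *\<^sub>R v) <= d * norm u + d * norm v"
   using that by (intro norm_triangle_le add_mono) (auto intro!: mult_right_mono)
  also have "... < d * (2 * (norm u + norm v + 1))" using d by (simp add: algebra_simps)
   (smt (verit) mult_nonneg_nonneg norm_ge_zero)
  also have "... = e" by (simp add: d_def) (smt (verit) norm_ge_zero)
  finally have "norm (r *\<^sub>R u + t *\<^sub>R v) < e" .
  moreover have "dist x (x + r *\<^sub>R u + t *\<^sub>R v) = norm (r *\<^sub>R u + t *\<^sub>R v)"
   by (metis add.assoc add_diff_cancel_left' dist_commute dist_norm)
  ultimately have "x + r *\<^sub>R u + t *\<^sub>R v \<in> ball x e" by simp
  then show ?thesis using e by blast
 qed
 have I1: "((%r. dird u f (x + r *\<^sub>R u + t *\<^sub>R v)) has_integral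
   f (x + s *\<^sub>R u + t *\<^sub>R v) - f (x + t *\<^sub>R v)) {0..s}" if "0 <= s" "s <= d" "\<bar>t\<bar> <= d" for s t
 proof -
  have "((%r. dird u f ((x + t *\<^sub>R v) + r *\<^sub>R u)) has_integral
   f ((x + t *\<^sub>R v) + s *\<^sub>R u) - f ((x + t *\<^sub>R v) + 0 *\<^sub>R u)) {0..s}"
  proof (rule fundamental_theorem_of_calculus[OF that(1)])
   fix r assume "r \<in> {0..s}"
   then have "x + r *\<^sub>R u + t *\<^sub>R v \<in> S" using in_S that by auto
   then have "(x + t *\<^sub>R v) + r *\<^sub>R u \<in> S" by (simp add: ac_simps)
   then show "((%r. f ((x + t *\<^sub>R v) + r *\<^sub>R u)) has_vector_derivative dird u f ((x + t *\<^sub>R v) + r *\<^sub>R u)) (at r within {0..s})"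
    by (intro dird_linear_comp f1)
  qed
  then show ?thesis by (simp add: ac_simps)
 qed
 have I2: "dird v f (x + s *\<^sub>R u) - dird v f x = integral {0..s} (%r. dird v (dird u f) (x + r *\<^sub>R u))"
  if s: "0 <= s" "s <= d" for s
 proof -
  let ?T = "{-d<..<d}"
  have img: "(%(t, r). x + r *\<^sub>R u + t *\<^sub>R v) ` (?T \<times> {0..s}) \<subseteq> S" using in_S s by auto
  have cc: "continuous_on (?T \<times> {0..s}) (%(t, r). g (x + r *\<^sub>R u + t *\<^sub>R v))" if "continuous_on S g" for g :: "'a => complex"
   unfolding case_prod_unfold
   by (rule continuous_on_compose2[OF that]) (use img in "auto intro!: continuous_intros")
  have "((%t. integral {0..s} (%r. dird u f (x + r *\<^sub>R u + t *\<^sub>R v))) has_derivative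
   (%\<tau>. integral {0..s} (%r. \<tau> *\<^sub>R dird v (dird u f) (x + r *\<^sub>R u + 0 *\<^sub>R v)))) (at 0)"
  proof (rule has_derivative_integral_param[where S="?T"])
   fix t r assume tr: "t \<in> ?T" "r \<in> {0..s}"
   then have "x + r *\<^sub>R u + t *\<^sub>R v \<in> S" using in_S s by auto
   from dird_linear_comp[OF f2[OF this], where T=UNIV]
   show "((%t. dird u f (x + r *\<^sub>R u + t *\<^sub>R v)) has_derivative (%\<tau>. \<tau> *\<^sub>R dird v (dird u f) (x + r *\<^sub>R u + t *\<^sub>R v))) (at t)"
    by (simp add: has_vector_derivative_def)
  next
   show "continuous_on (?T \<times> {0..s}) (%(t, r). dird u f (x + r *\<^sub>R u + t *\<^sub>R v))"
    by (rule cc[OF c1])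
   fix \<tau> :: real
   show "continuous_on (?T \<times> {0..s}) (%(t, r). \<tau> *\<^sub>R dird v (dird u f) (x + r *\<^sub>R u + t *\<^sub>R v))"
    using continuous_on_scaleR[OF continuous_on_const cc[OF c2]] by (simp add: case_prod_unfold)
  qed (use d in auto)
  then have A: "((%t. integral {0..s} (%r. dird u f (x + r *\<^sub>R u + t *\<^sub>R v))) has_vector_derivative
   integral {0..s} (%r. dird v (dird u f) (x + r *\<^sub>R u))) (at 0)"
   by (simp add: has_vector_derivative_def)
  have B: "((%t. f ((x + s *\<^sub>R u) + t *\<^sub>R v) - f (x + t *\<^sub>R v)) has_vector_derivative
   dird v f (x + s *\<^sub>R u) - dird v f x) (at 0)"
   using in_S[of s 0] in_S[of 0 0] s d
   by (intro has_vector_derivative_diff dird_linear_comp) (use f1 in auto)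
  have "((%t. f ((x + s *\<^sub>R u) + t *\<^sub>R v) - f (x + t *\<^sub>R v)) has_vector_derivative
   integral {0..s} (%r. dird v (dird u f) (x + r *\<^sub>R u))) (at 0)"
  proof (rule has_vector_derivative_transform_within_open[OF A, of "?T"])
   fix t assume "t \<in> ?T"
   then have "\<bar>t\<bar> <= d" by auto
   from integral_unique[OF I1[OF s this]]
   show "integral {0..s} (%r. dird u f (x + r *\<^sub>R u + t *\<^sub>R v)) = f ((x + s *\<^sub>R u) + t *\<^sub>R v) - f (x + t *\<^sub>R v)"
    by simp
  qed (use d in auto)
  then show ?thesis using vector_derivative_unique_at[OF B] by blast
 qed
 have cont: "continuous_on {0..d} (%r. dird v (dird u f) (x + r *\<^sub>R u))"
  by (rule continuous_on_compose2[OF c2]) (use in_S[of _ 0] in "auto intro!: continuous_intros")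
 have A: "((%s. integral {0..s} (%r. dird v (dird u f) (x + r *\<^sub>R u))) has_vector_derivative dird v (dird u f) (x + 0 *\<^sub>R u)) (at 0 within {0..d})"
  by (rule integral_has_vector_derivative[OF cont]) (use d in auto)
 have "((%s. dird v f (x + s *\<^sub>R u) - dird v f x) has_vector_derivative dird v (dird u f) x) (at 0 within {0..d})"
  by (rule has_vector_derivative_transform[OF _ _ A[simplified]]) (use d I2 in auto)
 moreover have "((%s. dird v f (x + s *\<^sub>R u) - dird v f x) has_vector_derivative dird u (dird v f) x - 0) (at 0 within {0..d})"
  by (intro has_vector_derivative_diff dird_linear_comp has_vector_derivative_const) (use f2[OF x] in auto)
 moreover have nt: "at (0::real) within {0..d} ~= bot"
  using d by (auto simp: trivial_limit_within islimpt_Icc)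
 ultimately show ?thesis
  by (metis (no_types, lifting) diff_zero vector_derivative_unique_within)
qed

lemma C_null_smooth_mult:
 assumes "open S" "smooth S g" "C_null k F S \<Phi>"
 shows "C_null k F S (%i x. g x * \<Phi> i x :: 'b::real_normed_algebra)"
 by (rule C_null_prod[OF assms(1) bounded_bilinear_mult smoothD[OF assms(2)] assms(3)])

section \<open>Null families of smooth functions\<close>

definition smooth_null :: "'i filter => 'a::real_normed_vector set => ('i => 'a => 'b::real_normed_vector) => bool" where
 "smooth_null F S \<Phi> \<longleftrightarrow> (\<forall>k. C_null k F S \<Phi>)"

lemma smooth_iff_smooth_null: "smooth S f \<longleftrightarrow> smooth_null bot S (%_::'i. f)"
 by (simp add: smooth_def smooth_null_def C_k_on_iff_C_null[where 'i='i])

lemma C_null_imp_C_k: "C_null k F S \<Phi> ==> C_k_on k S (\<Phi> i)"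
proof (induction k arbitrary: \<Phi>)
 case 0 then show ?case by (auto simp: null_loc_def)
next
 case (Suc k)
 then show ?case by auto
qed

lemma smooth_null_smooth: "smooth_null F S \<Phi> ==> smooth S (\<Phi> i)"
 by (meson C_null_imp_C_k smooth_null_def smooth_def)

lemma smooth_null_dird: "smooth_null F S \<Phi> ==> smooth_null F S (%i. dird v (\<Phi> i))"
 unfolding smooth_null_def by (metis C_null.simps(2))

lemma smooth_null_cong:
 "open S ==> (!!i x. x \<in> S ==> \<Phi> i x = \<Psi> i x) ==> smooth_null F S \<Phi> ==> smooth_null F S \<Psi>"
 unfolding smooth_null_def using C_null_cong by blast

lemma smooth_null_subset: "T \<subseteq> S ==> smooth_null F S \<Phi> ==> smooth_null F T \<Phi>"
 unfolding smooth_null_def using C_null_subset by blast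

lemma smooth_null_sum:
 "open S ==> (!!j. j \<in> I ==> smooth_null F S (\<Phi> j)) ==> smooth_null F S (%i x. \<Sum>j\<in>I. \<Phi> j i x)"
 by (simp add: smooth_null_def C_null_sum)

lemma smooth_null_bilinear:
 "open S ==> bounded_bilinear pr ==> smooth S g ==> smooth_null F S \<Phi> ==> smooth_null F S (%i x. pr (g x) (\<Phi> i x))"
 by (simp add: smooth_null_def smooth_def C_null_prod)

lemma smooth_null_mult:
 fixes g :: "'a::real_normed_vector => 'b::real_normed_algebra"
 shows "open S ==> smooth S g ==> smooth_null F S \<Phi> ==> smooth_null F S (%i x. g x * \<Phi> i x)"
 by (rule smooth_null_bilinear[OF _ bounded_bilinear_mult])

lemma smooth_null_compose:
 fixes \<phi> :: "'a::euclidean_space => 'c::euclidean_space"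
 assumes "open S" "open T" "\<phi> ` S \<subseteq> T" "smooth S \<phi>" "smooth_null F T \<Phi>"
 shows "smooth_null F S (%i x. \<Phi> i (\<phi> x))"
 using assms(5) by (simp add: smooth_null_def C_null_compose_smooth[OF assms(1-4)])

lemma smooth_null_open_cover:
 fixes S :: "'a::euclidean_space set"
 assumes "open S" and "!!x. x \<in> S ==> \<exists>U. open U & x \<in> U & smooth_null F U \<Phi>"
 shows "smooth_null F S \<Phi>"
 unfolding smooth_null_def
proof
 fix k show "C_null k F S \<Phi>"
 proof (rule C_null_open_cover[OF assms(1)])
  fix x assume "x \<in> S"
  then show "\<exists>U. open U & x \<in> U & C_null k F U \<Phi>"
   using assms(2)[of x] unfolding smooth_null_def by auto
 qed
qed

lemma smooth_null_weighted_integral: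
 fixes \<Theta> :: "'i => 'a::euclidean_space \<times> real => complex"
 assumes "open S" "!!j. continuous_on (\<Omega> \<times> {c..d}) (%(m, t). w j m t)"
  and "!!j m t. m \<in> \<Omega> ==> t \<in> {c..d} ==> ((%m. w j m t) has_field_derivative w (Suc j) m t) (at m)"
  and "\<mu> ` S \<subseteq> \<Omega>" "smooth S \<mu>" "smooth_null F (S \<times> UNIV) \<Theta>"
 shows "smooth_null F S (%i q. integral {c..d} (%t. w j (\<mu> q) t * \<Theta> i (q, t)))"
 unfolding smooth_null_def
proof
 fix k
 show "C_null k F S (%i q. integral {c..d} (%t. w j (\<mu> q) t * \<Theta> i (q, t)))"
  by (rule C_null_weighted_integral[where \<Omega>=\<Omega> and w=w, OF assms(1-4)])
   (use assms(5,6) in "auto simp: smooth_null_def smooth_def")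
qed

lemma smooth_null_integral:
 fixes \<Theta> :: "'i => 'a::euclidean_space \<times> real => complex"
 assumes "open S" "smooth_null F (S \<times> UNIV) \<Theta>"
 shows "smooth_null F S (%i q. integral {c..d} (%t. \<Theta> i (q, t)))"
 using smooth_null_weighted_integral[OF assms(1), where \<Omega>=UNIV and c=c and d=d and \<mu>="%_. 0" and
   w="%j _ _. if j = 0 then 1 else 0" and j=0, OF _ _ _ _ assms(2)]
 by (auto simp: smooth_const case_prod_unfold)

section \<open>Complex-linear directional derivatives\<close>

text \<open>The Cauchy-Riemann equation in the real plane spanned by \<open>u\<close> and \<open>v\<close>, where \<open>v\<close> stands
for \<open>\<i> u\<close>.\<close>

definition clin :: "'a::real_normed_vector => 'a => 'a set => ('a => complex) => bool" where
 "clin u v S f \<longleftrightarrow> (\<forall>x\<in>S. dird v f x = \<i> * dird u f x)"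

lemma clin_cong:
 assumes S: "open S" and fg: "!!x. x \<in> S ==> f x = g x" and f: "smooth S f" "clin u v S f"
 shows "clin u v S g"
proof -
 have "dird w g x = dird w f x" if "x \<in> S" for w x
  by (rule dird_eq, rule has_derivative_transform_within_open[OF smooth_has_derivative[OF f(1) that] S that fg])
 then show ?thesis using f(2) by (simp add: clin_def)
qed

lemma clin_mult:
 assumes "smooth S f" "smooth S g" "clin u v S f" "clin u v S g"
 shows "clin u v S (%x. f x * g x)"
proof -
 have "dird w (%x. f x * g x) x = f x * dird w g x + dird w f x * g x" if "x \<in> S" for w x
  by (intro dird_eq has_derivative_mult smooth_has_derivative[OF assms(1) that] smooth_has_derivative[OF assms(2) that])
 then show ?thesis using assms(3,4) by (simp add: clin_def algebra_simps)
qed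

lemma clin_holomorphic:
 assumes f: "smooth S f" "clin u v S f" and g: "g holomorphic_on T" "open T" "f ` S \<subseteq> T"
 shows "clin u v S (%x. g (f x))"
proof -
 have "dird w (%x. g (f x)) x = deriv g (f x) * dird w f x" if "x \<in> S" for w x
 proof (rule dird_eq)
  have "(g has_derivative (*) (deriv g (f x))) (at (f x))"
   using holomorphic_derivI[OF g(1,2), of "f x"] g(3) that by (auto simp: has_field_derivative_def)
  then show "((%x. g (f x)) has_derivative (%w. deriv g (f x) * dird w f x)) (at x)"
   by (rule has_derivative_compose[OF smooth_has_derivative[OF f(1) that]])
 qed
 then show ?thesis using f(2) by (simp add: clin_def)
qed

lemma clin_dird:
 fixes f :: "'a::euclidean_space => complex"
 assumes S: "open S" and f: "smooth S f" and c: "clin u v S f"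
 shows "clin u v S (dird w f)"
 unfolding clin_def
proof
 fix x assume x: "x \<in> S"
 have "dird v (dird w f) x = dird w (dird v f) x"
  by (rule dird_symmetric[OF S smoothD[OF f] x])
 also have "... = \<i> * dird w (dird u f) x"
 proof (rule dird_eq)
  have "((%x. \<i> * dird u f x) has_derivative (%w. \<i> * dird w (dird u f) x)) (at x)"
   by (intro has_derivative_mult_right smooth_has_derivative[OF smooth_dird[OF f] x])
  then show "(dird v f has_derivative (%w. \<i> * dird w (dird u f) x)) (at x)"
   by (rule has_derivative_transform_within_open[OF _ S x]) (use c in "auto simp: clin_def")
 qed
 also have "dird w (dird u f) x = dird u (dird w f) x"
  by (rule dird_symmetric[OF S smoothD[OF f] x])
 finally show "dird v (dird w f) x = \<i> * dird u (dird w f) x" .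
qed

lemma clin_compose:
 assumes f: "smooth T f" "clin u v T f" and g: "g ` S \<subseteq> T" and dg: "!!x. x \<in> S ==> (g has_derivative g' x) (at x)"
  and uv: "!!x. x \<in> S ==> g' x u' = u" "!!x. x \<in> S ==> g' x v' = v"
 shows "clin u' v' S (%x. f (g x))"
proof -
 have "dird w (%x. f (g x)) x = dird (g' x w) f (g x)" if "x \<in> S" for w x
  using g that by (intro dird_eq has_derivative_compose[OF dg] smooth_has_derivative[OF f(1)]) auto
 then show ?thesis using f(2) g uv by (auto simp: clin_def)
qed

lemma clin_weighted_integral:
 fixes \<Theta> :: "'a::euclidean_space \<times> real => complex"
 assumes S: "open S" and w: "!!j. continuous_on (\<Omega> \<times> {c..d}) (%(m, t). w j m t)"
  and dw: "!!j m t. m \<in> \<Omega> ==> t \<in> {c..d} ==> ((%m. w j m t) has_field_derivative w (Suc j) m t) (at m)"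
  and mu: "\<mu> ` S \<subseteq> \<Omega>" and s: "smooth S \<mu>" "smooth (S \<times> UNIV) \<Theta>"
  and cl: "clin u v S \<mu>" "clin (u, 0) (v, 0) (S \<times> UNIV) \<Theta>"
 shows "clin u v S (%q. integral {c..d} (%t. w j (\<mu> q) t * \<Theta> (q, t)))"
 unfolding clin_def
proof
 fix q assume q: "q \<in> S"
 have d: "dird v (%q. integral {c..d} (%t. w j (\<mu> q) t * \<Theta> (q, t))) q =
  dird v \<mu> q * integral {c..d} (%t. w (Suc j) (\<mu> q) t * \<Theta> (q, t)) +
    integral {c..d} (%t. w j (\<mu> q) t * dird (v, 0) \<Theta> (q, t))" for v
  by (rule dird_eq, rule has_derivative_weighted_integral[where w=w and \<Omega>=\<Omega> and k=0, OF S w dw mu smoothD[OF s(1)] smoothD[OF s(2)] q])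
 have "dird (v, 0) \<Theta> (q, t) = \<i> * dird (u, 0) \<Theta> (q, t)" for t
  using cl(2) q by (auto simp: clin_def)
 then have "integral {c..d} (%t. w j (\<mu> q) t * dird (v, 0) \<Theta> (q, t)) = integral {c..d} (%t. \<i> * (w j (\<mu> q) t * dird (u, 0) \<Theta> (q, t)))"
  by (simp add: mult_ac)
 then show "dird v (%q. integral {c..d} (%t. w j (\<mu> q) t * \<Theta> (q, t))) q =
  \<i> * dird u (%q. integral {c..d} (%t. w j (\<mu> q) t * \<Theta> (q, t))) q"
  unfolding d using cl(1) q by (simp add: clin_def distrib_left mult.assoc)
qed

lemma clin_integral:
 fixes \<Theta> :: "'a::euclidean_space \<times> real => complex"
 assumes S: "open S" "smooth (S \<times> UNIV) \<Theta>" "clin (u, 0) (v, 0) (S \<times> UNIV) \<Theta>"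
 shows "clin u v S (%q. integral {c..d} (%t. \<Theta> (q, t)))"
proof -
 have "clin u v S (%_. 0)"
  by (auto simp: clin_def intro!: dird_eq derivative_eq_intros simp: dird_eq[OF has_derivative_const])
 then show ?thesis
  using clin_weighted_integral[OF assms(1), where \<Omega>=UNIV and c=c and d=d and \<mu>="%_. 0" and
    w="%j _ _. if j = 0 then 1 else 0" and j=0, OF _ _ _ _ assms(2) _ assms(3)]
  by (auto simp: smooth_const case_prod_unfold)
qed

section \<open>Powers and logarithms as weights\<close>

definition log_powr :: "nat => complex => real => complex" where
 "log_powr j m t = of_real \<bar>t\<bar> powr m * of_real (ln \<bar>t\<bar>) ^ j"

lemma log_powr_deriv: "((%m. log_powr j m t) has_field_derivative log_powr (Suc j) m t) (at m)"
proof (cases "t = 0")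
 case False
 then have "Ln (of_real \<bar>t\<bar>) = of_real (ln \<bar>t\<bar>)" using Ln_of_real[of "\<bar>t\<bar>"] by simp
 then show ?thesis unfolding log_powr_def using False
  by (auto intro!: derivative_eq_intros  simp: powr_def)
qed (simp add: log_powr_def)

lemma norm_log_powr: "norm (log_powr j m t) = \<bar>t\<bar> powr Re m * \<bar>ln \<bar>t\<bar>\<bar> ^ j"
 by (simp add: log_powr_def norm_mult norm_power norm_powr_real_powr)

lemma abs_ln_le: 
 assumes "0 < x" "x <= 1" "d > 0" shows "\<bar>ln x\<bar> <= x powr (-d) / (d::real)"
proof -
 have "ln (x powr (-d)) <= x powr (-d) - 1" using assms by (intro ln_le_minus_one) auto
 then have "- d * ln x <= x powr (-d)" using assms by (simp add: ln_powr)
 then have "- ln x <= x powr (-d) / d" using assms by (simp add: field_simps)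
 moreover have "ln x <= 0" using assms by simp
 ultimately show ?thesis by simp
qed

lemma log_powr_continuous: "continuous_on ({m. Re m > 0} \<times> T) (%(m, t). log_powr j m t)"
proof (rule continuous_at_imp_continuous_on, safe)
 fix m0 :: complex and t0 :: real assume m0: "Re m0 > 0"
 show "isCont (%(m, t). log_powr j m t) (m0, t0)"
 proof (cases "t0 = 0")
  case False
  have "continuous_on (UNIV \<times> {t. t ~= 0}) (%x::complex \<times> real. exp (fst x * of_real (ln \<bar>snd x\<bar>)) * of_real (ln \<bar>snd x\<bar>) ^ j)"
   by (auto intro!: continuous_intros)
  then have "continuous_on (UNIV \<times> {t. t ~= 0}) (%(m, t). log_powr j m t)"
   by (rule continuous_on_eq) (auto simp: log_powr_def powr_def Ln_of_real )
  moreover have "open ((UNIV :: complex set) \<times> {t::real. t ~= 0})" by (intro open_Times open_UNIV open_Collect_neq continuous_intros)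
  ultimately show ?thesis using False by (simp add: continuous_on_eq_continuous_at)
 next
  case True
  define c where "c = Re m0 / 2"
  have c: "c > 0" using m0 by (simp add: c_def)
  define d where "d = c / (2 * (j + 1))"
  have d: "d > 0" "c - j * d \<ge> c / 2" using c by (auto simp: d_def field_simps)
  have bound: "norm (log_powr j m t) <= \<bar>t\<bar> powr (c/2) / d ^ j" if "Re m > c" "\<bar>t\<bar> < 1" for m t
  proof (cases "t = 0")
   case False
   have "norm (log_powr j m t) <= \<bar>t\<bar> powr c * (\<bar>t\<bar> powr (-d) / d) ^ j"
    unfolding norm_log_powr using that False d
    by (intro mult_mono power_mono abs_ln_le powr_mono') auto
   also have "... = \<bar>t\<bar> powr (c - j * d) / d ^ j"
    using False by (simp add: power_divide powr_diff powr_minus powr_power mult.commute field_simps)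
   also have "... <= \<bar>t\<bar> powr (c/2) / d ^ j"
    using d that False by (intro divide_right_mono powr_mono') auto
   finally show ?thesis .
  qed (use d in "simp add: norm_log_powr")
  have "((%x. \<bar>snd x\<bar> powr (c/2) / d ^ j) \<longlongrightarrow> 0) (at (m0, 0::real))"
  proof -
   have "isCont (%x::complex \<times> real. \<bar>snd x\<bar> powr (c/2) / d ^ j) (m0, 0)"
    using c d by (intro continuous_intros) auto
   then show ?thesis using c by (simp add: continuous_at)
  qed
  moreover have "eventually (%x. norm (case x of (m, t) => log_powr j m t) <= \<bar>snd x\<bar> powr (c/2) / d ^ j) (at (m0, 0::real))"
  proof -
   have "open ({m. Re m > c} \<times> {t::real. \<bar>t\<bar> < 1})"
    by (intro open_Times open_Collect_less continuous_intros)
   moreover have "(m0, 0) \<in> {m. Re m > c} \<times> {t::real. \<bar>t\<bar> < 1}" using m0 by (simp add: c_def)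
   ultimately show ?thesis
    unfolding eventually_at_topological using bound
    by (intro exI[of _ "{m. Re m > c} \<times> {t::real. \<bar>t\<bar> < 1}"]) auto
  qed
  ultimately have "((%(m, t). log_powr j m t) \<longlongrightarrow> 0) (at (m0, 0::real))"
   by (rule Lim_null_comparison[rotated])
  moreover have "log_powr j m0 0 = 0" by (simp add: log_powr_def)
  ultimately show ?thesis using True by (simp add: continuous_at)
 qed
qed

section \<open>Regularization in one coordinate\<close>

definition upd :: "'a::euclidean_space => 'a => real => 'a" where
 "upd e x s = x + (s - x \<bullet> e) *\<^sub>R e"

text \<open>Along the coordinate \<open>e\<close> this is the odd part of \<open>\<phi>\<close> divided by the coordinate,
written as an average of derivatives to make its smoothness at \<open>0\<close> visible.\<close>

definition avg_deriv :: "'a::euclidean_space => ('a => complex) => 'a => complex" where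
 "avg_deriv e \<phi> x = (1/2) * integral {-1..1} (%t. dird e \<phi> (x + ((t - 1) * (x \<bullet> e)) *\<^sub>R e))"

definition even_op :: "'a::euclidean_space => ('a => complex) => 'a => complex" where
 "even_op e \<phi> = avg_deriv e (dird e \<phi>)"

text \<open>The distribution \<open>|s|^m / \<Gamma>((m+1)/2)\<close> applied in the coordinate \<open>e\<close>, after
\<open>M\<close> integrations by parts, each of which trades a pole of the integral for a factor of the gamma
function and an application of \<^const>\<open>even_op\<close>. The integral converges for \<open>Re m + 2M > -1\<close>,
and for a smooth \<open>\<phi>\<close> satisfying \<open>van\<close> its value does not depend on such an \<open>M\<close>.\<close>

definition reg_even :: "real => 'a::euclidean_space => complex => nat => ('a => complex) => 'a => complex" where
 "reg_even R e m M \<phi> x = (- 1/2) ^ M * rGamma ((m + 1) / 2 + of_nat M) *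
  integral {-R..R} (%s. log_powr 0 (m + 2 * of_nat M) s * (even_op e ^^ M) \<phi> (upd e x s))"

text \<open>So many integrations by parts leave an exponent \<open>m + 2M\<close> with positive real part, hence
a continuous weight.\<close>

definition reg_order :: "complex => nat" where
 "reg_order m = nat \<lceil>- Re m\<rceil> + 1"

text \<open>The odd case reduces to the even one: \<open>sgn(s)|s|^m\<close> sees only the odd part of the
function, and this equals \<open>s\<close> times \<^const>\<open>avg_deriv\<close>.\<close>

definition reg :: "real => 'a::euclidean_space => bit => complex => ('a => complex) => 'a => complex" where
 "reg R e \<epsilon> m \<phi> = (if \<epsilon> = 0 then reg_even R e m (reg_order m) \<phi>
  else reg_even R e (m + 1) (reg_order (m + 1)) (avg_deriv e \<phi>))"

lemma reg_order: "Re m + 2 * real (reg_order m) > 0"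
proof -
 have "- Re m <= real (nat \<lceil>- Re m\<rceil>)" by linarith
 then have "- Re m < real (reg_order m)" by (simp add: reg_order_def)
 moreover have "real (reg_order m) > 0" by (simp add: reg_order_def)
 ultimately show ?thesis by linarith
qed

lemma upd_inner [simp]: "e \<in> Basis ==> upd e x s \<bullet> e = s"
 by (simp add: upd_def inner_add_left)

lemma upd_inner_other: "e \<in> Basis ==> e' \<in> Basis ==> e' ~= e ==> upd e x s \<bullet> e' = x \<bullet> e'"
 by (simp add: upd_def inner_add_left inner_not_same_Basis)

lemma upd_self [simp]: "upd e x (x \<bullet> e) = x"
 by (simp add: upd_def)

lemma upd_has_vector_derivative:
 assumes "smooth UNIV \<phi>"
 shows "((%s. \<phi> (upd e x s)) has_vector_derivative dird e \<phi> (upd e x s)) (at s within T)"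
proof -
 have "((%t. \<phi> ((x - (x \<bullet> e) *\<^sub>R e) + t *\<^sub>R e)) has_vector_derivative dird e \<phi> ((x - (x \<bullet> e) *\<^sub>R e) + s *\<^sub>R e)) (at s within T)"
  by (rule dird_linear_comp) (rule smooth_has_derivative[OF assms UNIV_I])
 moreover have "(x - (x \<bullet> e) *\<^sub>R e) + t *\<^sub>R e = upd e x t" for t by (simp add: upd_def algebra_simps)
 ultimately show ?thesis by simp
qed

lemma continuous_on_upd:
 assumes "continuous_on UNIV \<phi>"
 shows "continuous_on T (%s. \<phi> (upd e x s))"
 unfolding upd_def by (rule continuous_on_compose2[OF assms]) (auto intro!: continuous_intros)

lemma avg_deriv_upd:
 "e \<in> Basis ==> avg_deriv e \<phi> (upd e x s) = (1/2) * integral {-1..1} (%t. dird e \<phi> (upd e x (t * s)))"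
 by (simp add: avg_deriv_def upd_inner) (simp add: upd_def algebra_simps)

lemma avg_deriv_odd_part:
 assumes e: "e \<in> Basis" and s: "smooth UNIV \<phi>"
 shows "of_real s * avg_deriv e \<phi> (upd e x s) = (\<phi> (upd e x s) - \<phi> (upd e x (- s))) / 2"
proof -
 have "((%t. s *\<^sub>R dird e \<phi> (upd e x (t * s))) has_integral \<phi> (upd e x (1 * s)) - \<phi> (upd e x (-1 * s))) {-1..1}"
 proof (rule fundamental_theorem_of_calculus)
  fix t :: real assume "t \<in> {-1..1}"
  have d: "((%t. t * s) has_vector_derivative s) (at t within {-1..1})"
   by (auto intro!: derivative_eq_intros simp: has_vector_derivative_def)
  show "((%t. \<phi> (upd e x (t * s))) has_vector_derivative s *\<^sub>R dird e \<phi> (upd e x (t * s))) (at t within {-1..1})"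
   using vector_diff_chain_within[OF d upd_has_vector_derivative[OF s]] by (simp add: o_def)
 qed auto
 from integral_unique[OF this]
 have "integral {-1..1} (%t. s *\<^sub>R dird e \<phi> (upd e x (t * s))) = \<phi> (upd e x s) - \<phi> (upd e x (- s))"
  by simp
 then show ?thesis by (simp add: avg_deriv_upd[OF e] scaleR_conv_of_real)
qed

section \<open>One-dimensional integrals\<close>

lemma sgn_powr_0: "sgn_powr 0 m s = log_powr 0 m s"
 by (simp add: sgn_powr_def log_powr_def)

lemma sgn_powr_1: "sgn_powr 1 m s = of_real (sgn s) * log_powr 0 m s"
 by (simp add: sgn_powr_def log_powr_def)

lemma sgn_log_powr_continuous:
 assumes "Re m > 0" shows "continuous_on T (%s. of_real (sgn s) * log_powr 0 m s)"
proof -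
 have lp: "isCont (%s. log_powr 0 m s) s" for s
 proof -
  have "continuous_on UNIV (%s. (%(m, t). log_powr 0 m t) (m, s))"
   by (rule continuous_on_compose2[OF log_powr_continuous[of UNIV 0]]) (use assms in "auto intro!: continuous_intros")
  then show ?thesis by (simp add: continuous_on_eq_continuous_at)
 qed
 have "isCont (%s. of_real (sgn s) * log_powr 0 m s) s" for s :: real
 proof (cases "s = 0")
  case True
  have "((%s. norm (log_powr 0 m s)) \<longlongrightarrow> 0) (at 0)"
  proof (rule tendsto_norm_zero)
   show "(%s. log_powr 0 m s) \<midarrow>0\<rightarrow> 0"
    using lp[of 0] log_powr_def[of 0 m 0] unfolding isCont_def by simp
  qed
  then have "((%s. of_real (sgn s) * log_powr 0 m s) \<longlongrightarrow> 0) (at 0)"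
   by (rule Lim_null_comparison[rotated]) (auto simp: norm_mult abs_sgn_eq intro!: always_eventually)
  then show ?thesis using True by (simp add: isCont_def)
 next
  case False
  then show ?thesis by (intro continuous_intros isCont_of_real isCont_sgn lp) auto
 qed
 then show ?thesis by (simp add: continuous_at_imp_continuous_on)
qed

lemma log_powr_continuous1:
 assumes "Re m > 0" shows "continuous_on T (%s. log_powr 0 m s)"
proof -
 have "continuous_on T (%s. (%(m, t). log_powr 0 m t) (m, s))"
  by (rule continuous_on_compose2[OF log_powr_continuous[of UNIV 0]]) (use assms in "auto intro!: continuous_intros")
 then show ?thesis by simp
qed

lemma log_powr_plus1: "of_real \<bar>s\<bar> * log_powr 0 m s = log_powr 0 (m + 1) s"
 by (cases "s = 0") (auto simp: log_powr_def powr_add)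

text \<open>The function \<open>s|s|^m \<psi>(s)/(m+1)\<close> is a primitive away from \<open>0\<close> and continuous at
\<open>0\<close>.\<close>

lemma powr_by_parts:
 fixes \<psi> \<psi>' :: "real => complex"
 assumes R: "R > 0" and m: "Re m > -1" and d: "!!s. (\<psi> has_vector_derivative \<psi>' s) (at s)"
 shows "((%s. log_powr 0 m s * \<psi> s + of_real (sgn s) * log_powr 0 (m + 1) s * \<psi>' s / (m + 1)) has_integral
  of_real R powr (m + 1) * (\<psi> R + \<psi> (- R)) / (m + 1)) {-R..R}"
proof -
 define F where "F s = of_real (sgn s) * log_powr 0 (m + 1) s * \<psi> s / (m + 1)" for s
 have m1: "m + 1 ~= 0" using m by (auto simp: complex_eq_iff)
 have c\<psi>: "continuous_on UNIV \<psi>" using d by (meson continuous_at_imp_continuous_on has_vector_derivative_continuous)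
 have cont: "continuous_on {-R..R} F"
  unfolding F_def using m m1
  by (intro continuous_intros sgn_log_powr_continuous continuous_on_subset[OF c\<psi>]) auto
 have der: "(F has_vector_derivative log_powr 0 m s * \<psi> s + of_real (sgn s) * log_powr 0 (m + 1) s * \<psi>' s / (m + 1)) (at s)"
  if s: "s ~= 0" for s
 proof (cases "s > 0")
  case True
  have "((%z. z powr (m + 1)) has_field_derivative (m + 1) * of_real s powr (m + 1 - 1)) (at (of_real s))"
   by (rule has_field_derivative_powr) (use True in "auto simp: complex_nonpos_Reals_iff")
  then have 1: "((%s. of_real s powr (m + 1)) has_vector_derivative (m + 1) * of_real s powr m) (at s)"
   using has_vector_derivative_real_field by force
  have "((%s. of_real s powr (m + 1) * \<psi> s / (m + 1)) has_vector_derivative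
   (of_real s powr (m + 1) * \<psi>' s + (m + 1) * of_real s powr m * \<psi> s) / (m + 1)) (at s)"
   by (intro has_vector_derivative_divide has_vector_derivative_mult 1 d)
  then have "(F has_vector_derivative (of_real s powr (m + 1) * \<psi>' s + (m + 1) * of_real s powr m * \<psi> s) / (m + 1)) (at s)"
   by (rule has_vector_derivative_transform_within_open[where S="{0<..}"]) (use True in "auto simp: F_def log_powr_def")
  then show ?thesis
   by (rule has_vector_derivative_eq_rhs) (use True m1 in "simp add: log_powr_def add_divide_distrib")
 next
  case False
  then have s: "s < 0" using s by simp
  have "((%z. (- z) powr (m + 1)) has_field_derivative - ((m + 1) * of_real (- s) powr (m + 1 - 1))) (at (of_real s))"
   using s by (auto intro!: derivative_eq_intros simp: complex_nonpos_Reals_iff)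
  then have 1: "((%s. (- of_real s) powr (m + 1)) has_vector_derivative - ((m + 1) * of_real (- s) powr m)) (at s)"
   using has_vector_derivative_real_field[where f="%z. (- z) powr (m + 1)"] by force
  have "((%s. - ((- of_real s) powr (m + 1) * \<psi> s / (m + 1))) has_vector_derivative
   - (((- of_real s) powr (m + 1) * \<psi>' s + - ((m + 1) * of_real (- s) powr m) * \<psi> s) / (m + 1))) (at s)"
   by (intro has_vector_derivative_minus has_vector_derivative_divide has_vector_derivative_mult 1 d)
  then have "(F has_vector_derivative - (((- of_real s) powr (m + 1) * \<psi>' s + - ((m + 1) * of_real (- s) powr m) * \<psi> s) / (m + 1))) (at s)"
   by (rule has_vector_derivative_transform_within_open[where S="{..<0}"]) (use s in "auto simp: F_def log_powr_def")
  then show ?thesis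
   by (rule has_vector_derivative_eq_rhs) (use s m1 in "simp add: log_powr_def diff_divide_distrib")
 qed
 have "((%s. log_powr 0 m s * \<psi> s + of_real (sgn s) * log_powr 0 (m + 1) s * \<psi>' s / (m + 1)) has_integral F R - F (- R)) {-R..R}"
  by (rule fundamental_theorem_of_calculus_interior_strong[of "{0}"]) (use R der cont in auto)
 moreover have "F R - F (- R) = of_real R powr (m + 1) * (\<psi> R + \<psi> (- R)) / (m + 1)"
  using R by (simp add: F_def log_powr_def distrib_left add_divide_distrib)
 ultimately show ?thesis by simp
qed

lemma abs_powr_integrable:
 fixes a :: real assumes "a > -1" "R > 0" shows "(%s. \<bar>s\<bar> powr a) integrable_on {-R..R}"
proof -
 have "((%s. log_powr 0 (of_real a) s * 1 + of_real (sgn s) * log_powr 0 (of_real a + 1) s * 0 / (of_real a + 1)) has_integral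
  of_real R powr (of_real a + 1) * (1 + 1) / (of_real a + 1)) {-R..R}"
  by (rule powr_by_parts[OF assms(2), of "of_real a" "%_. 1" "%_. 0"]) (use assms in "auto intro: has_vector_derivative_const")
 then have "(%s. log_powr 0 (of_real a) s) integrable_on {-R..R}" by (auto simp: integrable_on_def)
 then have "(%s. Re (log_powr 0 (of_real a) s)) integrable_on {-R..R}"
  unfolding integrable_on_def using has_integral_Re by blast
 moreover have "log_powr 0 (of_real a) s = of_real (\<bar>s\<bar> powr a)" for s
  unfolding log_powr_def by (simp add: powr_of_real[symmetric])
 ultimately show ?thesis by simp
qed

lemma borel_measurable_log_powr [measurable]: "(%s. log_powr 0 m s) \<in> borel_measurable borel"
proof -
 have "log_powr 0 m = (%s. if s = 0 then 0 else exp (m * of_real (ln \<bar>s\<bar>)))"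
  by (auto simp: log_powr_def powr_def Ln_of_real fun_eq_iff)
 then show ?thesis by simp
qed

lemma borel_measurable_sgn_powr [measurable]: "(%s. sgn_powr \<epsilon> m s) \<in> borel_measurable borel"
proof -
 have "sgn_powr \<epsilon> m = (%s. of_real (sgn s) ^ of_bit \<epsilon> * log_powr 0 m s)"
  by (simp add: sgn_powr_def log_powr_def fun_eq_iff)
 then show ?thesis by simp
qed

lemma norm_sgn_powr_le: "norm (sgn_powr \<epsilon> m s) <= \<bar>s\<bar> powr Re m"
 by (cases \<epsilon>) (auto simp: sgn_powr_0 sgn_powr_1 norm_mult norm_log_powr abs_sgn_eq)

lemma sgn_powr_absolutely_integrable:
 assumes "Re m > -1" "R > 0" "continuous_on {-R..R} \<theta>"
 shows "(%s. sgn_powr \<epsilon> m s * \<theta> s) absolutely_integrable_on {-R..R}"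
proof -
 obtain B where B: "!!s. s \<in> {-R..R} ==> norm (\<theta> s) <= B"
  using compact_imp_bounded[OF compact_continuous_image[OF assms(3)]] by (force simp: bounded_iff)
 show ?thesis
 proof (rule measurable_bounded_by_integrable_imp_absolutely_integrable)
  show "(%s. sgn_powr \<epsilon> m s * \<theta> s) \<in> borel_measurable (lebesgue_on {-R..R})"
  proof (rule borel_measurable_times)
   show "sgn_powr \<epsilon> m \<in> borel_measurable (lebesgue_on {-R..R})"
    by (intro measurable_restrict_space1 measurable_completion) simp
   show "\<theta> \<in> borel_measurable (lebesgue_on {-R..R})"
    by (rule continuous_imp_measurable_on_sets_lebesgue[OF assms(3)]) auto
  qed
  show "(%s. B * \<bar>s\<bar> powr Re m) integrable_on {-R..R}"
   using abs_powr_integrable[OF assms(1,2)] by (rule integrable_on_mult_right)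
  show "norm (sgn_powr \<epsilon> m s * \<theta> s) <= B * \<bar>s\<bar> powr Re m" if "s \<in> {-R..R}" for s
  proof -
   have "norm (sgn_powr \<epsilon> m s) * norm (\<theta> s) <= (\<bar>s\<bar> powr Re m) * B"
    by (intro mult_mono norm_sgn_powr_le B that) auto
   then show ?thesis by (simp add: norm_mult mult.commute)
  qed
 qed auto
qed

lemma sgn_powr_integrable:
 assumes "Re m > -1" "R > 0" "continuous_on {-R..R} \<theta>"
 shows "(%s. sgn_powr \<epsilon> m s * \<theta> s) integrable_on {-R..R}"
 using sgn_powr_absolutely_integrable[OF assms] set_lebesgue_integral_eq_integral(1) by blast

lemma odd_weight_integral:
 fixes \<theta> N :: "real => complex"
 assumes R: "R > 0" and m: "Re m > -1" and c: "continuous_on UNIV \<theta>"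
  and N: "!!s. of_real s * N s = (\<theta> s - \<theta> (- s)) / 2"
 shows "integral {-R..R} (%s. sgn_powr 1 m s * \<theta> s) = integral {-R..R} (%s. log_powr 0 (m + 1) s * N s)"
proof -
 let ?g = "%s. sgn_powr 1 m s * \<theta> s"
 have i1: "?g integrable_on {-R..R}"
  by (rule sgn_powr_integrable[OF m R continuous_on_subset[OF c]]) auto
 have "(%s. ?g (- s)) integrable_on {- R.. - (- R)}"
  using i1 by (subst Henstock_Kurzweil_Integration.integrable_reflect_real) auto
 then have i2: "(%s. ?g (- s)) integrable_on {-R..R}" by simp
 have "integral {- R..- (- R)} (%s. ?g (- s)) = integral {-R..R} ?g"
  by (rule Henstock_Kurzweil_Integration.integral_reflect_real)
 then have "2 * integral {-R..R} ?g = integral {-R..R} ?g + integral {-R..R} (%s. ?g (- s))" by simp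
 also have "... = integral {-R..R} (%s. ?g s + ?g (- s))"
  by (rule Henstock_Kurzweil_Integration.integral_add[OF i1 i2, symmetric])
 also have "... = integral {-R..R} (%s. 2 * (log_powr 0 (m + 1) s * N s))"
 proof (rule integral_cong)
  fix s :: real
  have "?g s + ?g (- s) = of_real (sgn s) * log_powr 0 m s * (\<theta> s - \<theta> (- s))"
   by (simp add: sgn_powr_1 log_powr_def algebra_simps)
  also have "... = of_real (sgn s) * log_powr 0 m s * (2 * (of_real s * N s))" by (simp add: N)
  also have "... = 2 * ((of_real (sgn s * s) * log_powr 0 m s) * N s)" by simp
  also have "sgn s * s = \<bar>s\<bar>" by (simp add: sgn_if)
  finally show "?g s + ?g (- s) = 2 * (log_powr 0 (m + 1) s * N s)" unfolding log_powr_plus1 .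
 qed
 finally show ?thesis by simp
qed

section \<open>Regularization of smooth functions\<close>

lemma smooth_null_avg_deriv:
 fixes \<Phi> :: "'i => 'a::euclidean_space => complex"
 assumes S: "open S" and inv: "!!q s. q \<in> S ==> q + s *\<^sub>R b \<in> S" and n: "smooth_null F S \<Phi>"
 shows "smooth_null F S (%i. avg_deriv b (\<Phi> i))"
 unfolding avg_deriv_def
proof (rule smooth_null_mult[OF S smooth_const])
 have S': "open (S \<times> (UNIV::real set))" using S by (simp add: open_Times)
 have "smooth_null F (S \<times> UNIV) (%i (q::'a, t). dird b (\<Phi> i) (q + ((t - 1) * (q \<bullet> b)) *\<^sub>R b))"
  unfolding case_prod_unfold
 proof (rule smooth_null_compose[OF S' S _ _ smooth_null_dird[OF n]])
  show "smooth (S \<times> UNIV) (%x::'a \<times> real. fst x + ((snd x - 1) * (fst x \<bullet> b)) *\<^sub>R b)"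
   by (intro smooth_add smooth_scaleR smooth_intros S'
    smooth_bounded_linear bounded_linear_fst bounded_linear_snd)
 qed (use inv in auto)
 from smooth_null_integral[OF S this, of "-1" 1]
 show "smooth_null F S (%i x. integral {- 1..1} (%t. dird b (\<Phi> i) (x + ((t - 1) * (x \<bullet> b)) *\<^sub>R b)))" by simp
qed

lemma smooth_avg_deriv:
 assumes S: "open S" and inv: "!!q s. q \<in> S ==> q + s *\<^sub>R b \<in> S" and n: "smooth S f"
 shows "smooth S (avg_deriv b f)"
 using smooth_null_avg_deriv[OF S inv, where F=bot and \<Phi>="%_::unit. f"] n
 by (simp add: smooth_iff_smooth_null[where 'i=unit])

lemma clin_avg_deriv:
 fixes f :: "'a::euclidean_space => complex"
 assumes S: "open S" and inv: "!!q s. q \<in> S ==> q + s *\<^sub>R b \<in> S" and f: "smooth S f" "clin u v S f"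
  and uv: "u \<bullet> b = 0" "v \<bullet> b = 0"
 shows "clin u v S (avg_deriv b f)"
proof -
 have S': "open (S \<times> (UNIV::real set))" using S by (simp add: open_Times)
 let ?\<tau> = "%x::'a \<times> real. fst x + ((snd x - 1) * (fst x \<bullet> b)) *\<^sub>R b"
 have \<tau>: "smooth (S \<times> UNIV) ?\<tau>" "?\<tau> ` (S \<times> UNIV) \<subseteq> S"
  by (intro smooth_add smooth_scaleR smooth_intros S'
    smooth_bounded_linear bounded_linear_fst bounded_linear_snd) (use inv in auto)
 have 1: "smooth (S \<times> UNIV) (%x. dird b f (?\<tau> x))"
  by (rule smooth_compose[OF S' S \<tau>(2,1) smooth_dird[OF f(1)]])
 have 2: "clin (u, 0) (v, 0) (S \<times> UNIV) (%x. dird b f (?\<tau> x))"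
 proof (rule clin_compose[OF smooth_dird[OF f(1)] clin_dird[OF S f] \<tau>(2)])
  show "(?\<tau> has_derivative (%w. fst w + ((snd x - 1) * (fst w \<bullet> b) + snd w * (fst x \<bullet> b)) *\<^sub>R b)) (at x)" for x
   by (auto intro!: derivative_eq_intros simp: algebra_simps)
 qed (use uv in auto)
 have "clin u v S (%x. (1/2) * integral {- 1..1} (%t. dird b f (?\<tau> (x, t))))"
  by (rule clin_mult[OF smooth_const _ _ clin_integral[OF S 1 2]])
   (use smooth_null_integral[OF S 1[unfolded smooth_iff_smooth_null[where 'i=unit]]] in
    \<open>auto simp: smooth_iff_smooth_null[where 'i=unit] clin_def dird_eq[OF has_derivative_const]\<close>)
 then show ?thesis by (simp add: avg_deriv_def[abs_def])
qed

lemma smooth_null_even_op_pow: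
 assumes S: "open S" and inv: "!!q s. q \<in> S ==> q + s *\<^sub>R b \<in> S" and n: "smooth_null F S \<Phi>"
 shows "smooth_null F S (%i. (even_op b ^^ M) (\<Phi> i))"
 by (induction M) (auto simp: even_op_def intro: smooth_null_avg_deriv[OF S inv] smooth_null_dird n)

lemma smooth_even_op_pow:
 assumes S: "open S" and inv: "!!q s. q \<in> S ==> q + s *\<^sub>R b \<in> S" and n: "smooth S f"
 shows "smooth S ((even_op b ^^ M) f)"
 by (induction M) (auto simp: even_op_def intro: smooth_avg_deriv[OF S inv] smooth_dird n)

lemma clin_even_op_pow:
 assumes S: "open S" and inv: "!!q s. q \<in> S ==> q + s *\<^sub>R b \<in> S" and f: "smooth S f" "clin u v S f"
  and uv: "u \<bullet> b = 0" "v \<bullet> b = 0"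
 shows "clin u v S ((even_op b ^^ M) f)"
proof (induction M)
 case (Suc M)
 note s = smooth_even_op_pow[OF S inv f(1), of M]
 have "clin u v S (avg_deriv b (dird b ((even_op b ^^ M) f)))"
  by (intro clin_avg_deriv[OF S inv _ _ uv] smooth_dird clin_dird[OF S] s Suc)
 then show ?case by (simp add: even_op_def[symmetric])
qed (use f in auto)

text \<open>Functions vanishing near and beyond the end points of \<open>[-R, R]\<close> in the coordinate \<open>e\<close>;
integrations by parts produce no boundary terms.\<close>

definition van :: "real => 'a::euclidean_space => ('a => complex) => bool" where
 "van R e \<phi> \<longleftrightarrow> (\<forall>x. \<bar>x \<bullet> e\<bar> > R - 1 --> \<phi> x = 0)"

lemma van_dird:
 assumes "van R e \<phi>"
 shows "van R e (dird v \<phi>)"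
 unfolding van_def
proof (intro allI impI)
 fix x :: 'a assume x: "\<bar>x \<bullet> e\<bar> > R - 1"
 have o: "open {x. \<bar>x \<bullet> e\<bar> > R - 1}" by (intro open_Collect_less continuous_intros)
 have "(\<phi> has_derivative (%_. 0)) (at x)"
  by (rule has_derivative_transform_within_open[OF has_derivative_const o]) (use x assms in "auto simp: van_def")
 then show "dird v \<phi> x = 0" by (rule dird_eq)
qed

lemma van_avg_deriv_other:
 assumes "van R e' \<phi>" "e \<in> Basis" "e' \<in> Basis" "e ~= e'"
 shows "van R e' (avg_deriv e \<phi>)"
 using van_dird[OF assms(1), of e] assms(2-4)
 by (auto simp: van_def avg_deriv_def inner_add_left inner_not_same_Basis)

lemma van_avg_deriv_same:
 assumes "van R e \<phi>" "e \<in> Basis" "smooth UNIV \<phi>" "R \<ge> 1"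
 shows "van R e (avg_deriv e \<phi>)"
 unfolding van_def
proof (intro allI impI)
 fix x :: 'a assume x: "\<bar>x \<bullet> e\<bar> > R - 1"
 have "of_real (x \<bullet> e) * avg_deriv e \<phi> (upd e x (x \<bullet> e)) = (\<phi> (upd e x (x \<bullet> e)) - \<phi> (upd e x (- (x \<bullet> e)))) / 2"
  by (rule avg_deriv_odd_part[OF assms(2,3)])
 moreover have "\<phi> (upd e x (- (x \<bullet> e))) = 0" "\<phi> x = 0"
  using x assms(1,2) by (auto simp: van_def)
 ultimately show "avg_deriv e \<phi> x = 0" using x assms(4) by auto
qed

lemma van_avg_deriv:
 assumes "van R e' \<phi>" "e \<in> Basis" "e' \<in> Basis" "smooth UNIV \<phi>" "R \<ge> 1"
 shows "van R e' (avg_deriv e \<phi>)"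
 using van_avg_deriv_other van_avg_deriv_same assms by metis

lemma van_even_op_pow:
 assumes "van R e' \<phi>" "e \<in> Basis" "e' \<in> Basis" "smooth UNIV \<phi>" "R \<ge> 1"
 shows "van R e' ((even_op e ^^ M) \<phi>)"
proof (induction M)
 case (Suc M)
 have "smooth UNIV ((even_op e ^^ M) \<phi>)" by (rule smooth_even_op_pow) (use assms in auto)
 then have "van R e' (avg_deriv e (dird e ((even_op e ^^ M) \<phi>)))"
  using Suc assms by (intro van_avg_deriv van_dird smooth_dird) auto
 then show ?case by (simp add: even_op_def[symmetric])
qed (use assms in auto)

lemma reg_even_Suc:
 assumes e: "e \<in> Basis" and s: "smooth UNIV \<phi>" and v: "van R e \<phi>" and R: "R \<ge> 1" and m: "Re m + 2 * real M > -1"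
 shows "reg_even R e m (Suc M) \<phi> x = reg_even R e m M \<phi> x"
proof -
 define \<psi> where "\<psi> = (even_op e ^^ M) \<phi>"
 define k where "k = m + 2 * of_nat M"
 have k: "Re k > -1" "k + 1 ~= 0" using m by (auto simp: k_def complex_eq_iff)
 have s\<psi>: "smooth UNIV \<psi>" unfolding \<psi>_def by (rule smooth_even_op_pow) (use s in auto)
 have s\<psi>': "smooth UNIV (dird e \<psi>)" by (rule smooth_dird[OF s\<psi>])
 have v\<psi>: "van R e \<psi>" unfolding \<psi>_def by (rule van_even_op_pow) (use assms in auto)
 let ?f = "%s. \<psi> (upd e x s)" and ?f' = "%s. dird e \<psi> (upd e x s)"
 have cf: "continuous_on UNIV ?f" and cf': "continuous_on UNIV ?f'"
  using continuous_on_upd smooth_continuous s\<psi> s\<psi>' by blast+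
 have z: "?f R = 0" "?f (- R) = 0" using v\<psi> R e by (auto simp: van_def)
 have R0: "R > 0" using R by simp
 have "((%s. log_powr 0 k s * ?f s + of_real (sgn s) * log_powr 0 (k + 1) s * ?f' s / (k + 1)) has_integral
  of_real R powr (k + 1) * (?f R + ?f (- R)) / (k + 1)) {-R..R}"
  by (rule powr_by_parts[OF R0 k(1)]) (rule upd_has_vector_derivative[OF s\<psi>])
 then have I0: "integral {-R..R} (%s. log_powr 0 k s * ?f s + of_real (sgn s) * log_powr 0 (k + 1) s * ?f' s / (k + 1)) = 0"
  using z by (simp add: integral_unique)
 have "integral {-R..R} (%s. log_powr 0 k s * ?f s + of_real (sgn s) * log_powr 0 (k + 1) s * ?f' s / (k + 1)) =
  integral {-R..R} (%s. log_powr 0 k s * ?f s) + integral {-R..R} (%s. of_real (sgn s) * log_powr 0 (k + 1) s * ?f' s / (k + 1))"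
 proof (rule Henstock_Kurzweil_Integration.integral_add)
  show "(%s. log_powr 0 k s * ?f s) integrable_on {-R..R}"
   using sgn_powr_integrable[OF k(1) R0 continuous_on_subset[OF cf], of 0] by (simp add: sgn_powr_0)
  have "(%s. sgn_powr 1 (k + 1) s * (?f' s / (k + 1))) integrable_on {-R..R}"
   by (rule sgn_powr_integrable[OF _ R0]) (use k continuous_on_subset[OF cf'] in "auto intro!: continuous_intros")
  then show "(%s. of_real (sgn s) * log_powr 0 (k + 1) s * ?f' s / (k + 1)) integrable_on {-R..R}"
   by (simp add: sgn_powr_1)
 qed
 then have "integral {-R..R} (%s. log_powr 0 k s * ?f s) = - integral {-R..R} (%s. of_real (sgn s) * log_powr 0 (k + 1) s * ?f' s / (k + 1))"
  using I0 by (simp add: eq_neg_iff_add_eq_0)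
 also have "integral {-R..R} (%s. of_real (sgn s) * log_powr 0 (k + 1) s * ?f' s / (k + 1))
  = integral {-R..R} (%s. sgn_powr 1 (k + 1) s * ?f' s) / (k + 1)"
  unfolding sgn_powr_1 by simp
 also have "integral {-R..R} (%s. sgn_powr 1 (k + 1) s * ?f' s) = integral {-R..R} (%s. log_powr 0 (k + 1 + 1) s * avg_deriv e (dird e \<psi>) (upd e x s))"
  by (rule odd_weight_integral[OF R0 _ cf' avg_deriv_odd_part[OF e s\<psi>']]) (use k in auto)
 finally have I: "integral {-R..R} (%s. log_powr 0 k s * ?f s) = - (integral {-R..R} (%s. log_powr 0 (k + 2) s * even_op e \<psi> (upd e x s)) / (k + 1))"
  by (simp add: even_op_def add.assoc)
 have a: "(m + 1) / 2 + of_nat (Suc M) = ((m + 1) / 2 + of_nat M) + 1" by simp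
 have b: "(m + 1) / 2 + of_nat M = (k + 1) / 2" by (simp add: k_def field_simps)
 have c: "m + 2 * of_nat (Suc M) = k + 2" by (simp add: k_def algebra_simps)
 have "((k + 1) / 2) * rGamma ((k + 1) / 2 + 1) = rGamma ((k + 1) / 2)" by (rule rGamma_plus1)
 then have "rGamma ((k + 1) / 2 + 1) = 2 * rGamma ((k + 1) / 2) / (k + 1)" using k(2) by (simp add: field_simps)
 then show ?thesis
  unfolding reg_even_def a b c k_def[symmetric] funpow.simps o_def \<psi>_def[symmetric] I
  by (simp add: k_def[symmetric] \<psi>_def[symmetric] I)
qed

lemma reg_even_le:
 assumes "e \<in> Basis" "smooth UNIV \<phi>" "van R e \<phi>" "R \<ge> 1" "Re m + 2 * real M > -1" "M <= M'"
 shows "reg_even R e m M' \<phi> x = reg_even R e m M \<phi> x"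
 using assms(6)
proof (induction rule: dec_induct)
 case (step n)
 have "Re m + 2 * real n > -1" using step assms(5) by auto
 then show ?case using reg_even_Suc[OF assms(1-4)] step by simp
qed simp

lemma reg_even_indep:
 assumes "e \<in> Basis" "smooth UNIV \<phi>" "van R e \<phi>" "R \<ge> 1" "Re m + 2 * real M > -1" "Re m + 2 * real M' > -1"
 shows "reg_even R e m M' \<phi> x = reg_even R e m M \<phi> x"
 using reg_even_le[OF assms(1-4)] assms(5,6) by (metis nat_le_linear)

lemma reg_convergent:
 assumes e: "e \<in> Basis" and s: "smooth UNIV \<phi>" and v: "van R e \<phi>" and R: "R \<ge> 1" and m: "Re m > -1"
 shows "reg R e \<epsilon> m \<phi> x = rGamma ((m + 1 + of_bit \<epsilon>) / 2) * integral {-R..R} (%s. sgn_powr \<epsilon> m s * \<phi> (upd e x s))"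
proof (cases "\<epsilon> = 0")
 case True
 have "reg_even R e m (reg_order m) \<phi> x = reg_even R e m 0 \<phi> x"
  by (rule reg_even_indep[OF e s v R]) (use m reg_order[of m] in auto)
 then show ?thesis using True by (simp add: reg_def reg_even_def sgn_powr_0)
next
 case False
 then have \<epsilon>: "\<epsilon> = 1" by (cases \<epsilon>) auto
 have sa: "smooth UNIV (avg_deriv e \<phi>)" by (rule smooth_avg_deriv) (use s in auto)
 have "reg_even R e (m+1) (reg_order (m+1)) (avg_deriv e \<phi>) x = reg_even R e (m+1) 0 (avg_deriv e \<phi>) x"
  by (rule reg_even_indep[OF e sa van_avg_deriv_same[OF v e s R] R]) (use m reg_order[of "m+1"] in auto)
 moreover have "integral {-R..R} (%s. sgn_powr 1 m s * \<phi> (upd e x s)) = integral {-R..R} (%s. log_powr 0 (m + 1) s * avg_deriv e \<phi> (upd e x s))"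
  by (rule odd_weight_integral[OF _ m continuous_on_upd[OF smooth_continuous[OF s]] avg_deriv_odd_part[OF e s]]) (use R in auto)
 ultimately show ?thesis using \<epsilon> by (simp add: reg_def reg_even_def add.assoc)
qed

definition plain :: "real => 'a::euclidean_space => ('a => complex) => 'a => complex" where
 "plain R e \<phi> x = integral {-R..R} (%s. \<phi> (upd e x s))"

definition reg_step :: "real => ('a::euclidean_space => (bit \<times> complex) option) => 'a => ('a => complex) => 'a => complex" where
 "reg_step R wt e \<phi> = (case wt e of None => plain R e \<phi> | Some (\<epsilon>, m) => reg R e \<epsilon> m \<phi>)"

text \<open>Coordinates with a weight are integrated against the normalized power, the others against
Lebesgue measure.\<close>

definition regs :: "real => ('a::euclidean_space => (bit \<times> complex) option) => 'a list => ('a => complex) => 'a => complex" where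
 "regs R wt es \<phi> = foldr (reg_step R wt) es \<phi>"

section \<open>Dependence on parameters\<close>

lemma open_Times_UNIV: "open S ==> open (S \<times> UNIV)"
 by (simp add: open_Times)

lemma smooth_fst:
 fixes f :: "'a::euclidean_space => 'c::real_normed_vector"
 assumes "open S" "smooth S f"
 shows "smooth (S \<times> UNIV) (%x::'a \<times> 'e::euclidean_space. f (fst x))"
 by (rule smooth_compose[OF open_Times_UNIV[OF assms(1)] assms(1) _ _ assms(2)])
  (auto intro: smooth_bounded_linear open_Times_UNIV assms bounded_linear_fst)

lemma smooth_null_log_integral:
 fixes \<Theta> :: "'i => 'a::euclidean_space \<times> real => complex"
 assumes "open S" "!!q. q \<in> S ==> Re (\<mu> q) > 0" "smooth S \<mu>" "smooth_null F (S \<times> UNIV) \<Theta>"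
 shows "smooth_null F S (%i q. integral {c..d} (%t. log_powr 0 (\<mu> q) t * \<Theta> i (q, t)))"
 by (rule smooth_null_weighted_integral[where \<Omega>="{m. Re m > 0}" and w=log_powr, OF assms(1) log_powr_continuous log_powr_deriv _ assms(3,4)])
  (use assms(2) in auto)

lemma clin_log_integral:
 fixes \<Theta> :: "'a::euclidean_space \<times> real => complex"
 assumes "open S" "!!q. q \<in> S ==> Re (\<mu> q) > 0" "smooth S \<mu>" "smooth (S \<times> UNIV) \<Theta>"
  "clin u v S \<mu>" "clin (u, 0) (v, 0) (S \<times> UNIV) \<Theta>"
 shows "clin u v S (%q. integral {c..d} (%t. log_powr 0 (\<mu> q) t * \<Theta> (q, t)))"
 by (rule clin_weighted_integral[where \<Omega>="{m. Re m > 0}" and w=log_powr, OF assms(1) log_powr_continuous log_powr_deriv _ assms(3-6)])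
  (use assms(2) in auto)

lemma smooth_null_slice:
 fixes \<Phi> :: "'i => 'p::euclidean_space \<times> 'e::euclidean_space => complex"
 assumes "open S" "smooth_null F (S \<times> UNIV) \<Phi>"
 shows "smooth_null F S (%i p. \<Phi> i (p, x))"
 by (rule smooth_null_compose[OF _ open_Times_UNIV _ _ assms(2)])
  (use assms in "auto intro!: smooth_intros")

lemma smooth_slice:
 fixes \<Phi> :: "'p::euclidean_space \<times> 'e::euclidean_space => complex"
 assumes "open S" "smooth (S \<times> UNIV) \<Phi>" "p \<in> S"
 shows "smooth UNIV (%x. \<Phi> (p, x))"
 by (rule smooth_compose[OF _ open_Times_UNIV _ _ assms(2)])
  (use assms in "auto intro!: smooth_intros")

lemma slice_dird:
 fixes \<Phi> :: "'p::euclidean_space \<times> 'e::euclidean_space => complex"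
 assumes "smooth (S \<times> UNIV) \<Phi>" "p \<in> S"
 shows "dird (0, e) \<Phi> (p, x) = dird e (%x. \<Phi> (p, x)) x"
proof -
 have "((%x. \<Phi> (p, x)) has_derivative (%v. dird (0, v) \<Phi> (p, x))) (at x)"
  by (rule has_derivative_compose[where f="%x. (p, x)" and g=\<Phi>, OF _ smooth_has_derivative[OF assms(1)]])
   (use assms in "auto intro!: derivative_eq_intros")
 from dird_eq[OF this] show ?thesis by simp
qed

lemma slice_avg_deriv:
 fixes \<Phi> :: "'p::euclidean_space \<times> 'e::euclidean_space => complex"
 assumes "smooth (S \<times> UNIV) \<Phi>" "p \<in> S"
 shows "avg_deriv (0, e) \<Phi> (p, x) = avg_deriv e (%x. \<Phi> (p, x)) x"
 unfolding avg_deriv_def by (simp add: slice_dird[OF assms])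

lemma translate_inv: "q \<in> S \<times> UNIV ==> q + s *\<^sub>R (0, e) \<in> S \<times> UNIV"
 by (cases q) auto

lemma slice_even_op_pow:
 fixes \<Phi> :: "'p::euclidean_space \<times> 'e::euclidean_space => complex"
 assumes S: "open S" and sm: "smooth (S \<times> UNIV) \<Phi>" and p: "p \<in> S"
 shows "(even_op (0, e) ^^ M) \<Phi> (p, x) = (even_op e ^^ M) (%x. \<Phi> (p, x)) x"
proof (induction M arbitrary: x)
 case (Suc M)
 have s: "smooth (S \<times> UNIV) ((even_op (0, e) ^^ M) \<Phi>)"
  by (rule smooth_even_op_pow[OF open_Times_UNIV[OF S] translate_inv sm])
 have "even_op (0, e) ((even_op (0, e) ^^ M) \<Phi>) (p, x) = avg_deriv e (%x. dird (0, e) ((even_op (0, e) ^^ M) \<Phi>) (p, x)) x"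
  unfolding even_op_def[of "(0, e)"] by (rule slice_avg_deriv[OF smooth_dird[OF s[unfolded even_op_def]] p])
 also have "... = avg_deriv e (dird e (%x. (even_op (0, e) ^^ M) \<Phi> (p, x))) x"
  by (simp add: slice_dird[OF s p])
 also have "... = avg_deriv e (dird e ((even_op e ^^ M) (%x. \<Phi> (p, x)))) x"
  by (simp add: Suc.IH)
 finally show ?case by (simp add: even_op_def[of e "(even_op e ^^ M) (%x. \<Phi> (p, x))"])
qed simp

lemma smooth_upd_map:
 fixes S :: "'p::euclidean_space set" and e :: "'e::euclidean_space"
 assumes "open S"
 shows "smooth ((S \<times> UNIV) \<times> UNIV) (%x::('p \<times> 'e) \<times> real. (fst (fst x), upd e (snd (fst x)) (snd x)))"
proof -
 have o: "open ((S \<times> (UNIV::'e set)) \<times> (UNIV::real set))" using assms by (intro open_Times_UNIV)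
 have b: "bounded_linear (%x::('p \<times> 'e) \<times> real. fst (fst x))" "bounded_linear (%x::('p \<times> 'e) \<times> real. snd (fst x))"
  by (intro bounded_linear_compose[OF bounded_linear_fst] bounded_linear_compose[OF bounded_linear_snd] bounded_linear_fst)+
 show ?thesis unfolding upd_def
  by (intro smooth_Pair smooth_add smooth_scaleR smooth_intros o
    smooth_bounded_linear[OF o b(1)] smooth_bounded_linear[OF o b(2)] smooth_bounded_linear[OF o bounded_linear_snd])
qed

lemma upd_map_has_derivative:
 "((%x::('p::euclidean_space \<times> 'e::euclidean_space) \<times> real. (fst (fst x), upd e (snd (fst x)) (snd x))) has_derivative
  (%w. (fst (fst w), snd (fst w) + (snd w - snd (fst w) \<bullet> e) *\<^sub>R e))) (at x)"
 unfolding upd_def by (auto intro!: derivative_eq_intros)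

lemma smooth_rGamma_compose:
 fixes \<mu> :: "'p::euclidean_space => complex"
 assumes "open S" "smooth S \<mu>"
 shows "smooth S (%p. rGamma ((\<mu> p + 1) / 2 + of_nat M))"
proof -
 have h: "(%m. rGamma ((m + 1) / 2 + of_nat M)) holomorphic_on UNIV"
  by (intro holomorphic_intros holomorphic_rGamma) auto
 show ?thesis
  by (rule smooth_compose[OF assms(1) _ _ assms(2) smooth_holomorphic[OF h]]) auto
qed

text \<open>For a fixed number of integrations by parts the formula is an integral against
\<open>|s|^(\<mu> + 2M)\<close>. The real part of this exponent is positive, so the weight may be differentiated
in \<open>\<mu>\<close>.\<close>

lemma smooth_null_reg_even:
 fixes \<Phi> :: "'i => 'p::euclidean_space \<times> 'e::euclidean_space => complex"
 assumes S: "open S" and n: "smooth_null F (S \<times> UNIV) \<Phi>" and mu: "smooth S \<mu>"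
  and M: "!!p. p \<in> S ==> Re (\<mu> p) + 2 * real M > 0"
 shows "smooth_null F (S \<times> UNIV) (%i (p, x). reg_even R e (\<mu> p) M (%x. \<Phi> i (p, x)) x)"
proof -
 note o = open_Times_UNIV[OF S] 
 let ?\<mu> = "%x::'p \<times> 'e. \<mu> (fst x)"
 let ?\<Psi> = "%i. (even_op (0, e) ^^ M) (\<Phi> i)"
 have n\<Psi>: "smooth_null F (S \<times> UNIV) ?\<Psi>"
  by (rule smooth_null_even_op_pow[OF o translate_inv n])
 have "smooth_null F ((S \<times> UNIV) \<times> UNIV) (%i x::('p \<times> 'e) \<times> real. ?\<Psi> i (fst (fst x), upd e (snd (fst x)) (snd x)))"
  by (rule smooth_null_compose[OF open_Times_UNIV[OF o] o _ smooth_upd_map[OF S] n\<Psi>]) auto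
 note A = this
 have B: "smooth (S \<times> UNIV) (%x::'p \<times> 'e. ?\<mu> x + 2 * of_nat M)"
  by (intro smooth_add smooth_const smooth_fst mu S o)
 have "smooth_null F (S \<times> UNIV) (%i x::'p \<times> 'e. integral {-R..R} (%s. log_powr 0 (?\<mu> x + 2 * of_nat M) s * ?\<Psi> i (fst x, upd e (snd x) s)))"
  using M smooth_null_log_integral[OF o _ B A, of "-R" R] by auto
 then have "smooth_null F (S \<times> UNIV) (%i x::'p \<times> 'e. ((- 1/2) ^ M * rGamma ((?\<mu> x + 1) / 2 + of_nat M)) *
   integral {-R..R} (%s. log_powr 0 (?\<mu> x + 2 * of_nat M) s * ?\<Psi> i (fst x, upd e (snd x) s)))"
  by (intro smooth_null_mult o smooth_mult smooth_const smooth_rGamma_compose smooth_fst mu S)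
 then show ?thesis
  by (rule smooth_null_cong[OF o, rotated])
   (auto simp: reg_even_def slice_even_op_pow[OF S smooth_null_smooth[OF n]])
qed

lemma clin_reg_even:
 fixes \<Phi> :: "'p::euclidean_space \<times> 'e::euclidean_space => complex"
 assumes S: "open S" and n: "smooth (S \<times> UNIV) \<Phi>" and mu: "smooth S \<mu>"
  and M: "!!p. p \<in> S ==> Re (\<mu> p) + 2 * real M > 0"
  and cl: "clin (u, 0) (v, 0) (S \<times> UNIV) \<Phi>" "clin u v S \<mu>"
 shows "clin (u, 0) (v, 0) (S \<times> UNIV) (%(p, x). reg_even R e (\<mu> p) M (%x. \<Phi> (p, x)) x)"
proof -
 note o = open_Times_UNIV[OF S] 
 let ?\<mu> = "%x::'p \<times> 'e. \<mu> (fst x)"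
 let ?\<Psi> = "(even_op (0, e) ^^ M) \<Phi>"
 have s\<Psi>: "smooth (S \<times> UNIV) ?\<Psi>"
  by (rule smooth_even_op_pow[OF o translate_inv n])
 have c\<Psi>: "clin (u, 0) (v, 0) (S \<times> UNIV) ?\<Psi>"
  by (rule clin_even_op_pow[OF o translate_inv n cl(1)]) auto
 have s\<mu>: "smooth (S \<times> UNIV) ?\<mu>" by (intro smooth_fst mu S)
 have c\<mu>: "clin (u, 0) (v, 0) (S \<times> UNIV) ?\<mu>"
  by (rule clin_compose[OF mu cl(2), where g'="%_. fst"]) (auto intro!: derivative_eq_intros)
 have "smooth ((S \<times> UNIV) \<times> UNIV) (%x::('p \<times> 'e) \<times> real. ?\<Psi> (fst (fst x), upd e (snd (fst x)) (snd x)))"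
  by (rule smooth_compose[OF open_Times_UNIV[OF o] o _ smooth_upd_map[OF S] s\<Psi>]) auto
 note s1 = this
 have c1: "clin ((u, 0), 0) ((v, 0), 0) ((S \<times> UNIV) \<times> UNIV) (%x::('p \<times> 'e) \<times> real. ?\<Psi> (fst (fst x), upd e (snd (fst x)) (snd x)))"
  by (rule clin_compose[OF s\<Psi> c\<Psi> _ upd_map_has_derivative]) auto
 have s\<mu>': "smooth (S \<times> UNIV) (%x. ?\<mu> x + 2 * of_nat M)"
  by (intro smooth_add smooth_const s\<mu> o)
 have c\<mu>': "clin (u, 0) (v, 0) (S \<times> UNIV) (%x. ?\<mu> x + 2 * of_nat M)"
  by (rule clin_holomorphic[OF s\<mu> c\<mu>, of "%m. m + 2 * of_nat M" UNIV]) (auto intro!: holomorphic_intros)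
 let ?I = "%x::'p \<times> 'e. integral {-R..R} (%s. log_powr 0 (?\<mu> x + 2 * of_nat M) s * ?\<Psi> (fst x, upd e (snd x) s))"
 have mur: "!!x::'p \<times> 'e. x \<in> S \<times> UNIV ==> Re (?\<mu> x + 2 * of_nat M) > 0" using M by auto
 have sI: "smooth (S \<times> UNIV) ?I"
  using smooth_null_log_integral[OF o mur s\<mu>' s1[unfolded smooth_iff_smooth_null[where 'i=unit]], where c="-R" and d=R]
  by (simp add: smooth_iff_smooth_null[where 'i=unit])
 have cI: "clin (u, 0) (v, 0) (S \<times> UNIV) ?I"
  using clin_log_integral[OF o mur s\<mu>' s1 c\<mu>' c1, where c="-R" and d=R] by simp
 have hG: "(%m. rGamma ((m + 1) / 2 + of_nat M) :: complex) holomorphic_on UNIV"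
  by (intro holomorphic_intros holomorphic_rGamma) auto
 have hG': "(%m. (- 1/2) ^ M * rGamma ((m + 1) / 2 + of_nat M) :: complex) holomorphic_on UNIV"
  by (intro holomorphic_intros hG)
 have cG: "clin (u, 0) (v, 0) (S \<times> UNIV) (%x. (- 1/2) ^ M * rGamma ((?\<mu> x + 1) / 2 + of_nat M))"
  by (rule clin_holomorphic[OF s\<mu> c\<mu> hG']) auto
 have sG: "smooth (S \<times> UNIV) (%x::'p \<times> 'e. (- 1/2) ^ M * rGamma ((?\<mu> x + 1) / 2 + of_nat M))"
  by (intro o smooth_mult smooth_const smooth_rGamma_compose s\<mu>)
 have s: "smooth (S \<times> UNIV) (%x. ((- 1/2) ^ M * rGamma ((?\<mu> x + 1) / 2 + of_nat M)) * ?I x)"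
  by (rule smooth_mult[OF o sG sI])
 show ?thesis
  by (rule clin_cong[OF o _ s clin_mult[OF sG sI cG cI]])
   (auto simp: reg_even_def slice_even_op_pow[OF S n])
qed

lemma open_Re_gt: 
 fixes S :: "'p::euclidean_space set"
 assumes "open S" "smooth S \<mu>"
 shows "open {p \<in> S. Re (\<mu> p) + c > 0}"
proof -
 have "open (S \<inter> (%p. Re (\<mu> p) + c) -` {0<..})"
  by (rule continuous_open_preimage) (use assms smooth_continuous in "auto intro!: continuous_intros")
 then show ?thesis by (simp add: vimage_def Int_def)
qed

lemma smooth_null_reg_aux:
 fixes \<Phi> :: "'i => 'p::euclidean_space \<times> 'e::euclidean_space => complex"
 assumes S: "open S" and n: "smooth_null F (S \<times> UNIV) \<Phi>" and mu: "smooth S \<mu>"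
  and e: "e \<in> Basis" and v: "!!i p. p \<in> S ==> van R e (%x. \<Phi> i (p, x))" and R: "R \<ge> 1"
 shows "smooth_null F (S \<times> UNIV) (%i (p, x). reg_even R e (\<mu> p) (reg_order (\<mu> p)) (%x. \<Phi> i (p, x)) x)"
proof (rule smooth_null_open_cover[OF open_Times_UNIV[OF S]])
 fix x0 :: "'p \<times> 'e" assume x0: "x0 \<in> S \<times> UNIV"
 define M where "M = reg_order (\<mu> (fst x0))"
 define U where "U = {p \<in> S. Re (\<mu> p) + 2 * real M > 0}"
 have U: "open U" "U \<subseteq> S" unfolding U_def using open_Re_gt[OF S mu] by auto
 have nU: "smooth_null F (U \<times> UNIV) \<Phi>" by (rule smooth_null_subset[OF _ n]) (use U in auto)
 have "smooth_null F (U \<times> UNIV) (%i (p, x). reg_even R e (\<mu> p) M (%x. \<Phi> i (p, x)) x)"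
  by (rule smooth_null_reg_even[OF U(1) nU smooth_subset[OF U(2) mu]]) (auto simp: U_def)
 then have "smooth_null F (U \<times> UNIV) (%i (p, x). reg_even R e (\<mu> p) (reg_order (\<mu> p)) (%x. \<Phi> i (p, x)) x)"
 proof (rule smooth_null_cong[OF open_Times_UNIV[OF U(1)], rotated], clarify)
  fix i p and x :: 'e assume p: "p \<in> U"
  then have pS: "p \<in> S" using U by auto
  show "reg_even R e (\<mu> p) M (%x. \<Phi> i (p, x)) x = reg_even R e (\<mu> p) (reg_order (\<mu> p)) (%x. \<Phi> i (p, x)) x"
   by (rule reg_even_indep[OF e smooth_slice[OF S smooth_null_smooth[OF n] pS] v[OF pS] R])
    (use p reg_order[of "\<mu> p"] in "auto simp: U_def")
 qed
 moreover have "x0 \<in> U \<times> UNIV" using x0 reg_order[of "\<mu> (fst x0)"] by (auto simp: U_def M_def)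
 ultimately show "\<exists>U. open U & x0 \<in> U & smooth_null F U (%i (p, x). reg_even R e (\<mu> p) (reg_order (\<mu> p)) (%x. \<Phi> i (p, x)) x)"
  using open_Times_UNIV[OF U(1)] by blast
qed

lemma clin_reg_aux:
 fixes \<Phi> :: "'p::euclidean_space \<times> 'e::euclidean_space => complex"
 assumes S: "open S" and n: "smooth (S \<times> UNIV) \<Phi>" and mu: "smooth S \<mu>"
  and e: "e \<in> Basis" and vn: "!!p. p \<in> S ==> van R e (%x. \<Phi> (p, x))" and R: "R \<ge> 1"
  and cl: "clin (u, 0) (v, 0) (S \<times> UNIV) \<Phi>" "clin u v S \<mu>"
 shows "clin (u, 0) (v, 0) (S \<times> UNIV) (%(p, x). reg_even R e (\<mu> p) (reg_order (\<mu> p)) (%x. \<Phi> (p, x)) x)"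
 unfolding clin_def
proof
 fix x0 :: "'p \<times> 'e" assume x0: "x0 \<in> S \<times> UNIV"
 define M where "M = reg_order (\<mu> (fst x0))"
 define U where "U = {p \<in> S. Re (\<mu> p) + 2 * real M > 0}"
 have U: "open U" "U \<subseteq> S" unfolding U_def using open_Re_gt[OF S mu] by auto
 have nU: "smooth (U \<times> UNIV) \<Phi>" by (rule smooth_subset[OF _ n]) (use U in auto)
 have mU: "!!p. p \<in> U ==> Re (\<mu> p) + 2 * real M > 0" by (auto simp: U_def)
 have s: "smooth (U \<times> UNIV) (%(p, x). reg_even R e (\<mu> p) M (%x. \<Phi> (p, x)) x)"
  using smooth_null_reg_even[OF U(1) nU[unfolded smooth_iff_smooth_null[where 'i=unit]] smooth_subset[OF U(2) mu] mU]
  by (simp add: smooth_iff_smooth_null[where 'i=unit])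
 have "clin (u, 0) (v, 0) (U \<times> UNIV) (%(p, x). reg_even R e (\<mu> p) M (%x. \<Phi> (p, x)) x)"
  by (rule clin_reg_even[OF U(1) nU smooth_subset[OF U(2) mu] mU]) (use cl U in "auto simp: clin_def")
 note c = this
 have "clin (u, 0) (v, 0) (U \<times> UNIV) (%(p, x). reg_even R e (\<mu> p) (reg_order (\<mu> p)) (%x. \<Phi> (p, x)) x)"
 proof (rule clin_cong[OF open_Times_UNIV[OF U(1)] _ s c], clarify)
  fix p and x :: 'e assume p: "p \<in> U"
  then have pS: "p \<in> S" using U by auto
  show "reg_even R e (\<mu> p) M (%x. \<Phi> (p, x)) x = reg_even R e (\<mu> p) (reg_order (\<mu> p)) (%x. \<Phi> (p, x)) x"
   by (rule reg_even_indep[OF e smooth_slice[OF S n pS] vn[OF pS] R])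
    (use p reg_order[of "\<mu> p"] in "auto simp: U_def")
 qed
 moreover have "x0 \<in> U \<times> UNIV" using x0 reg_order[of "\<mu> (fst x0)"] by (auto simp: U_def M_def)
 ultimately show "dird (v, 0) (%(p, x). reg_even R e (\<mu> p) (reg_order (\<mu> p)) (%x. \<Phi> (p, x)) x) x0 =
  \<i> * dird (u, 0) (%(p, x). reg_even R e (\<mu> p) (reg_order (\<mu> p)) (%x. \<Phi> (p, x)) x) x0"
  unfolding clin_def by blast
qed

lemma smooth_null_reg:
 fixes \<Phi> :: "'i => 'p::euclidean_space \<times> 'e::euclidean_space => complex"
 assumes S: "open S" and n: "smooth_null F (S \<times> UNIV) \<Phi>" and mu: "smooth S \<mu>"
  and e: "e \<in> Basis" and v: "!!i p. p \<in> S ==> van R e (%x. \<Phi> i (p, x))" and R: "R \<ge> 1"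
 shows "smooth_null F (S \<times> UNIV) (%i (p, x). reg R e \<epsilon> (\<mu> p) (%x. \<Phi> i (p, x)) x)"
proof (cases "\<epsilon> = 0")
 case True
 then show ?thesis using smooth_null_reg_aux[OF assms] by (simp add: reg_def)
next
 case False
 note o = open_Times_UNIV[OF S] 
 have n': "smooth_null F (S \<times> UNIV) (%i. avg_deriv (0, e) (\<Phi> i))"
  by (rule smooth_null_avg_deriv[OF o translate_inv n])
 have sl: "(%x. avg_deriv (0, e) (\<Phi> i) (p, x)) = avg_deriv e (%x. \<Phi> i (p, x))" if "p \<in> S" for i p
  by (rule ext, rule slice_avg_deriv[OF smooth_null_smooth[OF n] that])
 have v': "van R e (%x. avg_deriv (0, e) (\<Phi> i) (p, x))" if "p \<in> S" for i p
  unfolding sl[OF that] by (rule van_avg_deriv_same[OF v[OF that] e smooth_slice[OF S smooth_null_smooth[OF n] that] R])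
 have "smooth S (%p. \<mu> p + 1)" by (intro smooth_add S mu smooth_const)
 from smooth_null_reg_aux[OF S n' this e v' R]
 show ?thesis
  by (rule smooth_null_cong[OF o, rotated]) (auto simp: reg_def sl False)
qed

lemma clin_reg:
 fixes \<Phi> :: "'p::euclidean_space \<times> 'e::euclidean_space => complex"
 assumes S: "open S" and n: "smooth (S \<times> UNIV) \<Phi>" and mu: "smooth S \<mu>"
  and e: "e \<in> Basis" and vn: "!!p. p \<in> S ==> van R e (%x. \<Phi> (p, x))" and R: "R \<ge> 1"
  and cl: "clin (u, 0) (v, 0) (S \<times> UNIV) \<Phi>" "clin u v S \<mu>"
 shows "clin (u, 0) (v, 0) (S \<times> UNIV) (%(p, x). reg R e \<epsilon> (\<mu> p) (%x. \<Phi> (p, x)) x)"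
proof (cases "\<epsilon> = 0")
 case True
 then show ?thesis using clin_reg_aux[OF assms] by (simp add: reg_def)
next
 case False
 note o = open_Times_UNIV[OF S] 
 have n': "smooth (S \<times> UNIV) (avg_deriv (0, e) \<Phi>)"
  by (rule smooth_avg_deriv[OF o translate_inv n])
 have sl: "(%x. avg_deriv (0, e) \<Phi> (p, x)) = avg_deriv e (%x. \<Phi> (p, x))" if "p \<in> S" for p
  by (rule ext, rule slice_avg_deriv[OF n that])
 have v': "van R e (%x. avg_deriv (0, e) \<Phi> (p, x))" if "p \<in> S" for p
  unfolding sl[OF that] by (rule van_avg_deriv_same[OF vn[OF that] e smooth_slice[OF S n that] R])
 have mu1: "smooth S (%p. \<mu> p + 1)" by (intro smooth_add S mu smooth_const)
 have c1: "clin u v S (%p. \<mu> p + 1)"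
  by (rule clin_holomorphic[OF mu cl(2), of "%m. m + 1" UNIV]) (auto intro!: holomorphic_intros)
 have c2: "clin (u, 0) (v, 0) (S \<times> UNIV) (avg_deriv (0, e) \<Phi>)"
  by (rule clin_avg_deriv[OF o translate_inv n cl(1)]) auto
 have s: "smooth (S \<times> UNIV) (%(p, x). reg_even R e (\<mu> p + 1) (reg_order (\<mu> p + 1)) (%x. avg_deriv (0, e) \<Phi> (p, x)) x)"
  using smooth_null_reg_aux[OF S n'[unfolded smooth_iff_smooth_null[where 'i=unit]] mu1 e v' R]
  by (simp add: smooth_iff_smooth_null[where 'i=unit])
 show ?thesis
  by (rule clin_cong[OF o _ s clin_reg_aux[OF S n' mu1 e v' R c2 c1]]) (auto simp: reg_def sl False)
qed

lemma smooth_null_plain: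
 fixes \<Phi> :: "'i => 'p::euclidean_space \<times> 'e::euclidean_space => complex"
 assumes S: "open S" and n: "smooth_null F (S \<times> UNIV) \<Phi>"
 shows "smooth_null F (S \<times> UNIV) (%i (p, x). plain R e (%x. \<Phi> i (p, x)) x)"
proof -
 note o = open_Times_UNIV[OF S]
 have "smooth_null F ((S \<times> UNIV) \<times> UNIV) (%i x::('p \<times> 'e) \<times> real. \<Phi> i (fst (fst x), upd e (snd (fst x)) (snd x)))"
  by (rule smooth_null_compose[OF open_Times_UNIV[OF o] o _ smooth_upd_map[OF S] n]) auto
 from smooth_null_integral[OF o this, of "-R" R] show ?thesis by (simp add: plain_def case_prod_unfold)
qed

lemma clin_plain:
 fixes \<Phi> :: "'p::euclidean_space \<times> 'e::euclidean_space => complex"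
 assumes S: "open S" and n: "smooth (S \<times> UNIV) \<Phi>" and cl: "clin (u, 0) (v, 0) (S \<times> UNIV) \<Phi>"
 shows "clin (u, 0) (v, 0) (S \<times> UNIV) (%(p, x). plain R e (%x. \<Phi> (p, x)) x)"
proof -
 note o = open_Times_UNIV[OF S]
 have s1: "smooth ((S \<times> UNIV) \<times> UNIV) (%x::('p \<times> 'e) \<times> real. \<Phi> (fst (fst x), upd e (snd (fst x)) (snd x)))"
  by (rule smooth_compose[OF open_Times_UNIV[OF o] o _ smooth_upd_map[OF S] n]) auto
 have c1: "clin ((u, 0), 0) ((v, 0), 0) ((S \<times> UNIV) \<times> UNIV) (%x::('p \<times> 'e) \<times> real. \<Phi> (fst (fst x), upd e (snd (fst x)) (snd x)))"
  by (rule clin_compose[OF n cl _ upd_map_has_derivative]) auto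
 from clin_integral[OF o s1 c1, of "-R" R] show ?thesis by (simp add: plain_def case_prod_unfold)
qed

lemma van_reg_even:
 assumes "van R e' \<phi>" "e \<in> Basis" "e' \<in> Basis" "e ~= e'" "smooth UNIV \<phi>" "R \<ge> 1"
 shows "van R e' (reg_even R e m M \<phi>)"
 using van_even_op_pow[OF assms(1-3,5,6), of M] assms(2-4)
 by (auto simp: van_def reg_even_def upd_inner_other)

lemma van_reg:
 assumes "van R e' \<phi>" "e \<in> Basis" "e' \<in> Basis" "e ~= e'" "smooth UNIV \<phi>" "R \<ge> 1"
 shows "van R e' (reg R e \<epsilon> m \<phi>)"
proof -
 have "smooth UNIV (avg_deriv e \<phi>)" by (rule smooth_avg_deriv) (use assms in auto)
 then show ?thesis
  using van_reg_even[OF assms] van_reg_even[OF van_avg_deriv[OF assms(1-3,5,6)] assms(2-4) _ assms(6)]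
  by (simp add: reg_def)
qed

lemma van_plain:
 assumes "van R e' \<phi>" "e \<in> Basis" "e' \<in> Basis" "e ~= e'"
 shows "van R e' (plain R e \<phi>)"
 using assms by (auto simp: van_def plain_def upd_inner_other)

lemma smooth_snd:
 fixes f :: "'e::euclidean_space => 'c::real_normed_vector"
 assumes "smooth UNIV f"
 shows "smooth (UNIV \<times> UNIV) (%x::'p::euclidean_space \<times> 'e. f (snd x))"
 by (rule smooth_compose[OF _ _ _ _ assms]) (auto intro: smooth_bounded_linear bounded_linear_snd)

lemma smooth_reg:
 fixes \<phi> :: "'e::euclidean_space => complex"
 assumes "smooth UNIV \<phi>" "e \<in> Basis" "van R e \<phi>" "R \<ge> 1"
 shows "smooth UNIV (reg R e \<epsilon> m \<phi>)"
proof -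
 have "smooth_null bot (UNIV \<times> UNIV) (%(_::unit) (p::real, x). reg R e \<epsilon> m \<phi> x)"
  using smooth_null_reg[where S="UNIV::real set" and \<Phi>="%(_::unit) x. \<phi> (snd x)" and F=bot and \<mu>="%_. m"] assms
   smooth_snd[OF assms(1), where 'p=real] by (simp add: smooth_iff_smooth_null[where 'i=unit, symmetric] smooth_const)
 then have "smooth (UNIV \<times> UNIV) (%x::real \<times> 'e. reg R e \<epsilon> m \<phi> (snd x))"
  by (simp add: smooth_iff_smooth_null[where 'i=unit] case_prod_unfold)
 from smooth_slice[OF _ this, of 0] show ?thesis by simp
qed

lemma smooth_plain:
 fixes \<phi> :: "'e::euclidean_space => complex"
 assumes "smooth UNIV \<phi>"
 shows "smooth UNIV (plain R e \<phi>)"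
proof -
 have "smooth_null bot (UNIV \<times> UNIV) (%(_::unit) (p::real, x). plain R e \<phi> x)"
  using smooth_null_plain[where S="UNIV::real set" and \<Phi>="%(_::unit) x. \<phi> (snd x)" and F=bot] assms
   smooth_snd[OF assms(1), where 'p=real] by (simp add: smooth_iff_smooth_null[where 'i=unit, symmetric])
 then have "smooth (UNIV \<times> UNIV) (%x::real \<times> 'e. plain R e \<phi> (snd x))"
  by (simp add: smooth_iff_smooth_null[where 'i=unit] case_prod_unfold)
 from smooth_slice[OF _ this, of 0] show ?thesis by simp
qed

lemma regs_Cons: "regs R wt (e # es) \<phi> = reg_step R wt e (regs R wt es \<phi>)"
 and regs_Nil [simp]: "regs R wt [] \<phi> = \<phi>"
 and regs_snoc: "regs R wt (es @ [e]) \<phi> = regs R wt es (reg_step R wt e \<phi>)"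
 by (simp_all add: regs_def)

lemma smooth_reg_step:
 assumes "smooth UNIV \<phi>" "e \<in> Basis" "van R e \<phi>" "R \<ge> 1"
 shows "smooth UNIV (reg_step R wt e \<phi>)"
 using smooth_plain[OF assms(1)] smooth_reg[OF assms] by (auto simp: reg_step_def split: option.splits)

lemma van_reg_step:
 assumes "van R e' \<phi>" "e \<in> Basis" "e' \<in> Basis" "e ~= e'" "smooth UNIV \<phi>" "R \<ge> 1"
 shows "van R e' (reg_step R wt e \<phi>)"
 using van_plain[OF assms(1-4)] van_reg[OF assms] by (auto simp: reg_step_def split: option.splits)

lemma regs_smooth_van:
 assumes "R \<ge> 1"
 shows "distinct es ==> set es \<subseteq> Basis ==> smooth UNIV \<phi> ==> (!!e. e \<in> Basis ==> van R e \<phi>) ==>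
  smooth UNIV (regs R wt es \<phi>) & (\<forall>e\<in>Basis - set es. van R e (regs R wt es \<phi>))"
proof (induction es)
 case (Cons e es)
 then have IH: "smooth UNIV (regs R wt es \<phi>)" "\<forall>e\<in>Basis - set es. van R e (regs R wt es \<phi>)" by auto
 show ?case unfolding regs_Cons
  using Cons.prems IH assms by (auto intro!: smooth_reg_step van_reg_step)
qed auto

abbreviation wt_at :: "('e => (bit \<times> ('p => complex)) option) => 'p => 'e => (bit \<times> complex) option" where
 "wt_at W p \<equiv> (%e. map_option (%(\<epsilon>, \<mu>). (\<epsilon>, \<mu> p)) (W e))"

lemma smooth_null_regs:
 fixes \<Phi> :: "'i => 'p::euclidean_space \<times> 'e::euclidean_space => complex"
 assumes S: "open S" and n: "smooth_null F (S \<times> UNIV) \<Phi>" and mu: "!!e \<epsilon> \<mu>. W e = Some (\<epsilon>, \<mu>) ==> smooth S \<mu>"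
  and v: "!!e i p. e \<in> Basis ==> p \<in> S ==> van R e (%x. \<Phi> i (p, x))" and R: "R \<ge> 1"
 shows "distinct es ==> set es \<subseteq> Basis ==>
  smooth_null F (S \<times> UNIV) (%i (p, x). regs R (wt_at W p) es (%x. \<Phi> i (p, x)) x)"
proof (induction es)
 case Nil
 then show ?case using n by (simp add: case_prod_unfold)
next
 case (Cons e es)
 let ?\<Psi> = "%i (p, x). regs R (wt_at W p) es (%x. \<Phi> i (p, x)) x"
 have IH: "smooth_null F (S \<times> UNIV) ?\<Psi>" using Cons by auto
 have e: "e \<in> Basis" using Cons.prems by auto
 have vn: "van R e (%x. ?\<Psi> i (p, x))" if "p \<in> S" for i p
  using regs_smooth_van[OF R, of es "%x. \<Phi> i (p, x)"] Cons.prems smooth_slice[OF S smooth_null_smooth[OF n] that] v that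
  by auto
 show ?case
 proof (cases "W e")
  case None
  then show ?thesis using smooth_null_plain[OF S IH, of R e] by (simp add: regs_Cons reg_step_def case_prod_unfold)
 next
  case (Some a)
  obtain \<epsilon> \<mu> where "W e = Some (\<epsilon>, \<mu>)" using Some by (cases a) auto
  then show ?thesis using smooth_null_reg[OF S IH mu e vn R, of e \<epsilon> \<mu>  \<epsilon>] by (simp add: regs_Cons reg_step_def case_prod_unfold)
 qed
qed

lemma clin_regs:
 fixes \<Phi> :: "'p::euclidean_space \<times> 'e::euclidean_space => complex"
 assumes S: "open S" and n: "smooth (S \<times> UNIV) \<Phi>" and mu: "!!e \<epsilon> \<mu>. W e = Some (\<epsilon>, \<mu>) ==> smooth S \<mu>"
  and v: "!!e p. e \<in> Basis ==> p \<in> S ==> van R e (%x. \<Phi> (p, x))" and R: "R \<ge> 1"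
  and cl: "clin (u, 0) (v, 0) (S \<times> UNIV) \<Phi>" "!!e \<epsilon> \<mu>. W e = Some (\<epsilon>, \<mu>) ==> clin u v S \<mu>"
 shows "distinct es ==> set es \<subseteq> Basis ==>
  clin (u, 0) (v, 0) (S \<times> UNIV) (%(p, x). regs R (wt_at W p) es (%x. \<Phi> (p, x)) x)"
proof (induction es)
 case Nil
 then show ?case using cl by (simp add: case_prod_unfold)
next
 case (Cons e es)
 let ?\<Psi> = "%(p, x). regs R (wt_at W p) es (%x. \<Phi> (p, x)) x"
 have IH: "clin (u, 0) (v, 0) (S \<times> UNIV) ?\<Psi>" using Cons by auto
 have s: "smooth (S \<times> UNIV) ?\<Psi>"
  using smooth_null_regs[OF S n[unfolded smooth_iff_smooth_null[where 'i=unit]] mu v R, where W=W and es=es] Cons.prems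
  by (simp add: smooth_iff_smooth_null[where 'i=unit])
 have e: "e \<in> Basis" using Cons.prems by auto
 have vn: "van R e (%x. ?\<Psi> (p, x))" if "p \<in> S" for p
  using regs_smooth_van[OF R, of es "%x. \<Phi> (p, x)"] Cons.prems smooth_slice[OF S n that] v that
  by auto
 show ?case
 proof (cases "W e")
  case None
  then show ?thesis using clin_plain[OF S s IH, of R e] by (simp add: regs_Cons reg_step_def case_prod_unfold)
 next
  case (Some a)
  obtain \<epsilon> \<mu> where W: "W e = Some (\<epsilon>, \<mu>)" using Some by (cases a) auto
  then show ?thesis using clin_reg[OF S s mu[OF W] e vn R IH cl(2)[OF W], of \<epsilon>]
   by (simp add: regs_Cons reg_step_def case_prod_unfold)
 qed
qed

section \<open>Linearity\<close>

lemma dird_lincomb: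
 assumes "smooth UNIV f" "smooth UNIV g"
 shows "dird e (%x. a * f x + b * g x) = (%x. a * dird e f x + b * dird e g x :: complex)"
 by (rule ext, rule dird_eq) (intro has_derivative_add has_derivative_mult_right smooth_has_derivative[OF assms(1)] smooth_has_derivative[OF assms(2)] UNIV_I)

lemma integral_lincomb:
 fixes f g :: "real => complex"
 assumes "f integrable_on S" "g integrable_on S"
 shows "integral S (%t. a * f t + b * g t) = a * integral S f + b * integral S g"
 by (simp add: Henstock_Kurzweil_Integration.integral_add integrable_on_mult_right assms)

lemma avg_deriv_lincomb:
 fixes f g :: "'a::euclidean_space => complex"
 assumes "smooth UNIV f" "smooth UNIV g"
 shows "avg_deriv e (%x. a * f x + b * g x) = (%x. a * avg_deriv e f x + b * avg_deriv e g x)"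
proof
 fix x
 have i: "(%t. dird e h (x + ((t - 1) * (x \<bullet> e)) *\<^sub>R e)) integrable_on {-1..1}" if "smooth UNIV h" for h :: "'a => complex"
  by (rule integrable_continuous_real, rule continuous_on_compose2[OF smooth_continuous[OF smooth_dird[OF that, of e]]])
   (auto intro!: continuous_intros)
 show "avg_deriv e (%x. a * f x + b * g x) x = a * avg_deriv e f x + b * avg_deriv e g x"
  unfolding avg_deriv_def fun_cong[OF dird_lincomb[OF assms]] integral_lincomb[OF i[OF assms(1)] i[OF assms(2)]]
  by (simp add: algebra_simps)
qed

lemma even_op_pow_lincomb:
 fixes f g :: "'a::euclidean_space => complex"
 assumes "smooth UNIV f" "smooth UNIV g"
 shows "(even_op e ^^ M) (%x. a * f x + b * g x) = (%x. a * (even_op e ^^ M) f x + b * (even_op e ^^ M) g x)"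
proof (induction M)
 case (Suc M)
 have s: "smooth UNIV ((even_op e ^^ M) h)" if "smooth UNIV h" for h
  by (rule smooth_even_op_pow) (use that in auto)
 show ?case
  using avg_deriv_lincomb[OF smooth_dird[OF s[OF assms(1)]] smooth_dird[OF s[OF assms(2)]], of e a e b e]
  by (simp add: Suc.IH even_op_def[of e "_ ^^ _"] even_op_def[of e "%x. a * _ x + _ x"] dird_lincomb[OF s[OF assms(1)] s[OF assms(2)]])
   (simp add: even_op_def)
qed simp

lemma reg_even_lincomb:
 fixes f g :: "'a::euclidean_space => complex"
 assumes "smooth UNIV f" "smooth UNIV g" "Re m + 2 * real M > 0"
 shows "reg_even R e m M (%x. a * f x + b * g x) = (%x. a * reg_even R e m M f x + b * reg_even R e m M g x)"
proof
 fix x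
 have i: "(%s. log_powr 0 (m + 2 * of_nat M) s * (even_op e ^^ M) h (upd e x s)) integrable_on {-R..R}" if "smooth UNIV h" for h
 proof (rule integrable_continuous_real, intro continuous_on_mult log_powr_continuous1 continuous_on_upd smooth_continuous)
  show "smooth UNIV ((even_op e ^^ M) h)" by (rule smooth_even_op_pow) (use that in auto)
 qed (use assms in auto)
 have "integral {-R..R} (%s. log_powr 0 (m + 2 * of_nat M) s * (a * (even_op e ^^ M) f (upd e x s) + b * (even_op e ^^ M) g (upd e x s)))
  = a * integral {-R..R} (%s. log_powr 0 (m + 2 * of_nat M) s * (even_op e ^^ M) f (upd e x s))
  + b * integral {-R..R} (%s. log_powr 0 (m + 2 * of_nat M) s * (even_op e ^^ M) g (upd e x s))"
  unfolding integral_lincomb[OF i[OF assms(1)] i[OF assms(2)], symmetric]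
  by (rule integral_cong) (simp add: algebra_simps)
 then show "reg_even R e m M (%x. a * f x + b * g x) x = a * reg_even R e m M f x + b * reg_even R e m M g x"
  by (simp add: reg_even_def even_op_pow_lincomb[OF assms(1,2)] algebra_simps)
qed

lemma reg_step_lincomb:
 fixes f g :: "'a::euclidean_space => complex"
 assumes "smooth UNIV f" "smooth UNIV g"
 shows "reg_step R wt e (%x. a * f x + b * g x) = (%x. a * reg_step R wt e f x + b * reg_step R wt e g x)"
proof -
 have "plain R e (%x. a * f x + b * g x) = (%x. a * plain R e f x + b * plain R e g x)"
  unfolding plain_def
  by (rule ext, rule integral_lincomb; intro integrable_continuous_real continuous_on_upd smooth_continuous assms)
 moreover have "reg R e \<epsilon> m (%x. a * f x + b * g x) = (%x. a * reg R e \<epsilon> m f x + b * reg R e \<epsilon> m g x)" for \<epsilon> m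
 proof -
  have s: "smooth UNIV (avg_deriv e h)" if "smooth UNIV h" for h
   by (rule smooth_avg_deriv) (use that in auto)
  show ?thesis unfolding reg_def
   by (simp add: reg_even_lincomb[OF assms reg_order] avg_deriv_lincomb[OF assms] reg_even_lincomb[OF s[OF assms(1)] s[OF assms(2)] reg_order])
 qed
 ultimately show ?thesis by (auto simp: reg_step_def split: option.splits)
qed

lemma regs_lincomb:
 fixes f g :: "'a::euclidean_space => complex"
 assumes "smooth UNIV f" "smooth UNIV g" "!!e. e \<in> Basis ==> van R e f" "!!e. e \<in> Basis ==> van R e g" "R \<ge> 1"
 shows "distinct es ==> set es \<subseteq> Basis ==> regs R wt es (%x. a * f x + b * g x) = (%x. a * regs R wt es f x + b * regs R wt es g x)"
proof (induction es)
 case (Cons e es)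
 have "smooth UNIV (regs R wt es f)" "smooth UNIV (regs R wt es g)"
  using regs_smooth_van[OF assms(5)] Cons.prems assms by auto
 then show ?case using Cons by (simp add: regs_Cons reg_step_lincomb)
qed simp

section \<open>The region of convergence\<close>

definition wt_factor :: "(bit \<times> complex) option => complex" where
 "wt_factor w = (case w of None => 1 | Some (\<epsilon>, m) => rGamma ((m + 1 + of_bit \<epsilon>) / 2))"

definition wt_fun :: "(bit \<times> complex) option => real => complex" where
 "wt_fun w s = (case w of None => 1 | Some (\<epsilon>, m) => sgn_powr \<epsilon> m s)"

definition wt_conv :: "(bit \<times> complex) option => bool" where
 "wt_conv w = (case w of None => True | Some (\<epsilon>, m) => Re m > -1)"

lemma wt_fun_measurable [measurable]: "wt_fun w \<in> borel_measurable borel"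
 by (cases w) (auto simp: wt_fun_def[abs_def])

lemma wt_fun_integrable:
 assumes "wt_conv w" "R > 0" "continuous_on {-R..R} \<theta>" "\<theta> \<in> borel_measurable borel"
 shows "set_integrable lborel {-R..R} (%s. wt_fun w s * \<theta> s)"
proof -
 have "(%s. wt_fun w s * \<theta> s) absolutely_integrable_on {-R..R}"
 proof (cases w)
  case None
  then show ?thesis using absolutely_integrable_continuous_real[OF assms(3)] by (simp add: wt_fun_def)
 next
  case (Some a)
  then show ?thesis using assms sgn_powr_absolutely_integrable by (cases a) (auto simp: wt_conv_def wt_fun_def)
 qed
 then show ?thesis
  unfolding set_integrable_def using assms(4)
  by (subst (asm) integrable_completion) auto
qed

lemma reg_step_convergent:
 assumes e: "e \<in> Basis" and s: "smooth UNIV \<phi>" and v: "van R e \<phi>" and R: "R \<ge> 1" and c: "wt_conv (wt e)"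
 shows "reg_step R wt e \<phi> x = wt_factor (wt e) * (LINT s|lborel. wt_fun (wt e) s * \<phi> (upd e x s))"
proof -
 have co: "continuous_on T (%s. \<phi> (upd e x s))" for T by (rule continuous_on_upd[OF smooth_continuous[OF s]])
 have R0: "R > 0" using R by simp
 have "set_integrable lborel {-R..R} (%s. wt_fun (wt e) s * \<phi> (upd e x s))"
  by (rule wt_fun_integrable[OF c R0 co]) (rule borel_measurable_continuous_onI[OF co])
 from set_borel_integral_eq_integral(2)[OF this]
 have "integral {-R..R} (%s. wt_fun (wt e) s * \<phi> (upd e x s)) = (LINT s:{-R..R}|lborel. wt_fun (wt e) s * \<phi> (upd e x s))" by simp
 also have "... = (LINT s|lborel. wt_fun (wt e) s * \<phi> (upd e x s))"
  unfolding set_lebesgue_integral_def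
  by (rule Bochner_Integration.integral_cong) (use v e in "auto simp: van_def indicator_def")
 finally have I: "integral {-R..R} (%s. wt_fun (wt e) s * \<phi> (upd e x s)) = (LINT s|lborel. wt_fun (wt e) s * \<phi> (upd e x s))" .
 show ?thesis
 proof (cases "wt e")
  case None
  then show ?thesis using I by (simp add: reg_step_def plain_def wt_factor_def wt_fun_def)
 next
  case (Some a)
  then show ?thesis using I c reg_convergent[OF e s v R]
   by (cases a) (simp add: reg_step_def wt_factor_def wt_fun_def wt_conv_def)
 qed
qed

text \<open>The point \<open>x\<close> with the coordinates in \<open>J\<close> replaced by those of \<open>y\<close>.\<close>

definition comb :: "'a::euclidean_space set => 'a => ('a => real) => 'a" where
 "comb J x y = x + (\<Sum>e\<in>J. (y e - x \<bullet> e) *\<^sub>R e)"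

lemma comb_insert:
 assumes "e \<in> Basis" "J \<subseteq> Basis" "e \<notin> J"
 shows "upd e (comb J x y) s = comb (insert e J) x (y(e := s))"
proof -
 have f: "finite J" by (rule finite_subset[OF _ finite_Basis]) (use assms in auto)
 have "comb J x y \<bullet> e = x \<bullet> e"
  using assms by (auto simp: comb_def inner_add_left inner_sum_left inner_Basis intro!: sum.neutral)
 moreover have "(\<Sum>e'\<in>J. (y e' - x \<bullet> e') *\<^sub>R e') = (\<Sum>e'\<in>J. ((y(e := s)) e' - x \<bullet> e') *\<^sub>R e')"
  by (rule sum.cong) (use assms in auto)
 ultimately show ?thesis using f assms by (simp add: upd_def comb_def)
qed

lemma comb_inner:
 assumes "J \<subseteq> Basis" "e \<in> J" shows "comb J x y \<bullet> e = y e"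
proof -
 have f: "finite J" by (rule finite_subset[OF _ finite_Basis]) (use assms in auto)
 have "(\<Sum>e'\<in>J. ((y e' - x \<bullet> e') *\<^sub>R e') \<bullet> e) = (\<Sum>e'\<in>J. if e' = e then y e - x \<bullet> e else 0)"
  by (rule sum.cong) (use assms in "auto simp: inner_not_same_Basis subset_iff")
 then show ?thesis using assms f by (simp add: comb_def inner_add_left inner_sum_left)
qed

lemma comb_integrable:
 fixes \<phi> :: "'a::euclidean_space => complex"
 assumes J: "J \<subseteq> Basis" and s: "continuous_on UNIV \<phi>" and v: "!!e. e \<in> J ==> van R e \<phi>" and R: "R \<ge> 1"
  and c: "!!e. e \<in> J ==> wt_conv (wt e)"
 shows "integrable (\<Pi>\<^sub>M e\<in>J. lborel) (%y. (\<Prod>e\<in>J. wt_fun (wt e) (y e)) * \<phi> (comb J x y))"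
proof -
 interpret product_sigma_finite "%_::'a. lborel :: real measure" by standard
 have f: "finite J" by (rule finite_subset[OF J finite_Basis])
 have R0: "R > 0" using R by simp
 have [measurable]: "\<phi> \<in> borel_measurable borel" by (rule borel_measurable_continuous_onI[OF s])
 have [measurable]: "comb J x \<in> borel_measurable (\<Pi>\<^sub>M e\<in>J. lborel)"
  unfolding comb_def[abs_def] using f by measurable
 define g where "g e s = indicator {-R..R} s *\<^sub>R wt_fun (wt e) s" for e s
 have g: "integrable lborel (g e)" if "e \<in> J" for e
  using wt_fun_integrable[OF c[OF that] R0, of "%_. 1"] by (simp add: set_integrable_def g_def[abs_def])
 have "bounded (\<phi> ` cball 0 (norm x + real (DIM('a)) * (R + norm x)))"
  by (intro compact_imp_bounded compact_continuous_image continuous_on_subset[OF s]) auto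
 then obtain B where "\<forall>z\<in>cball 0 (norm x + real (DIM('a)) * (R + norm x)). norm (\<phi> z) <= B"
  by (auto simp: bounded_iff)
 then have B: "!!z. norm z <= norm x + real (DIM('a)) * (R + norm x) ==> norm (\<phi> z) <= B"
  by auto
 have "integrable (\<Pi>\<^sub>M e\<in>J. lborel) (%y. B *\<^sub>R (\<Prod>e\<in>J. g e (y e)))"
  by (intro integrable_scaleR_right product_integrable_prod f g)
 then show ?thesis
 proof (rule Bochner_Integration.integrable_bound)
  show "(%y. (\<Prod>e\<in>J. wt_fun (wt e) (y e)) * \<phi> (comb J x y)) \<in> borel_measurable (\<Pi>\<^sub>M e\<in>J. lborel)"
   using f by measurable
  show "AE y in \<Pi>\<^sub>M e\<in>J. lborel. norm ((\<Prod>e\<in>J. wt_fun (wt e) (y e)) * \<phi> (comb J x y)) <= norm (B *\<^sub>R (\<Prod>e\<in>J. g e (y e)))"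
  proof (rule AE_I2)
   fix y
   show "norm ((\<Prod>e\<in>J. wt_fun (wt e) (y e)) * \<phi> (comb J x y)) <= norm (B *\<^sub>R (\<Prod>e\<in>J. g e (y e)))"
   proof (cases "\<forall>e\<in>J. \<bar>y e\<bar> <= R")
    case True
    then have eq: "(\<Prod>e\<in>J. g e (y e)) = (\<Prod>e\<in>J. wt_fun (wt e) (y e))"
     by (intro prod.cong) (auto simp: g_def abs_le_iff)
    have "norm (\<Sum>e\<in>J. (y e - x \<bullet> e) *\<^sub>R e) <= (\<Sum>e\<in>J. R + norm x)"
    proof (rule sum_norm_le)
     fix e assume e: "e \<in> J"
     have "\<bar>x \<bullet> e\<bar> <= norm x" using e J Basis_le_norm by blast
     then show "norm ((y e - x \<bullet> e) *\<^sub>R e) <= R + norm x" using True e J by (auto simp: norm_Basis subset_iff)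
    qed
    also have "... <= real (DIM('a)) * (R + norm x)"
     using R card_mono[OF finite_Basis J] by (auto intro!: mult_right_mono)
    finally have "norm (comb J x y) <= norm x + real (DIM('a)) * (R + norm x)"
     unfolding comb_def by (intro norm_triangle_le add_mono) auto
    then have "norm (\<phi> (comb J x y)) <= B" by (rule B)
    moreover have "B <= \<bar>B\<bar>" by simp
    ultimately show ?thesis unfolding eq by (simp add: norm_mult mult.commute) (smt (verit) mult_right_mono norm_ge_zero)
   next
    case False
    then obtain e where e: "e \<in> J" "\<bar>y e\<bar> > R" by auto
    then have "\<phi> (comb J x y) = 0" using v[OF e(1)] comb_inner[OF J e(1)] by (auto simp: van_def)
    then show ?thesis by simp
   qed
  qed
 qed
qed

lemma regs_convergent_PiM:
 fixes \<phi> :: "'a::euclidean_space => complex"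
 assumes R: "R \<ge> 1"
 shows "distinct es ==> set es \<subseteq> Basis ==> smooth UNIV \<phi> ==> (!!e. e \<in> Basis ==> e \<notin> D ==> van R e \<phi>) ==> set es \<inter> D = {} ==>
  (!!e. e \<in> Basis ==> wt_conv (wt e)) ==>
  regs R wt es \<phi> x = (\<Prod>e\<in>set es. wt_factor (wt e)) *
   (LINT y|(\<Pi>\<^sub>M e\<in>set es. lborel). (\<Prod>e\<in>set es. wt_fun (wt e) (y e)) * \<phi> (comb (set es) x y))"
proof (induction es arbitrary: \<phi> D rule: rev_induct)
 case Nil
 interpret product_sigma_finite "%_::'a. lborel :: real measure" by standard
 show ?case by (simp add: comb_def measure_def space_PiM_empty)
next
 case (snoc e es)
 interpret product_sigma_finite "%_::'a. lborel :: real measure" by standard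
 let ?J = "set es"
 have e: "e \<in> Basis" "e \<notin> ?J" "?J \<subseteq> Basis" using snoc.prems by auto
 have ve: "van R e \<phi>" using snoc.prems e by auto
 have s1: "smooth UNIV (reg_step R wt e \<phi>)" by (rule smooth_reg_step[OF snoc.prems(3) e(1) ve R])
 have v1: "van R e' (reg_step R wt e \<phi>)" if "e' \<in> Basis" "e' \<notin> insert e D" for e'
  using that snoc.prems e R by (intro van_reg_step) auto
 have "regs R wt (es @ [e]) \<phi> x = (\<Prod>e\<in>?J. wt_factor (wt e)) *
   (LINT y|(\<Pi>\<^sub>M e\<in>?J. lborel). (\<Prod>e\<in>?J. wt_fun (wt e) (y e)) * reg_step R wt e \<phi> (comb ?J x y))"
  unfolding regs_snoc by (rule snoc.IH[of _ "insert e D"]) (use snoc.prems s1 v1 e in auto)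
 also have "(%y. (\<Prod>e\<in>?J. wt_fun (wt e) (y e)) * reg_step R wt e \<phi> (comb ?J x y)) =
  (%y. wt_factor (wt e) * (LINT s|lborel. (\<Prod>e'\<in>insert e ?J. wt_fun (wt e') ((y(e := s)) e')) * \<phi> (comb (insert e ?J) x (y(e := s)))))"
 proof
  fix y
  have p: "(\<Prod>e'\<in>?J. wt_fun (wt e') (y e')) = (\<Prod>e'\<in>?J. wt_fun (wt e') ((y(e := s)) e'))" for s
   by (rule prod.cong) (use e in auto)
  have "(%s. (\<Prod>e'\<in>insert e ?J. wt_fun (wt e') ((y(e := s)) e')) * \<phi> (comb (insert e ?J) x (y(e := s))))
   = (%s. (\<Prod>e\<in>?J. wt_fun (wt e) (y e)) * (wt_fun (wt e) s * \<phi> (upd e (comb ?J x y) s)))"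
  proof
   fix s
   have "(\<Prod>e'\<in>insert e ?J. wt_fun (wt e') ((y(e := s)) e')) = wt_fun (wt e) s * (\<Prod>e'\<in>?J. wt_fun (wt e') (y e'))"
    unfolding p[of s] using e by simp
   then show "(\<Prod>e'\<in>insert e ?J. wt_fun (wt e') ((y(e := s)) e')) * \<phi> (comb (insert e ?J) x (y(e := s)))
    = (\<Prod>e\<in>?J. wt_fun (wt e) (y e)) * (wt_fun (wt e) s * \<phi> (upd e (comb ?J x y) s))"
    using comb_insert[OF e(1,3,2), of x y s] by (simp add: mult_ac)
  qed
  then show "(\<Prod>e\<in>?J. wt_fun (wt e) (y e)) * reg_step R wt e \<phi> (comb ?J x y) =
   wt_factor (wt e) * (LINT s|lborel. (\<Prod>e'\<in>insert e ?J. wt_fun (wt e') ((y(e := s)) e')) * \<phi> (comb (insert e ?J) x (y(e := s))))"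
   by (simp add: reg_step_convergent[where wt=wt and e=e, OF e(1) snoc.prems(3) ve R snoc.prems(6)[OF e(1)]])
 qed
 also have "(LINT y|(\<Pi>\<^sub>M e\<in>?J. lborel). wt_factor (wt e) * (LINT s|lborel. (\<Prod>e'\<in>insert e ?J. wt_fun (wt e') ((y(e := s)) e')) * \<phi> (comb (insert e ?J) x (y(e := s)))))
  = wt_factor (wt e) * (LINT y|(\<Pi>\<^sub>M e\<in>insert e ?J. lborel). (\<Prod>e'\<in>insert e ?J. wt_fun (wt e') (y e')) * \<phi> (comb (insert e ?J) x y))"
 proof (subst product_integral_insert)
  show "integrable (Pi\<^sub>M (insert e ?J) (%_. lborel)) (%y. (\<Prod>e'\<in>insert e ?J. wt_fun (wt e') (y e')) * \<phi> (comb (insert e ?J) x y))"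
   by (rule comb_integrable[OF _ smooth_continuous[OF snoc.prems(3)] _ R]) (use e snoc.prems in auto)
 qed (use e in auto)
 finally show ?case using e by (simp add: mult_ac)
qed

lemma regs_convergent:
 fixes \<phi> :: "'a::euclidean_space => complex"
 assumes R: "R \<ge> 1" and es: "distinct es" "set es = Basis" and s: "smooth UNIV \<phi>"
  and v: "!!e. e \<in> Basis ==> van R e \<phi>" and c: "!!e. e \<in> Basis ==> wt_conv (wt e)"
 shows "integrable lborel (%z. (\<Prod>e\<in>Basis. wt_fun (wt e) (z \<bullet> e)) * \<phi> z)" (is ?i)
  and "regs R wt es \<phi> x = (\<Prod>e\<in>Basis. wt_factor (wt e)) *
   (LINT z|lborel. (\<Prod>e\<in>Basis. wt_fun (wt e) (z \<bullet> e)) * \<phi> z)" (is ?e)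
proof -
 have cb: "comb Basis x y = (\<Sum>e\<in>Basis. y e *\<^sub>R e)" for y
  by (simp add: comb_def scaleR_diff_left sum_subtractf euclidean_representation)
 have [measurable]: "\<phi> \<in> borel_measurable borel" by (rule borel_measurable_continuous_onI[OF smooth_continuous[OF s]])
 have eq: "(%y. (\<Prod>e\<in>Basis. wt_fun (wt e) (y e)) * \<phi> (comb Basis x y)) =
  (%y. (%z. (\<Prod>e\<in>Basis. wt_fun (wt e) (z \<bullet> e)) * \<phi> z) (\<Sum>e\<in>Basis. y e *\<^sub>R e))"
  by (auto simp: cb fun_eq_iff inner_sum_left inner_Basis if_distrib sum.delta cong: if_cong intro!: prod.cong)
 have i: "integrable (\<Pi>\<^sub>M e\<in>(Basis::'a set). lborel) (%y. (%z. (\<Prod>e\<in>Basis. wt_fun (wt e) (z \<bullet> e)) * \<phi> z) (\<Sum>e\<in>Basis. y e *\<^sub>R e))"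
  using comb_integrable[of Basis \<phi> R wt x] smooth_continuous[OF s] v R c unfolding eq by auto
 show ?i by (subst lborel_eq, subst integrable_distr_eq) (use i in auto)
 have "regs R wt es \<phi> x = (\<Prod>e\<in>Basis. wt_factor (wt e)) *
   (LINT y|(\<Pi>\<^sub>M e\<in>(Basis::'a set). lborel). (\<Prod>e\<in>Basis. wt_fun (wt e) (y e)) * \<phi> (comb Basis x y))"
  using regs_convergent_PiM[OF R es(1), of \<phi> "{}" wt x] es s v c by simp
 also have "(LINT y|(\<Pi>\<^sub>M e\<in>(Basis::'a set). lborel). (\<Prod>e\<in>Basis. wt_fun (wt e) (y e)) * \<phi> (comb Basis x y)) =
  (LINT z|lborel. (\<Prod>e\<in>Basis. wt_fun (wt e) (z \<bullet> e)) * \<phi> z)"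
  unfolding eq by (subst (2) lborel_eq, subst integral_distr) auto
 finally show ?e .
qed

section \<open>Maps that scale Lebesgue measure\<close>

text \<open>For a linear map \<open>c\<close> is the absolute value of the determinant.\<close>

definition scales :: "('a::euclidean_space => 'a) => real => bool" where
 "scales L c \<longleftrightarrow> c > 0 & L \<in> borel_measurable borel &
  (\<forall>f\<in>borel_measurable borel. ennreal c * (\<integral>\<^sup>+x. f (L x) \<partial>lborel) = (\<integral>\<^sup>+x. f x \<partial>lborel))"

lemma scales_pos: "scales L c ==> c > 0"
 and scales_measurable: "scales L c ==> L \<in> borel_measurable borel"
 and scales_nn_integral: "scales L c ==> f \<in> borel_measurable borel ==> ennreal c * (\<integral>\<^sup>+x. f (L x) \<partial>lborel) = (\<integral>\<^sup>+x. f x \<partial>lborel)"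
 by (auto simp: scales_def)

lemma scales_compose:
 assumes "scales L c" "scales K d"
 shows "scales (%x. L (K x)) (c * d)"
 unfolding scales_def
proof (intro conjI ballI)
 have m [measurable]: "L \<in> borel_measurable borel" "K \<in> borel_measurable borel" using assms by (auto dest: scales_measurable)
 show "(%x. L (K x)) \<in> borel_measurable borel" by measurable
 show "c * d > 0" using scales_pos[OF assms(1)] scales_pos[OF assms(2)] by simp
 fix f :: "'a => ennreal" assume [measurable]: "f \<in> borel_measurable borel"
 have "ennreal (c * d) * (\<integral>\<^sup>+x. f (L (K x)) \<partial>lborel) = ennreal c * (ennreal d * (\<integral>\<^sup>+x. f (L (K x)) \<partial>lborel))"
  using assms by (simp add: ennreal_mult scales_pos less_imp_le mult.assoc)
 also have "... = ennreal c * (\<integral>\<^sup>+x. f (L x) \<partial>lborel)"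
  using scales_nn_integral[OF assms(2), of "%x. f (L x)"] by simp
 also have "... = (\<integral>\<^sup>+x. f x \<partial>lborel)" by (rule scales_nn_integral[OF assms(1)]) simp
 finally show "ennreal (c * d) * (\<integral>\<^sup>+x. f (L (K x)) \<partial>lborel) = (\<integral>\<^sup>+x. f x \<partial>lborel)" .
qed

lemma lborel_eq_density_distr:
 assumes "scales L c"
 shows "lborel = density (distr lborel borel L) (%_. ennreal c)"
proof (rule measure_eqI)
 note [measurable] = scales_measurable[OF assms]
 fix A :: "'a set" assume "A \<in> sets lborel"
 then have [measurable]: "A \<in> sets borel" by simp
 have "emeasure (density (distr lborel borel L) (%_. ennreal c)) A = (\<integral>\<^sup>+x. ennreal c * indicator A x \<partial>distr lborel borel L)"
  by (subst emeasure_density) auto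
 also have "... = ennreal c * (\<integral>\<^sup>+x. indicator A (L x) \<partial>lborel)"
 proof -
  have "(\<integral>\<^sup>+x. indicator A (L x) \<partial>lborel) = (\<integral>\<^sup>+x. indicator A x \<partial>distr lborel borel L)"
   by (subst nn_integral_distr) auto
  then show ?thesis by (simp add: nn_integral_cmult)
 qed
 also have "... = (\<integral>\<^sup>+x. indicator A x \<partial>lborel)" by (rule scales_nn_integral[OF assms]) simp
 finally show "emeasure lborel A = emeasure (density (distr lborel borel L) (%_. ennreal c)) A" by simp
qed simp

lemma scales_integral:
 fixes f :: "'a::euclidean_space => 'b::{banach, second_countable_topology}"
 assumes "scales L c" "f \<in> borel_measurable borel"
 shows "integrable lborel (%x. f (L x)) \<longleftrightarrow> integrable lborel f"
  and "(LINT x|lborel. f x) = c *\<^sub>R (LINT x|lborel. f (L x))"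
proof -
 note [measurable] = scales_measurable[OF assms(1)] assms(2)
 have c: "c > 0" using assms(1) by (rule scales_pos)
 have "integrable lborel f \<longleftrightarrow> integrable (density (distr lborel borel L) (%_. ennreal c)) f"
  using lborel_eq_density_distr[OF assms(1)] by simp
 also have "... \<longleftrightarrow> integrable lborel (%x. c *\<^sub>R f (L x))"
  using c by (subst integrable_density) (auto simp: integrable_distr_eq)
 also have "... \<longleftrightarrow> integrable lborel (%x. f (L x))"
  using c integrable_scaleR_right[of "1/c" lborel "%x. c *\<^sub>R f (L x)"] by auto
 finally show "integrable lborel (%x. f (L x)) \<longleftrightarrow> integrable lborel f" by simp
 have "(LINT x|lborel. f x) = (LINT x|density (distr lborel borel L) (%_. ennreal c). f x)"
  using lborel_eq_density_distr[OF assms(1)] by simp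
 also have "... = (LINT x|lborel. c *\<^sub>R f (L x))"
  using c by (subst integral_density) (auto simp: integral_distr)
 finally show "(LINT x|lborel. f x) = c *\<^sub>R (LINT x|lborel. f (L x))" using c by simp
qed

lemma scales_translate: "scales (%x. a + x) 1" for a :: "'a::euclidean_space"
 unfolding scales_def
proof (intro conjI ballI)
 fix f :: "'a => ennreal" assume [measurable]: "f \<in> borel_measurable borel"
 have "(\<integral>\<^sup>+x. f x \<partial>lborel) = (\<integral>\<^sup>+x. f x \<partial>distr lborel borel ((+) a))" by (simp add: lborel_distr_plus)
 also have "... = (\<integral>\<^sup>+x. f (a + x) \<partial>lborel)" by (subst nn_integral_distr) auto
 finally show "ennreal 1 * (\<integral>\<^sup>+x. f (a + x) \<partial>lborel) = (\<integral>\<^sup>+x. f x \<partial>lborel)" by simp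
qed auto

lemma scales_diag:
 fixes c :: "'a::euclidean_space => real"
 assumes "!!j. j \<in> Basis ==> c j ~= 0"
 shows "scales (%x. \<Sum>j\<in>Basis. (c j * (x \<bullet> j)) *\<^sub>R j) (\<Prod>j\<in>Basis. \<bar>c j\<bar>)"
 unfolding scales_def
proof (intro conjI ballI)
 let ?T = "%x::'a. \<Sum>j\<in>Basis. (c j * (x \<bullet> j)) *\<^sub>R j"
 show p: "(\<Prod>j\<in>(Basis::'a set). \<bar>c j\<bar>) > 0" using assms by (intro prod_pos) auto
 show [measurable]: "?T \<in> borel_measurable borel" by measurable
 fix f :: "'a => ennreal" assume [measurable]: "f \<in> borel_measurable borel"
 have e: "lborel = density (distr lborel borel ?T) (%_. (\<Prod>j\<in>(Basis::'a set). \<bar>c j\<bar>))"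
  using lborel_affine_euclidean[of c 0] assms by simp
 have "(\<integral>\<^sup>+x. f x \<partial>lborel) = (\<integral>\<^sup>+x. f x \<partial>density (distr lborel borel ?T) (%_. (\<Prod>j\<in>(Basis::'a set). \<bar>c j\<bar>)))"
  by (rule arg_cong[where f="%M. nn_integral M f"]) (rule e)
 also have "... = ennreal (\<Prod>j\<in>(Basis::'a set). \<bar>c j\<bar>) * (\<integral>\<^sup>+x. f (?T x) \<partial>lborel)"
  by (subst nn_integral_density) (auto simp: nn_integral_cmult nn_integral_distr)
 finally show "ennreal (\<Prod>j\<in>(Basis::'a set). \<bar>c j\<bar>) * (\<integral>\<^sup>+x. f (?T x) \<partial>lborel) = (\<integral>\<^sup>+x. f x \<partial>lborel)" by simp
qed

lemma scales_uminus: "scales (%x::'a::euclidean_space. - x) 1"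
proof -
 have "(%x::'a. \<Sum>j\<in>Basis. ((-1) * (x \<bullet> j)) *\<^sub>R j) = (%x. - x)"
  by (simp add: sum_negf euclidean_representation)
 then show ?thesis using scales_diag[of "%_::'a. -1"] by simp
qed

text \<open>Averaging over translates in the direction \<open>b\<close>, weighted by a function of total mass one
in that coordinate, turns the shift by \<open>g(x)\<close> into a translation of the averaging variable.\<close>

lemma scales_shift:
 fixes b :: "'a::euclidean_space" and g :: "'a => real"
 assumes b: "b \<in> Basis" and g[measurable]: "g \<in> borel_measurable borel" and inv: "!!x t. g (x + t *\<^sub>R b) = g x"
 shows "scales (%x. x + g x *\<^sub>R b) 1"
proof -
 let ?u = "indicator {0..1} :: real => ennreal"
 have "(\<integral>\<^sup>+x. f (x + g x *\<^sub>R b) \<partial>lborel) = (\<integral>\<^sup>+x. (\<integral>\<^sup>+t. ?u (x \<bullet> b) * f (x + t *\<^sub>R b) \<partial>lborel) \<partial>lborel)"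
  if g[measurable]: "g \<in> borel_measurable borel" and inv: "!!x t. g (x + t *\<^sub>R b) = g x"
   and f[measurable]: "f \<in> borel_measurable borel" for f :: "'a => ennreal" and g :: "'a => real"
 proof -
  have u: "(\<integral>\<^sup>+t. ?u (s + t) \<partial>lborel) = 1" for s :: real
   using scales_nn_integral[OF scales_translate[of s], of ?u] by simp
  have "(\<integral>\<^sup>+x. f (x + g x *\<^sub>R b) \<partial>lborel) = (\<integral>\<^sup>+x. (\<integral>\<^sup>+t. ?u (x \<bullet> b + t) * f (x + g x *\<^sub>R b) \<partial>lborel) \<partial>lborel)"
   by (simp add: nn_integral_multc u)
  also have "... = (\<integral>\<^sup>+t. (\<integral>\<^sup>+x. ?u (x \<bullet> b + t) * f (x + g x *\<^sub>R b) \<partial>lborel) \<partial>lborel)"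
   by (rule lborel_pair.Fubini') measurable
  also have "... = (\<integral>\<^sup>+t. (\<integral>\<^sup>+x. ?u (x \<bullet> b) * f (x + (- t + g x) *\<^sub>R b) \<partial>lborel) \<partial>lborel)"
  proof (rule nn_integral_cong)
   fix t :: real
   have e: "(- t *\<^sub>R b + x) \<bullet> b + t = x \<bullet> b" "g (- t *\<^sub>R b + x) = g x"
    "- t *\<^sub>R b + x + g x *\<^sub>R b = x + (- t + g x) *\<^sub>R b" for x
    using b inv[of x "- t"] by (simp_all add: inner_diff_left inner_Basis algebra_simps)
   have "(%x. ?u (x \<bullet> b + t) * f (x + g x *\<^sub>R b)) \<in> borel_measurable borel" by measurable
   from scales_nn_integral[OF scales_translate[of "- t *\<^sub>R b"] this]
   show "(\<integral>\<^sup>+x. ?u (x \<bullet> b + t) * f (x + g x *\<^sub>R b) \<partial>lborel) = (\<integral>\<^sup>+x. ?u (x \<bullet> b) * f (x + (- t + g x) *\<^sub>R b) \<partial>lborel)"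
    unfolding e by simp
  qed
  also have "... = (\<integral>\<^sup>+x. (\<integral>\<^sup>+t. ?u (x \<bullet> b) * f (x + (g x + - t) *\<^sub>R b) \<partial>lborel) \<partial>lborel)"
   unfolding add.commute[of "- _" "g _"] by (rule lborel_pair.Fubini'[symmetric]) measurable
  also have "... = (\<integral>\<^sup>+x. (\<integral>\<^sup>+t. ?u (x \<bullet> b) * f (x + t *\<^sub>R b) \<partial>lborel) \<partial>lborel)"
  proof (rule nn_integral_cong)
   fix x
   show "(\<integral>\<^sup>+t. ?u (x \<bullet> b) * f (x + (g x + - t) *\<^sub>R b) \<partial>lborel) = (\<integral>\<^sup>+t. ?u (x \<bullet> b) * f (x + t *\<^sub>R b) \<partial>lborel)"
    using scales_nn_integral[OF scales_compose[OF scales_translate[of "g x"] scales_uminus], of "%t. ?u (x \<bullet> b) * f (x + t *\<^sub>R b)"]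
    by simp
  qed
  finally show ?thesis .
 qed
 note key = this
 have "(\<integral>\<^sup>+x. f (x + g x *\<^sub>R b) \<partial>lborel) = (\<integral>\<^sup>+x. f x \<partial>lborel)" if "f \<in> borel_measurable borel" for f :: "'a => ennreal"
  using key[OF g inv that] key[of "%_. 0", OF _ _ that] by simp
 then show ?thesis by (simp add: scales_def)
qed

lemma scales_basis_permutation:
 fixes L :: "'a::euclidean_space => 'a"
 assumes L: "linear L" and p: "bij_betw p Basis Basis" and Lp: "!!x b. b \<in> Basis ==> L x \<bullet> b = x \<bullet> p b"
 shows "scales L 1"
proof -
 have m[measurable]: "L \<in> borel_measurable borel"
  using L by (auto intro!: borel_measurable_continuous_onI linear_continuous_on linear_conv_bounded_linear[THEN iffD1])
 have "lborel = distr lborel borel L"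
 proof (rule lborel_eqI)
  fix l u :: 'a assume lu: "!!b. b \<in> Basis ==> l \<bullet> b <= u \<bullet> b"
  let ?q = "inv_into Basis p"
  define r where "r x = (\<Sum>b\<in>Basis. (x \<bullet> ?q b) *\<^sub>R b)" for x :: 'a
  have q: "?q b \<in> Basis" "p (?q b) = b" if "b \<in> Basis" for b
   using p that by (auto simp: bij_betw_def inv_into_into f_inv_into_f)
  have r: "r x \<bullet> b = x \<bullet> ?q b" if "b \<in> Basis" for x b
   using that by (simp add: r_def)
  have "L -` box l u = box (r l) (r u)"
  proof -
   have "(\<forall>b\<in>Basis. l \<bullet> b < x \<bullet> p b & x \<bullet> p b < u \<bullet> b) \<longleftrightarrow> (\<forall>b\<in>Basis. l \<bullet> ?q b < x \<bullet> b & x \<bullet> b < u \<bullet> ?q b)" for x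
    using p q by (metis bij_betw_def bij_betw_inv_into_left image_eqI)
   then show ?thesis by (auto simp: mem_box Lp r)
  qed
  moreover have "(\<Prod>b\<in>Basis. (u - l) \<bullet> ?q b) = (\<Prod>b\<in>Basis. (u - l) \<bullet> b)"
   by (rule prod.reindex_bij_betw[OF bij_betw_inv_into[OF p]])
  moreover have "(\<Prod>b\<in>Basis. (r u - r l) \<bullet> b) = (\<Prod>b\<in>Basis. (u - l) \<bullet> ?q b)"
   by (rule prod.cong) (auto simp: inner_diff_left r)
  ultimately show "emeasure (distr lborel borel L) (box l u) = (\<Prod>b\<in>Basis. (u - l) \<bullet> b)"
   using lu q by (simp add: emeasure_distr emeasure_lborel_box_eq r)
 qed simp
 then have "(\<integral>\<^sup>+x. f (L x) \<partial>lborel) = (\<integral>\<^sup>+x. f x \<partial>lborel)" if "f \<in> borel_measurable borel" for f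
  using nn_integral_distr[of L lborel borel f] that by simp
 then show ?thesis by (simp add: scales_def)
qed

definition diag_map :: "('a::euclidean_space => real) => 'a => 'a" where
 "diag_map c x = (\<Sum>j\<in>Basis. (c j * (x \<bullet> j)) *\<^sub>R j)"

lemma diag_map_linear: "linear (diag_map c)"
 unfolding diag_map_def
 by (intro linear_compose_sum ballI linearI) (auto simp: algebra_simps)

lemma diag_map_inner: "b \<in> Basis ==> diag_map c x \<bullet> b = c b * (x \<bullet> b)"
 by (simp add: diag_map_def inner_sum_left inner_Basis if_distrib sum.delta cong: if_cong)

lemma diag_map_Basis: "b \<in> Basis ==> diag_map c b = c b *\<^sub>R b"
 by (rule euclidean_eqI) (auto simp: diag_map_inner inner_Basis)

lemma diag_map_inverse: "(!!b. b \<in> Basis ==> c b * d b = 1) ==> diag_map c (diag_map d x) = x"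
 by (rule euclidean_eqI) (auto simp: diag_map_inner mult.assoc[symmetric])

text \<open>Such a map is a product of shifts in one coordinate each. Processing the coordinates from
the top level downwards, every shift depends on coordinates not yet modified.\<close>

lemma scales_unitriangular:
 fixes L :: "'a::euclidean_space => 'a" and \<rho> :: "'a => nat"
 assumes L: "linear L" and d: "!!b. b \<in> Basis ==> L b \<bullet> b = 1"
  and tri: "!!b b'. b \<in> Basis ==> b' \<in> Basis ==> L b \<bullet> b' ~= 0 ==> b' = b \<or> \<rho> b < \<rho> b'"
 shows "scales L 1"
proof -
 (* l e x is the contribution of the coordinates of lower level to the coordinate e of L x,
    and P es performs the shifts in all coordinates of es. *)
 define l where "l e x = (\<Sum>b\<in>{b \<in> Basis. \<rho> b < \<rho> e}. (x \<bullet> b) * (L b \<bullet> e))" for e x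
 define P where "P es x = x + (\<Sum>e\<in>set es. l e x *\<^sub>R e)" for es x
 have l_add: "l e (x + y) = l e x" if "!!b. b \<in> Basis ==> \<rho> b < \<rho> e ==> y \<bullet> b = 0" for e x y
  unfolding l_def by (rule sum.cong) (auto simp: inner_add_left that)
 have "scales (P es) 1" if "sorted (map \<rho> es)" "distinct es" "set es \<subseteq> Basis" for es
  using that
 proof (induction es)
  case Nil
  then show ?case using scales_translate[of "0::'a"] by (simp add: P_def[abs_def])
 next
  case (Cons e es)
  have e: "e \<in> Basis" using Cons.prems by simp
  have "scales (%x. x + l e x *\<^sub>R e) 1"
  proof (rule scales_shift[OF e])
   show "l e \<in> borel_measurable borel" unfolding l_def by measurable
   show "l e (x + t *\<^sub>R e) = l e x" for x t
    by (rule l_add) (use e in "auto simp: inner_Basis")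
  qed
  from scales_compose[OF this Cons.IH] Cons.prems
  have sc: "scales (%x. P es x + l e (P es x) *\<^sub>R e) 1" by simp
  have lP: "l e (P es x) = l e x" for x
  proof -
   have "(\<Sum>e'\<in>set es. l e' x *\<^sub>R e') \<bullet> b = 0" if b: "b \<in> Basis" "\<rho> b < \<rho> e" for b
    unfolding inner_sum_left by (rule sum.neutral) (use Cons.prems b in "auto simp: inner_Basis subset_iff")
   then show ?thesis unfolding P_def by (intro l_add)
  qed
  have "P (e # es) = (%x. P es x + l e (P es x) *\<^sub>R e)"
   unfolding lP using Cons.prems by (auto simp: P_def fun_eq_iff)
  with sc show ?case by simp
 qed
 moreover obtain bs where bs: "distinct bs" "set bs = (Basis :: 'a set)" using finite_distinct_list[OF finite_Basis] by blast
 ultimately have sP: "scales (P (sort_key \<rho> bs)) 1" by simp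
 have "P (sort_key \<rho> bs) x = L x" for x
 proof (rule euclidean_eqI)
  fix e :: 'a assume e: "e \<in> Basis"
  have "L x \<bullet> e = (\<Sum>b\<in>Basis. (x \<bullet> b) * (L b \<bullet> e))"
   by (subst euclidean_representation[of x, symmetric])
    (simp add: linear_sum[OF L] linear_cmul[OF L] inner_sum_left)
  also have "... = (x \<bullet> e) * (L e \<bullet> e) + (\<Sum>b\<in>Basis - {e}. (x \<bullet> b) * (L b \<bullet> e))"
   by (rule sum.remove) (use e in auto)
  also have "(\<Sum>b\<in>Basis - {e}. (x \<bullet> b) * (L b \<bullet> e)) = l e x"
   unfolding l_def by (rule sum.mono_neutral_right) (use tri e in fastforce)+
  finally show "P (sort_key \<rho> bs) x \<bullet> e = L x \<bullet> e"
   using e d[OF e] by (simp add: P_def bs inner_add_left inner_sum_left inner_Basis if_distrib sum.delta cong: if_cong)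
 qed
 then have "P (sort_key \<rho> bs) = L" ..
 with sP show ?thesis by simp
qed

lemma scales_triangular:
 fixes L :: "'a::euclidean_space => 'a" and \<rho> :: "'a => nat"
 assumes L: "linear L" and d: "!!b. b \<in> Basis ==> L b \<bullet> b ~= 0"
  and tri: "!!b b'. b \<in> Basis ==> b' \<in> Basis ==> L b \<bullet> b' ~= 0 ==> b' = b \<or> \<rho> b < \<rho> b'"
 shows "scales L (\<Prod>b\<in>Basis. \<bar>L b \<bullet> b\<bar>)"
proof -
 define c where "c b = L b \<bullet> b" for b
 let ?U = "%x. L (diag_map (%b. 1 / c b) x)"
 have U: "?U b = (1 / c b) *\<^sub>R L b" if "b \<in> Basis" for b
  using that by (simp add: diag_map_Basis linear_cmul[OF L])
 have "scales ?U 1"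
 proof (rule scales_unitriangular[where \<rho>=\<rho>])
  show "linear ?U" using linear_compose[OF diag_map_linear L] by (simp add: o_def)
 qed (use d tri in "auto simp: U[unfolded c_def] c_def")
 moreover have "scales (diag_map c) (\<Prod>b\<in>Basis. \<bar>c b\<bar>)"
  unfolding diag_map_def[abs_def] by (rule scales_diag) (use d in "auto simp: c_def")
 ultimately have "scales (%x. ?U (diag_map c x)) (1 * (\<Prod>b\<in>Basis. \<bar>c b\<bar>))" by (rule scales_compose)
 moreover have "diag_map (%b. 1 / c b) (diag_map c x) = x" for x
  by (rule diag_map_inverse) (use d in "auto simp: c_def")
 ultimately show ?thesis by (simp add: c_def)
qed

section \<open>Matrix multiplication and Lebesgue measure\<close>

abbreviation elem :: "'m => 'n => real^'n^'m" where
 "elem i j \<equiv> axis i (axis j 1)"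

lemma elem_nth: "elem i j $ k $ l = (if k = i & l = j then 1 else 0)"
 by (simp add: axis_def)

lemma inner_elem: "X \<bullet> elem i j = X $ i $ j"
 by (simp add: inner_axis)

lemma Basis_matrix: "(Basis :: (real^'n^'m) set) = (%(i, j). elem i j) ` UNIV"
 by (auto simp: Basis_vec_def)

lemma elem_eq_iff: "elem i j = elem k l \<longleftrightarrow> i = k & j = l"
 by (auto simp: axis_eq_axis)

lemma prod_Basis_matrix:
 "(\<Prod>b\<in>(Basis :: (real^'n^'m) set). g b) = (\<Prod>i\<in>UNIV. \<Prod>j\<in>UNIV. g (elem i j))"
proof -
 have "inj (%(i, j). elem i j :: real^'n^'m)" by (auto simp: inj_def elem_eq_iff)
 then have "(\<Prod>b\<in>(Basis :: (real^'n^'m) set). g b) = (\<Prod>x\<in>UNIV. g ((%(i, j). elem i j) x))"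
  unfolding Basis_matrix by (subst prod.reindex) auto
 also have "... = (\<Prod>i\<in>UNIV. \<Prod>j\<in>UNIV. g (elem i j))"
  by (simp add: UNIV_Times_UNIV[symmetric] prod.cartesian_product case_prod_unfold del: UNIV_Times_UNIV)
 finally show ?thesis .
qed

lemma linear_matrix_mult_left: "linear (%X::real^'n^'k. (B::real^'k^'m) ** X)"
 by (intro linearI) (simp_all add: vec_eq_iff matrix_matrix_mult_def sum_distrib_left sum.distrib algebra_simps)

lemma mult_elem_nth: "(B ** elem i j) $ k $ l = (if l = j then B $ k $ i else 0)"
proof -
 have "(B ** elem i j) $ k $ l = (\<Sum>m\<in>UNIV. B $ k $ m * (if m = i & l = j then 1 else 0))"
  by (simp add: matrix_matrix_mult_def elem_nth)
 also have "... = (\<Sum>m\<in>UNIV. if m = i then (if l = j then B $ k $ i else 0) else 0)"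
  by (rule sum.cong) auto
 finally show ?thesis by simp
qed

definition row_idx :: "real^'n^'m => 'm" where
 "row_idx b = (THE i. b $ i ~= 0)"

lemma row_idx_elem [simp]: "row_idx (elem i j) = i"
 unfolding row_idx_def
proof (rule the_equality)
 show "(elem i j :: real^'b^'a) $ i ~= 0" by (auto simp: axis_def vec_eq_iff)
 show "k = i" if "(elem i j :: real^'b^'a) $ k ~= 0" for k using that by (auto simp: axis_def split: if_splits)
qed

lemma scales_matrix_mult_left:
 fixes B :: "real^'n^'n"
 assumes "det B ~= 0"
 shows "scales (%X::real^'n^'n. B ** X) (\<bar>det B\<bar> ^ CARD('n))"
proof -
 have "det B ~= 0 --> scales (%X::real^'n^'n. B ** X) (\<bar>det B\<bar> ^ CARD('n))"
 proof (induction B rule: induct_matrix_elementary)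
  case (1 A B)
  then show ?case
   using scales_compose[of "%X::real^'n^'n. A ** X" _ "%X. B ** X"]
   by (auto simp: det_mul abs_mult power_mult_distrib matrix_mul_assoc)
 next
  case (2 A i)
  then show ?case using det_zero_row(2)[of i A] by (simp add: row_def vec_eq_iff)
 next
  case (3 A)
  show ?case
  proof
   assume "det A ~= 0"
   then have nz: "A $ i $ i ~= 0" for i by (auto simp: det_diagonal[OF 3])
   have "scales (%X::real^'n^'n. A ** X) (\<Prod>b\<in>(Basis::(real^'n^'n) set). \<bar>(A ** b) \<bullet> b\<bar>)"
   proof (rule scales_triangular[where \<rho>="%_. 0", OF linear_matrix_mult_left])
    show "b' = b \<or> (0::nat) < 0" if "b \<in> Basis" "b' \<in> Basis" "(A ** b) \<bullet> b' ~= 0" for b b' :: "real^'n^'n"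
     using that by (auto simp: Basis_matrix inner_elem mult_elem_nth elem_eq_iff split: if_splits) (metis 3)
   qed (use nz in "auto simp: Basis_matrix inner_elem mult_elem_nth")
   moreover have "(\<Prod>b\<in>(Basis::(real^'n^'n) set). \<bar>(A ** b) \<bullet> b\<bar>) = \<bar>det A\<bar> ^ CARD('n)"
    by (simp add: prod_Basis_matrix inner_elem mult_elem_nth det_diagonal[OF 3] abs_prod prod_power_distrib)
   ultimately show "scales (%X::real^'n^'n. A ** X) (\<bar>det A\<bar> ^ CARD('n))" by simp
  qed
 next
  case (4 m n)
  let ?P = "\<chi> i j. mat 1 $ i $ Transposition.transpose m n j :: real^'n^'n"
  have p: "Transposition.transpose m n permutes UNIV" by (rule permutes_swap_id) auto
  have d: "\<bar>det ?P\<bar> = 1"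
   using det_permute_columns[OF p, of "mat 1 :: real^'n^'n"] by (simp add: sign_def)
  have e: "(?P ** X) $ i = X $ Transposition.transpose m n i" for X :: "real^'n^'n" and i
  proof -
   have "Transposition.transpose m n k = i \<longleftrightarrow> k = Transposition.transpose m n i" for k
    by (metis transpose_involutory)
   then have "i = Transposition.transpose m n k \<longleftrightarrow> k = Transposition.transpose m n i" for k by metis
   then show ?thesis
    by (simp add: matrix_matrix_mult_def vec_eq_iff mat_def if_distrib[of "%x. x * _"] sum.delta cong: if_cong)
  qed
  have "scales (%X::real^'n^'n. ?P ** X) 1"
  proof (rule scales_basis_permutation[OF linear_matrix_mult_left])
   let ?p = "%b::real^'n^'n. (\<chi> i. b $ Transposition.transpose m n i)"
   have q: "?p (elem i j) = elem (Transposition.transpose m n i) j" for i j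
    using transpose_involutory[of m n] by (auto simp: vec_eq_iff axis_def)
   show "bij_betw ?p Basis Basis"
    by (rule bij_betw_byWitness[where f'="?p"]) (auto simp: Basis_matrix q image_iff, blast+)
   show "(?P ** X) \<bullet> b = X \<bullet> ?p b" if "b \<in> Basis" for X b
    using that by (auto simp: Basis_matrix q inner_elem e)
  qed
  then show ?case using d by simp
 next
  case (5 m n c)
  let ?P = "\<chi> i j. if i = m & j = n then c else of_bool (i = j) :: real^'n^'n"
  have "?P = (\<chi> k. if k = m then row m (mat 1) + c *s row n (mat 1) else row k (mat 1))"
   using 5 by (auto simp: vec_eq_iff row_def mat_def)
  then have d: "det ?P = 1" using det_row_operation[OF 5, of "mat 1" c] by simp
  have "scales (%X::real^'n^'n. ?P ** X) (\<Prod>b\<in>(Basis::(real^'n^'n) set). \<bar>(?P ** b) \<bullet> b\<bar>)"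
  proof (rule scales_triangular[where \<rho>="%b. if row_idx b = m then 1 else 0", OF linear_matrix_mult_left])
   show "b' = b \<or> (if row_idx b = m then 1 else 0) < (if row_idx b' = m then 1 else (0::nat))"
    if "b \<in> Basis" "b' \<in> Basis" "(?P ** b) \<bullet> b' ~= 0" for b b' :: "real^'n^'n"
    using that 5 by (auto simp: Basis_matrix inner_elem mult_elem_nth elem_eq_iff split: if_splits)
  qed (use 5 in "auto simp: Basis_matrix inner_elem mult_elem_nth split: if_splits")
  moreover have "(\<Prod>b\<in>(Basis::(real^'n^'n) set). \<bar>(?P ** b) \<bullet> b\<bar>) = 1"
   using 5 by (auto simp: prod_Basis_matrix inner_elem mult_elem_nth intro!: prod.neutral)
  ultimately show ?case by (simp add: d)
 qed
 then show ?thesis using assms by simp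
qed

lemma scales_transpose: "scales (transpose :: real^'n^'n => real^'n^'n) 1"
proof (rule scales_basis_permutation)
 show "linear (transpose :: real^'n^'n => real^'n^'n)"
  by (intro linearI) (simp_all add: transpose_def vec_eq_iff)
 have q: "transpose (elem i j) = (elem j i :: real^'n^'n)" for i j
  by (auto simp: vec_eq_iff transpose_def axis_def)
 show "bij_betw transpose (Basis :: (real^'n^'n) set) Basis"
  by (rule bij_betw_byWitness[where f'="transpose"]) (auto simp: Basis_matrix q image_iff, blast+)
 show "transpose X \<bullet> b = X \<bullet> transpose b" if "b \<in> Basis" for X b :: "real^'n^'n"
  using that by (auto simp: Basis_matrix q inner_elem) (simp add: transpose_def)
qed

lemma scales_matrix_mult_right:
 fixes B :: "real^'n^'n"
 assumes "det B ~= 0"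
 shows "scales (%X::real^'n^'n. X ** B) (\<bar>det B\<bar> ^ CARD('n))"
proof -
 have "scales (%X::real^'n^'n. transpose (transpose B ** transpose X)) (1 * (\<bar>det (transpose B)\<bar> ^ CARD('n) * 1))"
  by (intro scales_compose[OF scales_transpose] scales_compose[OF scales_matrix_mult_left scales_transpose])
   (use assms in "simp add: det_transpose")
 then show ?thesis by (simp add: matrix_transpose_mul det_transpose)
qed

section \<open>Lower triangular matrices\<close>

type_synonym 'n sq = "((real, 'n) vec, 'n) vec"

definition low :: "('n::{finite,linorder}) sq => 'n sq" where
 "low D = (\<chi> i j. if j <= i then D $ i $ j else 0)"

definition is_low :: "('n::{finite,linorder}) sq => bool" where
 "is_low D \<longleftrightarrow> (\<forall>i j. i < j --> D $ i $ j = 0)"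

lemma permutes_decreasing_id:
 fixes p :: "'n::{finite,linorder} => 'n"
 assumes "p permutes UNIV" "!!i. p i <= i" shows "p = id"
proof -
 have "p i = i" for i
 proof (induction "card {j. j < i}" arbitrary: i rule: less_induct)
  case less
  show ?case
  proof (rule ccontr)
   assume "p i ~= i"
   then have lt: "p i < i" using assms(2)[of i] by simp
   then have "{j. j < p i} \<subset> {j. j < i}" by auto
   then have "card {j. j < p i} < card {j. j < i}" by (simp add: psubset_card_mono)
   then have "p (p i) = p i" by (rule less)
   then show False using permutes_inj[OF assms(1)] \<open>p i ~= i\<close> by (auto simp: inj_def)
  qed
 qed
 then show ?thesis by auto
qed

lemma det_low:
 fixes D :: "('n::{finite,linorder}) sq"
 assumes "is_low D" shows "det D = (\<Prod>i\<in>UNIV. D $ i $ i)"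
proof -
 have "det D = (\<Sum>p\<in>{p. p permutes (UNIV :: 'n set)}. if p = id then (\<Prod>i\<in>UNIV. D $ i $ i) else 0)"
  unfolding det_def
 proof (rule sum.cong)
  fix p :: "'n => 'n" assume "p \<in> {p. p permutes UNIV}"
  then have p: "p permutes UNIV" by simp
  show "of_int (sign p) * (\<Prod>i\<in>UNIV. D $ i $ p i) = (if p = id then (\<Prod>i\<in>UNIV. D $ i $ i) else 0)"
  proof (cases "p = id")
   case False
   then obtain i where "\<not> p i <= i" using permutes_decreasing_id[OF p] by blast
   then have "D $ i $ p i = 0" using assms by (simp add: is_low_def)
   then have "(\<Prod>i\<in>UNIV. D $ i $ p i) = 0" by (auto intro!: prod_zero)
   then show ?thesis using False by simp
  qed (simp add: sign_id)
 qed simp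
 also have "... = (\<Prod>i\<in>UNIV. D $ i $ i)" by (simp add: sum.delta' finite_permutations permutes_id)
 finally show ?thesis .
qed

lemma low_nth: "low D $ i $ j = (if j <= i then D $ i $ j else 0)"
 by (simp add: low_def)

lemma is_low_low [simp]: "is_low (low D)" by (auto simp: is_low_def low_def dest: leD)

lemma low_diag [simp]: "low D $ i $ i = D $ i $ i" by (simp add: low_def)

lemma det_low_part: "det (low D) = (\<Prod>i\<in>UNIV. D $ i $ i)" by (simp add: det_low)

text \<open>Left multiplication of the lower triangular part, leaving the strictly upper entries alone:
a linear map of the whole matrix space that induces left translation on lower triangular
matrices.\<close>

definition low_mult :: "('n::{finite,linorder}) sq => 'n sq => 'n sq" where
 "low_mult D0 D = (\<chi> i j. if j <= i then (D0 ** low D) $ i $ j else D $ i $ j)"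

lemma linear_low: "linear low"
 by (intro linearI) (auto simp: low_def vec_eq_iff)

lemma is_low_mult:
 assumes "is_low A" "is_low B" shows "is_low (A ** B)"
 unfolding is_low_def
proof (intro allI impI)
 fix i j :: 'a assume ij: "i < j"
 have "A $ i $ k * B $ k $ j = 0" for k
  using assms ij unfolding is_low_def by (cases "i < k") auto
 then show "(A ** B) $ i $ j = 0" by (simp add: matrix_matrix_mult_def sum.neutral)
qed

lemma low_low_mult:
 assumes "is_low D0" shows "low (low_mult D0 D) = D0 ** low D"
proof -
 have z: "(D0 ** low D) $ i $ j = 0" if "i < j" for i j
  using is_low_mult[OF assms is_low_low, of D] that unfolding is_low_def by blast
 have "low (low_mult D0 D) $ i $ j = (D0 ** low D) $ i $ j" for i j
  using z[of i j] by (cases "j <= i") (simp_all add: low_nth low_mult_def)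
 then show ?thesis by (simp add: vec_eq_iff)
qed

lemma upp_low_mult: "low_mult D0 D - low (low_mult D0 D) = D - low D"
 by (auto simp: low_def low_mult_def vec_eq_iff)

lemma scales_low_mult:
 fixes D0 :: "('n::{finite,linorder}) sq"
 assumes "is_low D0" "!!i. D0 $ i $ i ~= 0"
 shows "scales (low_mult D0) (\<Prod>i\<in>UNIV. \<bar>D0 $ i $ i\<bar> ^ card {j. j <= i})"
proof -
 have lin: "linear (low_mult D0)"
 proof -
  have c: "linear (%X. D0 ** low X)"
   using linear_compose[OF linear_low linear_matrix_mult_left[of D0]] by (simp add: o_def)
  show ?thesis
   by (intro linearI) (auto simp: low_mult_def vec_eq_iff linear_add[OF c] linear_cmul[OF c])
 qed
 have low_elem: "low (elem i j) = (if j <= i then elem i j else (0 :: 'n sq))" for i j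
  by (auto simp: low_def vec_eq_iff elem_nth)
 have el: "low_mult D0 (elem i j) $ k $ l = (if j <= i & l <= k then (if l = j then D0 $ k $ i else 0) else if l <= k then 0 else if k = i & l = j then 1 else 0)" for i j k l
  by (simp add: low_mult_def low_elem mult_elem_nth elem_nth) 
 have "scales (low_mult D0) (\<Prod>b\<in>Basis. \<bar>low_mult D0 b \<bullet> b\<bar>)"
 proof (rule scales_triangular[where \<rho>="%b. card {j. j < row_idx b}", OF lin])
  fix b b' :: "'n sq" assume bb: "b \<in> Basis" "b' \<in> Basis" "low_mult D0 b \<bullet> b' ~= 0"
  then obtain i j k l where ij: "b = elem i j" "b' = elem k l" by (auto simp: Basis_matrix)
  show "b' = b \<or> card {j. j < row_idx b} < card {j. j < row_idx b'}"
  proof (cases "b' = b")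
   case False
   have "j <= i" "l = j" "D0 $ k $ i ~= 0"
    using bb(3) False by (auto simp: ij inner_elem el elem_eq_iff split: if_splits)
   then have "i < k" using assms(1) False by (metis antisym_conv3 elem_eq_iff ij is_low_def)
   then have "{j. j < i} \<subset> {j. j < k}" by auto
   then show ?thesis by (simp add: ij psubset_card_mono)
  qed simp
 next
  show "low_mult D0 b \<bullet> b ~= 0" if "b \<in> Basis" for b :: "'n sq"
   using that assms(2) by (auto simp: Basis_matrix inner_elem el split: if_splits)
 qed
 moreover have "(\<Prod>b\<in>(Basis::('n sq) set). \<bar>low_mult D0 b \<bullet> b\<bar>) = (\<Prod>i\<in>UNIV. \<bar>D0 $ i $ i\<bar> ^ card {j. j <= i})"
 proof -
  have "(\<Prod>j\<in>UNIV. \<bar>low_mult D0 (elem i j) \<bullet> elem i j\<bar>) = \<bar>D0 $ i $ i\<bar> ^ card {j. j <= i}" for i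
  proof -
   have "(\<Prod>j\<in>UNIV. \<bar>low_mult D0 (elem i j) \<bullet> elem i j\<bar>) = (\<Prod>j\<in>UNIV. if j \<in> {j. j <= i} then \<bar>D0 $ i $ i\<bar> else 1)"
    by (rule prod.cong) (auto simp: inner_elem el)
   also have "... = \<bar>D0 $ i $ i\<bar> ^ card {j. j <= i}"
    by (subst prod.inter_restrict[symmetric]) auto
   finally show ?thesis .
  qed
  then show ?thesis by (simp add: prod_Basis_matrix)
 qed
 ultimately show ?thesis by simp
qed

section \<open>Singular matrices form a null set\<close>

text \<open>On every line in the direction of the identity matrix the determinant is a nonzero
polynomial, so it has finitely many zeros there.\<close>

lemma AE_det_nonzero: "AE X in lborel. det (X :: real^'n^'n) ~= 0"
proof -
 let ?f = "%X::real^'n^'n. indicator {X. det X = 0} X :: ennreal"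
 have [measurable]: "(%X::real^'n^'n. det X) \<in> borel_measurable borel"
  by (intro borel_measurable_continuous_onI smooth_continuous smooth_det smooth_id) auto
 have fin: "finite {t::real. det (t *\<^sub>R mat 1 + X) = 0}" for X :: "real^'n^'n"
 proof -
  define q where "q = (\<Sum>p\<in>{p. p permutes (UNIV :: 'n set)}. smult (of_int (sign p)) (\<Prod>i\<in>UNIV. [:X $ i $ p i, if i = p i then 1 else 0:]))"
  have q: "poly q t = det (t *\<^sub>R mat 1 + X)" for t
   unfolding q_def det_def poly_sum poly_smult poly_prod
   by (intro sum.cong refl arg_cong2[where f="(*)"] prod.cong) (auto simp: mat_def)
  (* Beyond the operator norm of X the determinant does not vanish, so q is not the zero polynomial. *)
  obtain B where B: "B > 0" "!!v. norm (X *v v) <= B * norm v"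
   using linear_bounded_pos[of "(*v) X"] by auto
  have "det ((B + 1) *\<^sub>R mat 1 + X) ~= 0"
  proof -
   have "v = 0" if "((B + 1) *\<^sub>R mat 1 + X) *v v = 0" for v
   proof -
    have "(B + 1) *\<^sub>R v + X *v v = 0"
     using that by (simp add: matrix_vector_mult_add_rdistrib scaleR_matrix_vector_assoc[symmetric])
    then have "(B + 1) *\<^sub>R v = - (X *v v)" by (simp add: eq_neg_iff_add_eq_0)
    then have "norm ((B + 1) *\<^sub>R v) = norm (X *v v)" by simp
    then have "(B + 1) * norm v <= B * norm v" using B by simp
    then show "v = 0" by (simp add: algebra_simps)
   qed
   then have "invertible ((B + 1) *\<^sub>R mat 1 + X)"
    by (simp add: invertible_left_inverse matrix_left_invertible_ker)
   then show ?thesis by (simp add: invertible_det_nz)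
  qed
  then have "q ~= 0" using q[of "B + 1"] by auto
  then show ?thesis using poly_roots_finite[of q] by (simp add: q)
 qed
 have "(\<integral>\<^sup>+X. ?f X \<partial>lborel) = (\<integral>\<^sup>+t. indicator {0..1} t * (\<integral>\<^sup>+X. ?f X \<partial>lborel) \<partial>(lborel :: real measure))"
  by (simp add: nn_integral_multc)
 also have "... = (\<integral>\<^sup>+t. (\<integral>\<^sup>+X. indicator {0..1} t * ?f (t *\<^sub>R mat 1 + X) \<partial>lborel) \<partial>(lborel :: real measure))"
 proof (rule nn_integral_cong)
  fix t :: real
  show "indicator {0..1} t * (\<integral>\<^sup>+X. ?f X \<partial>lborel) = (\<integral>\<^sup>+X. indicator {0..1} t * ?f (t *\<^sub>R mat 1 + X) \<partial>lborel)"
   using scales_nn_integral[OF scales_translate[of "t *\<^sub>R mat 1"], of ?f] by (simp add: nn_integral_cmult)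
 qed
 also have "... = (\<integral>\<^sup>+X. (\<integral>\<^sup>+t. indicator {0..1} t * ?f (t *\<^sub>R mat 1 + X) \<partial>(lborel :: real measure)) \<partial>lborel)"
  by (rule lborel_pair.Fubini'[symmetric]) measurable
 also have "... = (\<integral>\<^sup>+(X::real^'n^'n). 0 \<partial>lborel)"
 proof (rule nn_integral_cong)
  fix X :: "real^'n^'n"
  have "(\<integral>\<^sup>+t. indicator {0..1} t * ?f (t *\<^sub>R mat 1 + X) \<partial>(lborel :: real measure)) <= (\<integral>\<^sup>+t. indicator {t. det (t *\<^sub>R mat 1 + X) = 0} t \<partial>lborel)"
   by (intro nn_integral_mono) (auto simp: indicator_def)
  also have "... = emeasure lborel {t::real. det (t *\<^sub>R mat 1 + X) = 0}"
   using fin[of X] by (subst nn_integral_indicator) (auto intro: borel_closed finite_imp_closed)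
  also have "... = 0" using fin[of X] by (intro emeasure_lborel_countable countable_finite)
  finally show "(\<integral>\<^sup>+t. indicator {0..1} t * ?f (t *\<^sub>R mat 1 + X) \<partial>(lborel :: real measure)) = 0" by simp
 qed
 finally have "(\<integral>\<^sup>+X. ?f X \<partial>lborel) = 0" by simp
 then have "AE X in lborel. ?f X = 0" by (subst (asm) nn_integral_0_iff_AE) auto
 then show ?thesis by eventually_elim (auto simp: indicator_def split: if_splits)
qed

section \<open>Inverse matrices\<close>

lemma matrix_inv_both:
 fixes A :: "real^'n^'n"
 assumes "invertible A"
 shows "A ** matrix_inv A = mat 1" "matrix_inv A ** A = mat 1"
 using someI_ex[OF assms[unfolded invertible_def]] by (auto simp: matrix_inv_def)

lemma matrix_inv_eqI:
 fixes A B :: "real^'n^'n"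
 assumes "A ** B = mat 1"
 shows "matrix_inv A = B" "invertible A"
proof -
 have BA: "B ** A = mat 1" using assms by (simp add: matrix_left_right_inverse)
 show i: "invertible A" using assms BA by (auto simp: invertible_def)
 have "matrix_inv A = matrix_inv A ** (A ** B)" by (simp add: assms)
 also have "... = B" by (simp add: matrix_mul_assoc matrix_inv_both[OF i])
 finally show "matrix_inv A = B" .
qed

lemma invertible_matrix_inv: "invertible A ==> invertible (matrix_inv (A :: real^'n^'n))"
 using matrix_inv_both(2) matrix_inv_eqI(2) by blast

lemma matrix_inv_inv: "invertible A ==> matrix_inv (matrix_inv A) = (A :: real^'n^'n)"
 using matrix_inv_both(2) matrix_inv_eqI(1) by blast

lemma matrix_inv_mult:
 fixes A B :: "real^'n^'n"
 assumes "invertible A" "invertible B"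
 shows "matrix_inv (A ** B) = matrix_inv B ** matrix_inv A"
proof (rule matrix_inv_eqI)
 have "(A ** B) ** (matrix_inv B ** matrix_inv A) = A ** (B ** matrix_inv B) ** matrix_inv A"
  by (simp only: matrix_mul_assoc)
 then show "(A ** B) ** (matrix_inv B ** matrix_inv A) = mat 1" by (simp add: matrix_inv_both assms)
qed

lemma det_matrix_inv: "invertible A ==> det (matrix_inv (A :: real^'n^'n)) = inverse (det A)"
 using arg_cong[OF matrix_inv_both(1)[of A], of det] by (simp add: det_mul field_simps invertible_det_nz)

lemma matrix_inv_nth:
 fixes A :: "real^'n^'n"
 assumes "invertible A"
 shows "matrix_inv A $ k $ l = det (\<chi> i j. if j = k then axis l 1 $ i else A $ i $ j) / det A"
proof -
 have d: "det A ~= 0" using assms by (simp add: invertible_det_nz)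
 have "A *v column l (matrix_inv A) = axis l 1"
 proof -
  have "A *v (matrix_inv A *v axis l 1) = axis l 1"
   by (simp add: matrix_vector_mul_assoc matrix_inv_both[OF assms])
  then show ?thesis by (simp add: matrix_vector_mult_basis)
 qed
 from cramer[OF d, of "column l (matrix_inv A)" "axis l 1"] this
 have "column l (matrix_inv A) = (\<chi> k. det (\<chi> i j. if j = k then axis l 1 $ i else A $ i $ j) / det A)" by simp
 then have "column l (matrix_inv A) $ k = det (\<chi> i j. if j = k then axis l 1 $ i else A $ i $ j) / det A" by simp
 then show ?thesis by (simp add: column_def)
qed

definition ginv :: "real^'n^'n => real^'n^'n" where
 "ginv A = (if invertible A then matrix_inv A else 0)"

lemma borel_measurable_det [measurable]: "(%X::real^'n^'n. det X) \<in> borel_measurable borel"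
 by (intro borel_measurable_continuous_onI smooth_continuous smooth_det smooth_id) auto

lemma borel_measurable_vec_lambda:
 fixes f :: "'a => 'n::finite => 'b::euclidean_space"
 assumes "!!i. (%x. f x i) \<in> borel_measurable M"
 shows "(%x. \<chi> i. f x i) \<in> borel_measurable M"
 unfolding borel_measurable_euclidean_space[of "%x. \<chi> i. f x i"]
 by (auto simp: Basis_vec_def inner_axis intro!: borel_measurable_inner assms)

lemma borel_measurable_vec_nth [measurable]: "(%x::'b::euclidean_space^'n. x $ i) \<in> borel_measurable borel"
 by (intro borel_measurable_continuous_onI continuous_intros)

lemma borel_measurable_matrix_nth: "f \<in> borel_measurable M ==> (%x. (f x :: real^'n^'m) $ i $ j) \<in> borel_measurable M"
 using measurable_compose[OF measurable_compose[OF _ borel_measurable_vec_nth[of i]] borel_measurable_vec_nth[of j], of f M] by simp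

lemma borel_measurable_ginv [measurable]: "(ginv :: real^'n^'n => real^'n^'n) \<in> borel_measurable borel"
proof -
 have e: "ginv A = (\<chi> k l. if det A = 0 then 0 else det (\<chi> i j. if j = k then axis l 1 $ i else A $ i $ j) / det A)" for A :: "real^'n^'n"
  by (auto simp: ginv_def invertible_det_nz matrix_inv_nth vec_eq_iff)
 have m: "(%A::real^'n^'n. det (\<chi> i j. if j = k then axis l 1 $ i else A $ i $ j)) \<in> borel_measurable borel" for k l
 proof (rule measurable_compose[OF _ borel_measurable_det])
  show "(%A::real^'n^'n. \<chi> i j. if j = k then axis l 1 $ i else A $ i $ j) \<in> borel_measurable borel"
   by (intro borel_measurable_vec_lambda) (auto intro: borel_measurable_matrix_nth)
 qed
 have "(%A::real^'n^'n. \<chi> k l. if det A = 0 then 0 else det (\<chi> i j. if j = k then axis l 1 $ i else A $ i $ j) / det A) \<in> borel_measurable borel"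
 proof (intro borel_measurable_vec_lambda)
  fix k l :: 'n
  define h where "h = (%A::real^'n^'n. det (\<chi> i j. if j = k then axis l 1 $ i else A $ i $ j))"
  have [measurable]: "h \<in> borel_measurable borel" using m unfolding h_def .
  have "(%A. if det A = 0 then 0 else h A / det A) \<in> borel_measurable borel" by measurable
  then show "(%A::real^'n^'n. if det A = 0 then 0 else det (\<chi> i j. if j = k then axis l 1 $ i else A $ i $ j) / det A) \<in> borel_measurable borel"
   unfolding h_def .
 qed
 then show ?thesis unfolding e[abs_def, symmetric] by (simp add: e[abs_def])
qed

section \<open>Haar measure and matrix inversion\<close>

definition haar_GL :: "(real^'n^'n) measure" where
 "haar_GL = density lborel (%X. ennreal (inverse (\<bar>det X\<bar> ^ CARD('n))))"

lemma haar_weight_measurable [measurable]: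
 "(%X::real^'n^'n. ennreal (inverse (\<bar>det X\<bar> ^ CARD('n)))) \<in> borel_measurable borel"
 by measurable

lemma sets_haar [simp, measurable_cong]: "sets haar_GL = sets borel"
 by (simp add: haar_GL_def)

lemma space_haar [simp]: "space haar_GL = UNIV"
 by (simp add: haar_GL_def)

lemma nn_integral_haar:
 "f \<in> borel_measurable borel ==> (\<integral>\<^sup>+X. f X \<partial>haar_GL) = (\<integral>\<^sup>+X. ennreal (inverse (\<bar>det X\<bar> ^ CARD('n))) * f X \<partial>(lborel :: (real^'n^'n) measure))"
 unfolding haar_GL_def by (subst nn_integral_density) auto

lemma sigma_finite_haar: "sigma_finite_measure (haar_GL :: (real^'n^'n) measure)"
 unfolding haar_GL_def by (subst sigma_finite_measure.sigma_finite_iff_density_finite[OF sigma_finite_lborel]) auto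

lemma AE_haar: "AE X in (haar_GL :: (real^'n^'n) measure). invertible X"
 unfolding haar_GL_def using AE_det_nonzero
 by (subst AE_density) (auto simp: invertible_det_nz elim: eventually_mono)

lemma haar_invariant:
 fixes f :: "real^'n^'n => ennreal"
 assumes L: "scales L (\<bar>d\<bar> ^ CARD('n))" and d: "d ~= 0" "!!X. det (L X) = d * det X" and f[measurable]: "f \<in> borel_measurable borel"
 shows "(\<integral>\<^sup>+X. f (L X) \<partial>haar_GL) = (\<integral>\<^sup>+X. f X \<partial>haar_GL)"
proof -
 note [measurable] = scales_measurable[OF L]
 have w: "ennreal (inverse (\<bar>det X\<bar> ^ CARD('n))) = ennreal (\<bar>d\<bar> ^ CARD('n)) * ennreal (inverse (\<bar>det (L X)\<bar> ^ CARD('n)))" for X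
  using d(1) by (simp add: d(2) ennreal_mult[symmetric] abs_mult power_mult_distrib)
 have "(\<integral>\<^sup>+X. f (L X) \<partial>haar_GL) = (\<integral>\<^sup>+X. ennreal (\<bar>d\<bar> ^ CARD('n)) * (ennreal (inverse (\<bar>det (L X)\<bar> ^ CARD('n))) * f (L X)) \<partial>lborel)"
 proof (subst nn_integral_haar)
  have "ennreal (inverse (\<bar>det X\<bar> ^ CARD('n))) * f (L X) = ennreal (\<bar>d\<bar> ^ CARD('n)) * (ennreal (inverse (\<bar>det (L X)\<bar> ^ CARD('n))) * f (L X))" for X
   by (subst w[of X]) (simp only: mult.assoc)
  then show "(\<integral>\<^sup>+X. ennreal (inverse (\<bar>det X\<bar> ^ CARD('n))) * f (L X) \<partial>lborel) =
   (\<integral>\<^sup>+X. ennreal (\<bar>d\<bar> ^ CARD('n)) * (ennreal (inverse (\<bar>det (L X)\<bar> ^ CARD('n))) * f (L X)) \<partial>lborel)"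
   by (intro nn_integral_cong)
 qed measurable
 also have "... = ennreal (\<bar>d\<bar> ^ CARD('n)) * (\<integral>\<^sup>+X. ennreal (inverse (\<bar>det (L X)\<bar> ^ CARD('n))) * f (L X) \<partial>lborel)"
  by (rule nn_integral_cmult) measurable
 also have "... = (\<integral>\<^sup>+X. ennreal (inverse (\<bar>det X\<bar> ^ CARD('n))) * f X \<partial>lborel)"
  by (rule scales_nn_integral[OF L, of "%X. ennreal (inverse (\<bar>det X\<bar> ^ CARD('n))) * f X"]) measurable
 also have "... = (\<integral>\<^sup>+X. f X \<partial>haar_GL)" by (subst nn_integral_haar) auto
 finally show ?thesis .
qed

lemma haar_left:
 fixes B :: "real^'n^'n"
 assumes "invertible B" "f \<in> borel_measurable borel"
 shows "(\<integral>\<^sup>+X. f (B ** X) \<partial>haar_GL) = (\<integral>\<^sup>+X. f X \<partial>haar_GL)"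
 by (rule haar_invariant[OF scales_matrix_mult_left]) (use assms in "auto simp: det_mul invertible_det_nz")

lemma haar_right:
 fixes B :: "real^'n^'n"
 assumes "invertible B" "f \<in> borel_measurable borel"
 shows "(\<integral>\<^sup>+X. f (X ** B) \<partial>haar_GL) = (\<integral>\<^sup>+X. f X \<partial>haar_GL)"
 by (rule haar_invariant[OF scales_matrix_mult_right]) (use assms in "auto simp: det_mul invertible_det_nz")

lemma borel_measurable_matrix_mult [measurable]:
 fixes f :: "'a => real^'n^'m" and g :: "'a => real^'k^'n"
 assumes "f \<in> borel_measurable M" "g \<in> borel_measurable M"
 shows "(%x. f x ** g x) \<in> borel_measurable M"
 unfolding matrix_matrix_mult_def
 by (intro borel_measurable_vec_lambda borel_measurable_sum borel_measurable_times borel_measurable_matrix_nth assms)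

lemma ginv_mult: "invertible A ==> invertible B ==> ginv (A ** B) = ginv B ** ginv A"
 by (simp add: ginv_def matrix_inv_mult invertible_mult)

text \<open>The standard argument for unimodular groups: compare \<open>f(x) \<kappa>(y)\<close> and
\<open>f(y^(-1)) \<kappa>(x)\<close> by translating in both variables. The auxiliary \<open>\<kappa>\<close> is chosen such
that its Haar integral is the volume of a ball.\<close>

lemma haar_inversion:
 fixes f :: "real^'n^'n => ennreal"
 assumes f[measurable]: "f \<in> borel_measurable borel"
 shows "(\<integral>\<^sup>+X. f (ginv X) \<partial>haar_GL) = (\<integral>\<^sup>+X. f X \<partial>haar_GL)"
proof -
 let ?\<mu> = "haar_GL :: (real^'n^'n) measure"
 interpret \<mu>: sigma_finite_measure ?\<mu> by (rule sigma_finite_haar)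
 interpret P: pair_sigma_finite ?\<mu> ?\<mu> by standard
 define \<kappa> where "\<kappa> X = ennreal (\<bar>det X\<bar> ^ CARD('n)) * indicator (cball 0 1) X" for X :: "real^'n^'n"
 have [measurable]: "(%X. indicator (cball 0 1) X :: ennreal) \<in> borel_measurable (borel :: (real^'n^'n) measure)"
  by (simp add: borel_measurable_indicator)
 have [measurable]: "\<kappa> \<in> borel_measurable borel" unfolding \<kappa>_def by measurable
 have "(\<integral>\<^sup>+X. \<kappa> X \<partial>?\<mu>) = (\<integral>\<^sup>+X. ennreal (inverse (\<bar>det X\<bar> ^ CARD('n))) * \<kappa> X \<partial>lborel)" by (rule nn_integral_haar) simp
 also have "... = (\<integral>\<^sup>+X. indicator (cball (0 :: real^'n^'n) 1) X \<partial>lborel)"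
 proof (rule nn_integral_cong_AE, rule eventually_mono[OF AE_det_nonzero])
  fix X :: "real^'n^'n" assume "det X ~= 0"
  then have "ennreal (inverse (\<bar>det X\<bar> ^ CARD('n))) * ennreal (\<bar>det X\<bar> ^ CARD('n)) = 1"
   by (simp flip: ennreal_mult')
  then show "ennreal (inverse (\<bar>det X\<bar> ^ CARD('n))) * \<kappa> X = indicator (cball 0 1) X"
   by (simp add: \<kappa>_def flip: mult.assoc)
 qed
 finally have "(\<integral>\<^sup>+X. \<kappa> X \<partial>?\<mu>) = emeasure lborel (cball (0 :: real^'n^'n) 1)"
  by (simp add: borel_measurable_indicator)
 moreover have v: "unit_ball_vol (real CARD('n) * real CARD('n)) > 0" by simp
 ultimately have mK: "(\<integral>\<^sup>+X. \<kappa> X \<partial>?\<mu>) < \<infinity>" and mK0: "(\<integral>\<^sup>+X. \<kappa> X \<partial>?\<mu>) ~= 0"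
  by (simp_all add: emeasure_cball order_less_imp_not_eq2[OF v])
 have "(\<integral>\<^sup>+X. f X \<partial>?\<mu>) * (\<integral>\<^sup>+X. \<kappa> X \<partial>?\<mu>) = (\<integral>\<^sup>+x. (\<integral>\<^sup>+y. f x * \<kappa> y \<partial>?\<mu>) \<partial>?\<mu>)"
  by (simp add: nn_integral_cmult nn_integral_multc)
 also have "... = (\<integral>\<^sup>+x. (\<integral>\<^sup>+y. f x * \<kappa> (y ** x) \<partial>?\<mu>) \<partial>?\<mu>)"
  by (rule nn_integral_cong_AE, rule eventually_mono[OF AE_haar]) (subst haar_right[where f="%y. f _ * \<kappa> y"]; simp)
 also have "... = (\<integral>\<^sup>+y. (\<integral>\<^sup>+x. f x * \<kappa> (y ** x) \<partial>?\<mu>) \<partial>?\<mu>)"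
  by (rule P.Fubini'[symmetric]) measurable
 also have "... = (\<integral>\<^sup>+y. (\<integral>\<^sup>+x. f (ginv y ** x) * \<kappa> x \<partial>?\<mu>) \<partial>?\<mu>)"
 proof (rule nn_integral_cong_AE, rule eventually_mono[OF AE_haar])
  fix y :: "real^'n^'n" assume y: "invertible y"
  have "(\<integral>\<^sup>+x. f x * \<kappa> (y ** x) \<partial>?\<mu>) = (\<integral>\<^sup>+x. f (ginv y ** x) * \<kappa> (y ** (ginv y ** x)) \<partial>?\<mu>)"
   by (rule haar_left[symmetric, where f="%x. f x * \<kappa> (y ** x)"]) (use y in "simp_all add: ginv_def invertible_matrix_inv")
  then show "(\<integral>\<^sup>+x. f x * \<kappa> (y ** x) \<partial>?\<mu>) = (\<integral>\<^sup>+x. f (ginv y ** x) * \<kappa> x \<partial>?\<mu>)"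
   using y by (simp add: matrix_mul_assoc ginv_def matrix_inv_both)
 qed
 also have "... = (\<integral>\<^sup>+x. (\<integral>\<^sup>+y. f (ginv y ** x) * \<kappa> x \<partial>?\<mu>) \<partial>?\<mu>)"
  by (rule P.Fubini') measurable
 also have "... = (\<integral>\<^sup>+x. (\<integral>\<^sup>+y. f (ginv y) * \<kappa> x \<partial>?\<mu>) \<partial>?\<mu>)"
 proof (rule nn_integral_cong_AE, rule eventually_mono[OF AE_haar])
  fix x :: "real^'n^'n" assume x: "invertible x"
  have "(\<integral>\<^sup>+y. f (ginv y ** x) * \<kappa> x \<partial>?\<mu>) = (\<integral>\<^sup>+y. f (ginv (x ** y) ** x) * \<kappa> x \<partial>?\<mu>)"
   by (rule haar_left[symmetric, where f="%y. f (ginv y ** x) * \<kappa> x"]) (use x in simp_all)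
  also have "... = (\<integral>\<^sup>+y. f (ginv y) * \<kappa> x \<partial>?\<mu>)"
  proof (rule nn_integral_cong_AE, rule eventually_mono[OF AE_haar])
   fix y :: "real^'n^'n" assume y: "invertible y"
   have "ginv (x ** y) ** x = ginv y ** (ginv x ** x)" by (simp add: ginv_mult x y matrix_mul_assoc)
   also have "... = ginv y" using x by (simp add: ginv_def matrix_inv_both)
   finally show "f (ginv (x ** y) ** x) * \<kappa> x = f (ginv y) * \<kappa> x" by simp
  qed
  finally show "(\<integral>\<^sup>+y. f (ginv y ** x) * \<kappa> x \<partial>?\<mu>) = (\<integral>\<^sup>+y. f (ginv y) * \<kappa> x \<partial>?\<mu>)" .
 qed
 also have "... = (\<integral>\<^sup>+X. f (ginv X) \<partial>?\<mu>) * (\<integral>\<^sup>+X. \<kappa> X \<partial>?\<mu>)"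
  by (simp add: nn_integral_cmult nn_integral_multc)
 finally have "(\<integral>\<^sup>+X. \<kappa> X \<partial>?\<mu>) * (\<integral>\<^sup>+X. f X \<partial>?\<mu>) = (\<integral>\<^sup>+X. \<kappa> X \<partial>?\<mu>) * (\<integral>\<^sup>+X. f (ginv X) \<partial>?\<mu>)"
  by (simp add: mult.commute)
 then show ?thesis using mK mK0 by (subst (asm) ennreal_mult_cancel_left) auto
qed

lemma haar_distr_ginv: "distr haar_GL borel ginv = (haar_GL :: (real^'n^'n) measure)"
proof (rule measure_eqI)
 fix A :: "(real^'n^'n) set" assume "A \<in> sets (distr haar_GL borel ginv)"
 then have [measurable]: "A \<in> sets borel" by simp
 have "emeasure (distr haar_GL borel ginv) A = (\<integral>\<^sup>+X. indicator A X \<partial>distr haar_GL borel ginv)" by simp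
 also have "... = (\<integral>\<^sup>+X. indicator A (ginv X) \<partial>haar_GL)" by (rule nn_integral_distr) measurable
 also have "... = (\<integral>\<^sup>+X. indicator A X \<partial>haar_GL)" by (rule haar_inversion) measurable
 also have "... = emeasure haar_GL A" by simp
 finally show "emeasure (distr haar_GL borel ginv) A = emeasure haar_GL A" .
qed simp

lemma lborel_inversion:
 fixes F :: "real^'n^'n => complex"
 assumes F[measurable]: "F \<in> borel_measurable borel" and z: "!!X. det X = 0 ==> F X = 0"
 defines "G \<equiv> %Y::real^'n^'n. inverse (\<bar>det Y\<bar> ^ (2 * CARD('n))) *\<^sub>R F (ginv Y)"
 shows "integrable lborel F \<longleftrightarrow> integrable lborel G" and "(LINT X|lborel. F X) = (LINT Y|lborel. G Y)"
proof -
 let ?\<mu> = "haar_GL :: (real^'n^'n) measure"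
 let ?w = "%X::real^'n^'n. inverse (\<bar>det X\<bar> ^ CARD('n))"
 define F' where "F' X = (\<bar>det X\<bar> ^ CARD('n)) *\<^sub>R F X" for X :: "real^'n^'n"
 have [measurable]: "F' \<in> borel_measurable borel" unfolding F'_def by measurable
 have wF: "?w X *\<^sub>R F' X = F X" for X using z[of X] by (cases "det X = 0") (auto simp: F'_def)
 have wG: "?w Y *\<^sub>R F' (ginv Y) = G Y" for Y
 proof (cases "det Y = 0")
  case True
  then show ?thesis by (simp add: G_def power_0_left)
 next
  case False
  then have "invertible Y" by (simp add: invertible_det_nz)
  then have "\<bar>det (ginv Y)\<bar> = inverse \<bar>det Y\<bar>" by (simp add: ginv_def det_matrix_inv)
  then show ?thesis by (simp add: F'_def G_def power_inverse mult_2 power_add)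
 qed
 have i1: "integrable ?\<mu> h \<longleftrightarrow> integrable lborel (%X. ?w X *\<^sub>R h X)" and e1: "(LINT X|?\<mu>. h X) = (LINT X|lborel. ?w X *\<^sub>R h X)"
  if [measurable]: "h \<in> borel_measurable borel" for h :: "real^'n^'n => complex"
  unfolding haar_GL_def by (subst integrable_density; simp) (subst integral_density; simp)
 have "integrable lborel F \<longleftrightarrow> integrable ?\<mu> F'" using i1[of F'] by (simp add: wF)
 also have "... \<longleftrightarrow> integrable (distr ?\<mu> borel ginv) F'" by (simp add: haar_distr_ginv)
 also have "... \<longleftrightarrow> integrable ?\<mu> (%Y. F' (ginv Y))" by (rule integrable_distr_eq) auto
 also have "... \<longleftrightarrow> integrable lborel G" using i1[of "%Y. F' (ginv Y)"] by (simp add: wG)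
 finally show "integrable lborel F \<longleftrightarrow> integrable lborel G" .
 have "(LINT X|lborel. F X) = (LINT X|?\<mu>. F' X)" using e1[of F'] by (simp add: wF)
 also have "... = (LINT X|distr ?\<mu> borel ginv. F' X)" by (simp add: haar_distr_ginv)
 also have "... = (LINT Y|?\<mu>. F' (ginv Y))" by (rule integral_distr) auto
 also have "... = (LINT Y|lborel. G Y)" using e1[of "%Y. F' (ginv Y)"] by (simp add: wG)
 finally show "(LINT X|lborel. F X) = (LINT Y|lborel. G Y)" .
qed

section \<open>The Gram-Schmidt process\<close>

text \<open>Gram-Schmidt on the columns of \<open>g\<close>; the last index of the list is treated first.\<close>

primrec gs :: "'m::finite list => real^'m^'m => 'm => real^'m" where
 "gs [] g = (%_. 0)"
| "gs (i # is) g = (gs is g)(i :=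
  (column i g - (\<Sum>j\<in>set is. (column i g \<bullet> gs is g j) *\<^sub>R gs is g j)) /\<^sub>R
   norm (column i g - (\<Sum>j\<in>set is. (column i g \<bullet> gs is g j) *\<^sub>R gs is g j)))"

lemma span_image_sum:
 assumes "finite J" "x \<in> span (f ` J)"
 shows "\<exists>c. x = (\<Sum>j\<in>J. c j *\<^sub>R f j)"
proof -
 have "span (f ` J) \<subseteq> {x. \<exists>c. x = (\<Sum>j\<in>J. c j *\<^sub>R f j)}"
 proof (rule span_minimal)
  show "f ` J \<subseteq> {x. \<exists>c. x = (\<Sum>j\<in>J. c j *\<^sub>R f j)}"
  proof safe
   fix j assume "j \<in> J"
   then show "\<exists>c. f j = (\<Sum>j\<in>J. c j *\<^sub>R f j)"
    using assms(1) by (intro exI[of _ "%k. if k = j then 1 else 0"]) (simp add: if_distrib[of "%c. c *\<^sub>R _"] cong: if_cong)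
  qed
  show "subspace {x. \<exists>c. x = (\<Sum>j\<in>J. c j *\<^sub>R f j)}"
   unfolding subspace_def
  proof (safe, goal_cases)
   case 1 show ?case by (rule exI[of _ "%_. 0"]) simp
  next
   case (2 _ _ c d) show ?case by (rule exI[of _ "%j. c j + d j"]) (simp add: scaleR_left_distrib sum.distrib)
  next
   case (3 r _ c) show ?case by (rule exI[of _ "%j. r * c j"]) (simp add: scaleR_sum_right)
  qed
 qed
 then show ?thesis using assms(2) by blast
qed

lemma column_not_in_span:
 fixes g :: "real^'m^'m"
 assumes "invertible g" "i \<notin> J"
 shows "column i g \<notin> span ((%j. column j g) ` J)"
proof
 assume "column i g \<in> span ((%j. column j g) ` J)"
 then obtain c where c: "column i g = (\<Sum>j\<in>J. c j *\<^sub>R column j g)" using span_image_sum[OF finite] by blast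
 define d where "d j = (if j = i then - 1 else if j \<in> J then c j else 0)" for j
 have J: "(\<Sum>j\<in>J. d j *s column j g) = column i g"
  unfolding c by (rule sum.cong) (use assms(2) in "auto simp: d_def scalar_mult_eq_scaleR")
 have "(\<Sum>j\<in>UNIV. d j *s column j g) = d i *s column i g + (\<Sum>j\<in>UNIV - {i}. d j *s column j g)"
  by (rule sum.remove) auto
 also have "(\<Sum>j\<in>UNIV - {i}. d j *s column j g) = (\<Sum>j\<in>J. d j *s column j g)"
  by (rule sum.mono_neutral_right) (use assms(2) in "auto simp: d_def")
 also have "d i *s column i g + (\<Sum>j\<in>J. d j *s column j g) = 0"
  unfolding J by (simp add: d_def scalar_mult_eq_scaleR)
 finally have "(\<Sum>j\<in>UNIV. d j *s column j g) = 0" .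
 moreover have "\<exists>B. B ** g = mat 1" using assms(1) unfolding invertible_def by blast
 ultimately have "d i = 0" unfolding matrix_left_invertible_independent_columns by blast
 then show False by (simp add: d_def)
qed

lemma gs_properties:
 fixes g :: "real^'m^'m"
 assumes g: "invertible g"
 shows "distinct is ==>
  (\<forall>i\<in>set is. \<forall>j\<in>set is. gs is g i \<bullet> gs is g j = (if i = j then 1 else 0)) &
  (\<forall>i\<in>set is. gs is g i \<in> span ((%j. column j g) ` set is)) &
  (\<forall>i\<in>set is. column i g \<in> span (gs is g ` set is))"
proof (induction "is")
 case (Cons i "is")
 let ?u = "gs is g"
 define w where "w = column i g - (\<Sum>j\<in>set is. (column i g \<bullet> ?u j) *\<^sub>R ?u j)"
 have IH: "!!i j. i \<in> set is ==> j \<in> set is ==> ?u i \<bullet> ?u j = (if i = j then 1 else 0)"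
  "!!j. j \<in> set is ==> ?u j \<in> span ((%j. column j g) ` set is)"
  "!!j. j \<in> set is ==> column j g \<in> span (?u ` set is)"
  using Cons by auto
 have i: "i \<notin> set is" using Cons.prems by simp
 have sp: "(\<Sum>j\<in>set is. (column i g \<bullet> ?u j) *\<^sub>R ?u j) \<in> span ((%j. column j g) ` set is)"
  by (intro span_sum span_scale IH(2))
 have w: "w ~= 0"
  using sp column_not_in_span[OF g i] by (auto simp: w_def)
 have orth: "w \<bullet> ?u k = 0" if k: "k \<in> set is" for k
 proof -
  have "(\<Sum>j\<in>set is. (column i g \<bullet> ?u j) * (?u j \<bullet> ?u k)) = (\<Sum>j\<in>set is. if j = k then column i g \<bullet> ?u k else 0)"
   by (rule sum.cong) (use IH(1) k in auto)
  then show ?thesis using k by (simp add: w_def inner_diff_left inner_sum_left)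
 qed
 have gs: "gs (i # is) g = ?u(i := w /\<^sub>R norm w)" by (simp add: w_def)
 have "column k g \<in> span (gs (i # is) g ` set (i # is))" if k: "k \<in> set (i # is)" for k
 proof -
  have sub: "?u ` set is \<subseteq> gs (i # is) g ` set (i # is)"
  proof
   fix x assume "x \<in> ?u ` set is"
   then obtain j where "j \<in> set is" "x = ?u j" by auto
   then show "x \<in> gs (i # is) g ` set (i # is)" using i by (intro image_eqI[of _ _ j]) (auto simp: gs)
  qed
  show ?thesis
  proof (cases "k = i")
   case True
   have "gs (i # is) g i \<in> span (gs (i # is) g ` set (i # is))" by (intro span_base) auto
   then have "norm w *\<^sub>R gs (i # is) g i \<in> span (gs (i # is) g ` set (i # is))" by (rule span_scale)
   moreover have "norm w *\<^sub>R gs (i # is) g i = w" using w unfolding gs by simp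
   ultimately have "w \<in> span (gs (i # is) g ` set (i # is))" by (simp only:)
   moreover have "(\<Sum>j\<in>set is. (column i g \<bullet> ?u j) *\<^sub>R ?u j) \<in> span (gs (i # is) g ` set (i # is))"
    by (intro span_sum span_scale span_base) (use sub in auto)
   moreover have "column i g = w + (\<Sum>j\<in>set is. (column i g \<bullet> ?u j) *\<^sub>R ?u j)" by (simp add: w_def)
   ultimately show ?thesis using True span_add by metis
  next
   case False
   then show ?thesis using IH(3)[of k] k span_mono[OF sub] by auto
  qed
 qed
 moreover have "gs (i # is) g k \<in> span ((%j. column j g) ` set (i # is))" if k: "k \<in> set (i # is)" for k
 proof (cases "k = i")
  case True
  have "w \<in> span ((%j. column j g) ` set (i # is))"
  proof -
   have "(\<Sum>j\<in>set is. (column i g \<bullet> ?u j) *\<^sub>R ?u j) \<in> span ((%j. column j g) ` set (i # is))"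
    using sp span_mono[of "(%j. column j g) ` set is" "(%j. column j g) ` set (i # is)"] by auto
   moreover have "column i g \<in> span ((%j. column j g) ` set (i # is))" by (intro span_base) auto
   ultimately show ?thesis unfolding w_def by (intro span_diff)
  qed
  then show ?thesis using True by (simp add: gs span_scale del: gs.simps)
 next
  case False
  then show ?thesis using IH(2)[of k] k span_mono[of "(%j. column j g) ` set is" "(%j. column j g) ` set (i # is)"]
   by (auto simp: gs simp del: gs.simps)
 qed
 moreover have "gs (i # is) g k \<bullet> gs (i # is) g l = (if k = l then 1 else 0)" if "k \<in> set (i # is)" "l \<in> set (i # is)" for k l
 proof -
  have ww: "w \<bullet> w = norm w * norm w" by (simp add: power2_norm_eq_inner[symmetric] power2_eq_square)
  show ?thesis
  proof (cases "k = i")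
   case k: True
   show ?thesis
   proof (cases "l = i")
    case True
    then show ?thesis unfolding gs using k w by (simp add: ww field_simps)
   next
    case False
    then have "l \<in> set is" using that by simp
    then show ?thesis unfolding gs using k False orth[of l] by simp
   qed
  next
   case k: False
   then have k': "k \<in> set is" using that by simp
   show ?thesis
   proof (cases "l = i")
    case True
    then show ?thesis unfolding gs using k orth[OF k'] by (simp add: inner_commute)
   next
    case False
    then have "l \<in> set is" using that by simp
    then show ?thesis unfolding gs using k False IH(1)[OF k'] by simp
   qed
  qed
 qed
 ultimately show ?case by blast
qed simp

lemma open_GL [smooth_intros]: "open (GL :: (real^'m^'m) set)"
proof -
 have "open {g::real^'m^'m. det g ~= 0}"
  by (intro open_Collect_neq smooth_continuous smooth_det smooth_id continuous_on_const) auto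
 then show ?thesis by (simp add: invertible_det_nz)
qed

lemma smooth_column:
 fixes f :: "'a::real_normed_vector => real^'n^'m"
 shows "open S ==> smooth S f ==> smooth S (%x. column i (f x))"
 unfolding column_def by (intro smooth_vec smooth_vec_nth)

lemma smooth_gs:
 fixes "is" :: "'m::finite list"
 shows "distinct is ==> smooth (GL :: (real^'m^'m) set) (%g. gs is g k)"
proof (induction "is" arbitrary: k)
 case Nil
 then show ?case by (simp add: smooth_const)
next
 case (Cons i "is")
 let ?w = "%g::real^'m^'m. column i g - (\<Sum>j\<in>set is. (column i g \<bullet> gs is g j) *\<^sub>R gs is g j)"
 show ?case
 proof (cases "k = i")
  case True
  have sw: "smooth (GL :: (real^'m^'m) set) ?w"
   using Cons by (intro smooth_diff smooth_column smooth_sum smooth_scaleR smooth_intros) auto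
  have nz: "?w g ~= 0" if "g \<in> GL" for g
  proof -
   have "(\<Sum>j\<in>set is. (column i g \<bullet> gs is g j) *\<^sub>R gs is g j) \<in> span ((%j. column j g) ` set is)"
    using gs_properties[of g "is"] that Cons.prems by (intro span_sum span_scale) auto
   moreover have "column i g \<notin> span ((%j. column j g) ` set is)"
    using column_not_in_span[of g i "set is"] that Cons.prems by auto
   ultimately show ?thesis by auto
  qed
  have "smooth GL (%g::real^'m^'m. inverse (norm (?w g)) *\<^sub>R ?w g)"
   by (intro smooth_scaleR smooth_inverse smooth_norm sw open_GL) (use nz in auto)
  then show ?thesis using True by simp
 next
  case False
  then show ?thesis using Cons by simp
 qed
qed

lemma gs_append: "distinct (as @ bs) ==> k \<in> set bs ==> gs (as @ bs) g k = gs bs g k"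
 by (induction as) auto

lemma gs_orth_column:
 fixes g :: "real^'m^'m"
 assumes "invertible g" "distinct (as @ i # bs)" "j \<in> set bs"
 shows "gs (as @ i # bs) g i \<bullet> column j g = 0"
proof -
 let ?u = "gs (as @ i # bs) g"
 have "column j g \<in> span (gs bs g ` set bs)" using gs_properties[OF assms(1), of bs] assms by auto
 moreover have "gs bs g ` set bs = ?u ` set bs"
 proof (rule image_cong[OF refl])
  fix k assume "k \<in> set bs"
  then show "gs bs g k = ?u k" using gs_append[of "as @ [i]" bs k g] assms(2) by simp
 qed
 ultimately have c: "column j g \<in> span (?u ` set bs)" by simp
 show ?thesis
 proof (rule orthogonal_to_span[OF c, unfolded orthogonal_def])
  fix y assume "y \<in> ?u ` set bs"
  then obtain k where "k \<in> set bs" "y = ?u k" by auto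
  moreover have "?u i \<bullet> ?u k = (if i = k then 1 else 0)" if "k \<in> set bs" for k
   using gs_properties[OF assms(1,2)] that by auto
  ultimately show "?u i \<bullet> y = 0" using assms(2) by auto
 qed
qed

section \<open>Orthogonal times block upper triangular\<close>

text \<open>With this order the columns of the first block come first, from the last column to the
first. The triangular factor is then block upper triangular with lower triangular upper left
block.\<close>

definition gs_order :: "('n::{finite,linorder} + 'n) list" where
 "gs_order = map Inr (sorted_list_of_set UNIV) @ map Inl (sorted_list_of_set UNIV)"

lemma set_gs_order [simp]: "set gs_order = UNIV"
 by (auto simp: gs_order_def UNIV_sum)

lemma distinct_gs_order [simp]: "distinct gs_order"
 by (auto simp: gs_order_def distinct_map)

definition kap :: "real^('n::{finite,linorder} + 'n)^('n + 'n) => real^('n + 'n)^('n + 'n)" where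
 "kap g = (\<chi> r c. gs gs_order g c $ r)"

lemma smooth_kap: "smooth GL kap"
 unfolding kap_def[abs_def] by (intro smooth_vec smooth_vec_nth smooth_gs open_GL) simp

lemma kap_orthogonal:
 assumes "invertible g" shows "orthogonal_matrix (kap g)"
proof -
 have "(transpose (kap g) ** kap g) $ i $ j = gs gs_order g i \<bullet> gs gs_order g j" for i j
  by (simp add: matrix_matrix_mult_def transpose_def kap_def inner_vec_def)
 then have "transpose (kap g) ** kap g = mat 1"
  using gs_properties[OF assms distinct_gs_order] by (auto simp: vec_eq_iff mat_def)
 then show ?thesis by (simp add: orthogonal_matrix)
qed

definition qpart :: "real^('n::{finite,linorder} + 'n)^('n + 'n) => real^('n + 'n)^('n + 'n)" where
 "qpart g = transpose (kap g) ** g"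

lemma kap_qpart:
 assumes "invertible g" shows "kap g ** qpart g = g"
proof -
 have "kap g ** transpose (kap g) = mat 1" using kap_orthogonal[OF assms] by (simp add: orthogonal_matrix_def)
 then show ?thesis by (simp add: qpart_def matrix_mul_assoc)
qed

lemma smooth_qpart: "smooth GL qpart"
 unfolding qpart_def[abs_def] by (intro smooth_matrix_mult smooth_transpose smooth_kap smooth_id open_GL)

lemma qpart_nth: "qpart g $ i $ j = gs gs_order g i \<bullet> column j g"
 by (simp add: qpart_def matrix_matrix_mult_def transpose_def kap_def inner_vec_def column_def)

lemma qpart_zero:
 assumes "invertible g" "gs_order = as @ i # bs" "j \<in> set bs" shows "qpart g $ i $ j = 0"
 unfolding qpart_nth using gs_orth_column[OF assms(1), of as i bs j] assms(2,3) distinct_gs_order by metis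

lemma sorted_split:
 fixes a b :: "'n::{finite,linorder}"
 assumes "a < b"
 shows "\<exists>as bs. sorted_list_of_set UNIV = as @ a # bs & b \<in> set bs"
proof -
 obtain as bs where s: "sorted_list_of_set (UNIV :: 'n set) = as @ a # bs"
  by (metis UNIV_I finite set_sorted_list_of_set split_list)
 have "sorted (as @ a # bs)" using sorted_sorted_list_of_set[of "UNIV :: 'n set"] s by simp
 then have "b \<notin> set as" using assms by (auto simp: sorted_append)
 moreover have "b \<in> set (as @ a # bs)" using s by (metis UNIV_I finite set_sorted_list_of_set)
 ultimately show ?thesis using s assms by auto
qed

lemma qpart_lower:
 assumes "invertible g" "a < b" shows "qpart g $ Inl a $ Inl b = 0"
proof -
 obtain as bs where s: "sorted_list_of_set UNIV = as @ a # bs" "b \<in> set bs" using sorted_split[OF assms(2)] by blast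
 then have "gs_order = (map Inr (sorted_list_of_set UNIV) @ map Inl as) @ Inl a # map Inl bs" by (simp add: gs_order_def)
 then show ?thesis by (rule qpart_zero[OF assms(1)]) (use s in auto)
qed

lemma qpart_block:
 assumes "invertible g" shows "qpart g $ Inr a $ Inl b = 0"
proof -
 obtain as bs where s: "gs_order = as @ Inr a # bs" by (metis UNIV_I set_gs_order split_list)
 have "Inl b \<in> set bs"
 proof -
  obtain as' bs' where s': "sorted_list_of_set (UNIV :: 'a set) = as' @ a # bs'"
   by (metis UNIV_I finite set_sorted_list_of_set split_list)
  have e: "gs_order = map Inr as' @ Inr a # (map Inr bs' @ map Inl (sorted_list_of_set UNIV))"
   by (simp add: gs_order_def s')
  have "as = map Inr as' & bs = map Inr bs' @ map Inl (sorted_list_of_set UNIV)"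
  proof -
   have d: "distinct (as @ Inr a # bs)" using distinct_gs_order s by metis
   then have nas: "Inr a \<notin> set as" "Inr a \<notin> set bs" by auto
   have "as @ Inr a # bs = map Inr as' @ Inr a # (map Inr bs' @ map Inl (sorted_list_of_set UNIV))"
    using s e by simp
   from append_Cons_eq_iff[OF nas, THEN iffD1, OF this] show ?thesis .
  qed
  then show ?thesis by auto
 qed
 then show ?thesis by (rule qpart_zero[OF assms s])
qed

section \<open>Lie derivatives along the orthogonal group\<close>

lemma smooth_null_lie_deriv:
 fixes \<Phi> :: "'i => real^'m^'m => complex"
 assumes "smooth_null F GL \<Phi>"
 shows "smooth_null F GL (%i. lie_deriv Y (\<Phi> i))"
proof -
 have "smooth_null F GL (%i g. \<Sum>b\<in>Basis. ((g ** Y) \<bullet> b) *\<^sub>R dird b (\<Phi> i) g)"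
  by (intro smooth_null_sum open_GL smooth_null_bilinear[OF _ bounded_bilinear_scaleR] smooth_null_dird assms
    smooth_intros)
 then show ?thesis
  by (rule smooth_null_cong[OF open_GL, rotated])
   (simp add: lie_deriv_def derivative_euclidean_expand[OF smooth_differentiable[OF smooth_null_smooth[OF assms]], symmetric])
qed

lemma smooth_lie_deriv: "smooth GL f ==> smooth GL (lie_deriv Y f)"
 for f :: "real^'m^'m => complex"
 using smooth_null_lie_deriv[of bot "%_::unit. f"] by (simp add: smooth_iff_smooth_null[where 'i=unit])

lemma smooth_null_lie_derivs:
 "smooth_null F GL \<Phi> ==> smooth_null F GL (%i. foldr lie_deriv Ys (\<Phi> i))"
 for \<Phi> :: "'i => real^'m^'m => complex"
 by (induction Ys) (auto intro: smooth_null_lie_deriv)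

lemma smooth_lie_derivs: "smooth GL f ==> smooth GL (foldr lie_deriv Ys f)"
 for f :: "real^'m^'m => complex"
 by (induction Ys) (auto intro: smooth_lie_deriv)

lemma compact_orthogonal: "compact {k :: real^'m^'m. orthogonal_matrix k}"
proof -
 have "closed {k :: real^'m^'m. transpose k ** k = mat 1}"
  by (intro closed_Collect_eq smooth_continuous smooth_intros continuous_on_const)
 moreover have "bounded {k :: real^'m^'m. transpose k ** k = mat 1}"
 proof -
  have "norm k <= sqrt (real CARD('m))" if "transpose k ** k = mat 1" for k :: "real^'m^'m"
  proof -
   have "(\<Sum>i\<in>UNIV. k $ i $ j * k $ i $ j) = (transpose k ** k) $ j $ j" for j
    by (simp add: matrix_matrix_mult_def transpose_def)
   then have "(\<Sum>j\<in>UNIV. \<Sum>i\<in>UNIV. k $ i $ j * k $ i $ j) = real CARD('m)" by (simp add: that mat_def)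
   then have "(\<Sum>i\<in>UNIV. \<Sum>j\<in>UNIV. k $ i $ j * k $ i $ j) = real CARD('m)" by (subst sum.swap)
   then show ?thesis by (simp add: norm_eq_sqrt_inner inner_vec_def)
  qed
  then show ?thesis by (auto intro!: boundedI)
 qed
 ultimately show ?thesis by (simp add: orthogonal_matrix compact_eq_bounded_closed)
qed

lemma orthogonal_subset_GL: "{k :: real^'m^'m. orthogonal_matrix k} \<subseteq> GL"
 by (auto simp: orthogonal_matrix_def invertible_def)

lemma lie_derivs_0: "foldr lie_deriv Ys (%_. 0) = (%_. 0)"
 by (induction Ys) (auto simp: lie_deriv_def dird_eq[OF has_derivative_const])

lemma smooth_limit_O_null:
 fixes \<Phi> :: "'i => real^'m^'m => complex"
 assumes "smooth_null F GL \<Phi>"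
 shows "smooth_limit_O \<Phi> (%_. 0) F"
 unfolding smooth_limit_O_def lie_derivs_0
proof (intro allI impI)
 fix Ys :: "(real^'m^'m) list"
 have "null_loc F GL (%i. foldr lie_deriv Ys (\<Phi> i))"
  using smooth_null_lie_derivs[OF assms, of Ys] unfolding smooth_null_def by (metis C_null.simps(1))
 then show "uniform_limit {k. orthogonal_matrix k} (%i. foldr lie_deriv Ys (\<Phi> i)) (%_. 0) F"
  unfolding null_loc_def using compact_orthogonal orthogonal_subset_GL by blast
qed

lemma lie_derivs_diff:
 fixes f g :: "real^'m^'m => complex"
 assumes "smooth GL f" "smooth GL g" "x \<in> GL"
 shows "foldr lie_deriv Ys (%x. f x - g x) x = foldr lie_deriv Ys f x - foldr lie_deriv Ys g x"
 using assms(3)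
proof (induction Ys arbitrary: x)
 case (Cons Y Ys)
 have "((%x. foldr lie_deriv Ys f x - foldr lie_deriv Ys g x) has_derivative
  (%v. dird v (foldr lie_deriv Ys f) x - dird v (foldr lie_deriv Ys g) x)) (at x)"
  by (intro has_derivative_diff smooth_has_derivative[OF smooth_lie_derivs[OF assms(1)] Cons.prems]
    smooth_has_derivative[OF smooth_lie_derivs[OF assms(2)] Cons.prems])
 then have "(foldr lie_deriv Ys (%x. f x - g x) has_derivative
  (%v. dird v (foldr lie_deriv Ys f) x - dird v (foldr lie_deriv Ys g) x)) (at x)"
  by (rule has_derivative_transform_within_open[OF _ open_GL Cons.prems]) (simp add: Cons.IH)
 from dird_eq[OF this, of "x ** Y"] show ?case by (simp add: lie_deriv_def[of Y])
qed simp

lemma smooth_limit_O_diff_iff: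
 fixes \<Phi> :: "'i => real^'m^'m => complex"
 assumes "!!i. smooth GL (\<Phi> i)" "smooth GL f"
 shows "smooth_limit_O \<Phi> f F \<longleftrightarrow> smooth_limit_O (%i x. \<Phi> i x - f x) (%_. 0) F"
proof -
 have "uniform_limit {k. orthogonal_matrix k} (%i. foldr lie_deriv Ys (\<Phi> i)) (foldr lie_deriv Ys f) F \<longleftrightarrow>
  uniform_limit {k. orthogonal_matrix k} (%i. foldr lie_deriv Ys (%x. \<Phi> i x - f x)) (%_. 0) F" for Ys
 proof -
  have "foldr lie_deriv Ys (%x. \<Phi> i x - f x) k = foldr lie_deriv Ys (\<Phi> i) k - foldr lie_deriv Ys f k"
   if "orthogonal_matrix k" for i k
   using lie_derivs_diff[OF assms(1,2)] orthogonal_subset_GL that by blast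
  then show ?thesis by (simp add: uniform_limit_iff dist_norm)
 qed
 then show ?thesis by (simp add: smooth_limit_O_def lie_derivs_0)
qed

text \<open>The derivative of \<^const>\<open>kap\<close> at \<open>g\<close> is \<open>kap g\<close> times a skew-symmetric matrix.
Hence every derivative of \<open>\<Phi> \<circ> kap\<close> is a combination, with smooth coefficients, of Lie
derivatives of \<open>\<Phi>\<close> at \<open>kap g\<close>, which the seminorms control.\<close>

lemma smooth_null_kap:
 fixes \<Phi> :: "'i => real^('n::{finite,linorder} + 'n)^('n + 'n) => complex"
 assumes sm: "!!i. smooth GL (\<Phi> i)" and lim: "smooth_limit_O \<Phi> (%_. 0) F"
 shows "smooth_null F GL (%i g. \<Phi> i (kap g))"
proof -
 let ?E = "%i j. elem i j - elem j i :: real^('n + 'n)^('n + 'n)"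
 define c where "c v i j g = (transpose (kap g) ** dird v kap g) $ i $ j / 2" for v i j and g :: "real^('n + 'n)^('n + 'n)"
 have sc: "smooth GL (c v i j)" for v i j
  unfolding c_def[abs_def] divide_inverse
  by (intro smooth_intros smooth_kap smooth_dird smooth_const open_GL)
 have kGL: "kap g \<in> GL" if "g \<in> GL" for g :: "real^('n + 'n)^('n + 'n)"
  using kap_orthogonal[of g] orthogonal_subset_GL that by auto
 have der: "((%g. f (kap g)) has_derivative (%v. \<Sum>i\<in>UNIV. \<Sum>j\<in>UNIV. of_real (c v i j g) * lie_deriv (?E i j) f (kap g))) (at g)"
  if f: "smooth GL f" and g: "g \<in> GL" for f :: "real^('n + 'n)^('n + 'n) => complex" and g
 proof -
  note df = smooth_has_derivative[OF f kGL[OF g]]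
  interpret df: bounded_linear "%w. dird w f (kap g)" using df by (rule has_derivative_bounded_linear)
  have "((%g. f (kap g)) has_derivative (%v. dird (dird v kap g) f (kap g))) (at g)"
   by (rule has_derivative_compose[OF smooth_has_derivative[OF smooth_kap g] df])
  moreover have "dird (dird v kap g) f (kap g) = (\<Sum>i\<in>UNIV. \<Sum>j\<in>UNIV. of_real (c v i j g) * lie_deriv (?E i j) f (kap g))" for v
  proof -
   let ?k = "kap g" and ?d = "dird v kap g"
   have k: "transpose ?k ** ?k = mat 1" "?k ** transpose ?k = mat 1"
    using kap_orthogonal[of g] g by (auto simp: orthogonal_matrix_def)
   define Y where "Y = transpose ?k ** ?d"
   have dk: "(kap has_derivative (%v. dird v kap g)) (at g)" by (rule smooth_has_derivative[OF smooth_kap g])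
   have dt: "((%g. transpose (kap g)) has_derivative (%v. transpose (dird v kap g))) (at g)"
    by (rule bounded_linear.has_derivative[OF _ dk])
     (auto simp: linear_conv_bounded_linear[symmetric] transpose_def vec_eq_iff intro!: linearI)
   have bm: "bounded_bilinear (%(a::real^('n + 'n)^('n + 'n)) (b::real^('n + 'n)^('n + 'n)). a ** b)"
    by (rule bilinear_conv_bounded_bilinear[THEN iffD1])
     (auto simp: bilinear_def vec_eq_iff matrix_matrix_mult_def sum.distrib sum_distrib_left algebra_simps intro!: linearI)
   have "((%g. transpose (kap g) ** kap g) has_derivative (%v. transpose ?k ** dird v kap g + transpose (dird v kap g) ** ?k)) (at g)"
    by (rule bounded_bilinear.FDERIV[OF bm dt dk])
   moreover have "((%g::real^('n + 'n)^('n + 'n). transpose (kap g) ** kap g) has_derivative (%v. 0)) (at g)"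
    by (rule has_derivative_transform_within_open[OF has_derivative_const[of "mat 1"] open_GL g])
     (metis kap_orthogonal mem_Collect_eq orthogonal_matrix_def)
   ultimately have "(%v. transpose ?k ** dird v kap g + transpose (dird v kap g) ** ?k) = (%v. 0)"
    by (rule has_derivative_unique)
   then have "Y + transpose Y = 0" unfolding Y_def matrix_transpose_mul transpose_transpose by metis
   then have skew: "Y $ j $ i = - Y $ i $ j" for i j
   proof -
    assume "Y + transpose Y = 0"
    then have "(Y + transpose Y) $ i $ j = 0" by simp
    then show ?thesis by (simp add: transpose_def)
   qed
   have Ysum: "Y = (\<Sum>i\<in>UNIV. \<Sum>j\<in>UNIV. (Y $ i $ j / 2) *\<^sub>R ?E i j)"
   proof -
    have s1: "(\<Sum>i\<in>UNIV. \<Sum>j\<in>UNIV. (Y $ i $ j / 2) * (?E i j $ r $ s)) = Y $ r $ s" for r s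
    proof -
     have "(\<Sum>i\<in>UNIV. \<Sum>j\<in>UNIV. (Y $ i $ j / 2) * (?E i j $ r $ s)) =
      (\<Sum>i\<in>UNIV. \<Sum>j\<in>UNIV. (if i = r then (if j = s then Y $ r $ s / 2 else 0) else 0)) -
      (\<Sum>i\<in>UNIV. \<Sum>j\<in>UNIV. (if j = r then (if i = s then Y $ s $ r / 2 else 0) else 0))"
      unfolding sum_subtractf[symmetric] by (intro sum.cong refl) (auto simp: elem_nth)
     also have "(\<Sum>i\<in>UNIV. \<Sum>j\<in>UNIV. (if i = r then (if j = s then Y $ r $ s / 2 else 0) else 0)) = Y $ r $ s / 2"
      by (subst sum.swap) (simp add: sum.delta)
     also have "(\<Sum>i\<in>UNIV. \<Sum>j\<in>UNIV. (if j = r then (if i = s then Y $ s $ r / 2 else 0) else 0)) = Y $ s $ r / 2"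
      by (simp add: sum.delta)
     finally show ?thesis using skew[of s r] by simp
    qed
    show ?thesis unfolding vec_eq_iff sum_component vector_scaleR_component real_scaleR_def by (simp only: s1 simp_thms)
   qed
   have "?d = ?k ** Y" by (simp add: Y_def matrix_mul_assoc k)
   also have "... = (\<Sum>i\<in>UNIV. \<Sum>j\<in>UNIV. (Y $ i $ j / 2) *\<^sub>R (?k ** ?E i j))"
   proof -
    have l: "linear (%X::real^('n + 'n)^('n + 'n). ?k ** X)" by (rule linear_matrix_mult_left)
    show ?thesis by (subst Ysum) (simp only: linear_sum[OF l] linear_cmul[OF l] o_def)
   qed
   finally have "dird ?d f ?k = (\<Sum>i\<in>UNIV. \<Sum>j\<in>UNIV. (Y $ i $ j / 2) *\<^sub>R dird (?k ** ?E i j) f ?k)"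
    by (simp only: df.sum df.scaleR)
   then show ?thesis by (simp add: c_def Y_def lie_deriv_def scaleR_conv_of_real)
  qed
  ultimately show ?thesis by simp
 qed
 have "C_null k F GL (%i g. foldr lie_deriv Ys (\<Phi> i) (kap g))" if "\<forall>Y\<in>set Ys. transpose Y = - Y" for k Ys
  using that
 proof (induction k arbitrary: Ys)
  case (0 Ys)
  have u: "uniform_limit {k. orthogonal_matrix k} (%i. foldr lie_deriv Ys (\<Phi> i)) (%_. 0) F"
   using lim 0 unfolding smooth_limit_O_def lie_derivs_0 by blast
  have "uniform_limit K (%i g. foldr lie_deriv Ys (\<Phi> i) (kap g)) (%_. 0) F" if "K \<subseteq> GL" for K
   using u kap_orthogonal that unfolding uniform_limit_iff by (fastforce elim!: eventually_mono)
  moreover have "continuous_on GL (%g. foldr lie_deriv Ys (\<Phi> i) (kap g))" for i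
   by (rule continuous_on_compose2[OF smooth_continuous[OF smooth_lie_derivs[OF sm]] smooth_continuous[OF smooth_kap]])
    (use kGL in auto)
  ultimately show ?case by (simp add: null_loc_def)
 next
  case (Suc k Ys)
  have sk: "transpose (?E i j) = - ?E i j" for i j
   unfolding vec_eq_iff by (intro allI) (simp add: transpose_def elem_nth conj_commute)
  show ?case
  proof (rule C_null_Suc_intro[OF open_GL _ der[OF smooth_lie_derivs[OF sm]]])
   show "null_loc F GL (%i g. foldr lie_deriv Ys (\<Phi> i) (kap g))" using Suc.IH[OF Suc.prems] by (rule C_null_loc)
   fix v
   have "C_null k F GL (%i g. foldr lie_deriv (?E a b # Ys) (\<Phi> i) (kap g))" for a b
    by (rule Suc.IH) (use Suc.prems sk in auto)
   then show "C_null k F GL (%i x. \<Sum>a\<in>UNIV. \<Sum>b\<in>UNIV. of_real (c v a b x) * lie_deriv (?E a b) (foldr lie_deriv Ys (\<Phi> i)) (kap x))"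
    by (intro C_null_sum open_GL C_null_smooth_mult smooth_of_real sc) simp
  qed
 qed
 from this[of "[]"] show ?thesis by (simp add: smooth_null_def)
qed

section \<open>A smooth bump function\<close>

text \<open>Dividing \<open>exp(-1/x)\<close> by all powers of \<open>x\<close> gives a family closed under
differentiation.\<close>

definition bump :: "nat => real => real" where
 "bump j x = (if x <= 0 then 0 else exp (- inverse x) * inverse x ^ j)"

lemma bump_deriv: "(bump j has_field_derivative (bump (j + 2) x - real j * bump (j + 1) x)) (at x)"
proof -
 consider "x > 0" | "x < 0" | "x = 0" by linarith
 then show ?thesis
 proof cases
  case 1
  have i: "(inverse has_field_derivative - (inverse x ^ 2)) (at x)"
   using DERIV_inverse[of x] 1 by (simp add: numeral_2_eq_2)
  have p: "((%x. inverse x ^ j) has_field_derivative - (real j * inverse x ^ (j + 1))) (at x)"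
   using DERIV_power[OF i, of j] by (cases j) (simp_all add: power2_eq_square algebra_simps)
  have "((%x. exp (- inverse x)) has_field_derivative exp (- inverse x) * - (- (inverse x ^ 2))) (at x)"
   by (rule DERIV_chain2[OF DERIV_exp DERIV_minus[OF i]])
  from DERIV_mult[OF this p]
  have "((%x. exp (- inverse x) * inverse x ^ j) has_field_derivative (bump (j + 2) x - real j * bump (j + 1) x)) (at x)"
   using 1 by (simp add: bump_def power_add power2_eq_square algebra_simps)
  then show ?thesis
   by (rule has_field_derivative_transform_within_open[where S="{0<..}"]) (use 1 in "auto simp: bump_def")
 next
  case 2
  have "((%_. 0) has_field_derivative (bump (j + 2) x - real j * bump (j + 1) x)) (at x)"
   using 2 by (auto intro!: derivative_eq_intros simp: bump_def)
  then show ?thesis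
   by (rule has_field_derivative_transform_within_open[where S="{..<0}"]) (use 2 in "auto simp: bump_def")
 next
  case 3
  have "((%h. bump j h / h) \<longlongrightarrow> 0) (at (0::real))"
  proof (rule filterlim_split_at)
   have "((%y::real. y ^ (j + 1) / exp y) \<longlongrightarrow> 0) at_top" by (rule tendsto_power_div_exp_0)
   then have "((%h::real. inverse h ^ (j + 1) / exp (inverse h)) \<longlongrightarrow> 0) (at_right 0)"
    by (rule filterlim_compose) (rule filterlim_inverse_at_top_right)
   then show "((%h. bump j h / h) \<longlongrightarrow> 0) (at_right (0::real))"
    by (rule Lim_transform_eventually)
     (auto simp: eventually_at_filter bump_def exp_minus field_simps intro!: always_eventually)
   show "((%h. bump j h / h) \<longlongrightarrow> 0) (at_left (0::real))"
    by (rule Lim_transform_eventually[OF tendsto_const])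
     (auto simp: eventually_at_filter bump_def intro!: always_eventually)
  qed
  then show ?thesis using 3 by (simp add: has_field_derivative_iff bump_def)
 qed
qed

lemma smooth_bump: "smooth UNIV (bump j)"
proof (rule smoothI)
 fix k show "C_k_on k UNIV (bump j)"
 proof (induction k arbitrary: j)
  case 0
  then show ?case using DERIV_isCont[OF bump_deriv] by (auto intro!: continuous_at_imp_continuous_on)
 next
  case (Suc k)
  show ?case
  proof (rule C_k_on_SucI)
   show "(bump j has_derivative (%v. (bump (j + 2) x + (- real j) * bump (j + 1) x) * v)) (at x)" for x
    using bump_deriv[of j x] by (simp add: has_field_derivative_def)
   fix v
   have s: "C_k_on k UNIV (%x. (- real j) * bump (j + 1) x)"
    by (rule C_null_linear_fixed[OF open_UNIV bounded_linear_mult_right Suc.IH])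
   have "C_k_on k UNIV (%x. bump (j + 2) x + (- real j) * bump (j + 1) x)"
    using C_null_add[OF open_UNIV, of k bot "%_::unit. bump (j + 2)" "%_ x. (- real j) * bump (j + 1) x"] Suc.IH[of "j+2"] s
    unfolding C_k_on_iff_C_null[where 'i=unit] by blast
   then show "C_k_on k UNIV (%x. (bump (j + 2) x + (- real j) * bump (j + 1) x) * v)"
    by (rule C_null_linear_fixed[OF open_UNIV bounded_linear_mult_left])
  qed auto
 qed
qed

lemma bump_nonneg: "bump j x \<ge> 0" and bump_pos: "x > 0 ==> bump 0 x > 0" and bump_zero: "x <= 0 ==> bump j x = 0"
 by (auto simp: bump_def)

section \<open>Block matrices\<close>

type_synonym 'n big = "((real, 'n + 'n) vec, 'n + 'n) vec"
type_synonym 'n quad = "'n sq \<times> 'n sq \<times> 'n sq \<times> 'n sq"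
type_synonym 'n cor = "((real, 'n corner) vec, 'n corner) vec"

lemma block_nth [simp]:
 "block_matrix A B C D $ Inl a $ Inl b = A $ a $ b"
 "block_matrix A B C D $ Inl a $ Inr b = B $ a $ b"
 "block_matrix A B C D $ Inr a $ Inl b = C $ a $ b"
 "block_matrix A B C D $ Inr a $ Inr b = D $ a $ b"
 by (simp_all add: block_matrix_def)

lemma sum_UNIV_sum: "(\<Sum>k\<in>(UNIV :: ('a::finite + 'b::finite) set). f k) = (\<Sum>i\<in>UNIV. f (Inl i)) + (\<Sum>i\<in>UNIV. f (Inr i))"
 unfolding UNIV_Plus_UNIV[symmetric] by (subst sum.Plus) (simp_all add: o_def)

lemma vec_sum_eq_iff:
 fixes A B :: "('n::finite) big"
 shows "A = B \<longleftrightarrow>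
  (\<forall>a b. A $ Inl a $ Inl b = B $ Inl a $ Inl b) & (\<forall>a b. A $ Inl a $ Inr b = B $ Inl a $ Inr b) &
  (\<forall>a b. A $ Inr a $ Inl b = B $ Inr a $ Inl b) & (\<forall>a b. A $ Inr a $ Inr b = B $ Inr a $ Inr b)"
 unfolding vec_eq_iff split_sum_all by blast

lemma block_mult: "block_matrix A B C D ** block_matrix A' B' C' D' =
 block_matrix (A ** A' + B ** C') (A ** B' + B ** D') (C ** A' + D ** C') (C ** B' + D ** D')"
 by (simp add: vec_sum_eq_iff matrix_matrix_mult_def sum_UNIV_sum)

lemma block_mat_1: "block_matrix (mat 1) 0 0 (mat 1) = mat 1"
 by (simp add: vec_sum_eq_iff mat_def)

definition b11 :: "real^('n + 'n)^('n + 'n) => real^'n^'n" where "b11 g = (\<chi> i j. g $ Inl i $ Inl j)"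
definition b12 :: "real^('n + 'n)^('n + 'n) => real^'n^'n" where "b12 g = (\<chi> i j. g $ Inl i $ Inr j)"
definition b21 :: "real^('n + 'n)^('n + 'n) => real^'n^'n" where "b21 g = (\<chi> i j. g $ Inr i $ Inl j)"
definition b22 :: "real^('n + 'n)^('n + 'n) => real^'n^'n" where "b22 g = (\<chi> i j. g $ Inr i $ Inr j)"

lemma block_eta: "block_matrix (b11 g) (b12 g) (b21 g) (b22 g) = g"
 by (simp add: vec_sum_eq_iff b11_def b12_def b21_def b22_def)

lemma blocks_block [simp]:
 "b11 (block_matrix A B C D) = A" "b12 (block_matrix A B C D) = B"
 "b21 (block_matrix A B C D) = C" "b22 (block_matrix A B C D) = D"
 by (simp_all add: b11_def b12_def b21_def b22_def vec_eq_iff)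

lemma blocks_mult:
 "b11 (g ** h) = b11 g ** b11 h + b12 g ** b21 h"
 "b21 (g ** h) = b21 g ** b11 h + b22 g ** b21 h"
 "b22 (g ** h) = b21 g ** b12 h + b22 g ** b22 h"
 using block_mult[of "b11 g" "b12 g" "b21 g" "b22 g" "b11 h" "b12 h" "b21 h" "b22 h"] by (simp_all add: block_eta)

lemma blocks_mat_1: "b11 (mat 1) = mat 1" "b21 (mat 1) = 0" "b22 (mat 1) = mat 1"
 by (simp_all add: b11_def b21_def b22_def mat_def vec_eq_iff)

lemma invertibleI: "A ** B = mat 1 ==> invertible (A :: real^'n^'n)" "B ** A = mat 1 ==> invertible (A :: real^'n^'n)"
 by (auto simp: invertible_def matrix_left_right_inverse)

lemma block_upper_invertible:
 fixes q :: "('n::finite) big"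
 assumes "invertible q" "b21 q = 0"
 shows "invertible (b11 q)" "invertible (b22 q)"
proof -
 let ?r = "matrix_inv q"
 have "b11 (?r ** q) = mat 1" "b22 (q ** ?r) = mat 1"
  using matrix_inv_both[OF assms(1)] by (simp_all add: blocks_mat_1)
 then have "b11 ?r ** b11 q = mat 1" "b22 q ** b22 ?r = mat 1"
  by (simp_all add: blocks_mult assms(2))
 then show "invertible (b11 q)" "invertible (b22 q)" by (auto intro: invertibleI)
qed

lemma matrix_mult_minus: "A ** (- B) = - (A ** B)" for A :: "real^'n^'m" and B :: "real^'k^'n"
 by (simp add: matrix_matrix_mult_def vec_eq_iff sum_negf)

lemma block_upper_invertible_iff:
 assumes "invertible A" "invertible D" shows "invertible (block_matrix A B 0 D)"
proof -
 have "block_matrix A B 0 D ** block_matrix (matrix_inv A) (- (matrix_inv A ** B ** matrix_inv D)) 0 (matrix_inv D) = mat 1"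
 proof -
  have "A ** (- (matrix_inv A ** B ** matrix_inv D)) = - (A ** matrix_inv A ** B ** matrix_inv D)"
   by (simp add: matrix_mul_assoc matrix_mult_minus)
  then show ?thesis by (simp add: block_mult matrix_inv_both assms block_mat_1)
 qed
 then show ?thesis by (rule invertibleI)
qed

lemma smooth_b11 [smooth_intros]: "open S ==> smooth S f ==> smooth S (%x. b11 (f x))"
 and smooth_b22 [smooth_intros]: "open S ==> smooth S f ==> smooth S (%x. b22 (f x))"
 unfolding b11_def b22_def by (intro smooth_vec smooth_vec_nth; assumption)+

lemma smooth_block [smooth_intros]:
 fixes A B C D :: "'a::real_normed_vector => real^'n::finite^'n::finite"
 assumes "open S" "smooth S A" "smooth S B" "smooth S C" "smooth S D"
 shows "smooth S (%x. block_matrix (A x) (B x) (C x) (D x))"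
 unfolding block_matrix_def
proof (intro smooth_vec assms(1))
 fix i j :: "'n + 'n"
 show "smooth S (%x. case i of Inl a => (case j of Inl b => A x $ a $ b | Inr b => B x $ a $ b)
   | Inr a => (case j of Inl b => C x $ a $ b | Inr b => D x $ a $ b))"
  using assms by (cases i; cases j) (auto intro!: smooth_vec_nth)
qed

text \<open>The strictly upper part of the third component is a dummy variable; it keeps the parameter
space a full space of matrices.\<close>

definition Gm :: "'n::{finite,linorder} quad => 'n big" where
 "Gm x = block_matrix (fst x) (fst (snd x)) (low (fst (snd (snd x)))) (snd (snd (snd x)))"

lemma smooth_low [smooth_intros]: "open S ==> smooth S f ==> smooth S (%x. low (f x))"
 unfolding low_def
proof (intro smooth_vec, assumption+)
 fix i j assume S: "open S" "smooth S f"
 show "smooth S (%x. if j <= i then f x $ i $ j else 0)"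
  using S by (cases "j <= i") (auto intro!: smooth_vec_nth smooth_const)
qed

lemma smooth_quad:
 "smooth UNIV (%x::('n::{finite,linorder}) quad. fst x)" "smooth UNIV (%x::'n quad. fst (snd x))"
 "smooth UNIV (%x::'n quad. fst (snd (snd x)))" "smooth UNIV (%x::'n quad. snd (snd (snd x)))"
 by (intro smooth_bounded_linear open_UNIV bounded_linear_compose[OF bounded_linear_fst] bounded_linear_compose[OF bounded_linear_snd]
   bounded_linear_fst bounded_linear_snd)+

lemma smooth_Gm: "smooth UNIV Gm"
 unfolding Gm_def[abs_def] by (intro smooth_block smooth_low smooth_quad open_UNIV)

section \<open>The cutoff function\<close>

text \<open>The identity matrix has squared norm \<open>2n\<close>, so the cutoff is positive there.\<close>

definition rad :: "'n::finite itself => real" where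
 "rad _ = real (2 * CARD('n)) + 1"

text \<open>Left invariance under the orthogonal group and support in a compact part of the set of
invertible matrices are all that matters. The bounds make the cutoff positive at the identity matrix and
\<open>U = 0\<close>, where \<open>U\<close> is the dummy variable.\<close>

definition om :: "'n::finite big => 'n sq => real" where
 "om g U = bump 0 (rad TYPE('n) - g \<bullet> g) * bump 0 (det g ^ 2 - 1/2) * bump 0 (1 - U \<bullet> U)"

definition omq :: "'n::{finite,linorder} quad => real" where
 "omq x = om (Gm x) (fst (snd (snd x)) - low (fst (snd (snd x))))"

lemma smooth_bump_compose:
 fixes f :: "'a::euclidean_space => real"
 shows "open S ==> smooth S f ==> smooth S (%x. bump j (f x))"
 by (rule smooth_compose[OF _ open_UNIV _ _ smooth_bump]) auto

lemma smooth_omq: "smooth UNIV omq"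
 unfolding omq_def[abs_def] om_def
 by (intro smooth_mult smooth_bump_compose smooth_intros
   smooth_Gm smooth_low smooth_quad open_UNIV)

lemma om_left_orthogonal:
 assumes "orthogonal_matrix k" shows "om (k ** g) U = om g U"
proof -
 have "(k ** g) \<bullet> (k ** g) = g \<bullet> g"
 proof -
  have "transpose (k ** g) ** (k ** g) = transpose g ** (transpose k ** k) ** g"
   by (simp add: matrix_transpose_mul matrix_mul_assoc)
  also have "... = transpose g ** g" using assms by (simp add: orthogonal_matrix)
  finally have e: "transpose (k ** g) ** (k ** g) = transpose g ** g" .
  have t: "h \<bullet> h = (\<Sum>j\<in>UNIV. (transpose h ** h) $ j $ j)" for h :: "'a big"
   unfolding matrix_matrix_mult_def transpose_def inner_vec_def by (simp add: sum.swap[of "%i j. h $ i $ j * h $ i $ j"])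
  show ?thesis unfolding t e ..
 qed
 moreover have "det (k ** g) ^ 2 = det g ^ 2"
  using det_orthogonal_matrix[OF assms] by (auto simp: det_mul power2_eq_square)
 ultimately show ?thesis by (simp add: om_def)
qed

lemma om_nonneg: "om g U \<ge> 0" by (simp add: om_def bump_nonneg)

lemma om_det_zero: "det g ^ 2 <= 1/2 ==> om g U = 0" by (simp add: om_def bump_zero)

lemma entry_le_inner: "(X :: real^'n^'m) $ i $ j * X $ i $ j <= X \<bullet> X"
proof -
 have "\<bar>X $ i $ j\<bar> <= norm X" using component_le_norm_cart[of "X $ i" j] Finite_Cartesian_Product.norm_nth_le[of X i] by linarith
 then have "\<bar>X $ i $ j\<bar> * \<bar>X $ i $ j\<bar> <= norm X * norm X" by (intro mult_mono) auto
 then show ?thesis by (simp add: power2_norm_eq_inner[symmetric] power2_eq_square)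
qed

lemma om_bounded:
 assumes "om g U ~= 0" shows "\<bar>g $ i $ j\<bar> <= rad TYPE('n::finite)" "\<bar>(U :: 'n sq) $ k $ l\<bar> <= rad TYPE('n)"
proof -
 have r: "rad TYPE('n) \<ge> 1" by (simp add: rad_def)
 have g: "g \<bullet> g < rad TYPE('n)" "U \<bullet> U < 1"
  using assms bump_zero by (force simp: om_def not_le[symmetric])+
 have b: "\<bar>t\<bar> <= rad TYPE('n)" if "t * t <= rad TYPE('n)" for t
 proof (rule ccontr)
  assume "\<not> ?thesis"
  then have lt: "\<bar>t\<bar> > rad TYPE('n)" by simp
  then have "\<bar>t\<bar> * \<bar>t\<bar> > rad TYPE('n) * 1" using r by (intro mult_strict_mono') auto
  then show False using that by simp
 qed
 show "\<bar>g $ i $ j\<bar> <= rad TYPE('n)" by (rule b) (use entry_le_inner[of g i j] g in linarith)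
 show "\<bar>U $ k $ l\<bar> <= rad TYPE('n)" by (rule b) (use entry_le_inner[of U k l] g r in linarith)
qed

text \<open>The cutoff vanishes where a coordinate exceeds \<open>RR - 1\<close> in absolute value; the remaining
strip is the margin required by \<open>van\<close>.\<close>

definition RR :: "'n::finite itself => real" where "RR _ = rad TYPE('n) + 2"

lemma Basis_quad: "(e :: ('n::{finite,linorder}) quad) \<in> Basis ==>
 (\<exists>i j. e = (elem i j, 0, 0, 0) \<or> e = (0, elem i j, 0, 0) \<or> e = (0, 0, elem i j, 0) \<or> e = (0, 0, 0, elem i j))"
 by (auto simp: Basis_prod_def Basis_matrix zero_prod_def)

lemma van_omq:
 fixes \<phi> :: "('n::{finite,linorder}) quad => complex"
 assumes "!!x. omq x = 0 ==> \<phi> x = 0" "e \<in> Basis"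
 shows "van (RR TYPE('n)) e \<phi>"
 unfolding van_def
proof (intro allI impI)
 fix x :: "'n quad" assume x: "\<bar>x \<bullet> e\<bar> > RR TYPE('n) - 1"
 obtain A B D E where xx: "x = (A, B, D, E)" by (metis prod.collapse)
 have "omq x = 0"
 proof (rule ccontr)
  assume nz: "omq x ~= 0"
  note b = om_bounded[OF nz[unfolded omq_def]]
  obtain i j where "e = (elem i j, 0, 0, 0) \<or> e = (0, elem i j, 0, 0) \<or> e = (0, 0, elem i j, 0) \<or> e = (0, 0, 0, elem i j)"
   using Basis_quad[OF assms(2)] by blast
  then have "x \<bullet> e = A $ i $ j \<or> x \<bullet> e = B $ i $ j \<or> x \<bullet> e = D $ i $ j \<or> x \<bullet> e = E $ i $ j"
   by (auto simp: xx inner_elem)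
  moreover have "\<bar>A $ i $ j\<bar> <= rad TYPE('n)" "\<bar>B $ i $ j\<bar> <= rad TYPE('n)" "\<bar>E $ i $ j\<bar> <= rad TYPE('n)"
   using b(1)[of "Inl i" "Inl j"] b(1)[of "Inl i" "Inr j"] b(1)[of "Inr i" "Inr j"] by (simp_all add: Gm_def xx)
  moreover have "\<bar>D $ i $ j\<bar> <= rad TYPE('n)"
   using b(1)[of "Inr i" "Inl j"] b(2)[of i j] by (cases "j <= i") (simp_all add: Gm_def xx low_nth)
  ultimately have "\<bar>x \<bullet> e\<bar> <= rad TYPE('n)" by auto
  then show False using x by (simp add: RR_def)
 qed
 then show "\<phi> x = 0" by (rule assms(1))
qed

section \<open>The corner embedding\<close>

lemma Rep_corner_neq: "Rep_corner c ~= Inr last_idx"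
 using Rep_corner[of c] by auto

lemma Abs_corner_Rep: "i ~= Inr last_idx ==> Rep_corner (Abs_corner i) = i"
 by (rule Abs_corner_inverse) simp

lemma sum_corner:
 "(\<Sum>c\<in>(UNIV :: ('n::{finite,linorder}) corner set). f (Rep_corner c)) = (\<Sum>k\<in>UNIV - {Inr last_idx}. f k)"
proof (rule sum.reindex_bij_betw)
 show "bij_betw Rep_corner UNIV (UNIV - {Inr last_idx :: 'n + 'n})"
  unfolding bij_betw_def
  using type_definition.Rep_range[OF type_definition_corner] by (auto simp: inj_def Rep_corner_inject)
qed

lemma embed_nth:
 "embed_corner h $ i $ j = (if i = Inr last_idx \<or> j = Inr last_idx then (if i = j then 1 else 0) else h $ Abs_corner i $ Abs_corner j)"
 by (simp add: embed_corner_def)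

lemma embed_mult: "embed_corner (g ** h) = embed_corner g ** embed_corner h"
proof -
 have "(embed_corner g ** embed_corner h) $ i $ j = embed_corner (g ** h) $ i $ j" for i j
 proof -
  let ?L = "Inr last_idx :: 'a + 'a"
  have "(embed_corner g ** embed_corner h) $ i $ j = embed_corner g $ i $ ?L * embed_corner h $ ?L $ j +
   (\<Sum>k\<in>UNIV - {?L}. embed_corner g $ i $ k * embed_corner h $ k $ j)"
   by (simp add: matrix_matrix_mult_def sum.remove[of _ ?L])
  also have "(\<Sum>k\<in>UNIV - {?L}. embed_corner g $ i $ k * embed_corner h $ k $ j) =
   (\<Sum>c\<in>UNIV. embed_corner g $ i $ Rep_corner c * embed_corner h $ Rep_corner c $ j)"
   by (rule sum_corner[symmetric])
  also have "embed_corner g $ i $ ?L * embed_corner h $ ?L $ j + ... = embed_corner (g ** h) $ i $ j"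
   by (auto simp: embed_nth Rep_corner_neq Rep_corner_inverse matrix_matrix_mult_def intro!: sum.neutral)
    (auto simp: Rep_corner_neq Rep_corner_neq[symmetric])
  finally show ?thesis .
 qed
 then show ?thesis by (simp add: vec_eq_iff)
qed

lemma embed_mat_1: "embed_corner (mat 1) = mat 1"
proof -
 have "Abs_corner i = Abs_corner j \<longleftrightarrow> i = j" if "i ~= Inr last_idx" "j ~= Inr last_idx" for i j :: "'a + 'a"
  by (rule Abs_corner_inject) (use that in auto)
 then show ?thesis by (simp add: vec_eq_iff embed_nth mat_def)
qed

lemma invertible_embed: "invertible h ==> invertible (embed_corner h)"
 by (metis embed_mat_1 embed_mult invertibleI(1) matrix_inv_both(1))

lemma matrix_inv_embed: "invertible h ==> matrix_inv (embed_corner h) = embed_corner (matrix_inv h)"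
 by (rule matrix_inv_eqI) (simp add: embed_mult[symmetric] matrix_inv_both embed_mat_1)

lemma smooth_embed [smooth_intros]:
 fixes f :: "'a::real_normed_vector => ('n::{finite,linorder}) cor"
 assumes "open S" "smooth S f" shows "smooth S (%x. embed_corner (f x))"
 unfolding embed_corner_def
proof (intro smooth_vec assms(1))
 fix i j :: "'n + 'n"
 show "smooth S (%x. if i = Inr last_idx \<or> j = Inr last_idx then if i = j then 1 else 0 else f x $ Abs_corner i $ Abs_corner j)"
  by (cases "i = Inr last_idx \<or> j = Inr last_idx") (auto intro!: smooth_vec_nth smooth_const assms)
qed

section \<open>Principal minors\<close>

lemma principal_minor_cong:
 assumes "!!i j. i \<in> S ==> j \<in> S ==> A $ i $ j = B $ i $ j"
 shows "principal_minor S A = principal_minor S B"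
 unfolding principal_minor_def
proof (rule sum.cong[OF refl])
 fix p assume "p \<in> {p. p permutes S}"
 then have "p i \<in> S" if "i \<in> S" for i using permutes_in_image[of p S] that by simp
 then have "(\<Prod>i\<in>S. A $ i $ p i) = (\<Prod>i\<in>S. B $ i $ p i)" by (intro prod.cong refl assms)
 then show "of_int (sign p) * (\<Prod>i\<in>S. A $ i $ p i) = of_int (sign p) * (\<Prod>i\<in>S. B $ i $ p i)" by simp
qed

lemma principal_minor_singleton [simp]: "principal_minor {i} A = A $ i $ i"
proof -
 have "{p. p permutes {i}} = {id}" by (auto simp: permutes_sing)
 then show ?thesis by (simp add: principal_minor_def)
qed

text \<open>A permutation with nonzero contribution preserves both sets and is a product of permutations
of \<open>S\<close> and \<open>T\<close>.\<close>

lemma principal_minor_block: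
 fixes A :: "real^'m^'m"
 assumes disj: "S \<inter> T = {}" and z: "!!i j. i \<in> T ==> j \<in> S ==> A $ i $ j = 0"
 shows "principal_minor (S \<union> T) A = principal_minor S A * principal_minor T A"
proof -
 let ?t = "%p. of_int (sign p) * (\<Prod>i\<in>S \<union> T. A $ i $ p i)"
 let ?c = "%(p, q). p \<circ> q"
 let ?P = "{p. p permutes S} \<times> {q. q permutes T}"
 have fin: "finite S" "finite T" by simp_all
 have inj: "inj_on ?c ?P"
 proof (rule inj_onI, clarsimp)
  fix p q p' q' assume *: "p permutes S" "q permutes T" "p' permutes S" "q' permutes T" "p \<circ> q = p' \<circ> q'"
  have q: "q x = x" "q' x = x" if "x \<in> S" for x using * disj that permutes_not_in by (metis disjoint_iff)+
  have p: "p (q x) = q x" "p' (q' x) = q' x" if "x \<in> T" for x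
   using * disj that permutes_not_in permutes_in_image by (metis disjoint_iff)+
  have "p x = p' x" for x
   using fun_cong[OF *(5), of x] q permutes_not_in[OF *(1)] permutes_not_in[OF *(3)] by (cases "x \<in> S") auto
  moreover have "q x = q' x" for x
   using fun_cong[OF *(5), of x] p permutes_not_in[OF *(2)] permutes_not_in[OF *(4)] by (cases "x \<in> T") auto
  ultimately show "p = p' & q = q'" by auto
 qed
 have "principal_minor (S \<union> T) A = (\<Sum>p\<in>?c ` ?P. ?t p)"
  unfolding principal_minor_def
 proof (rule sum.mono_neutral_right)
  show "finite {p. p permutes S \<union> T}" by (simp add: finite_permutations)
  show "?c ` ?P \<subseteq> {p. p permutes S \<union> T}"
   by (auto intro!: permutes_compose elim: permutes_subset)
  show "\<forall>p\<in>{p. p permutes S \<union> T} - ?c ` ?P. ?t p = 0"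
  proof
   fix p assume p: "p \<in> {p. p permutes S \<union> T} - ?c ` ?P"
   have pp: "p permutes S \<union> T" using p by simp
   show "?t p = 0"
   proof (cases "\<exists>i\<in>T. p i \<in> S")
    case True
    then have "(\<Prod>i\<in>S \<union> T. A $ i $ p i) = 0" using z by (intro prod_zero) auto
    then show ?thesis by simp
   next
    case False
    then have "p ` T \<subseteq> T" using permutes_in_image[OF pp] by blast
    then have T: "bij_betw p T T"
     using permutes_inj_on[OF pp] endo_inj_surj[of T p] by (auto simp: bij_betw_def)
    have "p ` S \<subseteq> S"
    proof
     fix y assume "y \<in> p ` S"
     then obtain x where x: "x \<in> S" "y = p x" by blast
     have "y \<notin> T"
     proof
      assume "y \<in> T"
      then obtain x' where "x' \<in> T" "y = p x'" using T by (auto simp: bij_betw_def)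
      then show False using x disj permutes_inj[OF pp] by (auto simp: inj_eq)
     qed
     then show "y \<in> S" using x permutes_in_image[OF pp, of x] by auto
    qed
    then have S: "bij_betw p S S"
     using permutes_inj_on[OF pp] endo_inj_surj[of S p] by (auto simp: bij_betw_def)
    let ?p = "restrict_id p S" and ?q = "restrict_id p T"
    have "?p permutes S" "?q permutes T" by (rule permutes_restrict_id[OF S], rule permutes_restrict_id[OF T])
    moreover have "p = ?p \<circ> ?q"
    proof
     fix x
     show "p x = (?p \<circ> ?q) x"
      using T disj permutes_not_in[OF pp, of x] by (auto simp: restrict_id_def bij_betw_def)
    qed
    ultimately have "p \<in> ?c ` ?P" by (intro image_eqI[where x="(?p, ?q)"]) auto
    then show ?thesis using p by blast
   qed
  qed
 qed
 also have "... = (\<Sum>(p, q)\<in>?P. ?t (p \<circ> q))"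
  by (subst sum.reindex[OF inj]) (simp add: o_def case_prod_unfold)
 also have "... = (\<Sum>(p, q)\<in>?P. (of_int (sign p) * (\<Prod>i\<in>S. A $ i $ p i)) * (of_int (sign q) * (\<Prod>i\<in>T. A $ i $ q i)))"
 proof (rule sum.cong[OF refl], clarsimp)
  fix p q assume p: "p permutes S" and q: "q permutes T"
  have "(\<Prod>i\<in>S \<union> T. A $ i $ p (q i)) = (\<Prod>i\<in>S. A $ i $ p (q i)) * (\<Prod>i\<in>T. A $ i $ p (q i))"
   by (rule prod.union_disjoint[OF fin disj])
  also have "(\<Prod>i\<in>S. A $ i $ p (q i)) = (\<Prod>i\<in>S. A $ i $ p i)"
  proof (rule prod.cong[OF refl])
   fix i assume "i \<in> S"
   then have "i \<notin> T" using disj by blast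
   then show "A $ i $ p (q i) = A $ i $ p i" by (simp add: permutes_not_in[OF q])
  qed
  also have "(\<Prod>i\<in>T. A $ i $ p (q i)) = (\<Prod>i\<in>T. A $ i $ q i)"
  proof (rule prod.cong[OF refl])
   fix i assume "i \<in> T"
   then have "q i \<notin> S" using disj permutes_in_image[OF q, of i] by blast
   then show "A $ i $ p (q i) = A $ i $ q i" by (simp add: permutes_not_in[OF p])
  qed
  finally show "of_int (sign (p \<circ> q)) * (\<Prod>i\<in>S \<union> T. A $ i $ p (q i)) =
   of_int (sign p) * (\<Prod>i\<in>S. A $ i $ p i) * (of_int (sign q) * (\<Prod>i\<in>T. A $ i $ q i))"
   using sign_compose[OF permutes_imp_permutation[OF fin(1) p] permutes_imp_permutation[OF fin(2) q]]
   by simp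
 qed
 also have "... = principal_minor S A * principal_minor T A"
  by (simp add: principal_minor_def sum_product sum.cartesian_product)
 finally show ?thesis .
qed

lemma principal_minor_reindex:
 fixes A :: "real^'m^'m" and f :: "'k::finite => 'm"
 assumes f: "bij_betw f S T"
 shows "principal_minor T A = principal_minor S (\<chi> i j. A $ f i $ f j)"
proof -
 have bij: "bij_betw (map_permutation S f) {p. p permutes S} {p. p permutes T}"
 proof (rule bij_betw_byWitness[where f'="map_permutation T (inv_into S f)"])
  show "\<forall>p\<in>{p. p permutes S}. map_permutation T (inv_into S f) (map_permutation S f p) = p"
  proof clarify
   fix p assume "p permutes S"
   with f show "map_permutation T (inv_into S f) (map_permutation S f p) = p"
    by (rule map_permutation_compose_inv) (use f in "auto simp: bij_betw_def")
  qed
  show "\<forall>p\<in>{p. p permutes T}. map_permutation S f (map_permutation T (inv_into S f) p) = p"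
  proof clarify
   fix p assume "p permutes T"
   with bij_betw_inv_into[OF f] show "map_permutation S f (map_permutation T (inv_into S f) p) = p"
    by (rule map_permutation_compose_inv) (use f in "auto simp: bij_betw_def f_inv_into_f")
  qed
  show "map_permutation S f ` {p. p permutes S} \<subseteq> {p. p permutes T}"
   using map_permutation_permutes[OF f] by auto
  show "map_permutation T (inv_into S f) ` {p. p permutes T} \<subseteq> {p. p permutes S}"
   using map_permutation_permutes[OF bij_betw_inv_into[OF f]] by auto
 qed
 have inj: "inj_on f S" using f by (simp add: bij_betw_def)
 have "principal_minor T A = (\<Sum>p | p permutes S. of_int (sign (map_permutation S f p)) * (\<Prod>i\<in>T. A $ i $ map_permutation S f p i))"
  unfolding principal_minor_def by (rule sum.reindex_bij_betw[OF bij, symmetric])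
 also have "... = (\<Sum>p | p permutes S. of_int (sign p) * (\<Prod>i\<in>S. A $ f i $ f (p i)))"
 proof (rule sum.cong[OF refl])
  fix p assume "p \<in> {p. p permutes S}"
  then have p: "p permutes S" by simp
  have "(\<Prod>i\<in>T. A $ i $ map_permutation S f p i) = (\<Prod>i\<in>S. A $ f i $ map_permutation S f p (f i))"
   by (rule prod.reindex_bij_betw[OF f, symmetric])
  also have "... = (\<Prod>i\<in>S. A $ f i $ f (p i))"
   by (intro prod.cong refl) (simp add: map_permutation_apply[OF inj])
  finally show "of_int (sign (map_permutation S f p)) * (\<Prod>i\<in>T. A $ i $ map_permutation S f p i) =
   of_int (sign p) * (\<Prod>i\<in>S. A $ f i $ f (p i))"
   using sign_map_permutation[OF inj p] by simp
 qed
 finally show ?thesis by (simp add: principal_minor_def)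
qed

lemma principal_minor_b11: "principal_minor (range Inl) g = det (b11 g)"
 and principal_minor_b22: "principal_minor (range Inr) g = det (b22 g)"
 unfolding principal_minor_UNIV[symmetric] b11_def b22_def
 by (rule principal_minor_reindex; simp add: bij_betw_def)+

lemma range_Inl_Inr: "range Inl \<union> range Inr = UNIV" "range Inl \<inter> range Inr = {}"
 by (auto simp: UNIV_sum)

lemma det_block_upper:
 assumes "b21 g = 0" shows "det g = det (b11 g) * det (b22 g)"
proof -
 have "g $ Inr i $ Inl j = 0" for i j using arg_cong[OF assms, of "%A. A $ i $ j"] by (simp add: b21_def)
 then have "principal_minor (range Inl \<union> range Inr) g = principal_minor (range Inl) g * principal_minor (range Inr) g"
  by (intro principal_minor_block range_Inl_Inr) auto
 then show ?thesis by (simp only: range_Inl_Inr principal_minor_UNIV principal_minor_b11 principal_minor_b22)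
qed

lemma minor_inverse:
 fixes X :: "('n::{finite,linorder}) sq"
 assumes "invertible X"
 shows "principal_minor (- {l}) X = det X * matrix_inv X $ l $ l"
proof -
 let ?Z = "(\<chi> i j. if j = l then axis l 1 $ i else X $ i $ j) :: 'n sq"
 have "det ?Z = principal_minor ({l} \<union> - {l}) ?Z"
  by (simp add: principal_minor_UNIV[symmetric])
 also have "... = principal_minor {l} ?Z * principal_minor (- {l}) ?Z"
  by (rule principal_minor_block) (auto simp: axis_def)
 also have "principal_minor (- {l}) ?Z = principal_minor (- {l}) X"
  by (rule principal_minor_cong) auto
 finally have "det ?Z = principal_minor (- {l}) X" by simp
 then show ?thesis using matrix_inv_nth[OF assms, of l l] assms by (simp add: invertible_det_nz)
qed

section \<open>The open cell\<close>

text \<open>For \<open>X = Y^(-1)\<close> the matrix \<open>(1, 0; X, 1)\<close> equals \<open>gY Y\<close> times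
\<open>(X, 1; 0, Y)\<close>.\<close>

definition gY :: "('n::finite) sq => 'n big" where
 "gY Y = block_matrix Y (- mat 1) (mat 1) 0"

lemma matrix_minus_mult: "(- A) ** B = - (A ** B)" for A :: "real^'n^'m" and B :: "real^'k^'n"
 by (simp add: matrix_matrix_mult_def vec_eq_iff sum_negf)

text \<open>The product of three unipotent factors below is the matrix \<open>(0, -1; 1, 0)\<close>.\<close>

lemma det_gY: "det (gY Y) = 1"
proof -
 let ?J = "block_matrix 0 (- mat 1) (mat 1) 0 :: 'a big"
 let ?U = "block_matrix (mat 1) (- mat 1) 0 (mat 1) :: 'a big" and ?L = "block_matrix (mat 1) 0 (mat 1) (mat 1) :: 'a big"
 have "transpose ?L = block_matrix (mat 1) (mat 1) 0 (mat 1)"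
  by (simp add: vec_sum_eq_iff transpose_def mat_def)
 then have "det ?L = 1" using det_block_upper[of "transpose ?L"] det_transpose[of ?L] by simp
 moreover have "det ?U = 1" using det_block_upper[of ?U] by simp
 moreover have "?J = ?U ** ?L ** ?U" by (simp add: block_mult)
 ultimately have J: "det ?J = 1" by (simp add: det_mul)
 have "gY Y = block_matrix (mat 1) Y 0 (mat 1) ** ?J" by (simp add: gY_def block_mult matrix_mult_minus)
 then show ?thesis using J det_block_upper[of "block_matrix (mat 1) Y 0 (mat 1)"] by (simp add: det_mul)
qed

lemma invertible_gY: "invertible (gY Y)" by (simp add: invertible_det_nz det_gY)

lemma block_gY: "gY Y ** block_matrix L E 0 Q = block_matrix (Y ** L) (Y ** E - Q) L E"
 by (simp add: gY_def block_mult matrix_minus_mult)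

section \<open>Minors of block upper triangular elements\<close>

lemma principal_minor_corner:
 "principal_minor S p = principal_minor (Rep_corner ` S) (embed_corner p)"
proof -
 have "principal_minor (Rep_corner ` S) (embed_corner p) = principal_minor S (\<chi> i j. embed_corner p $ Rep_corner i $ Rep_corner j)"
  by (rule principal_minor_reindex) (auto simp: bij_betw_def inj_on_def Rep_corner_inject)
 then show ?thesis by (simp add: embed_nth Rep_corner_neq Rep_corner_inverse)
qed

lemma set_sum_eqI:
 "(!!a. Inl a \<in> A \<longleftrightarrow> Inl a \<in> B) ==> (!!b. Inr b \<in> A \<longleftrightarrow> Inr b \<in> B) ==> A = B"
 by (rule set_eqI) (metis sum.exhaust)

lemma Rep_corner_image: "Rep_corner ` {c. P (Rep_corner c)} = {i. i ~= Inr last_idx & P i}"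
proof -
 have "i \<in> Rep_corner ` {c. P (Rep_corner c)}" if "i ~= Inr last_idx" "P i" for i
  using that by (intro image_eqI[where x="Abs_corner i"]) (simp_all add: Abs_corner_Rep)
 then show ?thesis using Rep_corner_neq by auto
qed

definition block_of :: "('n::{finite,linorder}) + 'n => nat" where
 "block_of i = (case i of Inl j => (if j = last_idx then 1 else 0) | Inr j => 2)"

lemma corner_block_eq: "corner_block c = block_of (Rep_corner c)"
 by (simp add: corner_block_def block_of_def)

context
 fixes p :: "('n::{finite,linorder}) cor"
 assumes upper: "\<forall>i j. corner_block j < corner_block i --> p $ i $ j = 0"
begin

lemma embed_upper:
 "i ~= Inr last_idx ==> j ~= Inr last_idx ==> block_of j < block_of i ==> embed_corner p $ i $ j = 0"
 using upper by (simp add: embed_nth corner_block_eq Abs_corner_Rep)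

lemma embed_b21: "b21 (embed_corner p) = 0"
proof -
 have "embed_corner p $ Inr i $ Inl j = 0" for i j
 proof (cases "i = last_idx")
  case False
  then show ?thesis by (intro embed_upper) (auto simp: block_of_def)
 qed (simp add: embed_nth)
 then show ?thesis by (simp add: b21_def vec_eq_iff)
qed

lemma embed_last_row: "j ~= last_idx ==> embed_corner p $ Inl last_idx $ Inl j = 0"
 by (rule embed_upper) (auto simp: block_of_def)

lemma corner_minors:
 "principal_minor {i. corner_block i = 1} p = embed_corner p $ Inl last_idx $ Inl last_idx"
 "det (b11 (embed_corner p)) = principal_minor {i. corner_block i = 0} p * principal_minor {i. corner_block i = 1} p"
 "det (b22 (embed_corner p)) = principal_minor {i. corner_block i = 2} p"
proof -
 let ?P = "embed_corner p"
 let ?S = "%k. {i. i ~= Inr last_idx & block_of i = k} :: ('n + 'n) set"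
 have pm: "principal_minor {i. corner_block i = k} p = principal_minor (?S k) ?P" for k
  unfolding principal_minor_corner corner_block_eq Rep_corner_image[of "%i. block_of i = k"] ..
 have S: "?S 0 = Inl ` (- {last_idx})" "?S 1 = {Inl last_idx}" "?S 2 = Inr ` (- {last_idx})"
  by (rule set_sum_eqI; auto simp: block_of_def split: if_splits)+
 show "principal_minor {i. corner_block i = 1} p = ?P $ Inl last_idx $ Inl last_idx"
  by (simp only: pm S principal_minor_singleton)
 have "range (Inl :: 'n => 'n + 'n) = ?S 0 \<union> ?S 1" unfolding S by auto
 then have "det (b11 ?P) = principal_minor (?S 0 \<union> ?S 1) ?P" by (simp only: principal_minor_b11[symmetric])
 also have "... = principal_minor (?S 0) ?P * principal_minor (?S 1) ?P"
  by (rule principal_minor_block) (auto intro: embed_upper)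
 finally show "det (b11 ?P) = principal_minor {i. corner_block i = 0} p * principal_minor {i. corner_block i = 1} p"
  by (simp only: pm)
 have "range (Inr :: 'n => 'n + 'n) = ?S 2 \<union> {Inr last_idx}" unfolding S by auto
 then have "det (b22 ?P) = principal_minor (?S 2 \<union> {Inr last_idx}) ?P" by (simp only: principal_minor_b22[symmetric])
 also have "... = principal_minor (?S 2) ?P * principal_minor {Inr last_idx} ?P"
  by (rule principal_minor_block) (auto simp: embed_nth)
 finally show "det (b22 ?P) = principal_minor {i. corner_block i = 2} p"
  by (simp add: pm embed_nth)
qed

end

section \<open>Characters of the multiplicative group\<close>

lemma sgn_powr_zero [simp]: "sgn_powr e m 0 = 0"
 by (simp add: sgn_powr_def)

lemma sgn_powr_one [simp]: "sgn_powr e m 1 = 1"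
 by (simp add: sgn_powr_def)

lemma sgn_powr_mult: "sgn_powr e m (x * y) = sgn_powr e m x * sgn_powr e m y"
 by (simp add: sgn_powr_def sgn_mult abs_mult power_mult_distrib powr_times_real)

lemma sgn_powr_inverse: "sgn_powr e m (inverse x) = inverse (sgn_powr e m x)"
proof (cases "x = 0")
 case False
 then have "sgn_powr e m (inverse x) * sgn_powr e m x = 1" by (simp flip: sgn_powr_mult)
 then show ?thesis by (metis inverse_unique mult.commute)
qed simp

lemma sgn_powr_prod: "finite I ==> sgn_powr e m (\<Prod>i\<in>I. x i) = (\<Prod>i\<in>I. sgn_powr e m (x i))"
 by (induction I rule: finite_induct) (simp_all add: sgn_powr_mult)

lemma sgn_powr_add:
 assumes "x ~= 0"
 shows "sgn_powr e m x * sgn_powr e' m' x = sgn_powr (e + e') (m + m') x"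
proof -
 have "complex_of_real (sgn x) ^ of_bit e * of_real (sgn x) ^ of_bit e' = of_real (sgn x) ^ of_bit (e + e')"
  using assms by (cases e; cases e') (auto simp: sgn_if)
 then show ?thesis using assms by (simp add: sgn_powr_def powr_add)
qed

lemma sgn_powr_nat: "x ~= 0 ==> sgn_powr 0 (of_nat k) x = of_real (\<bar>x\<bar> ^ k)"
 by (simp add: sgn_powr_def powr_nat' flip: of_real_power)

lemma sgn_powr_uminus: "sgn_powr e (- m) x = inverse (sgn_powr e m x)"
 by (simp add: sgn_powr_def powr_minus sgn_if)

lemma sgn_powr_neg_nat: "x ~= 0 ==> sgn_powr 0 (- of_nat k) x = of_real (inverse (\<bar>x\<bar> ^ k))"
 by (simp add: sgn_powr_uminus sgn_powr_nat)

lemma sgn_powr_nonzero: "x ~= 0 ==> sgn_powr e m x ~= 0"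
 by (simp add: sgn_powr_def sgn_if)

lemma sgn_powr_abs_1: "\<bar>x\<bar> = 1 ==> sgn_powr e m x = sgn_powr e m' x"
 by (simp add: sgn_powr_def)

section \<open>Substitutions in one factor of a product\<close>

lemma nn_integral_lborel_pair:
 fixes f :: "'a::euclidean_space \<times> 'b::euclidean_space => ennreal"
 assumes "f \<in> borel_measurable borel"
 shows "(\<integral>\<^sup>+x. f x \<partial>lborel) = (\<integral>\<^sup>+a. \<integral>\<^sup>+r. f (a, r) \<partial>lborel \<partial>lborel)"
  and "(\<integral>\<^sup>+x. f x \<partial>lborel) = (\<integral>\<^sup>+r. \<integral>\<^sup>+a. f (a, r) \<partial>lborel \<partial>lborel)"
proof -
 have m: "f \<in> borel_measurable (lborel \<Otimes>\<^sub>M lborel)" using assms by (simp add: lborel_prod)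
 show "(\<integral>\<^sup>+x. f x \<partial>lborel) = (\<integral>\<^sup>+a. \<integral>\<^sup>+r. f (a, r) \<partial>lborel \<partial>lborel)"
  using lborel.nn_integral_fst[OF m] by (simp add: lborel_prod)
 show "(\<integral>\<^sup>+x. f x \<partial>lborel) = (\<integral>\<^sup>+r. \<integral>\<^sup>+a. f (a, r) \<partial>lborel \<partial>lborel)"
  using lborel_pair.nn_integral_snd[OF m] by (simp add: lborel_prod)
qed

lemma measurable_nn_integral_slice:
 fixes f :: "'a::euclidean_space \<times> 'b::euclidean_space => ennreal"
 assumes "f \<in> borel_measurable borel"
 shows "(%a. \<integral>\<^sup>+r. f (a, r) \<partial>lborel) \<in> borel_measurable borel"
  and "(%r. \<integral>\<^sup>+a. f (a, r) \<partial>lborel) \<in> borel_measurable borel"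
  and "(%a. f (a, r)) \<in> borel_measurable borel" and "(%r. f (a, r)) \<in> borel_measurable borel"
proof -
 have m[measurable]: "f \<in> borel_measurable (borel \<Otimes>\<^sub>M borel)" using assms by (simp add: borel_prod)
 show "(%a. \<integral>\<^sup>+r. f (a, r) \<partial>lborel) \<in> borel_measurable borel"
  "(%r. \<integral>\<^sup>+a. f (a, r) \<partial>lborel) \<in> borel_measurable borel"
  "(%a. f (a, r)) \<in> borel_measurable borel" "(%r. f (a, r)) \<in> borel_measurable borel"
  by measurable
qed

lemma scales_prod:
 fixes L :: "'a::euclidean_space => 'a" and M :: "'a => 'b::euclidean_space => 'b"
 assumes L: "scales L c" and M: "!!a. scales (M a) d" and m: "(%x. M (fst x) (snd x)) \<in> borel_measurable borel"
 shows "scales (%x. (L (fst x), M (fst x) (snd x))) (c * d)"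
 unfolding scales_def
proof (intro conjI ballI)
 show "c * d > 0" using scales_pos[OF L] scales_pos[OF M] by simp
 have fs: "(fst :: 'a \<times> 'b => 'a) \<in> borel_measurable borel"
  by (intro borel_measurable_continuous_onI continuous_on_fst continuous_on_id)
 show meas: "(%x. (L (fst x), M (fst x) (snd x))) \<in> borel_measurable borel"
  by (intro borel_measurable_Pair m measurable_compose[OF fs scales_measurable[OF L]])
 fix f :: "'a \<times> 'b => ennreal" assume f: "f \<in> borel_measurable borel"
 have "(\<integral>\<^sup>+x. f (L (fst x), M (fst x) (snd x)) \<partial>lborel) = (\<integral>\<^sup>+a. \<integral>\<^sup>+r. f (L a, M a r) \<partial>lborel \<partial>lborel)"
  using nn_integral_lborel_pair(1)[OF measurable_compose[OF meas f]] by simp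
 then have "ennreal d * (\<integral>\<^sup>+x. f (L (fst x), M (fst x) (snd x)) \<partial>lborel) =
   (\<integral>\<^sup>+a. ennreal d * (\<integral>\<^sup>+r. f (L a, M a r) \<partial>lborel) \<partial>lborel)"
  using measurable_nn_integral_slice(1)[OF measurable_compose[OF meas f]] by (simp add: nn_integral_cmult)
 also have "... = (\<integral>\<^sup>+a. (\<integral>\<^sup>+r. f (L a, r) \<partial>lborel) \<partial>lborel)"
  by (intro nn_integral_cong scales_nn_integral[OF M] measurable_nn_integral_slice(4)[OF f])
 finally have "ennreal (c * d) * (\<integral>\<^sup>+x. f (L (fst x), M (fst x) (snd x)) \<partial>lborel) =
  ennreal c * (\<integral>\<^sup>+a. (\<integral>\<^sup>+r. f (L a, r) \<partial>lborel) \<partial>lborel)"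
  using scales_pos[OF L] scales_pos[OF M] by (simp add: ennreal_mult mult.assoc)
 also have "... = (\<integral>\<^sup>+a. (\<integral>\<^sup>+r. f (a, r) \<partial>lborel) \<partial>lborel)"
  by (rule scales_nn_integral[OF L measurable_nn_integral_slice(1)[OF f]])
 finally show "ennreal (c * d) * (\<integral>\<^sup>+x. f (L (fst x), M (fst x) (snd x)) \<partial>lborel) = (\<integral>\<^sup>+x. f x \<partial>lborel)"
  by (simp add: nn_integral_lborel_pair(1)[OF f])
qed

lemma scales_shear:
 fixes M :: "'b::euclidean_space => 'a::euclidean_space => 'a"
 assumes M: "!!r. scales (M r) d" and m: "(%x. M (snd x) (fst x)) \<in> borel_measurable borel"
 shows "scales (%x. (M (snd x) (fst x), snd x)) d"
 unfolding scales_def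
proof (intro conjI ballI)
 show "d > 0" using scales_pos[OF M] .
 show meas: "(%x. (M (snd x) (fst x), snd x)) \<in> borel_measurable borel"
  by (intro borel_measurable_Pair m borel_measurable_continuous_onI continuous_on_snd continuous_on_id)
 fix f :: "'a \<times> 'b => ennreal" assume f: "f \<in> borel_measurable borel"
 have "(\<integral>\<^sup>+x. f (M (snd x) (fst x), snd x) \<partial>lborel) = (\<integral>\<^sup>+r. \<integral>\<^sup>+a. f (M r a, r) \<partial>lborel \<partial>lborel)"
  using nn_integral_lborel_pair(2)[OF measurable_compose[OF meas f]] by simp
 then have "ennreal d * (\<integral>\<^sup>+x. f (M (snd x) (fst x), snd x) \<partial>lborel) =
   (\<integral>\<^sup>+r. ennreal d * (\<integral>\<^sup>+a. f (M r a, r) \<partial>lborel) \<partial>lborel)"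
  using measurable_nn_integral_slice(2)[OF measurable_compose[OF meas f]] by (simp add: nn_integral_cmult)
 also have "... = (\<integral>\<^sup>+r. (\<integral>\<^sup>+a. f (a, r) \<partial>lborel) \<partial>lborel)"
  by (intro nn_integral_cong scales_nn_integral[OF M] measurable_nn_integral_slice(3)[OF f])
 finally show "ennreal d * (\<integral>\<^sup>+x. f (M (snd x) (fst x), snd x) \<partial>lborel) = (\<integral>\<^sup>+x. f x \<partial>lborel)"
  by (simp add: nn_integral_lborel_pair(2)[OF f])
qed

lemma scales_id: "scales (%x::'a::euclidean_space. x) 1"
 using scales_translate[of "0::'a"] by simp

lemma smooth_measurable: "smooth UNIV f ==> f \<in> borel_measurable borel"
 by (intro borel_measurable_continuous_onI smooth_continuous)

section \<open>The fibre integral\<close>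

type_synonym 'n tri = "'n sq \<times> 'n sq \<times> 'n sq"

definition gq :: "('n::{finite,linorder}) tri => 'n big" where
 "gq s = block_matrix (low (fst (snd s))) (snd (snd s)) 0 (fst s)"

text \<open>The density of a left Haar measure on the group of block matrices \<open>(L, E; 0, Q)\<close> with
\<open>L\<close> lower triangular.\<close>

definition wq :: "('n::{finite,linorder}) tri => real" where
 "wq s = inverse (\<bar>det (fst s)\<bar> ^ CARD('n) * \<bar>det (low (fst (snd s)))\<bar> ^ CARD('n) *
  (\<Prod>i\<in>UNIV. \<bar>fst (snd s) $ i $ i\<bar> ^ card {j. j <= i}))"

definition omt :: "('n::{finite,linorder}) big => 'n tri => real" where
 "omt g s = wq s * om (g ** gq s) (fst (snd s) - low (fst (snd s)))"

definition tri_mult :: "('n::{finite,linorder}) tri => 'n tri => 'n tri" where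
 "tri_mult s0 s = (fst s0 ** fst s, low_mult (fst (snd s0)) (fst (snd s)), snd (snd s0) ** fst s + fst (snd s0) ** snd (snd s))"

lemma smooth_tri:
 "smooth UNIV (%x::('n::{finite,linorder}) tri. fst x)" "smooth UNIV (%x::'n tri. fst (snd x))"
 "smooth UNIV (%x::'n tri. snd (snd x))"
 by (intro smooth_bounded_linear open_UNIV bounded_linear_compose[OF bounded_linear_fst] bounded_linear_compose[OF bounded_linear_snd]
   bounded_linear_fst bounded_linear_snd)+

lemma smooth_gq: "smooth UNIV gq"
 unfolding gq_def[abs_def] by (intro smooth_block smooth_low smooth_tri smooth_const open_UNIV)

lemma smooth_gY: "smooth UNIV gY"
 unfolding gY_def[abs_def] by (intro smooth_intros)

lemma smooth_om:
 fixes g :: "'a::euclidean_space => ('n::{finite,linorder}) big"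
 assumes "smooth UNIV g" "smooth UNIV U"
 shows "smooth UNIV (%x. om (g x) (U x))"
 unfolding om_def by (intro smooth_mult smooth_bump_compose smooth_intros
   assms open_UNIV)

lemma wq_nonneg: "wq s \<ge> 0" by (simp add: wq_def prod_nonneg)

lemma wq_measurable [measurable]: "wq \<in> borel_measurable borel"
proof -
 note s = smooth_measurable[OF smooth_det[OF open_UNIV smooth_tri(1)]]
  smooth_measurable[OF smooth_det[OF open_UNIV smooth_low[OF open_UNIV smooth_tri(2)]]]
  smooth_measurable[OF smooth_vec_nth[OF open_UNIV smooth_vec_nth[OF open_UNIV smooth_tri(2)]]]
 show ?thesis unfolding wq_def[abs_def]
  by (intro borel_measurable_inverse borel_measurable_times borel_measurable_power borel_measurable_abs borel_measurable_prod s)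
qed

lemma det_gq: "det (gq s) = det (low (fst (snd s))) * det (fst s)"
 by (simp add: gq_def det_block_upper)

lemma gq_tri_mult:
 assumes "is_low (fst (snd s0))"
 shows "gq (tri_mult s0 s) = block_matrix (fst (snd s0)) (snd (snd s0)) 0 (fst s0) ** gq s"
 using assms by (simp add: gq_def tri_mult_def block_mult low_low_mult add.commute)

lemma tri_invariant:
 fixes s0 :: "('n::{finite,linorder}) tri"
 assumes q: "det (fst s0) ~= 0" and l: "is_low (fst (snd s0))" and d: "det (fst (snd s0)) ~= 0"
  and F: "F \<in> borel_measurable borel"
 shows "(\<integral>\<^sup>+s. ennreal (wq s) * F (tri_mult s0 s) \<partial>lborel) = (\<integral>\<^sup>+s. ennreal (wq s) * F s \<partial>lborel)"
proof -
 obtain Q0 D0 E0 where s0: "s0 = (Q0, D0, E0)" by (metis prod.collapse)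
 have nz: "D0 $ i $ i ~= 0" for i using d l by (auto simp: s0 det_low)
 let ?c = "\<bar>det Q0\<bar> ^ CARD('n) * ((\<Prod>i\<in>UNIV. \<bar>D0 $ i $ i\<bar> ^ card {j. j <= i}) * (1 * \<bar>det D0\<bar> ^ CARD('n)))"
 have E: "scales (%E::'n sq. E0 ** Q + D0 ** E) (1 * \<bar>det D0\<bar> ^ CARD('n))" for Q :: "'n sq"
 proof -
  have "scales (%E::'n sq. D0 ** E) (\<bar>det D0\<bar> ^ CARD('n))" by (rule scales_matrix_mult_left) (use d in "simp add: s0")
  from scales_compose[OF scales_translate[of "E0 ** Q"] this] show ?thesis .
 qed
 have DE: "scales (%x. (low_mult D0 (fst x), E0 ** Q + D0 ** snd x))
   ((\<Prod>i\<in>UNIV. \<bar>D0 $ i $ i\<bar> ^ card {j. j <= i}) * (1 * \<bar>det D0\<bar> ^ CARD('n)))" for Q :: "'n sq"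
 proof (rule scales_prod[OF scales_low_mult E])
  show "is_low D0" using l by (simp add: s0)
  show "D0 $ i $ i ~= 0" for i by (rule nz)
  show "(%x::'n sq \<times> 'n sq. E0 ** Q + D0 ** snd x) \<in> borel_measurable borel"
   by (intro smooth_measurable smooth_intros
    smooth_bounded_linear bounded_linear_snd)
 qed
 have sc: "scales (%x::'n tri. (Q0 ** fst x, low_mult D0 (fst (snd x)), E0 ** fst x + D0 ** snd (snd x))) ?c"
 proof (rule scales_prod[where M="%Q x. (low_mult D0 (fst x), E0 ** Q + D0 ** snd x)", OF _ DE])
  show "scales (%X::'n sq. Q0 ** X) (\<bar>det Q0\<bar> ^ CARD('n))"
   by (rule scales_matrix_mult_left) (use q in "simp add: s0")
  have "low_mult D0 \<in> borel_measurable borel"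
   by (rule scales_measurable[OF scales_low_mult]) (use l nz in "auto simp: s0")
  then have "(%x::'n tri. low_mult D0 (fst (snd x))) \<in> borel_measurable borel"
   by (rule measurable_compose[OF smooth_measurable[OF smooth_tri(2)]])
  then show "(%x::'n tri. (low_mult D0 (fst (snd x)), E0 ** fst x + D0 ** snd (snd x))) \<in> borel_measurable borel"
   by (intro borel_measurable_Pair) (auto intro!: smooth_measurable smooth_intros smooth_tri)
 qed
 then have sc: "scales (tri_mult s0) ?c" by (simp add: tri_mult_def[abs_def] s0)
 have cpos: "?c > 0" using scales_pos[OF sc] .
 have w: "?c * wq (tri_mult s0 s) = wq s" for s
 proof -
  obtain Q D E where s: "s = (Q, D, E)" by (metis prod.collapse)
  have l0: "is_low D0" using l by (simp add: s0)
  have diag: "low_mult D0 D $ i $ i = D0 $ i $ i * D $ i $ i" for i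
  proof -
   have "low_mult D0 D $ i $ i = (\<Sum>k\<in>UNIV. D0 $ i $ k * low D $ k $ i)"
    by (simp add: low_mult_def matrix_matrix_mult_def)
   also have "... = (\<Sum>k\<in>{i}. D0 $ i $ k * low D $ k $ i)"
    by (rule sum.mono_neutral_right) (use l0 in "auto simp: is_low_def low_nth")
   finally show ?thesis by simp
  qed
  show ?thesis
   using nz q d
   by (simp add: wq_def tri_mult_def s0 s det_mul low_low_mult[OF l0] diag abs_mult power_mult_distrib prod.distrib field_simps)
 qed
 have Fw[measurable]: "(%s. ennreal (wq s) * F s) \<in> borel_measurable borel" using F by measurable
 have "(\<integral>\<^sup>+s. ennreal (wq s) * F s \<partial>lborel) = ennreal ?c * (\<integral>\<^sup>+s. ennreal (wq (tri_mult s0 s)) * F (tri_mult s0 s) \<partial>lborel)"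
  by (rule scales_nn_integral[OF sc, symmetric]) measurable
 also have "... = (\<integral>\<^sup>+s. ennreal ?c * (ennreal (wq (tri_mult s0 s)) * F (tri_mult s0 s)) \<partial>lborel)"
  by (rule nn_integral_cmult[symmetric]) (use measurable_compose[OF scales_measurable[OF sc] Fw] in simp)
 also have "... = (\<integral>\<^sup>+s. ennreal (wq s) * F (tri_mult s0 s) \<partial>lborel)"
 proof (rule nn_integral_cong)
  fix s
  have "ennreal ?c * ennreal (wq (tri_mult s0 s)) = ennreal (?c * wq (tri_mult s0 s))"
   by (rule ennreal_mult'[symmetric]) (use cpos in simp)
  then have "ennreal ?c * ennreal (wq (tri_mult s0 s)) = ennreal (wq s)" by (simp only: w)
  then show "ennreal ?c * (ennreal (wq (tri_mult s0 s)) * F (tri_mult s0 s)) = ennreal (wq s) * F (tri_mult s0 s)"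
   by (simp only: mult.assoc[symmetric])
 qed
 finally show ?thesis ..
qed

lemma om_shift_measurable:
 "(%s::('n::{finite,linorder}) tri. om (g ** gq s) (fst (snd s) - low (fst (snd s)))) \<in> borel_measurable borel"
 by (intro smooth_measurable smooth_om smooth_matrix_mult smooth_const smooth_gq smooth_diff smooth_low smooth_tri open_UNIV)

text \<open>Write \<open>g = kap g ** qpart g\<close>. The cutoff ignores the orthogonal factor, and the
triangular factor is absorbed by left translation of the Haar measure.\<close>

lemma omt_nn_integral_invariant:
 fixes g :: "('n::{finite,linorder}) big"
 assumes g: "invertible g"
 shows "(\<integral>\<^sup>+s. ennreal (omt g s) \<partial>lborel) = (\<integral>\<^sup>+(s::'n tri). ennreal (omt (mat 1) s) \<partial>lborel)"
proof -
 let ?k = "kap g" and ?q = "qpart g"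
 define s0 where "s0 = (b22 ?q, b11 ?q, b12 ?q)"
 have k: "orthogonal_matrix ?k" by (rule kap_orthogonal[OF g])
 have b21: "b21 ?q = 0" using qpart_block[OF g] by (simp add: b21_def vec_eq_iff)
 have q: "?q = block_matrix (b11 ?q) (b12 ?q) 0 (b22 ?q)" using block_eta[of ?q] b21 by simp
 have iq: "invertible ?q"
 proof -
  have "det g = det ?k * det ?q" using kap_qpart[OF g] det_mul by metis
  then show ?thesis using g by (auto simp: invertible_det_nz)
 qed
 have low: "is_low (b11 ?q)" using qpart_lower[OF g] by (simp add: is_low_def b11_def)
 have F: "(%s::'n tri. ennreal (om (gq s) (fst (snd s) - low (fst (snd s))))) \<in> borel_measurable borel"
  using measurable_compose[OF om_shift_measurable[of "mat 1"] measurable_ennreal] by simp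
 have "(\<integral>\<^sup>+s. ennreal (omt g s) \<partial>lborel) =
  (\<integral>\<^sup>+s. ennreal (wq s) * ennreal (om (gq (tri_mult s0 s)) (fst (snd (tri_mult s0 s)) - low (fst (snd (tri_mult s0 s))))) \<partial>lborel)"
 proof (rule nn_integral_cong)
  fix s :: "'n tri"
  have "om (g ** gq s) U = om (?q ** gq s) U" for U
   using om_left_orthogonal[OF k, of "?q ** gq s"] kap_qpart[OF g] by (simp add: matrix_mul_assoc)
  moreover have "?q ** gq s = gq (tri_mult s0 s)"
   using low q by (simp add: gq_tri_mult s0_def)
  moreover have "fst (snd (tri_mult s0 s)) - low (fst (snd (tri_mult s0 s))) = fst (snd s) - low (fst (snd s))"
   by (simp add: tri_mult_def upp_low_mult)
  ultimately show "ennreal (omt g s) = ennreal (wq s) * ennreal (om (gq (tri_mult s0 s)) (fst (snd (tri_mult s0 s)) - low (fst (snd (tri_mult s0 s)))))"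
   by (simp add: omt_def ennreal_mult wq_nonneg om_nonneg)
 qed
 also have "... = (\<integral>\<^sup>+(s::'n tri). ennreal (wq s) * ennreal (om (gq s) (fst (snd s) - low (fst (snd s)))) \<partial>lborel)"
 proof (rule tri_invariant[of s0 "%s. ennreal (om (gq s) (fst (snd s) - low (fst (snd s))))"])
  show "det (fst s0) ~= 0" "det (fst (snd s0)) ~= 0" "is_low (fst (snd s0))"
   using block_upper_invertible[OF iq b21] low by (auto simp: s0_def invertible_det_nz)
 qed (rule F)
 also have "... = (\<integral>\<^sup>+(s::'n tri). ennreal (omt (mat 1) s) \<partial>lborel)"
  by (intro nn_integral_cong) (simp add: omt_def ennreal_mult wq_nonneg om_nonneg)
 finally show ?thesis .
qed

lemma omt_nonneg: "omt g s \<ge> 0" by (simp add: omt_def wq_nonneg om_nonneg)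

lemma omt_measurable: "omt g \<in> borel_measurable borel"
 unfolding omt_def[abs_def] by (intro borel_measurable_times wq_measurable om_shift_measurable)

lemma open_positive_nn_integral:
 fixes f :: "'a::euclidean_space => real"
 assumes f: "f \<in> borel_measurable borel" and c: "isCont f x" "f x > 0"
 shows "(\<integral>\<^sup>+x. ennreal (f x) \<partial>lborel) > 0"
proof (rule ccontr)
 assume "\<not> ?thesis"
 then have "(\<integral>\<^sup>+x. ennreal (f x) \<partial>lborel) = 0" by simp
 then have "AE x in lborel. ennreal (f x) = 0" using f by (subst (asm) nn_integral_0_iff_AE) auto
 then have ae: "AE x in lborel. f x <= 0" by eventually_elim (simp add: ennreal_eq_0_iff)
 have "eventually (%y. f y > 0) (nhds x)" using c by (intro order_tendstoD(1)[OF _ c(2)]) (simp add: isCont_def tendsto_at_iff_tendsto_nhds)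
 then obtain e where e: "e > 0" "!!y. dist y x < e ==> f y > 0" unfolding eventually_nhds_metric by blast
 have "emeasure lborel (ball x e) = 0"
 proof -
  have "AE y in lborel. y \<notin> ball x e"
   using ae by eventually_elim (use e in "auto simp: dist_commute not_less[symmetric]")
  then show ?thesis by (subst (asm) AE_iff_measurable[of "ball x e"]) auto
 qed
 moreover have "ball x e \<notin> null_sets lborel" using open_not_negligible[of "ball x e"] e
  by (auto simp: negligible_iff_null_sets null_sets_completionI)
 ultimately show False by (auto simp: null_sets_def)
qed

text \<open>The mass of a fibre, the same for all fibres by \<open>omt_nn_integral_invariant\<close>.\<close>

definition c0 :: "('n::{finite,linorder}) itself => real" where
 "c0 _ = enn2real (\<integral>\<^sup>+s. ennreal (omt (mat 1 :: 'n big) s) \<partial>lborel)"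

lemma isCont_smooth: "smooth UNIV f ==> isCont f x"
 using smooth_continuous continuous_on_eq_continuous_at[OF open_UNIV] by blast

lemma wq_isCont:
 assumes "det (gq s) ~= 0" shows "isCont wq s"
proof -
 have nz: "det (fst s) ~= 0" "det (low (fst (snd s))) ~= 0" "fst (snd s) $ i $ i ~= 0" for i
  using assms by (auto simp: det_gq det_low_part)
 note s = isCont_smooth[OF smooth_det[OF open_UNIV smooth_tri(1)]]
  isCont_smooth[OF smooth_det[OF open_UNIV smooth_low[OF open_UNIV smooth_tri(2)]]]
  isCont_smooth[OF smooth_vec_nth[OF open_UNIV smooth_vec_nth[OF open_UNIV smooth_tri(2)]]]
 show ?thesis unfolding wq_def[abs_def]
  by (intro continuous_intros s continuous_at_within_inverse) (use nz in "auto")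
qed

lemma omt_isCont: "isCont (omt (mat 1)) s"
proof -
 have o: "smooth UNIV (%s::'a tri. om (gq s) (fst (snd s) - low (fst (snd s))))"
  by (intro smooth_om smooth_gq smooth_diff smooth_low smooth_tri open_UNIV)
 show ?thesis
 proof (cases "det (gq s) = 0")
  case False
  then show ?thesis unfolding omt_def[abs_def]
   using wq_isCont[OF False] isCont_smooth[OF o] by (auto intro!: isCont_mult)
 next
  case True
  (* Near singular matrices the cutoff vanishes, which hides the singularity of the Haar density. *)
  have d: "continuous_on UNIV (%s::'a tri. det (gq s) ^ 2)"
   by (intro smooth_continuous smooth_power smooth_det smooth_gq open_UNIV)
  have "open {s::'a tri. det (gq s) ^ 2 < 1/2}" by (intro open_Collect_less d continuous_on_const)
  then have "eventually (%s. s \<in> {s::'a tri. det (gq s) ^ 2 < 1/2}) (nhds s)" by (rule eventually_nhds_in_open) (simp add: True)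
  then have "eventually (%s. omt (mat 1) s = 0) (nhds s)"
   by eventually_elim (simp add: omt_def om_det_zero)
  then show ?thesis by (subst isCont_cong) auto
 qed
qed

lemma omt_integral:
 fixes g :: "('n::{finite,linorder}) big"
 assumes "invertible g"
 shows "(\<integral>\<^sup>+s. ennreal (omt g s) \<partial>lborel) = ennreal (c0 TYPE('n))" "c0 TYPE('n) > 0"
  "integrable lborel (omt g)" "(LINT s|lborel. omt g s) = c0 TYPE('n)"
proof -
 let ?I = "mat 1 :: 'n big"
 let ?r = "rad TYPE('n)"
 let ?S = "cball 0 (3 * (real CARD('n) * real CARD('n) * ?r)) :: 'n tri set"
 have nm: "norm X <= real CARD('n) * real CARD('n) * ?r" if "!!i j. \<bar>X $ i $ j\<bar> <= ?r" for X :: "'n sq"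
 proof -
  have "norm X <= (\<Sum>i\<in>UNIV. norm (X $ i))" by (simp add: norm_vec_def L2_set_le_sum)
  also have "... <= (\<Sum>i\<in>UNIV. \<Sum>j\<in>UNIV. \<bar>X $ i $ j\<bar>)" by (intro sum_mono norm_le_l1_cart)
  also have "... <= (\<Sum>i\<in>(UNIV::'n set). \<Sum>j\<in>(UNIV::'n set). ?r)" by (intro sum_mono that)
  finally show ?thesis by simp
 qed
 have supp: "omt ?I s = 0" if "s \<notin> ?S" for s
 proof (rule ccontr)
  assume nz: "omt ?I s ~= 0"
  obtain Q D E where s: "s = (Q, D, E)" by (metis prod.collapse)
  have nz': "om (gq s) (D - low D) ~= 0" using nz by (auto simp: omt_def s)
  note b = om_bounded[OF nz']
  have "\<bar>Q $ i $ j\<bar> <= ?r" "\<bar>E $ i $ j\<bar> <= ?r" "\<bar>D $ i $ j\<bar> <= ?r" for i j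
   using b(1)[of "Inr i" "Inr j"] b(1)[of "Inl i" "Inr j"] b(1)[of "Inl i" "Inl j"] b(2)[of i j]
   by (cases "j <= i"; simp add: gq_def s low_nth)+
  then have "norm Q + (norm D + norm E) <= 3 * (real CARD('n) * real CARD('n) * ?r)"
   using nm[of Q] nm[of D] nm[of E] by simp
  moreover have "norm s <= norm Q + (norm D + norm E)"
   unfolding s by (meson add_left_mono norm_Pair_le order_trans)
  ultimately show False using that by simp
 qed
 have int: "integrable lborel (%s. indicator ?S s *\<^sub>R omt ?I s)"
  by (rule borel_integrable_compact) (auto intro!: continuous_at_imp_continuous_on omt_isCont)
 have "(%s. indicator ?S s *\<^sub>R omt ?I s) = omt ?I"
 proof
  show "indicator ?S s *\<^sub>R omt ?I s = omt ?I s" for s using supp[of s] by (cases "s \<in> ?S") auto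
 qed
 then have int: "integrable lborel (omt ?I)" using int by metis
 then have fin: "(\<integral>\<^sup>+s. ennreal (omt ?I s) \<partial>lborel) < \<infinity>"
  using nn_integral_eq_integral[OF int] omt_nonneg[of ?I] by simp
 have pos: "(\<integral>\<^sup>+s. ennreal (omt ?I s) \<partial>lborel) > 0"
 proof (rule open_positive_nn_integral[OF omt_measurable omt_isCont[of "(mat 1 :: 'n sq, mat 1 :: 'n sq, 0 :: 'n sq)"]])
  have l: "low (mat 1 :: 'n sq) = mat 1" by (simp add: low_def mat_def vec_eq_iff)
  have mat_nth: "(mat 1 :: 'n sq) $ i $ i = 1" for i by (simp add: mat_def)
  have gq: "gq (mat 1 :: 'n sq, mat 1 :: 'n sq, 0 :: 'n sq) = ?I" by (simp add: gq_def l block_mat_1)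
  have "?I \<bullet> ?I = real CARD('n + 'n)" by (simp add: inner_vec_def mat_def if_distrib cong: if_cong)
  then have "om ?I 0 > 0" by (simp add: om_def rad_def bump_pos card_UNIV_sum)
  moreover have "wq (mat 1 :: 'n sq, mat 1 :: 'n sq, 0 :: 'n sq) > 0" by (simp add: wq_def l) (simp add: mat_nth)
  ultimately show "0 < omt ?I (mat 1 :: 'n sq, mat 1 :: 'n sq, 0 :: 'n sq)" by (simp add: omt_def gq l)
 qed
 show nn: "(\<integral>\<^sup>+s. ennreal (omt g s) \<partial>lborel) = ennreal (c0 TYPE('n))"
  using omt_nn_integral_invariant[OF assms] fin by (simp add: c0_def)
 show "c0 TYPE('n) > 0" using pos fin by (simp add: c0_def enn2real_positive_iff)
 show ig: "integrable lborel (omt g)"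
  by (rule integrableI_nonneg) (use nn omt_measurable[of g] omt_nonneg[of g] in "auto intro: AE_I2")
 show "(LINT s|lborel. omt g s) = c0 TYPE('n)"
  using nn_integral_eq_integral[OF ig] omt_nonneg[of g] nn \<open>c0 TYPE('n) > 0\<close> by (simp add: integral_nonneg_AE)
qed

section \<open>Coordinates adapted to the open cell\<close>

text \<open>Under this substitution \<^const>\<open>Gm\<close> becomes \<open>gY Y\<close> times the element of the
triangular group given by the other three components.\<close>

definition chart :: "('n::{finite,linorder}) quad => 'n quad" where
 "chart x = (fst x ** low (fst (snd (snd x))), fst x ** snd (snd (snd x)) - fst (snd x), snd (snd x))"

lemma scales_reflect: "scales (%x. c - x) 1" for c :: "'a::euclidean_space"
 using scales_compose[OF scales_translate[of c] scales_uminus] by simp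

lemma chart_nn_integral:
 fixes F :: "('n::{finite,linorder}) quad => ennreal"
 assumes F: "F \<in> borel_measurable borel" and z: "!!x. det (low (fst (snd (snd x)))) = 0 ==> F x = 0"
 shows "(\<integral>\<^sup>+x. F x \<partial>lborel) = (\<integral>\<^sup>+x. ennreal (\<bar>det (low (fst (snd (snd x))))\<bar> ^ CARD('n)) * F (chart x) \<partial>lborel)"
proof -
 define w where "w r = \<bar>det (low (fst (snd r)))\<bar> ^ CARD('n)" for r :: "'n tri"
 define S where "S x = (fst x ** low (fst (snd (snd x))), snd x)" for x :: "'n quad"
 define T where "T x = (fst x, fst x ** snd (snd (snd x)) - fst (snd x), snd (snd x))" for x :: "'n quad"
 have sS: "smooth UNIV S" unfolding S_def
  by (intro smooth_intros smooth_quad open_UNIV smooth_bounded_linear bounded_linear_snd)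
 have w: "w \<in> borel_measurable borel"
  unfolding w_def using smooth_measurable[OF smooth_det[OF open_UNIV smooth_low[OF open_UNIV smooth_tri(2)]]]
  by (intro borel_measurable_power borel_measurable_abs)
 have sT: "scales T 1"
 proof -
  have "scales (%r::'n tri. (Y ** snd (snd r) - fst r, snd r)) 1" for Y :: "'n sq"
   by (rule scales_shear[where M="%(p :: 'n sq \<times> 'n sq) Q. Y ** snd p - Q", OF scales_reflect])
    (intro smooth_measurable smooth_intros smooth_tri open_UNIV)
  moreover have "(%x::'n quad. (fst x ** snd (snd (snd x)) - fst (snd x), snd (snd x))) \<in> borel_measurable borel"
   by (intro smooth_measurable smooth_intros smooth_quad smooth_bounded_linear
     bounded_linear_compose[OF bounded_linear_snd bounded_linear_snd] open_UNIV)
  ultimately have "scales (%x::'n quad. (fst x, fst x ** snd (snd (snd x)) - fst (snd x), snd (snd x))) (1 * 1)"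
   by (intro scales_prod[where L="%x. x" and M="%Y r. (Y ** snd (snd r) - fst r, snd r)", OF scales_id])
  then show ?thesis by (simp add: T_def[abs_def])
 qed
 have G: "(%x. ennreal (w (snd x)) * F (S x)) \<in> borel_measurable borel"
 proof (rule borel_measurable_times_ennreal)
  show "(%x. F (S x)) \<in> borel_measurable borel" by (rule measurable_compose[OF smooth_measurable[OF sS] F])
  have "(%x::'n quad. w (snd x)) \<in> borel_measurable borel"
   by (rule measurable_compose[OF smooth_measurable w]) (intro smooth_bounded_linear bounded_linear_snd open_UNIV)
  then show "(%x::'n quad. ennreal (w (snd x))) \<in> borel_measurable borel" by (rule measurable_compose) (rule measurable_ennreal)
 qed
 have "(\<integral>\<^sup>+x. F x \<partial>lborel) = (\<integral>\<^sup>+r. \<integral>\<^sup>+A. F (A, r) \<partial>lborel \<partial>lborel)"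
  by (rule nn_integral_lborel_pair(2)[OF F])
 also have "... = (\<integral>\<^sup>+r. \<integral>\<^sup>+Y. ennreal (w r) * F (S (Y, r)) \<partial>lborel \<partial>lborel)"
 proof (rule nn_integral_cong)
  fix r :: "'n tri"
  show "(\<integral>\<^sup>+A. F (A, r) \<partial>lborel) = (\<integral>\<^sup>+Y. ennreal (w r) * F (S (Y, r)) \<partial>lborel)"
  proof (cases "det (low (fst (snd r))) = 0")
   case True
   then show ?thesis by (simp add: z S_def)
  next
   case False
   have m: "(%Y. F (S (Y, r))) \<in> borel_measurable borel"
    using measurable_nn_integral_slice(3)[OF measurable_compose[OF smooth_measurable[OF sS] F]] .
   show ?thesis
    using scales_nn_integral[OF scales_matrix_mult_right[OF False] measurable_nn_integral_slice(3)[OF F, of r]] m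
    by (simp add: w_def nn_integral_cmult S_def)
  qed
 qed
 also have "... = (\<integral>\<^sup>+x. ennreal (w (snd x)) * F (S x) \<partial>lborel)"
  using nn_integral_lborel_pair(2)[OF G] by simp
 also have "... = (\<integral>\<^sup>+x. ennreal (w (snd (T x))) * F (S (T x)) \<partial>lborel)"
  using scales_nn_integral[OF sT G] by simp
 also have "... = (\<integral>\<^sup>+x. ennreal (w (snd x)) * F (chart x) \<partial>lborel)"
  by (simp add: S_def T_def chart_def w_def)
 finally show ?thesis by (simp add: w_def)
qed

lemma smooth_chart: "smooth UNIV chart"
 unfolding chart_def[abs_def]
 by (intro smooth_intros smooth_quad open_UNIV smooth_bounded_linear
   bounded_linear_compose[OF bounded_linear_snd bounded_linear_snd])

lemma chart_integral:
 fixes \<Theta> :: "('n::{finite,linorder}) quad => complex"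
 assumes m: "\<Theta> \<in> borel_measurable borel" and z: "!!x. det (low (fst (snd (snd x)))) = 0 ==> \<Theta> x = 0"
 defines "N \<equiv> %x. \<bar>det (low (fst (snd (snd x))))\<bar> ^ CARD('n) *\<^sub>R \<Theta> (chart x)"
 shows "integrable lborel \<Theta> \<longleftrightarrow> integrable lborel N" "(LINT x|lborel. \<Theta> x) = (LINT x|lborel. N x)"
proof -
 let ?d = "%x::'n quad. det (low (fst (snd (snd x))))"
 define w where "w x = \<bar>?d x\<bar> ^ CARD('n)" for x
 define i where "i x = (indicator {x. ?d x ~= 0} x :: real)" for x
 have d[measurable]: "?d \<in> borel_measurable borel"
  by (intro smooth_measurable smooth_det smooth_low smooth_quad open_UNIV)
 have wm[measurable]: "w \<in> borel_measurable borel" unfolding w_def by measurable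
 have im[measurable]: "i \<in> borel_measurable borel" unfolding i_def by measurable
 have c[measurable]: "chart \<in> borel_measurable borel" by (rule smooth_measurable[OF smooth_chart])
 note m[measurable]
 have eq: "density lborel (%x. ennreal (i x)) = distr (density lborel (%x. ennreal (w x))) borel chart"
 proof (rule measure_eqI)
  fix A assume "A \<in> sets (density lborel (%x. ennreal (i x)))"
  then have A[measurable]: "A \<in> sets borel" by simp
  have "emeasure (density lborel (%x. ennreal (i x))) A = (\<integral>\<^sup>+x. ennreal (i x) * indicator A x \<partial>lborel)"
   by (rule emeasure_density) auto
  also have "... = (\<integral>\<^sup>+x. ennreal (w x) * (ennreal (i (chart x)) * indicator A (chart x)) \<partial>lborel)"
   using chart_nn_integral[of "%x. ennreal (i x) * indicator A x"] by (simp add: i_def w_def)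
  also have "... = (\<integral>\<^sup>+x. ennreal (w x) * indicator (chart -` A) x \<partial>lborel)"
   by (intro nn_integral_cong) (auto simp: i_def w_def chart_def indicator_def)
  also have "... = emeasure (density lborel (%x. ennreal (w x))) (chart -` A)"
   by (rule emeasure_density[symmetric]) (use measurable_sets[OF c A] in auto)
  also have "... = emeasure (distr (density lborel (%x. ennreal (w x))) borel chart) A"
   by (subst emeasure_distr) auto
  finally show "emeasure (density lborel (%x. ennreal (i x))) A = emeasure (distr (density lborel (%x. ennreal (w x))) borel chart) A" .
 qed simp
 have i: "i x *\<^sub>R \<Theta> x = \<Theta> x" for x using z[of x] by (simp add: i_def indicator_def)
 have pos: "AE x in lborel. 0 <= i x" "AE x in lborel. 0 <= w x" by (auto simp: i_def w_def)
 have N: "N = (%x. w x *\<^sub>R \<Theta> (chart x))" by (simp add: N_def w_def)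
 have "integrable lborel \<Theta> \<longleftrightarrow> integrable (density lborel (%x. ennreal (i x))) \<Theta>"
  by (subst integrable_density) (use pos in "auto simp: i")
 also have "... \<longleftrightarrow> integrable (density lborel (%x. ennreal (w x))) (%x. \<Theta> (chart x))"
  unfolding eq by (rule integrable_distr_eq) auto
 also have "... \<longleftrightarrow> integrable lborel N"
  by (subst integrable_density) (use pos in "auto simp: N")
 finally show "integrable lborel \<Theta> \<longleftrightarrow> integrable lborel N" .
 have "(LINT x|lborel. \<Theta> x) = (LINT x|density lborel (%x. ennreal (i x)). \<Theta> x)"
  by (subst integral_density) (use pos in "auto simp: i")
 also have "... = (LINT x|density lborel (%x. ennreal (w x)). \<Theta> (chart x))"
  unfolding eq by (rule integral_distr) auto
 also have "... = (LINT x|lborel. N x)"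
  by (subst integral_density) (use pos in "auto simp: N")
 finally show "(LINT x|lborel. \<Theta> x) = (LINT x|lborel. N x)" .
qed

section \<open>Thickening the integral\<close>

lemma pi_spaceD:
 fixes f :: "('n::{finite,linorder}) big => complex"
 assumes "f \<in> pi_space (\<xi>1, \<xi>2) (l1, l2)"
 shows "smooth GL f" "!!g. \<not> invertible g ==> f g = 0"
  "!!g g1 g2 b. invertible g ==> invertible g1 ==> invertible g2 ==> f (g ** block_matrix g1 b 0 g2) =
    sgn_powr \<xi>1 (- l1 - of_nat CARD('n) / 2) (det g1) * sgn_powr \<xi>2 (- l2 + of_nat CARD('n) / 2) (det g2) * f g"
 using assms by (auto simp: pi_space_def smooth_GL_def smooth_def)

lemma smooth_GL_measurable:
 fixes f :: "real^'m^'m => complex"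
 assumes "smooth GL f" "!!g. \<not> invertible g ==> f g = 0"
 shows "f \<in> borel_measurable borel"
proof -
 have "(%x. indicator GL x *\<^sub>R f x) \<in> borel_measurable borel"
  by (rule borel_measurable_continuous_on_indicator) (auto intro!: borel_open open_GL smooth_continuous assms)
 moreover have "(%x. indicator GL x *\<^sub>R f x) = f" using assms(2) by (auto simp: indicator_def)
 ultimately show ?thesis by simp
qed

context
 fixes \<xi>1 \<xi>2 \<eta> :: bit
begin

text \<open>Parity and exponent of the power of the \<open>i\<close>-th diagonal entry. The exponents are those for
which \<open>diagonal_weight\<close> holds, and they produce the gamma factors of the normalization.\<close>

definition dexp :: "complex => complex => complex => 'n::{finite,linorder} => bit \<times> complex" where
 "dexp l1 l2 \<nu> i = (if i = last_idx then (\<xi>1 + \<eta>, l1 - \<nu> - of_nat CARD('n) / 2)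
  else (\<xi>1 + \<xi>2, l1 - l2 - of_nat CARD('n) + of_nat (card {j. i < j})))"

definition Kz :: "complex => complex => complex => 'n::{finite,linorder} sq => complex" where
 "Kz l1 l2 \<nu> D = (\<Prod>i\<in>UNIV. sgn_powr (fst (dexp l1 l2 \<nu> i)) (snd (dexp l1 l2 \<nu> i)) (D $ i $ i))"

text \<open>With this power of the determinant the equivariance of \<open>f\<close> yields the power of \<open>det Q\<close>
in the left Haar density.\<close>

definition amp :: "complex => ('n::{finite,linorder} big => complex) => 'n big => 'n quad => complex" where
 "amp l2 f g x = f (g ** Gm x) * (sgn_powr \<xi>2 (l2 - 3 * of_nat CARD('n) / 2) (det (Gm x)) * of_real (omq x))"

text \<open>The integrand of the operator in the coordinate \<open>Y = X^(-1)\<close>: only the power of one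
matrix entry is left of the kernel.\<close>

definition Yfun :: "complex => complex => ('n::{finite,linorder} big => complex) => 'n big => 'n sq => complex" where
 "Yfun l2 \<nu> f g Y = sgn_powr (\<eta> + \<xi>2) (\<nu> - l2 - of_nat CARD('n) / 2) (Y $ last_idx $ last_idx) * f (g ** gY Y)"

lemma last_idx_ge: "i <= (last_idx :: 'n::{finite,linorder})"
 by (simp add: last_idx_def)

lemma card_le_lt: "card {j. i < j} + card {j. j <= i} = CARD('n)" for i :: "'n::{finite,linorder}"
proof -
 have "card ({j. i < j} \<union> {j. j <= i}) = card {j. i < j} + card {j. j <= i}"
  by (rule card_Un_disjoint) auto
 moreover have "{j. i < j} \<union> {j. j <= i} = UNIV" by auto
 ultimately show ?thesis by simp
qed

lemma bit_identities:
 fixes a b c :: bit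
 shows "b + b = 0" "(b + c) + (a + b) = a + c" "0 + (a + c) + a + c = 0" "0 + (a + b) + (b + c) + a + c = 0" "c + (b + c) + 0 = b"
 by (cases a; cases b; cases c; simp)+

text \<open>All powers of the diagonal entries, coming from the kernel, the Jacobian, the equivariance
of \<open>f\<close> and the determinant, combine into the density of the left Haar measure.\<close>

lemma diagonal_weight:
 fixes D :: "('n::{finite,linorder}) sq"
 assumes nz: "!!i. D $ i $ i ~= 0"
 shows "of_real (\<bar>det (low D)\<bar> ^ CARD('n)) * (sgn_powr (\<eta> + \<xi>2) (\<nu> - l2 - of_nat CARD('n) / 2) (D $ last_idx $ last_idx) *
   Kz l1 l2 \<nu> D) * sgn_powr \<xi>1 (- l1 - of_nat CARD('n) / 2) (det (low D)) *
   sgn_powr \<xi>2 (l2 - 3 * of_nat CARD('n) / 2) (det (low D)) =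
  of_real (inverse (\<bar>det (low D)\<bar> ^ CARD('n) * (\<Prod>i\<in>UNIV. \<bar>D $ i $ i\<bar> ^ card {j. j <= i})))"
proof -
 let ?n = "of_nat CARD('n) :: complex"
 let ?b = "sgn_powr (\<eta> + \<xi>2) (\<nu> - l2 - ?n / 2) (D $ last_idx $ last_idx)"
 let ?t = "%i. sgn_powr (\<xi>1 + \<xi>2) (l1 - l2 - ?n + of_nat (card {j. i < j})) (D $ i $ i)"
 have K: "?b * Kz l1 l2 \<nu> D = (\<Prod>i\<in>UNIV. ?t i)"
 proof -
  let ?k = "%i. sgn_powr (fst (dexp l1 l2 \<nu> i)) (snd (dexp l1 l2 \<nu> i)) (D $ i $ i)"
  have "{j. last_idx < j} = ({} :: 'n set)" using last_idx_ge by (auto simp: not_le[symmetric])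
  then have m: "(\<nu> - l2 - ?n / 2) + (l1 - \<nu> - ?n / 2) = l1 - l2 - ?n + of_nat (card {j. (last_idx :: 'n) < j})"
   by simp
  have l: "?b * ?k last_idx = ?t last_idx"
   by (simp only: dexp_def simp_thms if_True fst_conv snd_conv sgn_powr_add[OF nz] m bit_identities)
  have "?b * Kz l1 l2 \<nu> D = ?b * (?k last_idx * (\<Prod>i\<in>UNIV - {last_idx}. ?k i))"
   unfolding Kz_def by (subst prod.remove[of _ last_idx]) auto
  also have "... = ?t last_idx * (\<Prod>i\<in>UNIV - {last_idx}. ?k i)" by (simp only: mult.assoc[symmetric] l)
  also have "(\<Prod>i\<in>UNIV - {last_idx}. ?k i) = (\<Prod>i\<in>UNIV - {last_idx}. ?t i)"
   by (intro prod.cong refl) (simp add: dexp_def)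
  also have "?t last_idx * ... = (\<Prod>i\<in>UNIV. ?t i)" by (subst prod.remove[of UNIV last_idx]) auto
  finally show ?thesis .
 qed
 have step: "of_real (\<bar>D $ i $ i\<bar> ^ CARD('n)) * ?t i * sgn_powr \<xi>1 (- l1 - ?n / 2) (D $ i $ i) * sgn_powr \<xi>2 (l2 - 3 * ?n / 2) (D $ i $ i) =
  of_real (inverse (\<bar>D $ i $ i\<bar> ^ CARD('n) * \<bar>D $ i $ i\<bar> ^ card {j. j <= i}))" for i
 proof -
  have exponent: "n + (l1 - l2 - n + x) + (- l1 - n / 2) + (l2 - 3 * n / 2) = - (n + y)" if "x + y = n" for x y n :: complex
   using that by (auto simp: field_simps)
  have m: "?n + (l1 - l2 - ?n + of_nat (card {j. i < j})) + (- l1 - ?n / 2) + (l2 - 3 * ?n / 2) =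
    - of_nat (CARD('n) + card {j. j <= i})"
   unfolding of_nat_add by (rule exponent) (simp only: of_nat_add[symmetric] card_le_lt)
  have "of_real (\<bar>D $ i $ i\<bar> ^ CARD('n)) * ?t i * sgn_powr \<xi>1 (- l1 - ?n / 2) (D $ i $ i) * sgn_powr \<xi>2 (l2 - 3 * ?n / 2) (D $ i $ i) =
    sgn_powr 0 (- of_nat (CARD('n) + card {j. j <= i})) (D $ i $ i)"
   by (simp only: sgn_powr_nat[OF nz, symmetric] sgn_powr_add[OF nz] m bit_identities)
  then show ?thesis by (simp only: sgn_powr_neg_nat[OF nz] power_add)
 qed
 have "of_real (\<bar>det (low D)\<bar> ^ CARD('n)) * (?b * Kz l1 l2 \<nu> D) * sgn_powr \<xi>1 (- l1 - ?n / 2) (det (low D)) *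
   sgn_powr \<xi>2 (l2 - 3 * ?n / 2) (det (low D)) =
  (\<Prod>i\<in>UNIV. of_real (\<bar>D $ i $ i\<bar> ^ CARD('n)) * ?t i * sgn_powr \<xi>1 (- l1 - ?n / 2) (D $ i $ i) * sgn_powr \<xi>2 (l2 - 3 * ?n / 2) (D $ i $ i))"
  unfolding K det_low_part by (simp add: sgn_powr_prod prod.distrib abs_prod prod_power_distrib)
 also have "... = of_real (inverse (\<bar>det (low D)\<bar> ^ CARD('n) * (\<Prod>i\<in>UNIV. \<bar>D $ i $ i\<bar> ^ card {j. j <= i})))"
  unfolding step det_low_part by (simp add: prod.distrib abs_prod prod_power_distrib prod_inversef[unfolded o_def])
 finally show ?thesis .
qed

lemma mult_low_last: "(Y ** low D) $ last_idx $ last_idx = Y $ last_idx $ last_idx * D $ last_idx $ last_idx"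
 for D :: "('n::{finite,linorder}) sq"
proof -
 have "(Y ** low D) $ last_idx $ last_idx = (\<Sum>k\<in>UNIV. Y $ last_idx $ k * low D $ k $ last_idx)"
  by (simp add: matrix_matrix_mult_def)
 also have "... = (\<Sum>k\<in>{last_idx}. Y $ last_idx $ k * low D $ k $ last_idx)"
  by (rule sum.mono_neutral_right) (auto simp: low_nth dest: antisym[OF last_idx_ge])
 finally show ?thesis by simp
qed

lemma chart_pointwise:
 fixes f :: "('n::{finite,linorder}) big => complex"
 assumes f: "f \<in> pi_space (\<xi>1, \<xi>2) (l1, l2)" and g: "invertible g"
 shows "\<bar>det (low D)\<bar> ^ CARD('n) *\<^sub>R
   (sgn_powr (\<eta> + \<xi>2) (\<nu> - l2 - of_nat CARD('n) / 2) ((Y ** low D) $ last_idx $ last_idx) * Kz l1 l2 \<nu> D *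
   amp l2 f g (chart (Y, Q, D, E))) =
  Yfun l2 \<nu> f g Y * of_real (omt (gY Y) (Q, D, E))"
proof -
 have Gm: "Gm (chart (Y, Q, D, E)) = gY Y ** gq (Q, D, E)"
  by (simp add: Gm_def chart_def gq_def block_gY)
 have omq: "omq (chart (Y, Q, D, E)) = om (gY Y ** gq (Q, D, E)) (D - low D)"
  by (simp add: omq_def Gm) (simp add: chart_def)
 consider "det (low D) = 0" | "det (low D) ~= 0" "det Q = 0" | "det (low D) ~= 0" "det Q ~= 0" by blast
 then show ?thesis
 proof cases
  case 1
  then show ?thesis by (simp add: omt_def wq_def power_0_left)
 next
  case 2
  have "\<not> invertible (g ** (gY Y ** gq (Q, D, E)))"
   by (simp add: invertible_det_nz det_mul det_gq 2)
  then have "amp l2 f g (chart (Y, Q, D, E)) = 0" using pi_spaceD(2)[OF f] by (simp add: amp_def Gm)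
  moreover have "omt (gY Y) (Q, D, E) = 0" using 2 by (simp add: omt_def wq_def power_0_left)
  ultimately show ?thesis by simp
 next
  case 3
  let ?n = "of_nat CARD('n) :: complex"
  have nz: "D $ i $ i ~= 0" for i using 3 by (simp add: det_low_part)
  have fe: "f (g ** (gY Y ** gq (Q, D, E))) = sgn_powr \<xi>1 (- l1 - ?n / 2) (det (low D)) * sgn_powr \<xi>2 (- l2 + ?n / 2) (det Q) * f (g ** gY Y)"
   using pi_spaceD(3)[OF f, of "g ** gY Y" "low D" Q E] 3 g
   by (simp add: gq_def matrix_mul_assoc invertible_det_nz det_mul det_gY)
  have dG: "det (gY Y ** gq (Q, D, E)) = det (low D) * det Q" by (simp add: det_mul det_gY det_gq)
  have Qw: "sgn_powr \<xi>2 (- l2 + ?n / 2) (det Q) * sgn_powr \<xi>2 (l2 - 3 * ?n / 2) (det Q) = of_real (inverse (\<bar>det Q\<bar> ^ CARD('n)))"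
  proof -
   have "(- l2 + ?n / 2) + (l2 - 3 * ?n / 2) = - ?n" by (simp add: field_simps)
   then show ?thesis
    using sgn_powr_add[OF 3(2), of \<xi>2 "- l2 + ?n / 2" \<xi>2 "l2 - 3 * ?n / 2"] sgn_powr_neg_nat[OF 3(2), of "CARD('n)"]
    by (simp add: bit_identities(1))
  qed
  let ?b = "%x. sgn_powr (\<eta> + \<xi>2) (\<nu> - l2 - ?n / 2) x"
  have "\<bar>det (low D)\<bar> ^ CARD('n) *\<^sub>R (?b ((Y ** low D) $ last_idx $ last_idx) * Kz l1 l2 \<nu> D * amp l2 f g (chart (Y, Q, D, E))) =
   (of_real (\<bar>det (low D)\<bar> ^ CARD('n)) * (?b (D $ last_idx $ last_idx) * Kz l1 l2 \<nu> D) *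
    sgn_powr \<xi>1 (- l1 - ?n / 2) (det (low D)) * sgn_powr \<xi>2 (l2 - 3 * ?n / 2) (det (low D))) *
   (sgn_powr \<xi>2 (- l2 + ?n / 2) (det Q) * sgn_powr \<xi>2 (l2 - 3 * ?n / 2) (det Q)) *
   (?b (Y $ last_idx $ last_idx) * f (g ** gY Y)) * of_real (om (gY Y ** gq (Q, D, E)) (D - low D))"
   unfolding amp_def Gm omq fe dG mult_low_last sgn_powr_mult scaleR_conv_of_real by (simp only: ac_simps)
  also have "... = Yfun l2 \<nu> f g Y * of_real (omt (gY Y) (Q, D, E))"
   unfolding diagonal_weight[OF nz] Qw by (simp add: Yfun_def omt_def wq_def ac_simps)
  finally show ?thesis .
 qed
qed

lemma Yfun_measurable:
 fixes f :: "('n::{finite,linorder}) big => complex"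
 assumes f: "f \<in> pi_space (\<xi>1, \<xi>2) (l1, l2)"
 shows "Yfun l2 \<nu> f g \<in> borel_measurable borel"
proof -
 have f': "f \<in> borel_measurable borel" using smooth_GL_measurable pi_spaceD(1,2)[OF f] by blast
 have "(%Y. f (g ** gY Y)) \<in> borel_measurable borel"
  by (rule measurable_compose[OF smooth_measurable f']) (intro smooth_matrix_mult smooth_const smooth_gY open_UNIV)
 moreover have "(%Y::'n sq. Y $ last_idx $ last_idx) \<in> borel_measurable borel"
  by (intro smooth_measurable smooth_intros)
 then have "(%Y::'n sq. sgn_powr (\<eta> + \<xi>2) (\<nu> - l2 - of_nat CARD('n) / 2) (Y $ last_idx $ last_idx)) \<in> borel_measurable borel"
  by (rule measurable_compose) (rule borel_measurable_sgn_powr)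
 ultimately show ?thesis unfolding Yfun_def[abs_def] by (intro borel_measurable_times)
qed

text \<open>In the coordinates of \<^const>\<open>chart\<close> the integrand splits into the \<open>Y\<close>-integrand and a
fibre whose integral is the constant \<open>c0\<close>.\<close>

theorem quad_integral:
 fixes f :: "('n::{finite,linorder}) big => complex" and \<nu> :: complex
 assumes f: "f \<in> pi_space (\<xi>1, \<xi>2) (l1, l2)" and g: "invertible g"
 defines "\<Theta> \<equiv> %x. sgn_powr (\<eta> + \<xi>2) (\<nu> - l2 - of_nat CARD('n) / 2) (fst x $ last_idx $ last_idx) *
  Kz l1 l2 \<nu> (fst (snd (snd x))) * amp l2 f g x"
 assumes int: "integrable lborel \<Theta>"
 shows "integrable lborel (Yfun l2 \<nu> f g)"
  and "(LINT x|lborel. \<Theta> x) = of_real (c0 TYPE('n)) * (LINT Y|lborel. Yfun l2 \<nu> f g Y)"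
proof -
 let ?Y = "Yfun l2 \<nu> f g"
 define N where "N x = ?Y (fst x) * of_real (omt (gY (fst x)) (snd x))" for x :: "'n quad"
 have m: "\<Theta> \<in> borel_measurable borel" using int by simp
 have z: "\<Theta> x = 0" if d0: "det (low (fst (snd (snd x)))) = 0" for x
 proof -
  have "\<exists>i. fst (snd (snd x)) $ i $ i = 0" using d0 by (simp add: det_low_part)
  then obtain i where "fst (snd (snd x)) $ i $ i = 0" by blast
  then have "Kz l1 l2 \<nu> (fst (snd (snd x))) = 0" unfolding Kz_def by (intro prod_zero bexI[of _ i]) auto
  then show ?thesis by (simp add: \<Theta>_def)
 qed
 have N: "(%x. \<bar>det (low (fst (snd (snd x))))\<bar> ^ CARD('n) *\<^sub>R \<Theta> (chart x)) = N"
 proof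
  fix x :: "'n quad"
  obtain Y Q D E where x: "x = (Y, Q, D, E)" by (metis prod.collapse)
  show "\<bar>det (low (fst (snd (snd x))))\<bar> ^ CARD('n) *\<^sub>R \<Theta> (chart x) = N x"
   using chart_pointwise[OF f g, of D \<nu> Y Q E] by (simp add: x N_def \<Theta>_def chart_def)
 qed
 note ch = chart_integral[OF m z, unfolded N]
 have iN: "integrable lborel N" using ch(1) int by simp
 have mN: "N \<in> borel_measurable borel" using iN by simp
 have c0: "c0 TYPE('n) > 0" by (rule omt_integral(2)[OF invertible_gY[of 0]])
 (* By Tonelli, integrating out the fibre reduces integrability of the Y-integrand to that of N. *)
 have "(\<integral>\<^sup>+Y. ennreal (norm (?Y Y)) \<partial>lborel) * ennreal (c0 TYPE('n)) = (\<integral>\<^sup>+Y. \<integral>\<^sup>+s. ennreal (norm (N (Y, s))) \<partial>lborel \<partial>lborel)"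
 proof -
  have "(\<integral>\<^sup>+s. ennreal (norm (N (Y, s))) \<partial>lborel) = ennreal (norm (?Y Y)) * ennreal (c0 TYPE('n))" for Y
  proof -
   have "(\<integral>\<^sup>+s. ennreal (norm (N (Y, s))) \<partial>lborel) = (\<integral>\<^sup>+s. ennreal (norm (?Y Y)) * ennreal (omt (gY Y) s) \<partial>lborel)"
    by (intro nn_integral_cong) (simp add: N_def norm_mult ennreal_mult omt_nonneg abs_of_nonneg)
   also have "... = ennreal (norm (?Y Y)) * (\<integral>\<^sup>+s. ennreal (omt (gY Y) s) \<partial>lborel)"
    by (rule nn_integral_cmult) (use omt_measurable[of "gY Y"] in simp)
   finally show ?thesis by (simp add: omt_integral(1)[OF invertible_gY])
  qed
  moreover have "(\<integral>\<^sup>+Y. ennreal (norm (?Y Y)) * ennreal (c0 TYPE('n)) \<partial>lborel) = (\<integral>\<^sup>+Y. ennreal (norm (?Y Y)) \<partial>lborel) * ennreal (c0 TYPE('n))"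
   by (rule nn_integral_multc) (use Yfun_measurable[OF f] in simp)
  ultimately show ?thesis by simp
 qed
 also have "... = (\<integral>\<^sup>+x. ennreal (norm (N x)) \<partial>lborel)"
  by (rule nn_integral_lborel_pair(1)[symmetric]) (use mN in simp)
 also have "... < \<infinity>" using iN by (simp add: integrable_iff_bounded)
 finally have "(\<integral>\<^sup>+Y. ennreal (norm (?Y Y)) \<partial>lborel) < \<infinity>"
  using c0 by (auto simp: ennreal_mult_less_top)
 then show "integrable lborel ?Y" using Yfun_measurable[OF f] by (simp add: integrable_iff_bounded)
 have "(LINT x|lborel. \<Theta> x) = (LINT x|lborel. N x)" by (rule ch(2))
 also have "... = (LINT Y|lborel. LINT s|lborel. N (Y, s))"
  using lborel_pair.integral_fst'[of N] iN by (simp add: lborel_prod)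
 also have "... = (LINT Y|lborel. ?Y Y * of_real (c0 TYPE('n)))"
  by (simp add: N_def omt_integral(4)[OF invertible_gY])
 finally show "(LINT x|lborel. \<Theta> x) = of_real (c0 TYPE('n)) * (LINT Y|lborel. ?Y Y)" by simp
qed

section \<open>The integral in the inverse coordinate\<close>

text \<open>The minor of \<open>X\<close> is \<open>det X\<close> times an entry of \<open>X^(-1)\<close>; the remaining powers of
\<open>det Y\<close>, including the Jacobian of inversion, cancel.\<close>

lemma A_integrand_Y:
 fixes f :: "('n::{finite,linorder}) big => complex"
 assumes f: "f \<in> pi_space (\<xi>1, \<xi>2) (l1, l2)" and h: "invertible h"
 shows "integrable lborel (A_integrand (\<xi>1, \<xi>2) (l1, l2) \<eta> \<nu> f h) \<longleftrightarrow> integrable lborel (Yfun l2 \<nu> f (embed_corner h))"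
  and "A_int (\<xi>1, \<xi>2) (l1, l2) \<eta> \<nu> f h = (LINT Y|lborel. Yfun l2 \<nu> f (embed_corner h) Y)"
proof -
 let ?g = "embed_corner h" and ?n = "of_nat CARD('n) :: complex"
 let ?F = "A_integrand (\<xi>1, \<xi>2) (l1, l2) \<eta> \<nu> f h"
 let ?G = "%Y::'n sq. inverse (\<bar>det Y\<bar> ^ (2 * CARD('n))) *\<^sub>R ?F (ginv Y)"
 have f': "f \<in> borel_measurable borel" using smooth_GL_measurable pi_spaceD(1,2)[OF f] by blast
 have pm: "(%X::'n sq. principal_minor S X) \<in> borel_measurable borel" for S
  unfolding principal_minor_def
  by (intro smooth_measurable smooth_intros)
 have mF: "?F \<in> borel_measurable borel"
  unfolding A_integrand_def prod.case
 proof (intro borel_measurable_times)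
  show "(%X::'n sq. sgn_powr (\<xi>1 + \<eta>) (l1 - \<nu> - ?n / 2) (det X)) \<in> borel_measurable borel"
   by (rule measurable_compose[OF borel_measurable_det borel_measurable_sgn_powr])
  show "(%X::'n sq. sgn_powr (\<eta> + \<xi>2) (\<nu> - l2 - ?n / 2) (principal_minor (- {last_idx}) X)) \<in> borel_measurable borel"
   by (rule measurable_compose[OF pm borel_measurable_sgn_powr])
  show "(%X. f (?g ** block_matrix (mat 1) 0 X (mat 1))) \<in> borel_measurable borel"
   by (rule measurable_compose[OF smooth_measurable f'])
    (intro smooth_intros)
 qed
 have zF: "?F X = 0" if "det X = 0" for X using that by (simp add: A_integrand_def)
 note inv = lborel_inversion[OF mF zF]
 have GY: "?G Y = Yfun l2 \<nu> f ?g Y" if d: "det Y ~= 0" for Y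
 proof -
  have iY: "invertible Y" using d by (simp add: invertible_det_nz)
  let ?X = "matrix_inv Y" and ?d = "det Y"
  have X: "det ?X = inverse ?d" "invertible ?X" using iY by (simp_all add: det_matrix_inv invertible_matrix_inv)
  have pmX: "principal_minor (- {last_idx}) ?X = inverse ?d * Y $ last_idx $ last_idx"
   using minor_inverse[OF X(2), of last_idx] iY by (simp add: X(1) matrix_inv_inv)
  have "block_matrix (mat 1) 0 ?X (mat 1) = gY Y ** block_matrix ?X (mat 1) 0 Y"
   by (simp add: block_gY matrix_inv_both[OF iY])
  then have "f (?g ** block_matrix (mat 1) 0 ?X (mat 1)) = f (?g ** gY Y ** block_matrix ?X (mat 1) 0 Y)"
   by (simp add: matrix_mul_assoc)
  also have "... = sgn_powr \<xi>1 (- l1 - ?n / 2) (inverse ?d) * sgn_powr \<xi>2 (- l2 + ?n / 2) ?d * f (?g ** gY Y)"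
   using pi_spaceD(3)[OF f, of "?g ** gY Y" ?X Y] X iY h by (simp add: invertible_mult invertible_gY invertible_embed)
  finally have fe: "f (?g ** block_matrix (mat 1) 0 ?X (mat 1)) =
   sgn_powr \<xi>1 (l1 + ?n / 2) ?d * sgn_powr \<xi>2 (- l2 + ?n / 2) ?d * f (?g ** gY Y)"
   using sgn_powr_uminus[of \<xi>1 "- l1 - ?n / 2" ?d] by (simp add: sgn_powr_inverse add.commute)
  have "of_real (inverse (\<bar>?d\<bar> ^ (2 * CARD('n)))) = sgn_powr 0 (- of_nat (2 * CARD('n))) ?d"
   by (rule sgn_powr_neg_nat[OF d, symmetric])
  then have w: "of_real (inverse (\<bar>?d\<bar> ^ (2 * CARD('n)))) = sgn_powr 0 (- 2 * ?n) ?d" by simp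
  have i: "sgn_powr e m (inverse ?d) = sgn_powr e (- m) ?d" for e m by (simp add: sgn_powr_inverse sgn_powr_uminus)
  have "?G Y = (sgn_powr 0 (- 2 * ?n) ?d * sgn_powr (\<xi>1 + \<eta>) (- (l1 - \<nu> - ?n / 2)) ?d * sgn_powr (\<eta> + \<xi>2) (- (\<nu> - l2 - ?n / 2)) ?d *
   sgn_powr \<xi>1 (l1 + ?n / 2) ?d * sgn_powr \<xi>2 (- l2 + ?n / 2) ?d) * Yfun l2 \<nu> f ?g Y"
   unfolding scaleR_conv_of_real w using iY
   by (simp only: A_integrand_def prod.case ginv_def if_True fe X pmX sgn_powr_mult i Yfun_def ac_simps)
  also have "sgn_powr 0 (- 2 * ?n) ?d * sgn_powr (\<xi>1 + \<eta>) (- (l1 - \<nu> - ?n / 2)) ?d * sgn_powr (\<eta> + \<xi>2) (- (\<nu> - l2 - ?n / 2)) ?d *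
   sgn_powr \<xi>1 (l1 + ?n / 2) ?d * sgn_powr \<xi>2 (- l2 + ?n / 2) ?d = sgn_powr 0 (of_nat 0) ?d"
  proof -
   have "- 2 * ?n + - (l1 - \<nu> - ?n / 2) + - (\<nu> - l2 - ?n / 2) + (l1 + ?n / 2) + (- l2 + ?n / 2) = of_nat 0"
    by (simp add: field_simps)
   then show ?thesis by (simp only: sgn_powr_add[OF d] bit_identities)
  qed
  also have "... = 1" using sgn_powr_nat[OF d, of 0] by simp
  finally show ?thesis by simp
 qed
 have ae: "AE Y in lborel. ?G Y = Yfun l2 \<nu> f ?g Y"
  using AE_det_nonzero by eventually_elim (rule GY)
 have mG: "?G \<in> borel_measurable borel"
 proof (rule borel_measurable_scaleR)
  show "(%Y::'n sq. ?F (ginv Y)) \<in> borel_measurable borel" by (rule measurable_compose[OF borel_measurable_ginv mF])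
 qed measurable
 show "integrable lborel ?F \<longleftrightarrow> integrable lborel (Yfun l2 \<nu> f ?g)"
 proof (rule trans[OF inv(1)])
  show "integrable lborel ?G \<longleftrightarrow> integrable lborel (Yfun l2 \<nu> f ?g)"
   by (rule integrable_cong_AE) (use ae mG Yfun_measurable[OF f] in auto)
 qed
 show "A_int (\<xi>1, \<xi>2) (l1, l2) \<eta> \<nu> f h = (LINT Y|lborel. Yfun l2 \<nu> f ?g Y)"
  unfolding A_int_def
 proof (rule trans[OF inv(2)])
  show "(LINT Y|lborel. ?G Y) = (LINT Y|lborel. Yfun l2 \<nu> f ?g Y)"
   by (rule integral_cong_AE) (use ae mG Yfun_measurable[OF f] in auto)
 qed
qed

section \<open>Equivariance of the convergent integral\<close>

lemma matrix_add_mult: "(A + B) ** C = A ** C + B ** C" for A B :: "real^'n^'m" and C :: "real^'k^'n"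
 by (simp add: matrix_matrix_mult_def vec_eq_iff distrib_right sum.distrib)

text \<open>Right translation by \<open>p\<close> acts on the coordinate \<open>Y\<close> by the affine map
\<open>Y \<mapsto> (P11 Y + P12) P22^(-1)\<close>, which multiplies the last entry of \<open>Y\<close> by the middle
block of \<open>p\<close>.\<close>

lemma Yfun_equivariance:
 fixes f :: "('n::{finite,linorder}) big => complex"
 assumes f: "f \<in> pi_space (\<xi>1, \<xi>2) (l1, l2)" and h: "invertible h" and p: "invertible p"
  and upper: "\<forall>i j. corner_block j < corner_block i --> p $ i $ j = 0"
 shows "(LINT Y|lborel. Yfun l2 \<nu> f (embed_corner (h ** p)) Y) =
  sgn_powr \<xi>2 (- l2 - of_nat CARD('n) / 2) (principal_minor {i. corner_block i = 0} p) *
  sgn_powr \<eta> (- \<nu>) (principal_minor {i. corner_block i = 1} p) *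
  sgn_powr \<xi>1 (- l1 + of_nat CARD('n) / 2) (principal_minor {i. corner_block i = 2} p) *
  (LINT Y|lborel. Yfun l2 \<nu> f (embed_corner h) Y)"
proof -
 let ?n = "of_nat CARD('n) :: complex"
 let ?F = "Yfun l2 \<nu> f (embed_corner h)"
 let ?P = "embed_corner p"
 define P11 P12 P22 where P: "P11 = b11 ?P" "P12 = b12 ?P" "P22 = b22 ?P"
 define d0 d1 d2 where d: "d0 = principal_minor {i. corner_block i = 0} p" "d1 = principal_minor {i. corner_block i = 1} p"
  "d2 = principal_minor {i. corner_block i = 2} p"
 have Pblock: "?P = block_matrix P11 P12 0 P22" using block_eta[of ?P] embed_b21[OF upper] by (simp add: P)
 have inv: "invertible P11" "invertible P22"
  using block_upper_invertible[OF invertible_embed[OF p] embed_b21[OF upper]] by (simp_all add: P)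
 have det: "det P11 = d0 * d1" "det P22 = d2" using corner_minors[OF upper] by (simp_all add: P d)
 have nz: "d0 ~= 0" "d1 ~= 0" "d2 ~= 0" using inv det by (auto simp: invertible_det_nz)
 define R where "R = matrix_inv P22"
 have R: "P22 ** R = mat 1" "R ** P22 = mat 1" "det R = inverse d2" unfolding R_def
  using matrix_inv_both[OF inv(2)] det_matrix_inv[OF inv(2)] det by simp_all
 define S where "S Y = P12 ** R + P11 ** (Y ** R)" for Y :: "'n sq"
 have sS: "scales S (\<bar>det P11\<bar> ^ CARD('n) * \<bar>det R\<bar> ^ CARD('n))"
 proof -
  have "scales (%Y::'n sq. Y ** R) (\<bar>det R\<bar> ^ CARD('n))" by (rule scales_matrix_mult_right) (use R nz in simp)
  moreover have "scales (%Y::'n sq. P11 ** Y) (\<bar>det P11\<bar> ^ CARD('n))" by (rule scales_matrix_mult_left) (use det nz in simp)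
  ultimately have "scales (%Y::'n sq. P11 ** (Y ** R)) (\<bar>det P11\<bar> ^ CARD('n) * \<bar>det R\<bar> ^ CARD('n))" by (intro scales_compose)
  from scales_compose[OF scales_translate[of "P12 ** R"] this] show ?thesis by (simp add: S_def[abs_def])
 qed
 have SR: "S Y ** P22 = P12 + P11 ** Y" for Y
 proof -
  have "S Y ** P22 = P12 ** (R ** P22) + P11 ** Y ** (R ** P22)"
   unfolding S_def by (simp add: matrix_add_mult matrix_mul_assoc)
  then show ?thesis by (simp add: R)
 qed
 have key: "?P ** gY Y = gY (S Y) ** block_matrix P22 0 0 P11" for Y
  unfolding block_gY by (simp add: Pblock gY_def block_mult SR matrix_mult_minus add.commute)
 have fe: "f (embed_corner (h ** p) ** gY Y) = sgn_powr \<xi>1 (- l1 - ?n / 2) d2 * sgn_powr \<xi>2 (- l2 + ?n / 2) (d0 * d1) * f (embed_corner h ** gY (S Y))" for Y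
 proof -
  have "embed_corner (h ** p) ** gY Y = embed_corner h ** gY (S Y) ** block_matrix P22 0 0 P11"
   using key[of Y] by (simp add: embed_mult matrix_mul_assoc[symmetric])
  then show ?thesis
   using pi_spaceD(3)[OF f, of "embed_corner h ** gY (S Y)" P22 P11 0] inv h
   by (simp add: invertible_mult invertible_gY invertible_embed det)
 qed
 have corner: "S Y $ last_idx $ last_idx = d1 * Y $ last_idx $ last_idx" for Y
 proof -
  have c22: "P22 $ k $ last_idx = (if k = last_idx then 1 else 0)" for k by (simp add: P b22_def embed_nth)
  have c12: "P12 $ k $ last_idx = 0" for k by (simp add: P b12_def embed_nth)
  have c11: "P11 $ last_idx $ k = (if k = last_idx then d1 else 0)" for k
   using embed_last_row[OF upper, of k] corner_minors(1)[OF upper] by (simp add: P b11_def d)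
  have m: "(A ** P22) $ last_idx $ last_idx = A $ last_idx $ last_idx" for A
   by (simp add: matrix_matrix_mult_def c22 if_distrib cong: if_cong)
  have "(P11 ** Y) $ last_idx $ last_idx = d1 * Y $ last_idx $ last_idx"
   by (simp add: matrix_matrix_mult_def c11 if_distrib if_distribR cong: if_cong)
  then show ?thesis using m[of "S Y"] by (simp add: SR c12)
 qed
 let ?C = "sgn_powr \<xi>1 (- l1 - ?n / 2) d2 * sgn_powr \<xi>2 (- l2 + ?n / 2) (d0 * d1) * sgn_powr (\<eta> + \<xi>2) (- (\<nu> - l2 - ?n / 2)) d1"
 have Y: "Yfun l2 \<nu> f (embed_corner (h ** p)) Y = ?C * ?F (S Y)" for Y
 proof -
  have "sgn_powr (\<eta> + \<xi>2) (- (\<nu> - l2 - ?n / 2)) d1 * sgn_powr (\<eta> + \<xi>2) (\<nu> - l2 - ?n / 2) d1 = 1"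
   unfolding sgn_powr_uminus by (rule left_inverse[OF sgn_powr_nonzero[OF nz(2)]])
  then show ?thesis unfolding Yfun_def corner sgn_powr_mult fe by (simp add: ac_simps)
 qed
 have c: "\<bar>det P11\<bar> ^ CARD('n) * \<bar>det R\<bar> ^ CARD('n) = \<bar>d0\<bar> ^ CARD('n) * \<bar>d1\<bar> ^ CARD('n) * inverse (\<bar>d2\<bar> ^ CARD('n))"
  by (simp add: det R abs_mult power_mult_distrib power_inverse)
 have "(LINT Y|lborel. ?F Y) = (\<bar>det P11\<bar> ^ CARD('n) * \<bar>det R\<bar> ^ CARD('n)) *\<^sub>R (LINT Y|lborel. ?F (S Y))"
  by (rule scales_integral(2)[OF sS]) (use Yfun_measurable[OF f] in simp)
 then have J: "(LINT Y|lborel. ?F (S Y)) = of_real (inverse (\<bar>d0\<bar> ^ CARD('n)) * inverse (\<bar>d1\<bar> ^ CARD('n)) * \<bar>d2\<bar> ^ CARD('n)) * (LINT Y|lborel. ?F Y)"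
  unfolding c scaleR_conv_of_real using nz by (simp add: field_simps)
 have e: "- l2 + ?n / 2 + - ?n = - l2 - ?n / 2" "- l2 + ?n / 2 + - (\<nu> - l2 - ?n / 2) + - ?n = - \<nu>"
  "- l1 - ?n / 2 + ?n = - l1 + ?n / 2"
  by (simp_all add: field_simps)
 have "(LINT Y|lborel. Yfun l2 \<nu> f (embed_corner (h ** p)) Y) = ?C * (LINT Y|lborel. ?F (S Y))"
  unfolding Y by simp
 also have "... = (sgn_powr \<xi>2 (- l2 + ?n / 2) d0 * sgn_powr 0 (- ?n) d0) *
   (sgn_powr \<xi>2 (- l2 + ?n / 2) d1 * sgn_powr (\<eta> + \<xi>2) (- (\<nu> - l2 - ?n / 2)) d1 * sgn_powr 0 (- ?n) d1) *
   (sgn_powr \<xi>1 (- l1 - ?n / 2) d2 * sgn_powr 0 ?n d2) * (LINT Y|lborel. ?F Y)"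
  unfolding J sgn_powr_mult using nz by (simp add: sgn_powr_nat sgn_powr_neg_nat ac_simps)
 also have "sgn_powr \<xi>2 (- l2 + ?n / 2) d0 * sgn_powr 0 (- ?n) d0 = sgn_powr \<xi>2 (- l2 - ?n / 2) d0"
  by (simp only: sgn_powr_add[OF nz(1)] add_0_right e)
 also have "sgn_powr \<xi>2 (- l2 + ?n / 2) d1 * sgn_powr (\<eta> + \<xi>2) (- (\<nu> - l2 - ?n / 2)) d1 * sgn_powr 0 (- ?n) d1 = sgn_powr \<eta> (- \<nu>) d1"
  by (simp only: sgn_powr_add[OF nz(2)] bit_identities e)
 also have "sgn_powr \<xi>1 (- l1 - ?n / 2) d2 * sgn_powr 0 ?n d2 = sgn_powr \<xi>1 (- l1 + ?n / 2) d2"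
  by (simp only: sgn_powr_add[OF nz(3)] add_0_right e)
 finally show ?thesis by (simp only: d)
qed

section \<open>Characters as functions of the exponent\<close>

lemma smooth_exp_complex:
 fixes f :: "'a::euclidean_space => complex"
 shows "open S ==> smooth S f ==> smooth S (%x. exp (f x))"
 by (rule smooth_compose[OF _ open_UNIV _ _ smooth_holomorphic[OF holomorphic_on_exp open_UNIV]]) auto

lemma sgn_powr_exp: "x ~= 0 ==> sgn_powr e m x = of_real (sgn x) ^ of_bit e * exp (m * of_real (ln (norm x)))"
 by (simp add: sgn_powr_def powr_def Ln_of_real)

lemma smooth_sgn:
 fixes d :: "'a::euclidean_space => real"
 assumes S: "open S" and d: "smooth S d" and nz: "!!x. x \<in> S ==> d x ~= 0"
 shows "smooth S (%x. of_real (sgn (d x)) ^ k :: complex)"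
proof (rule smooth_open_cover[OF S])
 fix x assume x: "x \<in> S"
 define U where "U = {y \<in> S. sgn (d x) * d y > 0}"
 have "continuous_on S (%y. sgn (d x) * d y)" by (intro continuous_intros smooth_continuous d)
 then have "open (S \<inter> (%y. sgn (d x) * d y) -` {0<..})" by (rule continuous_open_preimage[OF _ S open_greaterThan])
 moreover have "U = S \<inter> (%y. sgn (d x) * d y) -` {0<..}" by (auto simp: U_def)
 ultimately have U: "open U" by simp
 have "sgn (d y) = sgn (d x)" if "y \<in> U" for y
  using that nz[OF x] by (auto simp: U_def sgn_if split: if_splits)
 then have "smooth U (%x. of_real (sgn (d x)) ^ k :: complex)"
  by (intro smooth_cong[OF U _ smooth_const[of _ "of_real (sgn (d x)) ^ k"]]) simp
 moreover have "x \<in> U" using x nz[OF x] by (simp add: U_def sgn_if)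
 ultimately show "\<exists>U. open U & x \<in> U & smooth U (%x. of_real (sgn (d x)) ^ k :: complex)" using U by blast
qed

lemma smooth_sgn_powr:
 fixes d :: "'a::euclidean_space => real"
 assumes S: "open S" and d: "smooth S d" and nz: "!!x. x \<in> S ==> d x ~= 0" and m: "smooth S m"
 shows "smooth S (%x. sgn_powr e (m x) (d x))"
proof (rule smooth_cong[OF S])
 show "of_real (sgn (d x)) ^ of_bit e * exp (m x * of_real (ln (norm (d x)))) = sgn_powr e (m x) (d x)" if "x \<in> S" for x
  using sgn_powr_exp[OF nz[OF that]] by simp
 show "smooth S (%x. of_real (sgn (d x)) ^ of_bit e * exp (m x * of_real (ln (norm (d x)))))"
  by (intro smooth_mult S smooth_sgn d nz smooth_exp_complex smooth_of_real smooth_ln_compose smooth_norm m) (use nz in auto)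
qed

lemma clin_invariant:
 fixes f :: "'a::euclidean_space => complex"
 assumes f: "smooth S f" and inv: "!!x t. x \<in> S ==> f (x + t *\<^sub>R u) = f x" "!!x t. x \<in> S ==> f (x + t *\<^sub>R v) = f x"
 shows "clin u v S f"
proof -
 have "dird w f x = 0" if "x \<in> S" and inv: "!!t. f (x + t *\<^sub>R w) = f x" for x w
 proof -
  have "((%t. f (x + t *\<^sub>R w)) has_vector_derivative dird w f x) (at 0)"
   by (rule dird_linear_comp) (use smooth_has_derivative[OF f that(1)] in simp)
  moreover have "((%t. f (x + t *\<^sub>R w)) has_vector_derivative 0) (at 0)"
   by (simp add: inv)
  ultimately show ?thesis by (rule vector_derivative_unique_at)
 qed
 then show ?thesis using inv by (simp add: clin_def)
qed

lemma clin_sgn_powr: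
 fixes d :: "'a::euclidean_space => real"
 assumes S: "open S" and d: "smooth S d" and nz: "!!x. x \<in> S ==> d x ~= 0" and m: "smooth S m" "clin u v S m"
  and inv: "!!x t. x \<in> S ==> d (x + t *\<^sub>R u) = d x" "!!x t. x \<in> S ==> d (x + t *\<^sub>R v) = d x"
 shows "clin u v S (%x. sgn_powr e (m x) (d x))"
proof (rule clin_cong[OF S])
 show "of_real (sgn (d x)) ^ of_bit e * exp (m x * of_real (ln (norm (d x)))) = sgn_powr e (m x) (d x)" if "x \<in> S" for x
  using sgn_powr_exp[OF nz[OF that]] by simp
 have s: "smooth S (%x. of_real (ln (norm (d x))) :: complex)" "smooth S (%x. of_real (sgn (d x)) ^ of_bit e :: complex)"
  by (intro S smooth_sgn d nz smooth_of_real smooth_ln_compose smooth_norm; use nz in auto)+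
 have p: "smooth S (%x. m x * of_real (ln (norm (d x))))" by (intro smooth_mult S m s)
 show "smooth S (%x. of_real (sgn (d x)) ^ of_bit e * exp (m x * of_real (ln (norm (d x)))))"
  by (intro smooth_mult S s smooth_exp_complex p)
 show "clin u v S (%x. of_real (sgn (d x)) ^ of_bit e * exp (m x * of_real (ln (norm (d x)))))"
 proof (rule clin_mult[OF s(2) smooth_exp_complex[OF S p]])
  show "clin u v S (%x. of_real (sgn (d x)) ^ of_bit e)" by (rule clin_invariant[OF s(2)]) (simp_all add: inv)
  have "clin u v S (%x. m x * of_real (ln (norm (d x))))"
   by (rule clin_mult[OF m(1) s(1) m(2)]) (rule clin_invariant[OF s(1)], simp_all add: inv)
  then show "clin u v S (%x. exp (m x * of_real (ln (norm (d x)))))"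
   by (rule clin_holomorphic[OF p _ holomorphic_on_exp open_UNIV]) auto
 qed
qed

section \<open>Flat families\<close>

text \<open>For \<open>\<Psi> = \<phi> \<circ> kap\<close> these are the members of all the spaces with the
same restriction to the orthogonal group.\<close>

definition fl :: "('n::{finite,linorder} big => complex) => complex \<times> complex => 'n big => complex" where
 "fl \<Psi> l g = (if invertible g then
  sgn_powr \<xi>1 (- fst l - of_nat CARD('n) / 2) (det (b11 (qpart g))) *
  sgn_powr \<xi>2 (- snd l + of_nat CARD('n) / 2) (det (b22 (qpart g))) * \<Psi> g else 0)"

lemma qpart_blocks:
 fixes g :: "('n::{finite,linorder}) big"
 assumes g: "invertible g"
 shows "b21 (qpart g) = 0" "invertible (qpart g)" "det (b11 (qpart g)) ~= 0" "det (b22 (qpart g)) ~= 0"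
  "qpart g = block_matrix (b11 (qpart g)) (b12 (qpart g)) 0 (b22 (qpart g))" "invertible (kap g)"
proof -
 show b: "b21 (qpart g) = 0" using qpart_block[OF g] by (simp add: b21_def vec_eq_iff)
 have "det g = det (kap g) * det (qpart g)" using kap_qpart[OF g] det_mul by metis
 then show i: "invertible (qpart g)" "invertible (kap g)" using g by (auto simp: invertible_det_nz)
 show "det (b11 (qpart g)) ~= 0" "det (b22 (qpart g)) ~= 0"
  using block_upper_invertible[OF i(1) b] by (auto simp: invertible_det_nz)
 show "qpart g = block_matrix (b11 (qpart g)) (b12 (qpart g)) 0 (b22 (qpart g))" using block_eta[of "qpart g"] b by simp
qed

lemma pi_space_kap:
 fixes f :: "('n::{finite,linorder}) big => complex"
 assumes f: "f \<in> pi_space (\<xi>1, \<xi>2) l" and g: "invertible g"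
 shows "f g = sgn_powr \<xi>1 (- fst l - of_nat CARD('n) / 2) (det (b11 (qpart g))) *
  sgn_powr \<xi>2 (- snd l + of_nat CARD('n) / 2) (det (b22 (qpart g))) * f (kap g)"
proof -
 obtain l1 l2 where l: "l = (l1, l2)" by fastforce
 have "f g = f (kap g ** block_matrix (b11 (qpart g)) (b12 (qpart g)) 0 (b22 (qpart g)))"
  using kap_qpart[OF g] qpart_blocks(5)[OF g] by simp
 also have "... = sgn_powr \<xi>1 (- l1 - of_nat CARD('n) / 2) (det (b11 (qpart g))) *
  sgn_powr \<xi>2 (- l2 + of_nat CARD('n) / 2) (det (b22 (qpart g))) * f (kap g)"
  by (rule pi_spaceD(3)[OF f[unfolded l]]) (use qpart_blocks[OF g] in "auto simp: invertible_det_nz")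
 finally show ?thesis by (simp add: l)
qed

lemma pi_space_eq_fl:
 fixes f :: "('n::{finite,linorder}) big => complex"
 assumes f: "f \<in> pi_space (\<xi>1, \<xi>2) l" and \<Psi>: "!!g. invertible g ==> \<Psi> g = f (kap g)"
 shows "fl \<Psi> l = f"
proof
 fix g
 show "fl \<Psi> l g = f g"
 proof (cases "invertible g")
  case True
  then show ?thesis using pi_space_kap[OF f True] \<Psi> by (simp add: fl_def)
 next
  case False
  then show ?thesis using pi_spaceD(2)[of f \<xi>1 \<xi>2 "fst l" "snd l"] f by (simp add: fl_def)
 qed
qed

lemma smooth_kap_compose:
 fixes f :: "('n::{finite,linorder}) big => complex"
 assumes "smooth GL f" shows "smooth GL (%g. f (kap g))"
 by (rule smooth_compose[OF open_GL open_GL _ smooth_kap assms]) (use qpart_blocks(6) in auto)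

lemma smooth_fl_weight:
 fixes k :: "'a::euclidean_space => ('n::{finite,linorder}) big"
 assumes S: "open S" and k: "smooth S k" and inv: "k ` S \<subseteq> GL"
 shows "smooth S (%x. det (b11 (qpart (k x))))" "smooth S (%x. det (b22 (qpart (k x))))"
proof -
 have q: "smooth S (%x. qpart (k x))" by (rule smooth_compose[OF S open_GL inv k smooth_qpart])
 show "smooth S (%x. det (b11 (qpart (k x))))" "smooth S (%x. det (b22 (qpart (k x))))"
  by (intro smooth_intros S q)+
qed

text \<open>For block upper triangular \<open>p\<close> the orthogonal parts of \<open>g\<close> and \<open>g p\<close> differ by an
orthogonal block upper triangular matrix. Its diagonal blocks have determinant \<open>\<plusminus>1\<close>, where
characters do not depend on the exponent.\<close>

lemma fl_in_pi_space:
 fixes f :: "('n::{finite,linorder}) big => complex"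
 assumes f: "f \<in> pi_space (\<xi>1, \<xi>2) l"
 shows "fl (%g. f (kap g)) l' \<in> pi_space (\<xi>1, \<xi>2) l'"
proof -
 let ?n = "of_nat CARD('n) :: complex"
 let ?F = "fl (%g. f (kap g)) l'"
 obtain l1 l2 m1 m2 where l: "l = (l1, l2)" and l': "l' = (m1, m2)" by fastforce
 have "smooth GL ?F"
 proof (rule smooth_cong[OF open_GL])
  have id: "smooth GL (%g::'n big. g)" by (rule smooth_id[OF open_GL])
  show "smooth GL (%g. sgn_powr \<xi>1 (- fst l' - ?n / 2) (det (b11 (qpart g))) *
    sgn_powr \<xi>2 (- snd l' + ?n / 2) (det (b22 (qpart g))) * f (kap g))"
   using pi_spaceD(1)[OF f[unfolded l]]
   by (intro smooth_mult open_GL smooth_sgn_powr smooth_const smooth_kap_compose smooth_fl_weight[OF open_GL id])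
    (use qpart_blocks in auto)
 qed (simp add: fl_def)
 moreover have "?F (g ** block_matrix g1 b 0 g2) =
   sgn_powr \<xi>1 (- m1 - ?n / 2) (det g1) * sgn_powr \<xi>2 (- m2 + ?n / 2) (det g2) * ?F g"
  if g: "invertible g" and g1: "invertible g1" and g2: "invertible g2" for g g1 g2 b
 proof -
  let ?p = "block_matrix g1 b 0 g2"
  have p: "invertible ?p" by (rule block_upper_invertible_iff[OF g1 g2])
  have gp: "invertible (g ** ?p)" by (rule invertible_mult[OF g p])
  define k where "k = transpose (kap (g ** ?p)) ** kap g"
  have ok: "orthogonal_matrix k" unfolding k_def
   by (intro orthogonal_matrix_mul kap_orthogonal g gp) (simp add: orthogonal_matrix_transpose kap_orthogonal gp)
  have kk: "kap (g ** ?p) ** k = kap g"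
   using kap_orthogonal[OF gp] by (simp add: k_def matrix_mul_assoc orthogonal_matrix_def)
  have q: "qpart (g ** ?p) = k ** qpart g ** ?p"
  proof -
   have "qpart (g ** ?p) = transpose (kap (g ** ?p)) ** (kap g ** qpart g ** ?p)"
    unfolding qpart_def[of "g ** ?p"] by (simp add: kap_qpart[OF g])
   then show ?thesis by (simp add: k_def matrix_mul_assoc)
  qed
  have b21k: "b21 k = 0"
  proof -
   have "k = qpart (g ** ?p) ** matrix_inv ?p ** matrix_inv (qpart g)"
    using matrix_inv_both(1)[OF p] matrix_inv_both(1)[OF qpart_blocks(2)[OF g]] unfolding q
    by (simp add: matrix_mul_assoc[symmetric])
   moreover have "b21 (matrix_inv A) = 0" if A: "invertible A" "b21 A = 0" for A :: "'n big"
   proof -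
    have "b21 A ** b11 (matrix_inv A) + b22 A ** b21 (matrix_inv A) = 0"
     using arg_cong[OF matrix_inv_both(1)[OF A(1)], of b21] by (simp add: blocks_mult blocks_mat_1)
    then have "matrix_inv (b22 A) ** (b22 A ** b21 (matrix_inv A)) = 0" by (simp add: A)
    then show ?thesis using matrix_inv_both(2)[OF block_upper_invertible(2)[OF A]] by (simp add: matrix_mul_assoc)
   qed
   ultimately show ?thesis
    using qpart_blocks(1)[OF gp] qpart_blocks(1,2)[OF g] p by (simp add: blocks_mult)
  qed
  have ik: "invertible k" using ok by (meson invertibleI(2) orthogonal_matrix)
  have d: "det k ^ 2 = 1" using det_orthogonal_matrix[OF ok] by auto
  have kT: "transpose k ** k = mat 1" "k ** transpose k = mat 1" using ok by (simp_all add: orthogonal_matrix_def)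
  have bT: "b11 (transpose k) = transpose (b11 k)" "b22 (transpose k) = transpose (b22 k)" "b12 (transpose k) = transpose (b21 k)"
   by (simp_all add: b11_def b22_def b12_def b21_def transpose_def)
  have "transpose (b11 k) ** b11 k = mat 1"
   using arg_cong[OF kT(1), of b11] by (simp add: blocks_mult blocks_mat_1 b21k bT)
  then have d1: "\<bar>det (b11 k)\<bar> = 1"
   using det_orthogonal_matrix[of "b11 k"] by (auto simp: orthogonal_matrix)
  have "b22 k ** transpose (b22 k) = mat 1"
   using arg_cong[OF kT(2), of b22] by (simp add: blocks_mult blocks_mat_1 b21k bT)
  then have d2: "\<bar>det (b22 k)\<bar> = 1"
   using det_orthogonal_matrix[of "transpose (b22 k)"] by (auto simp: orthogonal_matrix)
  have qb: "b11 (qpart (g ** ?p)) = b11 k ** b11 (qpart g) ** g1" "b22 (qpart (g ** ?p)) = b22 k ** b22 (qpart g) ** g2"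
   using qpart_blocks(1)[OF g] b21k by (simp_all add: q blocks_mult)
  have "f (kap g) = f (kap (g ** ?p) ** block_matrix (b11 k) (b12 k) 0 (b22 k))"
   using kk block_eta[of k] b21k by simp
  also have "... = sgn_powr \<xi>1 (- l1 - ?n / 2) (det (b11 k)) * sgn_powr \<xi>2 (- l2 + ?n / 2) (det (b22 k)) * f (kap (g ** ?p))"
   by (rule pi_spaceD(3)[OF f[unfolded l]]) (use qpart_blocks(6)[OF gp] block_upper_invertible[OF ik b21k] in auto)
  also have "... = sgn_powr \<xi>1 (- m1 - ?n / 2) (det (b11 k)) * sgn_powr \<xi>2 (- m2 + ?n / 2) (det (b22 k)) * f (kap (g ** ?p))"
   using sgn_powr_abs_1[OF d1] sgn_powr_abs_1[OF d2] by metis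
  finally have fk: "f (kap g) = sgn_powr \<xi>1 (- m1 - ?n / 2) (det (b11 k)) * sgn_powr \<xi>2 (- m2 + ?n / 2) (det (b22 k)) * f (kap (g ** ?p))" .
  have "?F (g ** ?p) = sgn_powr \<xi>1 (- m1 - ?n / 2) (det (b11 (qpart (g ** ?p)))) * sgn_powr \<xi>2 (- m2 + ?n / 2) (det (b22 (qpart (g ** ?p)))) * f (kap (g ** ?p))"
   using gp by (simp add: fl_def l')
  also have "... = sgn_powr \<xi>1 (- m1 - ?n / 2) (det g1) * sgn_powr \<xi>2 (- m2 + ?n / 2) (det g2) * ?F g"
   unfolding fl_def if_P[OF g] fk qb det_mul sgn_powr_mult l' by (simp only: fst_conv snd_conv ac_simps)
  finally show ?thesis .
 qed
 ultimately show ?thesis by (simp add: pi_space_def l' smooth_GL_def smooth_def fl_def)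
qed

section \<open>The integrand as a function of the parameters\<close>

type_synonym 'n par = "((complex \<times> complex) \<times> complex) \<times> 'n cor"

abbreviation PS :: "('n::{finite,linorder}) par set" where "PS \<equiv> UNIV \<times> GL"

definition cscale :: "complex => (complex \<times> complex) \<times> complex => (complex \<times> complex) \<times> complex" where
 "cscale c w = ((c * fst (fst w), c * snd (fst w)), c * snd w)"

lemma open_PS: "open (PS :: ('n::{finite,linorder}) par set)"
 by (intro open_Times open_UNIV open_GL)

definition amp_fam :: "('n::{finite,linorder} big => complex) => 'n par \<times> 'n quad => complex" where
 "amp_fam \<Psi> q = amp (snd (fst (fst (fst q)))) (fl \<Psi> (fst (fst (fst q)))) (embed_corner (snd (fst q))) (snd q)"

lemma smooth_par:
 assumes "open T"
 shows "smooth T (%q::('n::{finite,linorder}) par \<times> 'n quad. fst (fst (fst (fst q))))"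
  "smooth T (%q::('n::{finite,linorder}) par \<times> 'n quad. snd (fst (fst (fst q))))"
  "smooth T (%q::('n::{finite,linorder}) par \<times> 'n quad. snd (fst q))"
  "smooth T (%q::('n::{finite,linorder}) par \<times> 'n quad. snd q)"
 by (intro smooth_bounded_linear assms bounded_linear_compose[OF bounded_linear_fst] bounded_linear_compose[OF bounded_linear_snd]
   bounded_linear_fst bounded_linear_snd)+

definition good :: "('n::{finite,linorder} par \<times> 'n quad) set" where
 "good = (PS \<times> UNIV) \<inter> {q. det (Gm (snd q)) ~= 0}"

text \<open>Below the bound \<open>1/2\<close> for the squared determinant the cutoff vanishes.\<close>

definition null_part :: "('n::{finite,linorder} par \<times> 'n quad) set" where
 "null_part = {q. det (Gm (snd q)) ^ 2 < 1/2}"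

lemma smooth_Gm_snd:
 assumes "open T"
 shows "smooth T (%q::('n::{finite,linorder}) par \<times> 'n quad. Gm (snd q))" "smooth T (%q::('n::{finite,linorder}) par \<times> 'n quad. omq (snd q))"
 by (rule smooth_compose[OF assms open_UNIV _ smooth_par(4)[OF assms]]; auto intro: smooth_Gm smooth_omq)+

lemma continuous_det_Gm_snd: "continuous_on UNIV (%q::('n::{finite,linorder}) par \<times> 'n quad. det (Gm (snd q)))"
 by (intro smooth_continuous smooth_det smooth_Gm_snd open_UNIV)

lemma open_good: "open good"
 unfolding good_def
 by (intro open_Int open_Times_UNIV open_PS open_Collect_neq continuous_det_Gm_snd continuous_on_const)

lemma open_null_part: "open null_part"
 unfolding null_part_def by (intro open_Collect_less continuous_on_power continuous_det_Gm_snd continuous_on_const)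

lemma good_null_cover: "PS \<times> UNIV \<subseteq> good \<union> null_part"
 by (auto simp: good_def null_part_def)

lemma amp_null_part: "q \<in> null_part ==> amp_fam \<Psi> q = 0"
 by (simp add: null_part_def amp_fam_def amp_def omq_def om_det_zero)

definition amp_arg :: "('n::{finite,linorder}) par \<times> 'n quad => 'n big" where
 "amp_arg q = embed_corner (snd (fst q)) ** Gm (snd q)"

definition amp_coeff :: "('n::{finite,linorder}) par \<times> 'n quad => complex" where
 "amp_coeff q = sgn_powr \<xi>1 (- fst (fst (fst (fst q))) - of_nat CARD('n) / 2) (det (b11 (qpart (amp_arg q)))) *
  sgn_powr \<xi>2 (- snd (fst (fst (fst q))) + of_nat CARD('n) / 2) (det (b22 (qpart (amp_arg q)))) *
  sgn_powr \<xi>2 (snd (fst (fst (fst q))) - 3 * of_nat CARD('n) / 2) (det (Gm (snd q))) * of_real (omq (snd q))"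

lemma amp_arg_GL: "q \<in> good ==> invertible (amp_arg q)"
 by (auto simp: good_def amp_arg_def invertible_det_nz det_mul invertible_embed[unfolded invertible_det_nz])

lemma good_nonzero:
 assumes "q \<in> good"
 shows "det (b11 (qpart (amp_arg q))) ~= 0" "det (b22 (qpart (amp_arg q))) ~= 0" "det (Gm (snd q)) ~= 0"
 using qpart_blocks(3,4)[OF amp_arg_GL[OF assms]] assms by (auto simp: good_def)

lemma amp_good: "q \<in> good ==> amp_fam \<Psi> q = amp_coeff q * \<Psi> (amp_arg q)"
 using amp_arg_GL[of q] by (simp add: amp_fam_def amp_def fl_def amp_coeff_def amp_arg_def[symmetric])

lemma smooth_amp_arg: "open T ==> smooth T amp_arg"
 unfolding amp_arg_def[abs_def] by (intro smooth_matrix_mult smooth_embed smooth_par smooth_Gm_snd)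

lemma smooth_amp_coeff: "smooth good (amp_coeff)"
proof -
 have arg: "amp_arg ` good \<subseteq> GL" using amp_arg_GL by auto
 note w = smooth_fl_weight[OF open_good smooth_amp_arg[OF open_good] arg]
 show ?thesis unfolding amp_coeff_def[abs_def]
  by (intro smooth_mult open_good smooth_sgn_powr w smooth_intros smooth_par smooth_const
    smooth_det smooth_Gm_snd smooth_of_real good_nonzero; assumption)
qed

lemma smooth_null_zero: "smooth_null F S (%_ _. 0)"
 by (simp add: smooth_null_def C_null_0)

text \<open>Where \<open>det (Gm x)\<close> is small the cutoff vanishes; elsewhere all factors are
smooth.\<close>

lemma amp_smooth_null:
 fixes \<Psi> :: "'i => ('n::{finite,linorder}) big => complex"
 assumes n: "smooth_null F GL \<Psi>"
 shows "smooth_null F (PS \<times> UNIV) (%i. amp_fam (\<Psi> i))"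
proof (rule smooth_null_open_cover[OF open_Times_UNIV[OF open_PS]])
 have "smooth_null F good (%i q. amp_coeff q * \<Psi> i (amp_arg q))"
  by (intro smooth_null_mult open_good smooth_amp_coeff smooth_null_compose[OF open_good open_GL _ smooth_amp_arg[OF open_good] n])
   (use amp_arg_GL in auto)
 then have g: "smooth_null F good (%i. amp_fam (\<Psi> i))"
  by (rule smooth_null_cong[OF open_good, rotated]) (simp add: amp_good)
 have z: "smooth_null F null_part (%i. amp_fam (\<Psi> i))"
  by (rule smooth_null_cong[OF open_null_part _ smooth_null_zero]) (simp add: amp_null_part)
 fix q :: "'n par \<times> 'n quad" assume "q \<in> PS \<times> UNIV"
 then show "\<exists>U. open U & q \<in> U & smooth_null F U (%i. amp_fam (\<Psi> i))"
  using good_null_cover g z open_good open_null_part by blast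
qed

lemma clin_linear:
 assumes L: "bounded_linear L" and uv: "L v = \<i> * L u"
 shows "clin u v S L"
 using dird_eq[OF bounded_linear_imp_has_derivative[OF L]] uv by (simp add: clin_def)

lemma clin_add:
 assumes "smooth S f" "smooth S g" "clin u v S f" "clin u v S g"
 shows "clin u v S (%x. f x + g x)"
proof -
 have "dird w (%x. f x + g x) x = dird w f x + dird w g x" if "x \<in> S" for w x
  by (rule dird_eq) (intro has_derivative_add smooth_has_derivative[OF assms(1) that] smooth_has_derivative[OF assms(2) that])
 then show ?thesis using assms by (simp add: clin_def algebra_simps)
qed

lemma clin_const: "clin u v S (%_. c)"
 by (simp add: clin_def frechet_derivative_const)

lemma clin_amp:
 fixes \<Psi> :: "('n::{finite,linorder}) big => complex"
 assumes s: "smooth GL \<Psi>"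
 shows "clin ((w, 0), 0) ((cscale \<i> w, 0), 0) (PS \<times> UNIV) (amp_fam \<Psi>)"
proof -
 let ?u = "((w, 0), 0) :: 'n par \<times> 'n quad" and ?v = "((cscale \<i> w, 0), 0) :: 'n par \<times> 'n quad"
 let ?n = "of_nat CARD('n) :: complex"
 let ?l1 = "%q::'n par \<times> 'n quad. fst (fst (fst (fst q)))" and ?l2 = "%q::'n par \<times> 'n quad. snd (fst (fst (fst q)))"
 note op = open_good
 have arg: "amp_arg ` good \<subseteq> GL" using amp_arg_GL by auto
 note wt = smooth_fl_weight[OF open_good smooth_amp_arg[OF open_good] arg]
 have bl: "bounded_linear ?l1" "bounded_linear ?l2"
  by (intro bounded_linear_compose[OF bounded_linear_fst] bounded_linear_compose[OF bounded_linear_snd] bounded_linear_fst bounded_linear_snd)+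
 have cl: "clin ?u ?v good ?l1" "clin ?u ?v good ?l2"
  by (rule clin_linear; simp add: bl cscale_def)+
 have m1: "smooth good (%q. (-1) * ?l1 q + (- ?n / 2))" "clin ?u ?v good (%q. (-1) * ?l1 q + (- ?n / 2))"
  by (intro smooth_intros smooth_par op clin_add clin_mult clin_const cl)+
 have m2: "smooth good (%q. (-1) * ?l2 q + ?n / 2)" "clin ?u ?v good (%q. (-1) * ?l2 q + ?n / 2)"
  by (intro smooth_intros smooth_par op clin_add clin_mult clin_const cl)+
 have m3: "smooth good (%q. ?l2 q + (- 3 * ?n / 2))" "clin ?u ?v good (%q. ?l2 q + (- 3 * ?n / 2))"
  by (intro smooth_add smooth_const smooth_par op clin_add clin_const cl)+
 note nz = good_nonzero
 have inv: "amp_arg (q + t *\<^sub>R ?u) = amp_arg q" "amp_arg (q + t *\<^sub>R ?v) = amp_arg q" for q t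
  by (simp_all add: amp_arg_def)
 have sG: "smooth good (%q::'n par \<times> 'n quad. det (Gm (snd q)))" by (intro smooth_det smooth_Gm_snd op)
 have so: "smooth good (%q::'n par \<times> 'n quad. of_real (omq (snd q)) :: complex)" by (intro smooth_of_real smooth_Gm_snd op)
 have s\<Psi>: "smooth good (%q. \<Psi> (amp_arg q))" by (rule smooth_compose[OF op open_GL arg smooth_amp_arg[OF op] s])
 let ?A = "%q. sgn_powr \<xi>1 ((-1) * ?l1 q + (- ?n / 2)) (det (b11 (qpart (amp_arg q))))"
 let ?B = "%q. sgn_powr \<xi>2 ((-1) * ?l2 q + ?n / 2) (det (b22 (qpart (amp_arg q))))"
 let ?C = "%q. sgn_powr \<xi>2 (?l2 q + (- 3 * ?n / 2)) (det (Gm (snd q)))"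
 have sA: "smooth good ?A" by (rule smooth_sgn_powr[OF op wt(1) nz(1) m1(1)])
 have sB: "smooth good ?B" by (rule smooth_sgn_powr[OF op wt(2) nz(2) m2(1)])
 have sC: "smooth good ?C" by (rule smooth_sgn_powr[OF op sG nz(3) m3(1)])
 have cA: "clin ?u ?v good ?A" by (rule clin_sgn_powr[OF op wt(1) nz(1) m1]) (simp_all only: inv)
 have cB: "clin ?u ?v good ?B" by (rule clin_sgn_powr[OF op wt(2) nz(2) m2]) (simp_all only: inv)
 have cC: "clin ?u ?v good ?C" by (rule clin_sgn_powr[OF op sG nz(3) m3]) simp_all
 have co: "clin ?u ?v good (%q. of_real (omq (snd q)))" by (rule clin_invariant[OF so]) simp_all
 have c\<Psi>: "clin ?u ?v good (%q. \<Psi> (amp_arg q))" by (rule clin_invariant[OF s\<Psi>]) (simp_all only: inv)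
 have sAll: "smooth good (%q. ?A q * ?B q * ?C q * of_real (omq (snd q)) * \<Psi> (amp_arg q))"
  by (intro smooth_mult op sA sB sC so s\<Psi>)
 have cAll: "clin ?u ?v good (%q. ?A q * ?B q * ?C q * of_real (omq (snd q)) * \<Psi> (amp_arg q))"
  by (intro clin_mult smooth_mult op sA sB sC so s\<Psi> cA cB cC co c\<Psi>)
 have g: "clin ?u ?v good (amp_fam \<Psi>)"
  by (rule clin_cong[OF op _ sAll cAll]) (simp add: amp_good amp_coeff_def)
 have z: "clin ?u ?v null_part (amp_fam \<Psi>)"
  by (rule clin_cong[OF open_null_part _ smooth_const clin_const[of _ _ _ 0]]) (simp add: amp_null_part)
 show ?thesis using g z good_null_cover unfolding clin_def by blast
qed

section \<open>The regularized operators\<close>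

definition wts :: "'n::{finite,linorder} quad => (bit \<times> ('n par => complex)) option" where
 "wts e = (if e = (elem last_idx last_idx, 0, 0, 0) then Some (\<eta> + \<xi>2, %p. snd (fst p) - snd (fst (fst p)) - of_nat CARD('n) / 2)
  else if \<exists>i. e = (0, 0, elem i i, 0) then
   (let i = (THE i. e = (0, 0, elem i i, 0)) in
    Some (fst (dexp 0 0 0 i), %p. snd (dexp (fst (fst (fst p))) (snd (fst (fst p))) (snd (fst p)) i)))
  else None)"

lemma elem_nonzero: "elem i j ~= (0 :: real^'n^'m)"
 by (metis elem_nth zero_index zero_neq_one)

lemma wts_diag: "wts (0, 0, elem i i, 0) = Some (fst (dexp 0 0 0 i),
  %p. snd (dexp (fst (fst (fst p))) (snd (fst (fst p))) (snd (fst p)) i))"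
 using elem_nonzero[of i i] by (auto simp: wts_def Let_def elem_eq_iff)

definition basis_list :: "('n::{finite,linorder}) quad list" where
 "basis_list = (SOME bs. distinct bs & set bs = Basis)"

lemma basis_list: "distinct (basis_list :: ('a::{finite,linorder}) quad list)" "set basis_list = (Basis :: 'a quad set)"
proof -
 have "\<exists>bs. distinct bs & set bs = (Basis :: ('a quad) set)" using finite_distinct_list[OF finite_Basis] by blast
 from someI_ex[OF this] show "distinct (basis_list :: 'a quad list)" "set basis_list = (Basis :: ('a quad) set)"
  unfolding basis_list_def by blast+
qed

text \<open>The regularization integrates over all coordinates, so its value at \<open>0\<close> is its only
value.\<close>

definition Jop :: "(('n::{finite,linorder}) par => 'n big => complex) => 'n par => complex" where
 "Jop f p = regs (RR TYPE('n)) (wt_at (wts) p) basis_list (%x. amp (snd (fst (fst p))) (f p) (embed_corner (snd p)) x) 0"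

abbreviation Jfl :: "('n::{finite,linorder} big => complex) => 'n par => complex" where
 "Jfl \<Psi> \<equiv> Jop (%p. fl \<Psi> (fst (fst p)))"

lemma RR_ge: "RR TYPE('n::finite) \<ge> 1" by (simp add: RR_def rad_def)

lemma amp_van:
 fixes g :: "('n::{finite,linorder}) big"
 shows "e \<in> Basis ==> van (RR TYPE('n)) e (amp l2 f g)"
 by (rule van_omq) (simp_all add: amp_def)

lemma wts_smooth:
 assumes "wts (e :: ('n::{finite,linorder}) quad) = Some (\<epsilon>, \<mu>)"
 shows "smooth PS \<mu>" "clin (w, 0) (cscale \<i> w, 0) PS \<mu>"
proof -
 let ?l1 = "%p::'n par. fst (fst (fst p))" and ?l2 = "%p::'n par. snd (fst (fst p))" and ?v = "%p::'n par. snd (fst p)"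
 have bl: "bounded_linear (%p. ?v p - ?l2 p)" "bounded_linear (%p. ?l1 p - ?v p)" "bounded_linear (%p. ?l1 p - ?l2 p)"
  by (intro bounded_linear_sub bounded_linear_compose[OF bounded_linear_fst] bounded_linear_compose[OF bounded_linear_snd] bounded_linear_fst bounded_linear_snd)+
 have ok: "smooth PS (%p. L p + c) & clin (w, 0) (cscale \<i> w, 0) PS (%p. L p + c)"
  if L: "bounded_linear L" "L (cscale \<i> w, 0) = \<i> * L (w, 0)" for L and c :: complex
  by (intro conjI smooth_add smooth_const smooth_bounded_linear L open_PS clin_add clin_const clin_linear)
 have form: "\<exists>L c. \<mu> = (%p. L p + c) & bounded_linear L & L (cscale \<i> w, 0) = \<i> * L (w, 0)"
 proof (cases "e = (elem last_idx last_idx, 0, 0, 0)")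
  case True
  then have "\<mu> = (%p. (?v p - ?l2 p) + (- of_nat CARD('n) / 2))" using assms by (simp add: wts_def)
  then show ?thesis using bl(1)
   by (intro exI[of _ "%p. ?v p - ?l2 p"] exI[of _ "- of_nat CARD('n) / 2"]) (auto simp: cscale_def algebra_simps)
 next
  case False
  then obtain i where "e = (0, 0, elem i i, 0)" using assms by (auto simp: wts_def split: if_splits)
  then have mu: "\<mu> = (%p. snd (dexp (?l1 p) (?l2 p) (?v p) i))"
   using assms by (simp add: wts_diag)
  show ?thesis
  proof (cases "i = last_idx")
   case True
   then have "\<mu> = (%p. (?l1 p - ?v p) + (- of_nat CARD('n) / 2))" using mu by (simp add: dexp_def)
   then show ?thesis using bl(2)
    by (intro exI[of _ "%p. ?l1 p - ?v p"] exI[of _ "- of_nat CARD('n) / 2"]) (auto simp: cscale_def algebra_simps)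
  next
   case False
   define c where "c = (of_nat (card {j. i < j}) :: complex)"
   have "\<mu> = (%p. ?l1 p - ?l2 p - of_nat CARD('n) + c)" using mu False by (simp add: dexp_def c_def)
   also have "... = (%p. (?l1 p - ?l2 p) + (- of_nat CARD('n) + c))" by (simp add: fun_eq_iff)
   finally show ?thesis using bl(3)
    by (intro exI[of _ "%p. ?l1 p - ?l2 p"] exI[of _ "- of_nat CARD('n) + c"]) (auto simp: cscale_def algebra_simps)
  qed
 qed
 then show "smooth PS \<mu>" "clin (w, 0) (cscale \<i> w, 0) PS \<mu>" using ok by auto
qed

lemma amp_fam_van: "e \<in> Basis ==> van (RR TYPE('n)) e (%x. amp_fam \<Psi> (p, x))" for e :: "('n::{finite,linorder}) quad"
 using amp_van[of e] by (simp add: amp_fam_def)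

lemma Jfl_smooth_null:
 fixes \<Psi> :: "'i => ('n::{finite,linorder}) big => complex"
 assumes n: "smooth_null F GL \<Psi>"
 shows "smooth_null F PS (%i. Jfl (\<Psi> i))"
proof -
 have "smooth_null F (PS \<times> UNIV) (%i (p, x). regs (RR TYPE('n)) (wt_at (wts) p) basis_list (%x. amp_fam (\<Psi> i) (p, x)) x)"
  by (rule smooth_null_regs[OF open_PS amp_smooth_null[OF n] wts_smooth(1) amp_fam_van RR_ge]) (simp_all add: basis_list)
 from smooth_null_slice[OF open_PS this, of 0] show ?thesis by (simp add: Jop_def[abs_def] amp_fam_def)
qed

lemma Jfl_smooth:
 fixes \<Psi> :: "('n::{finite,linorder}) big => complex"
 assumes "smooth GL \<Psi>"
 shows "smooth PS (Jfl \<Psi>)"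
 using assms Jfl_smooth_null[of bot "%_::unit. \<Psi>"] by (simp add: smooth_iff_smooth_null[where 'i=unit])

lemma Jfl_clin:
 fixes \<Psi> :: "('n::{finite,linorder}) big => complex"
 assumes s: "smooth GL \<Psi>"
 shows "clin (w, 0) (cscale \<i> w, 0) PS (Jfl \<Psi>)"
proof -
 let ?R = "%(p, x). regs (RR TYPE('n)) (wt_at (wts) p) basis_list (%x. amp_fam \<Psi> (p, x)) x"
 have sm: "smooth (PS \<times> UNIV) (amp_fam \<Psi>)"
  using s amp_smooth_null[of bot "%_::unit. \<Psi>"] by (simp add: smooth_iff_smooth_null[where 'i=unit])
 have cl: "clin ((w, 0), 0) ((cscale \<i> w, 0), 0) (PS \<times> UNIV) ?R"
  by (rule clin_regs[OF open_PS sm wts_smooth(1) amp_fam_van RR_ge clin_amp[OF s] wts_smooth(2)]) (simp_all add: basis_list)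
 have sR: "smooth (PS \<times> UNIV) ?R"
  using smooth_null_regs[OF open_PS amp_smooth_null[of bot "%_::unit. \<Psi>"] wts_smooth(1) amp_fam_van RR_ge, where es=basis_list] s
  by (simp add: smooth_iff_smooth_null[where 'i=unit] basis_list)
 have "clin (w, 0) (cscale \<i> w, 0) PS (%p. ?R (p, 0))"
 proof (rule clin_compose[OF sR cl])
  show "((%p::'n par. (p, 0 :: 'n quad)) has_derivative (%v. (v, 0))) (at p)" for p
   by (rule has_derivative_Pair[OF has_derivative_ident has_derivative_const])
 qed auto
 then show ?thesis by (simp add: Jop_def[abs_def] amp_fam_def)
qed

section \<open>Comparison with the convergent integral\<close>

lemma dexp_fst: "fst (dexp l1 l2 \<nu> i) = fst (dexp 0 0 0 i)"
 by (simp add: dexp_def)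

lemma elem_Basis: "elem i j \<in> Basis"
 by (auto simp: Basis_matrix)

lemma weights_product:
 fixes x :: "('n::{finite,linorder}) quad" and G :: "(bit \<times> complex) option => real => complex"
 assumes G: "!!s. G None s = 1"
 shows "(\<Prod>e\<in>Basis. G (wt_at (wts) (((l1, l2), \<nu>), h :: 'n cor) e) (x \<bullet> e)) =
  G (Some (\<eta> + \<xi>2, \<nu> - l2 - of_nat CARD('n) / 2)) (fst x $ last_idx $ last_idx) *
  (\<Prod>i\<in>UNIV. G (Some (dexp l1 l2 \<nu> i)) (fst (snd (snd x)) $ i $ i))"
proof -
 let ?g = "%e. G (wt_at (wts) (((l1, l2), \<nu>), h) e) (x \<bullet> e)"
 let ?e0 = "(elem last_idx last_idx, 0, 0, 0) :: 'n quad"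
 let ?d = "%i. (0, 0, elem i i, 0) :: 'n quad"
 have B: "insert ?e0 (range ?d) \<subseteq> Basis"
  by (auto simp: Basis_prod_def zero_prod_def elem_Basis)
 have "(\<Prod>e\<in>Basis. ?g e) = (\<Prod>e\<in>insert ?e0 (range ?d). ?g e)"
  by (rule prod.mono_neutral_right[OF finite_Basis B]) (auto simp: wts_def G)
 also have "... = ?g ?e0 * (\<Prod>e\<in>range ?d. ?g e)"
  by (rule prod.insert) (use elem_nonzero[of "last_idx :: 'n" "last_idx :: 'n"] in auto)
 also have "(\<Prod>e\<in>range ?d. ?g e) = (\<Prod>i\<in>UNIV. ?g (?d i))"
  by (subst prod.reindex) (auto simp: inj_def elem_eq_iff)
 also have "?g ?e0 = G (Some (\<eta> + \<xi>2, \<nu> - l2 - of_nat CARD('n) / 2)) (fst x $ last_idx $ last_idx)"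
  by (simp add: wts_def inner_prod_def inner_elem)
 also have "(\<Prod>i\<in>UNIV. ?g (?d i)) = (\<Prod>i\<in>UNIV. G (Some (dexp l1 l2 \<nu> i)) (fst (snd (snd x)) $ i $ i))"
 proof (rule prod.cong[OF refl])
  fix i :: 'n
  have "(fst (dexp 0 0 0 i), snd (dexp l1 l2 \<nu> i)) = dexp l1 l2 \<nu> i"
   by (metis dexp_fst prod.collapse)
  moreover have "x \<bullet> ?d i = fst (snd (snd x)) $ i $ i" by (simp add: inner_prod_def inner_elem)
  ultimately show "?g (?d i) = G (Some (dexp l1 l2 \<nu> i)) (fst (snd (snd x)) $ i $ i)"
   by (simp add: wts_diag)
 qed
 finally show ?thesis .
qed

lemma card_greater_pos: "i ~= (last_idx :: 'n::{finite,linorder}) ==> card {j. i < j} \<ge> 1"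
proof -
 assume "i ~= last_idx"
 then have "last_idx \<in> {j. i < j}" using last_idx_ge[of i] by (simp add: less_le)
 then show ?thesis by (metis One_nat_def Suc_leI card_gt_0_iff empty_iff finite)
qed

lemma card_greater_bij:
 "bij_betw (%i::'n::{finite,linorder}. card {j. i < j} + 1) (UNIV - {last_idx}) {2..CARD('n)}"
proof -
 let ?f = "%i::'n. card {j. i < j} + 1"
 have inj: "inj_on ?f (UNIV - {last_idx})"
 proof (rule linorder_inj_onI)
  fix x y :: 'n assume "x < y"
  then have "{j. y < j} \<subset> {j. x < j}" by auto
  from psubset_card_mono[OF _ this] show "?f x ~= ?f y" by simp
 qed auto
 have "?f ` (UNIV - {last_idx}) \<subseteq> {2..CARD('n)}"
 proof
  fix k assume "k \<in> ?f ` (UNIV - {last_idx})"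
  then obtain i :: 'n where i: "i ~= last_idx" "k = ?f i" by auto
  have "card {j. j <= i} \<ge> 1" by (auto simp: Suc_le_eq card_gt_0_iff)
  then show "k \<in> {2..CARD('n)}" using card_greater_pos[OF i(1)] card_le_lt[of i] i(2) by auto
 qed
 moreover have "card (?f ` (UNIV - {last_idx})) = card {2..CARD('n)}"
  using card_image[OF inj] by (simp add: card_Diff_singleton)
 ultimately have "?f ` (UNIV - {last_idx}) = {2..CARD('n)}" by (intro card_subset_eq) auto
 then show ?thesis using inj by (simp add: bij_betw_def)
qed

lemma weight_factors:
 "wt_factor (Some (\<eta> + \<xi>2, \<nu> - l2 - of_nat CARD('n) / 2)) *
  (\<Prod>i\<in>(UNIV :: 'n::{finite,linorder} set). wt_factor (Some (dexp l1 l2 \<nu> i))) =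
 inverse (n_A CARD('n) (\<xi>1, \<xi>2) (l1, l2) \<eta> \<nu>)"
proof -
 let ?n = "of_nat CARD('n) :: complex"
 let ?w = "%i::'n. wt_factor (Some (dexp l1 l2 \<nu> i))"
 let ?r = "%k::nat. rGamma ((l1 - l2 + of_nat k - ?n + of_bit (\<xi>1 + \<xi>2)) / 2)"
 have "(\<Prod>i\<in>UNIV - {last_idx}. ?w i) = (\<Prod>i\<in>UNIV - {last_idx :: 'n}. ?r (card {j. i < j} + 1))"
  by (rule prod.cong[OF refl]) (simp add: wt_factor_def dexp_def algebra_simps)
 also have "... = (\<Prod>k=2..CARD('n). ?r k)"
  by (rule prod.reindex_bij_betw[OF card_greater_bij])
 finally have p: "(\<Prod>i\<in>UNIV - {last_idx}. ?w i) = (\<Prod>k=2..CARD('n). ?r k)" .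
 have "(\<Prod>i\<in>UNIV. ?w i) = ?w last_idx * (\<Prod>k=2..CARD('n). ?r k)"
  unfolding p[symmetric] by (rule prod.remove) auto
 moreover have "?w last_idx = rGamma ((l1 - \<nu> + 1 - ?n / 2 + of_bit (\<xi>1 + \<eta>)) / 2)"
  by (simp only: wt_factor_def dexp_def if_True simp_thms option.case prod.case) (simp add: algebra_simps)
 moreover have "wt_factor (Some (\<eta> + \<xi>2, \<nu> - l2 - ?n / 2)) = rGamma ((\<nu> - l2 + 1 - ?n / 2 + of_bit (\<xi>2 + \<eta>)) / 2)"
  by (simp only: wt_factor_def option.case prod.case add.commute[of \<eta> \<xi>2]) (simp add: algebra_simps)
 ultimately show ?thesis
  unfolding n_A_def prod.case Gamma_def inverse_mult_distrib prod_inversef[symmetric] by (simp add: o_def ac_simps)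
qed

context
 fixes l1 l2 \<nu> :: complex and f :: "('n::{finite,linorder}) big => complex"
 assumes f: "f \<in> pi_space (\<xi>1, \<xi>2) (l1, l2)"
  and conv: "Re (l1 - \<nu>) > (real CARD('n) - 2) / 2" "Re (\<nu> - l2) > (real CARD('n) - 2) / 2"
begin

lemma wts_conv: "wt_conv (wt_at (wts) (((l1, l2), \<nu>), h) (e :: 'n quad))"
proof (cases "e = (elem last_idx last_idx, 0, 0, 0)")
 case True
 then show ?thesis using conv by (simp add: wts_def wt_conv_def field_simps)
next
 case False
 show ?thesis
 proof (cases "\<exists>i. e = (0, 0, elem i i, 0)")
  case True
  then obtain i where e: "e = (0, 0, elem i i, 0)" by blast
  show ?thesis
  proof (cases "i = last_idx")
   case True
   then show ?thesis using conv by (simp add: e wts_diag wt_conv_def dexp_def field_simps)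
  next
   case False
   then show ?thesis using conv card_greater_pos[OF False]
    by (simp add: e wts_diag wt_conv_def dexp_def field_simps)
  qed
 qed (use False in "simp add: wts_def wt_conv_def")
qed

text \<open>In the convergent region the regularized integral is the true one times the product of the
reciprocal gamma factors.\<close>

lemma Jop_convergent:
 assumes h: "invertible (h :: 'n cor)"
 shows "integrable lborel (Yfun l2 \<nu> f (embed_corner h))"
  and "Jop (%_. f) (((l1, l2), \<nu>), h) = inverse (n_A CARD('n) (\<xi>1, \<xi>2) (l1, l2) \<eta> \<nu>) *
   (of_real (c0 TYPE('n)) * (LINT Y|lborel. Yfun l2 \<nu> f (embed_corner h) Y))"
proof -
 let ?p = "(((l1, l2), \<nu>), h)"
 let ?\<phi> = "amp l2 f (embed_corner h)"
 let ?wt = "wt_at (wts) ?p"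
 let ?\<Psi> = "%g. f (kap g)"
 have fl: "fl ?\<Psi> (l1, l2) = f" by (rule pi_space_eq_fl[OF f]) simp
 have s\<Psi>: "smooth GL ?\<Psi>" by (rule smooth_kap_compose[OF pi_spaceD(1)[OF f]])
 have "smooth (PS \<times> UNIV) (amp_fam ?\<Psi>)"
  using s\<Psi> amp_smooth_null[of bot "%_::unit. ?\<Psi>"] by (simp add: smooth_iff_smooth_null[where 'i=unit])
 from smooth_slice[OF open_PS this, of ?p] have s: "smooth UNIV ?\<phi>"
  using h by (simp add: amp_fam_def fl)
 have rc: "integrable lborel (%x. (\<Prod>e\<in>Basis. wt_fun (?wt e) (x \<bullet> e)) * ?\<phi> x)"
  "regs (RR TYPE('n)) ?wt basis_list ?\<phi> 0 = (\<Prod>e\<in>Basis. wt_factor (?wt e)) * (LINT x|lborel. (\<Prod>e\<in>Basis. wt_fun (?wt e) (x \<bullet> e)) * ?\<phi> x)"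
  by (rule regs_convergent[OF RR_ge basis_list s amp_van wts_conv]; assumption)+
 have eq: "(\<Prod>e\<in>Basis. wt_fun (?wt e) (x \<bullet> e)) * ?\<phi> x =
  sgn_powr (\<eta> + \<xi>2) (\<nu> - l2 - of_nat CARD('n) / 2) (fst x $ last_idx $ last_idx) *
  Kz l1 l2 \<nu> (fst (snd (snd x))) * ?\<phi> x" for x
 proof -
  have "(\<Prod>e\<in>Basis. wt_fun (?wt e) (x \<bullet> e)) = wt_fun (Some (\<eta> + \<xi>2, \<nu> - l2 - of_nat CARD('n) / 2)) (fst x $ last_idx $ last_idx) *
    (\<Prod>i\<in>UNIV. wt_fun (Some (dexp l1 l2 \<nu> i)) (fst (snd (snd x)) $ i $ i))"
   by (rule weights_product) (simp add: wt_fun_def)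
  then show ?thesis by (simp add: wt_fun_def Kz_def case_prod_unfold)
 qed
 have fac: "(\<Prod>e\<in>Basis. wt_factor (?wt e)) = inverse (n_A CARD('n) (\<xi>1, \<xi>2) (l1, l2) \<eta> \<nu>)"
  unfolding weight_factors[symmetric, where 'n='n]
  by (rule weights_product[of "%w _. wt_factor w"]) (simp add: wt_factor_def)
 note q = quad_integral[OF f invertible_embed[OF h], of \<nu>]
 have int: "integrable lborel (%x. sgn_powr (\<eta> + \<xi>2) (\<nu> - l2 - of_nat CARD('n) / 2) (fst x $ last_idx $ last_idx) *
  Kz l1 l2 \<nu> (fst (snd (snd x))) * ?\<phi> x)"
  using rc(1) unfolding eq .
 show "integrable lborel (Yfun l2 \<nu> f (embed_corner h))" by (rule q(1)[OF int])
 have "Jop (%_. f) ?p = regs (RR TYPE('n)) ?wt basis_list ?\<phi> 0" by (simp add: Jop_def)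
 also have "... = inverse (n_A CARD('n) (\<xi>1, \<xi>2) (l1, l2) \<eta> \<nu>) *
   (of_real (c0 TYPE('n)) * (LINT Y|lborel. Yfun l2 \<nu> f (embed_corner h) Y))"
  unfolding rc(2) fac eq q(2)[OF int] ..
 finally show "Jop (%_. f) ?p = inverse (n_A CARD('n) (\<xi>1, \<xi>2) (l1, l2) \<eta> \<nu>) *
   (of_real (c0 TYPE('n)) * (LINT Y|lborel. Yfun l2 \<nu> f (embed_corner h) Y))" .
qed

end

lemma Jfl_eq: "Jfl \<Psi> (z, h) = Jop (%_. fl \<Psi> (fst z)) (z, h)"
 by (simp add: Jop_def)

section \<open>Continuation of the equivariance\<close>

lemma cscale_decompose: "cscale s w = Re s *\<^sub>R w + Im s *\<^sub>R cscale \<i> w"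
 by (simp add: cscale_def prod_eq_iff complex_eq_iff)

lemma clin_derivative:
 fixes J :: "('n::{finite,linorder}) par => complex"
 assumes J: "smooth PS J" and cl: "clin (w, 0) (cscale \<i> w, 0) PS J" and p: "p \<in> PS"
 shows "dird (cscale s w, 0) J p = s * dird (w, 0) J p"
proof -
 have L: "linear (%v. dird v J p)" by (rule has_derivative_linear[OF smooth_has_derivative[OF J p]])
 have "(cscale s w, 0 :: 'n cor) = Re s *\<^sub>R (w, 0) + Im s *\<^sub>R (cscale \<i> w, 0)" by (simp add: cscale_decompose[of s])
 then have "dird (cscale s w, 0) J p = Re s *\<^sub>R dird (w, 0) J p + Im s *\<^sub>R dird (cscale \<i> w, 0) J p"
  by (simp only: linear_add[OF L] linear_scale[OF L])
 also have "dird (cscale \<i> w, 0) J p = \<i> * dird (w, 0) J p" using cl p unfolding clin_def by blast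
 finally show ?thesis by (simp add: complex_eq_iff)
qed

lemma holomorphic_line:
 fixes J :: "('n::{finite,linorder}) par => complex"
 assumes J: "smooth PS J" and cl: "clin (w, 0) (cscale \<i> w, 0) PS J" and h: "invertible h"
 shows "(%\<zeta>. J (z + cscale \<zeta> w, h)) holomorphic_on UNIV"
proof (rule holomorphic_onI)
 fix \<zeta> :: complex
 have p: "(z + cscale \<zeta> w, h) \<in> PS" using h by simp
 have "bounded_linear (%s. cscale s w)"
  unfolding cscale_def by (intro bounded_linear_Pair bounded_linear_mult_left)
 then have "((%\<zeta>. (z + cscale \<zeta> w, h)) has_derivative (%s. (0 + cscale s w, 0))) (at \<zeta>)"
  by (intro has_derivative_Pair has_derivative_add has_derivative_const bounded_linear_imp_has_derivative)
 from has_derivative_compose[OF this smooth_has_derivative[OF J p]]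
 have "((%\<zeta>. J (z + cscale \<zeta> w, h)) has_derivative (%s. dird (cscale s w, 0) J (z + cscale \<zeta> w, h))) (at \<zeta>)" by simp
 then have "((%\<zeta>. J (z + cscale \<zeta> w, h)) has_field_derivative dird (w, 0) J (z + cscale \<zeta> w, h)) (at \<zeta>)"
  unfolding has_field_derivative_def clin_derivative[OF J cl p] by (simp add: mult.commute[of _ "dird _ _ _"])
 then show "(%\<zeta>. J (z + cscale \<zeta> w, h)) field_differentiable at \<zeta> within UNIV"
  unfolding field_differentiable_def by auto
qed

lemma sgn_powr_holomorphic:
 assumes "x ~= 0" shows "(%\<zeta>. sgn_powr e (c + d * \<zeta>) x) holomorphic_on UNIV"
 unfolding sgn_powr_exp[OF assms] by (intro holomorphic_intros)

definition chi :: "complex => complex => complex => 'n::{finite,linorder} cor => complex" where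
 "chi l1 l2 \<nu> p = sgn_powr \<xi>2 (- l2 - of_nat CARD('n) / 2) (principal_minor {i. corner_block i = 0} p) *
  sgn_powr \<eta> (- \<nu>) (principal_minor {i. corner_block i = 1} p) *
  sgn_powr \<xi>1 (- l1 + of_nat CARD('n) / 2) (principal_minor {i. corner_block i = 2} p)"

text \<open>Both sides are entire along the line \<open>(l1 + \<zeta>, l2 - \<zeta>, \<nu>)\<close>, on which
\<open>f\<close> moves in its flat family, and they agree for large \<open>Re \<zeta>\<close>, where the integral
converges.\<close>

lemma Jop_equivariance:
 fixes f :: "('n::{finite,linorder}) big => complex"
 assumes f: "f \<in> pi_space (\<xi>1, \<xi>2) (l1, l2)" and h: "invertible h" and p: "invertible p"
  and upper: "\<forall>i j. corner_block j < corner_block i --> p $ i $ j = 0"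
 shows "Jop (%_. f) (((l1, l2), \<nu>), h ** p) = chi l1 l2 \<nu> p * Jop (%_. f) (((l1, l2), \<nu>), h)"
proof -
 let ?\<Psi> = "%g. f (kap g)" and ?z = "((l1, l2), \<nu>)" and ?w = "((1, -1), 0) :: (complex \<times> complex) \<times> complex"
 let ?J = "Jfl ?\<Psi>"
 have s\<Psi>: "smooth GL ?\<Psi>" by (rule smooth_kap_compose[OF pi_spaceD(1)[OF f]])
 have hp: "invertible (h ** p)" by (rule invertible_mult[OF h p])
 note hol = holomorphic_line[OF Jfl_smooth[OF s\<Psi>] Jfl_clin[OF s\<Psi>, of ?w]]
 define d0 d1 d2 where d: "d0 = principal_minor {i. corner_block i = 0} p" "d1 = principal_minor {i. corner_block i = 1} p"
  "d2 = principal_minor {i. corner_block i = 2} p"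
 have "det (b11 (embed_corner p)) ~= 0" "det (b22 (embed_corner p)) ~= 0"
  using block_upper_invertible[OF invertible_embed[OF p] embed_b21[OF upper]] by (simp_all add: invertible_det_nz)
 then have nz: "d0 ~= 0" "d1 ~= 0" "d2 ~= 0" using corner_minors[OF upper] by (auto simp: d)
 have z: "?z + cscale \<zeta> ?w = ((l1 + \<zeta>, l2 - \<zeta>), \<nu>)" for \<zeta> by (simp add: cscale_def)
 (* For Re \<zeta> > K the shifted parameters lie in the region of convergence. *)
 define K where "K = max (real CARD('n) / 2 - Re (l1 - \<nu>)) (real CARD('n) / 2 - Re (\<nu> - l2))"
 have chi_hol: "(%\<zeta>. chi (l1 + \<zeta>) (l2 - \<zeta>) \<nu> p) holomorphic_on UNIV"
 proof -
  have e: "chi (l1 + \<zeta>) (l2 - \<zeta>) \<nu> p = sgn_powr \<xi>2 ((- l2 - of_nat CARD('n) / 2) + 1 * \<zeta>) d0 *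
   sgn_powr \<eta> (- \<nu>) d1 * sgn_powr \<xi>1 ((- l1 + of_nat CARD('n) / 2) + (-1) * \<zeta>) d2" for \<zeta>
   by (simp add: chi_def d algebra_simps)
  show ?thesis unfolding e by (intro holomorphic_on_mult sgn_powr_holomorphic holomorphic_on_const nz)
 qed
 have "?J (?z + cscale 0 ?w, h ** p) = chi (l1 + 0) (l2 - 0) \<nu> p * ?J (?z + cscale 0 ?w, h)"
 proof (rule analytic_continuation_open[where s="{\<zeta>. Re \<zeta> > K}" and s'=UNIV
   and f="%\<zeta>. ?J (?z + cscale \<zeta> ?w, h ** p)" and g="%\<zeta>. chi (l1 + \<zeta>) (l2 - \<zeta>) \<nu> p * ?J (?z + cscale \<zeta> ?w, h)"])
  show "open {\<zeta>. Re \<zeta> > K}" by (simp add: open_halfspace_Re_gt)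
  have "of_real (K + 1) \<in> {\<zeta>. Re \<zeta> > K}" by simp
  then show "{\<zeta>. Re \<zeta> > K} ~= {}" by blast
  show "(%\<zeta>. ?J (?z + cscale \<zeta> ?w, h ** p)) holomorphic_on UNIV" by (rule hol[OF hp])
  show "(%\<zeta>. chi (l1 + \<zeta>) (l2 - \<zeta>) \<nu> p * ?J (?z + cscale \<zeta> ?w, h)) holomorphic_on UNIV"
   by (rule holomorphic_on_mult[OF chi_hol hol[OF h]])
  fix \<zeta> assume \<zeta>: "\<zeta> \<in> {\<zeta>. Re \<zeta> > K}"
  let ?F = "fl ?\<Psi> (l1 + \<zeta>, l2 - \<zeta>)"
  have F: "?F \<in> pi_space (\<xi>1, \<xi>2) (l1 + \<zeta>, l2 - \<zeta>)" by (rule fl_in_pi_space[OF f])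
  have c: "Re (l1 + \<zeta> - \<nu>) > (real CARD('n) - 2) / 2" "Re (\<nu> - (l2 - \<zeta>)) > (real CARD('n) - 2) / 2"
   using \<zeta> by (auto simp: K_def field_simps)
  show "?J (?z + cscale \<zeta> ?w, h ** p) = chi (l1 + \<zeta>) (l2 - \<zeta>) \<nu> p * ?J (?z + cscale \<zeta> ?w, h)"
   unfolding z Jfl_eq fst_conv Jop_convergent(2)[OF F c hp] Jop_convergent(2)[OF F c h] Yfun_equivariance[OF F h p upper]
   by (simp add: chi_def ac_simps)
 qed auto
 then show ?thesis
  unfolding z Jfl_eq fst_conv using pi_space_eq_fl[OF f, of ?\<Psi>] by simp
qed

section \<open>The intertwining property\<close>

text \<open>Division by \<open>c0\<close> undoes the thickening.\<close>

definition Aop :: "complex \<times> complex => complex => ('n::{finite,linorder} big => complex) => 'n cor => complex" where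
 "Aop l \<nu> f h = (if invertible h then of_real (inverse (c0 TYPE('n))) * Jop (%_. f) ((l, \<nu>), h) else 0)"

lemma c0_pos: "c0 TYPE('n::{finite,linorder}) > 0"
 by (rule omt_integral(2)[OF invertible_gY[of 0]])

lemma smooth_par_slice:
 fixes J :: "('n::{finite,linorder}) par => complex"
 assumes "smooth PS J" shows "smooth GL (%h. J (z, h))"
 by (rule smooth_compose[OF open_GL open_PS _ _ assms])
  (auto intro!: smooth_intros)

lemma Aop_smooth:
 fixes f :: "('n::{finite,linorder}) big => complex"
 assumes f: "f \<in> pi_space (\<xi>1, \<xi>2) l"
 shows "smooth GL (Aop l \<nu> f)"
proof (rule smooth_cong[OF open_GL])
 let ?\<Psi> = "%g. f (kap g)"
 have f': "f \<in> pi_space (\<xi>1, \<xi>2) (fst l, snd l)" using f by simp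
 show "smooth GL (%h. of_real (inverse (c0 TYPE('n))) * Jfl ?\<Psi> ((l, \<nu>), h))"
  by (intro smooth_intros smooth_par_slice Jfl_smooth smooth_kap_compose pi_spaceD(1)[OF f'])
 show "of_real (inverse (c0 TYPE('n))) * Jfl ?\<Psi> ((l, \<nu>), h) = Aop l \<nu> f h" if "h \<in> GL" for h
  using that pi_space_eq_fl[OF f, of ?\<Psi>] by (simp add: Aop_def Jfl_eq)
qed

lemma smooth_amp:
 fixes f :: "('n::{finite,linorder}) big => complex"
 assumes f: "f \<in> pi_space (\<xi>1, \<xi>2) l" and h: "invertible h"
 shows "smooth UNIV (amp (snd l) f (embed_corner h))"
proof -
 let ?\<Psi> = "%g. f (kap g)"
 have f': "f \<in> pi_space (\<xi>1, \<xi>2) (fst l, snd l)" using f by simp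
 have "smooth (PS \<times> UNIV) (amp_fam ?\<Psi>)"
  using smooth_kap_compose[OF pi_spaceD(1)[OF f']] amp_smooth_null[of bot "%_::unit. ?\<Psi>"]
  by (simp add: smooth_iff_smooth_null[where 'i=unit])
 from smooth_slice[OF open_PS this, of "((l, 0), h)"] show ?thesis
  using h pi_space_eq_fl[OF f, of ?\<Psi>] by (simp add: amp_fam_def)
qed

lemma Aop_linear:
 fixes f g :: "('n::{finite,linorder}) big => complex"
 assumes f: "f \<in> pi_space (\<xi>1, \<xi>2) l" and g: "g \<in> pi_space (\<xi>1, \<xi>2) l"
 shows "Aop l \<nu> (%x. a * f x + b * g x) = (%h. a * Aop l \<nu> f h + b * Aop l \<nu> g h)"
proof
 fix h :: "'n cor"
 show "Aop l \<nu> (%x. a * f x + b * g x) h = a * Aop l \<nu> f h + b * Aop l \<nu> g h"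
 proof (cases "invertible h")
  case True
  let ?p = "((l, \<nu>), h)" and ?h = "embed_corner h"
  have "amp (snd l) (%x. a * f x + b * g x) ?h = (%x. a * amp (snd l) f ?h x + b * amp (snd l) g ?h x)"
   by (simp add: amp_def fun_eq_iff algebra_simps)
  then have "Jop (%_. %x. a * f x + b * g x) ?p = a * Jop (%_. f) ?p + b * Jop (%_. g) ?p"
   using regs_lincomb[OF smooth_amp[OF f True] smooth_amp[OF g True] amp_van amp_van RR_ge, where es=basis_list and a=a and b=b]
   by (simp add: Jop_def basis_list)
  then show ?thesis using True by (simp add: Aop_def algebra_simps)
 qed (simp add: Aop_def)
qed

lemma wts_par: "wt_at (wts) (z, h) = wt_at (wts) (z, h')"
 by (simp add: wts_def fun_eq_iff Let_def)

lemma Aop_left_reg: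
 fixes f :: "('n::{finite,linorder}) big => complex"
 assumes h0: "invertible h0"
 shows "Aop l \<nu> (left_reg (embed_corner h0) f) = left_reg h0 (Aop l \<nu> f)"
proof
 fix h :: "'n cor"
 have amp: "amp (snd l) (left_reg (embed_corner h0) f) (embed_corner h) = amp (snd l) f (embed_corner (matrix_inv h0 ** h))"
  by (simp add: amp_def left_reg_def matrix_inv_embed[OF h0] embed_mult matrix_mul_assoc fun_eq_iff)
 have "Jop (%_. left_reg (embed_corner h0) f) ((l, \<nu>), h) = Jop (%_. f) ((l, \<nu>), matrix_inv h0 ** h)"
 proof -
  have "wt_at (wts) ((l, \<nu>), h) = wt_at (wts) ((l, \<nu>), matrix_inv h0 ** h)" by (rule wts_par)
  then show ?thesis unfolding Jop_def by (simp only: fst_conv snd_conv amp)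
 qed
 moreover have "invertible (matrix_inv h0 ** h) \<longleftrightarrow> invertible h"
  using h0 by (simp add: invertible_det_nz det_mul det_matrix_inv)
 ultimately show "Aop l \<nu> (left_reg (embed_corner h0) f) h = left_reg h0 (Aop l \<nu> f) h"
  by (simp add: Aop_def left_reg_def)
qed

lemma smooth_null_par_slice:
 fixes \<Phi> :: "'i => ('n::{finite,linorder}) par => complex"
 assumes "smooth_null F PS \<Phi>" shows "smooth_null F GL (%i h. \<Phi> i (z, h))"
 by (rule smooth_null_compose[OF open_GL open_PS _ _ assms])
  (auto intro!: smooth_intros)

lemma Aop_continuous:
 fixes f :: "('n::{finite,linorder}) big => complex" and F :: "'i => 'n big => complex"
 assumes f: "f \<in> pi_space (\<xi>1, \<xi>2) l" and F: "!!j. F j \<in> pi_space (\<xi>1, \<xi>2) l" and lim: "smooth_limit_O F f \<F>"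
 shows "smooth_limit_O (%j. Aop l \<nu> (F j)) (Aop l \<nu> f) \<F>"
proof -
 have sm: "smooth GL g" if "g \<in> pi_space (\<xi>1, \<xi>2) l" for g :: "'n big => complex"
  using pi_spaceD(1)[of g \<xi>1 \<xi>2 "fst l" "snd l"] that by simp
 let ?D = "%j x. F j x - f x"
 let ?\<Psi> = "%j g. ?D j (kap g)"
 have "smooth_limit_O ?D (%_. 0) \<F>" using lim smooth_limit_O_diff_iff[of F f \<F>] sm F f by blast
 then have n: "smooth_null \<F> GL ?\<Psi>"
  by (rule smooth_null_kap[rotated]) (intro smooth_diff open_GL sm F f)
 have "smooth_null \<F> GL (%j h. of_real (inverse (c0 TYPE('n))) * Jfl (?\<Psi> j) ((l, \<nu>), h))"
  by (intro smooth_null_mult open_GL smooth_const smooth_null_par_slice Jfl_smooth_null n)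
 then have "smooth_null \<F> GL (%j h. Aop l \<nu> (F j) h - Aop l \<nu> f h)"
 proof (rule smooth_null_cong[OF open_GL, rotated])
  fix j and h :: "'n cor" assume h: "h \<in> GL"
  have "fl (?\<Psi> j) l g = ?D j g" for g
  proof -
   have "fl (?\<Psi> j) l g = fl (%g. F j (kap g)) l g - fl (%g. f (kap g)) l g"
    by (simp add: fl_def algebra_simps)
   then show ?thesis using pi_space_eq_fl[OF F[of j]] pi_space_eq_fl[OF f] by simp
  qed
  then have "fl (?\<Psi> j) l = (%x. 1 * F j x + (-1) * f x)" by auto
  then have "of_real (inverse (c0 TYPE('n))) * Jfl (?\<Psi> j) ((l, \<nu>), h) = Aop l \<nu> (%x. 1 * F j x + (-1) * f x) h"
   unfolding Jfl_eq fst_conv using h by (simp add: Aop_def)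
  also have "... = 1 * Aop l \<nu> (F j) h + (-1) * Aop l \<nu> f h"
   using fun_cong[OF Aop_linear[OF F f, where a=1 and b="-1"]] .
  finally show "of_real (inverse (c0 TYPE('n))) * Jfl (?\<Psi> j) ((l, \<nu>), h) = Aop l \<nu> (F j) h - Aop l \<nu> f h"
   by simp
 qed
 then have "smooth_limit_O (%j h. Aop l \<nu> (F j) h - Aop l \<nu> f h) (%_. 0) \<F>" by (rule smooth_limit_O_null)
 then show ?thesis by (rule iffD2[OF smooth_limit_O_diff_iff[OF Aop_smooth[OF F] Aop_smooth[OF f]]])
qed

lemma Aop_intertwining:
 "intertwining_operator (\<xi>1, \<xi>2) (l1, l2) (\<xi>2, \<eta>, \<xi>1) (l2, \<nu>, l1)
  (Aop (l1, l2) \<nu> :: ('n::{finite,linorder} big => complex) => _)"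
 unfolding intertwining_operator_def
proof (intro conjI ballI allI impI)
 fix f :: "'n big => complex" assume f: "f \<in> pi_space (\<xi>1, \<xi>2) (l1, l2)"
 have "Aop (l1, l2) \<nu> f (h ** p) = chi l1 l2 \<nu> p * Aop (l1, l2) \<nu> f h"
  if "invertible h" "invertible p" "\<forall>i j. corner_block j < corner_block i --> p $ i $ j = 0" for h p
  using Jop_equivariance[OF f that] that by (simp add: Aop_def invertible_mult)
 then show "Aop (l1, l2) \<nu> f \<in> tau_space (\<xi>2, \<eta>, \<xi>1) (l2, \<nu>, l1)"
  using Aop_smooth[OF f] by (auto simp: tau_space_def smooth_GL_def smooth_def chi_def) (simp_all add: Aop_def)
qed (auto intro: Aop_linear Aop_left_reg Aop_continuous)

lemma Aop_extends:
 "extends_normalized_A (\<xi>1, \<xi>2) \<eta> (Aop :: _ => _ => ('n::{finite,linorder} big => complex) => _)"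
 unfolding extends_normalized_A_def
proof (intro allI impI ballI conjI)
 fix l1 l2 \<nu> and f :: "'n big => complex" and h :: "'n cor"
 assume c: "(real CARD('n) - 2) / 2 < Re (l1 - \<nu>) & (real CARD('n) - 2) / 2 < Re (\<nu> - l2)"
  and f: "f \<in> pi_space (\<xi>1, \<xi>2) (l1, l2)" and h: "h \<in> GL"
 have h': "invertible h" using h by simp
 note J = Jop_convergent[OF f conjunct1[OF c] conjunct2[OF c] h']
 show "integrable lborel (A_integrand (\<xi>1, \<xi>2) (l1, l2) \<eta> \<nu> f h)" using J(1) A_integrand_Y(1)[OF f h'] by simp
 show "Aop (l1, l2) \<nu> f h = inverse (n_A CARD('n) (\<xi>1, \<xi>2) (l1, l2) \<eta> \<nu>) * A_int (\<xi>1, \<xi>2) (l1, l2) \<eta> \<nu> f h"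
  using J(2) A_integrand_Y(2)[OF f h', of \<nu>] h' c0_pos[where 'n='n] by (simp add: Aop_def)
qed

section \<open>Holomorphic dependence\<close>

text \<open>Mean value estimate for \<open>u \<mapsto> J(z + u, h) - D J(z, h) u\<close>, with uniform
continuity of the first derivatives on compact sets.\<close>

lemma difference_quotient_null_loc:
 fixes J :: "('n::{finite,linorder}) par => complex"
 assumes J: "smooth PS J"
 shows "null_loc (at 0) GL (%w h. (J (z + w, h) - J (z, h) - dird (w, 0) J (z, h)) / of_real (norm w))"
 unfolding null_loc_def
proof (intro conjI allI impI)
 fix w
 have "smooth GL (%h. J (z + w, h) - J (z, h) - dird (w, 0) J (z, h))"
  by (intro smooth_diff open_GL smooth_par_slice J smooth_dird)
 from smooth_continuous[OF this]
 show "continuous_on GL (%h. (J (z + w, h) - J (z, h) - dird (w, 0) J (z, h)) / of_real (norm w))"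
  by (cases "w = 0") (auto intro!: continuous_on_divide continuous_on_const)
next
 fix K :: "'n cor set" assume K: "compact K & K \<subseteq> GL"
 let ?B = "Basis :: ((complex \<times> complex) \<times> complex) set"
 show "uniform_limit K (%w h. (J (z + w, h) - J (z, h) - dird (w, 0) J (z, h)) / of_real (norm w)) (%_. 0) (at 0)"
 proof (rule uniform_limitI)
  fix e :: real assume e: "e > 0"
  (* The derivative of the remainder is bounded by the oscillation of the partial derivatives,
     summed over a basis; this choice of e' keeps the sum below e. *)
  define e' where "e' = e / (2 * real (card ?B) + 1)"
  have e': "e' > 0" using e by (simp add: e'_def)
  have "\<exists>d>0. \<forall>b\<in>?B. \<forall>h\<in>K. \<forall>w. norm w <= d --> norm (dird (b, 0) J (z + w, h) - dird (b, 0) J (z, h)) <= e'"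
  proof -
   have "\<exists>d>0. \<forall>h\<in>K. \<forall>w. norm w <= d --> norm (dird (b, 0) J (z + w, h) - dird (b, 0) J (z, h)) <= e'" for b
   proof -
    have "compact (cball z 1 \<times> K)" using K by (intro compact_Times) auto
    moreover have "continuous_on (cball z 1 \<times> K) (dird (b, 0) J)"
     by (rule continuous_on_subset[OF smooth_continuous[OF smooth_dird[OF J]]]) (use K in auto)
    ultimately have "uniformly_continuous_on (cball z 1 \<times> K) (dird (b, 0) J)"
     by (intro compact_uniformly_continuous)
    then obtain d where d: "d > 0" "!!x y. x \<in> cball z 1 \<times> K ==> y \<in> cball z 1 \<times> K ==> dist y x < d ==>
      dist (dird (b, 0) J y) (dird (b, 0) J x) < e'"
     using e' unfolding uniformly_continuous_on_def by metis
    have "norm (dird (b, 0) J (z + w, h) - dird (b, 0) J (z, h)) <= e'" if "h \<in> K" "norm w <= min (d / 2) 1" for h w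
    proof -
     have "dist (dird (b, 0) J (z + w, h)) (dird (b, 0) J (z, h)) < e'"
      by (rule d(2)) (use that d(1) in "auto simp: dist_norm norm_Pair")
     then show ?thesis by (simp add: dist_norm)
    qed
    then show ?thesis using d(1) by (intro exI[of _ "min (d / 2) 1"]) auto
   qed
   then obtain d where d: "!!b. d b > 0" "!!b h w. h \<in> K ==> norm w <= d b ==> norm (dird (b, 0) J (z + w, h) - dird (b, 0) J (z, h)) <= e'"
    by metis
   have "Min (d ` ?B) > 0" using d(1) by (subst Min_gr_iff) auto
   moreover have "Min (d ` ?B) <= d b" if "b \<in> ?B" for b using that by (intro Min_le) auto
   ultimately show ?thesis using d(2) by (intro exI[of _ "Min (d ` ?B)"]) (meson order_trans)
  qed
  then obtain d where d: "d > 0" "!!b h w. b \<in> ?B ==> h \<in> K ==> norm w <= d ==>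
    norm (dird (b, 0) J (z + w, h) - dird (b, 0) J (z, h)) <= e'" by blast
  have "norm ((J (z + w, h) - J (z, h) - dird (w, 0) J (z, h)) / of_real (norm w)) < e"
   if w: "norm w < d" "w ~= 0" and h: "h \<in> K" for w h
  proof -
   have hG: "h \<in> GL" using K h by auto
   let ?L = "%v. dird (v, 0) J (z, h)"
   have L: "linear ?L"
    using linear_compose[of "%v. (v, 0)" "%v. dird v J (z, h)"] has_derivative_linear[OF smooth_has_derivative[OF J, of "(z, h)"]] hG
    by (simp add: o_def linear_iff)
   have der: "((%u. J (z + u, h) - ?L u) has_derivative (%v. dird (v, 0) J (z + u, h) - ?L v)) (at u within S)" for u S
   proof (rule has_derivative_diff)
    have "((%u. (z + u, h)) has_derivative (%v. (0 + v, 0))) (at u within S)"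
     by (intro has_derivative_Pair has_derivative_add has_derivative_const has_derivative_ident)
    from has_derivative_compose[OF this smooth_has_derivative[OF J, of "(z + u, h)"]]
    show "((%u. J (z + u, h)) has_derivative (%v. dird (v, 0) J (z + u, h))) (at u within S)" using hG by simp
    show "(?L has_derivative ?L) (at u within S)"
     by (rule bounded_linear_imp_has_derivative) (use L linear_conv_bounded_linear in blast)
   qed
   have on: "onorm (%v. dird (v, 0) J (z + u, h) - ?L v) <= real (card ?B) * e'" if u: "u \<in> cball 0 d" for u
   proof (rule onorm_le)
    fix v :: "(complex \<times> complex) \<times> complex"
    have lin: "linear (%v. dird (v, 0) J (z + u, h) - ?L v)"
     using has_derivative_linear[OF der[of u UNIV]] .
    have "dird (v, 0) J (z + u, h) - ?L v = (\<Sum>b\<in>?B. (v \<bullet> b) *\<^sub>R (dird (b, 0) J (z + u, h) - ?L b))"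
    proof -
     let ?G = "%v. dird (v, 0) J (z + u, h) - ?L v"
     have "?G (\<Sum>b\<in>?B. (v \<bullet> b) *\<^sub>R b) = (\<Sum>b\<in>?B. (v \<bullet> b) *\<^sub>R ?G b)"
      by (simp only: linear_sum[OF lin] linear_scale[OF lin])
     then show ?thesis by (simp only: euclidean_representation)
    qed
    also have "norm ... <= (\<Sum>b\<in>?B. norm v * e')"
    proof (rule order_trans[OF norm_sum], rule sum_mono)
     fix b assume b: "b \<in> ?B"
     have "\<bar>v \<bullet> b\<bar> <= norm v" by (rule Basis_le_norm[OF b])
     moreover have "norm (dird (b, 0) J (z + u, h) - ?L b) <= e'" using d(2)[OF b h, of u] u by simp
     ultimately show "norm ((v \<bullet> b) *\<^sub>R (dird (b, 0) J (z + u, h) - ?L b)) <= norm v * e'"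
      unfolding norm_scaleR by (intro mult_mono) auto
    qed
    finally show "norm (dird (v, 0) J (z + u, h) - ?L v) <= real (card ?B) * e' * norm v" by (simp add: mult.commute mult.left_commute)
   qed
   have "norm ((J (z + w, h) - ?L w) - (J (z + 0, h) - ?L 0)) <= real (card ?B) * e' * norm (w - 0)"
    by (rule differentiable_bound[where S="cball 0 d" and x=w and y=0, OF convex_cball der on]) (use w d in auto)
   then have "norm (J (z + w, h) - J (z, h) - ?L w) <= real (card ?B) * e' * norm w"
    using linear_0[OF L] by (simp add: algebra_simps)
   then have "norm ((J (z + w, h) - J (z, h) - ?L w) / of_real (norm w)) <= real (card ?B) * e'"
    using w by (simp add: norm_divide divide_le_eq)
   also have "... < e" using e by (simp add: e'_def divide_simps)
   finally show ?thesis .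
  qed
  then show "\<forall>\<^sub>F w in at 0. \<forall>h\<in>K. dist ((J (z + w, h) - J (z, h) - dird (w, 0) J (z, h)) / of_real (norm w)) 0 < e"
   unfolding eventually_at using d(1) by (intro exI[of _ d]) (auto simp: dist_norm)
 qed
qed

text \<open>Differentiating in \<open>h\<close> turns the difference quotient of \<open>J\<close> into that of a derivative of
\<open>J\<close>.\<close>

lemma difference_quotient_null:
 fixes J :: "('n::{finite,linorder}) par => complex"
 assumes "smooth PS J"
 shows "smooth_null (at 0) GL (%w h. (J (z + w, h) - J (z, h) - dird (w, 0) J (z, h)) / of_real (norm w))"
proof -
 have "C_null k (at 0) GL (%w h. (J (z + w, h) - J (z, h) - dird (w, 0) J (z, h)) / of_real (norm w))" for k
  using assms
 proof (induction k arbitrary: J)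
  case 0
  then show ?case using difference_quotient_null_loc by simp
 next
  case (Suc k)
  note J = \<open>smooth PS J\<close>
  let ?Q = "%J w h. (J (z + w, h) - J (z, h) - dird (w, 0) J (z, h)) / of_real (norm w) :: complex"
  show ?case
  proof (rule C_null_Suc_intro[OF open_GL difference_quotient_null_loc[OF J]])
   fix w and h :: "'n cor" assume h: "h \<in> GL"
   have slice: "((%h. G (y, h)) has_derivative (%v. dird (0, v) G (y, h))) (at h)" if G: "smooth PS G" for G :: "'n par => complex" and y
   proof -
    have "((%h. (y, h)) has_derivative (%v. (0, v))) (at h)"
     by (intro has_derivative_Pair has_derivative_const has_derivative_ident)
    from has_derivative_compose[OF this smooth_has_derivative[OF G, of "(y, h)"]] show ?thesis using h by simp
   qed
   have sym: "dird (0, v) (dird (w, 0) J) (z, h) = dird (w, 0) (dird (0, v) J) (z, h)" for v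
    by (rule dird_symmetric[OF open_PS smoothD[OF J]]) (use h in simp)
   have "((%h. J (z + w, h) - J (z, h) - dird (w, 0) J (z, h)) has_derivative
     (%v. dird (0, v) J (z + w, h) - dird (0, v) J (z, h) - dird (0, v) (dird (w, 0) J) (z, h))) (at h)"
    by (intro has_derivative_diff slice J smooth_dird)
   from has_derivative_mult_left[OF this, of "inverse (of_real (norm w))"]
   show "(?Q J w has_derivative (%v. ?Q (dird (0, v) J) w h)) (at h)"
    unfolding sym by (simp add: divide_inverse)
  next
   fix v
   show "C_null k (at 0) GL (%w h. ?Q (dird (0, v) J) w h)" by (rule Suc.IH[OF smooth_dird[OF J]])
  qed
 qed
 then show ?thesis by (simp add: smooth_null_def)
qed

lemma Aop_holomorphic:
 "holomorphic_operator_family (\<xi>1, \<xi>2) (Aop :: _ => _ => ('n::{finite,linorder} big => complex) => _)"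
 unfolding holomorphic_operator_family_def
proof (intro allI impI)
 fix \<phi> and f :: "complex \<times> complex => 'n big => complex"
 assume "\<forall>l. f l \<in> pi_space (\<xi>1, \<xi>2) l & (\<forall>k. orthogonal_matrix k --> f l k = \<phi> k)"
 then have f: "!!l. f l \<in> pi_space (\<xi>1, \<xi>2) l" and \<phi>: "!!l k. orthogonal_matrix k ==> f l k = \<phi> k" by auto
 define \<Psi> where "\<Psi> g = f (0, 0) (kap g)" for g
 have s\<Psi>: "smooth GL \<Psi>" unfolding \<Psi>_def by (rule smooth_kap_compose[OF pi_spaceD(1)[OF f]])
 have fl: "fl \<Psi> l = f l" for l
  by (rule pi_space_eq_fl[OF f]) (simp add: \<Psi>_def \<phi> kap_orthogonal)
 define J where "J p = of_real (inverse (c0 TYPE('n))) * Jfl \<Psi> p" for p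
 have sJ: "smooth PS J" unfolding J_def by (intro smooth_mult open_PS smooth_const Jfl_smooth s\<Psi>)
 have cJ: "clin (w, 0) (cscale \<i> w, 0) PS J" for w
  unfolding J_def by (intro clin_mult smooth_const Jfl_smooth s\<Psi> clin_const Jfl_clin)
 have A: "Aop l \<nu> (f l) h = (if invertible h then J ((l, \<nu>), h) else 0)" for l \<nu> h
 proof -
  have "Jfl \<Psi> ((l, \<nu>), h) = Jop (%_. f l) ((l, \<nu>), h)"
   by (subst Jfl_eq) (simp only: fst_conv fl)
  then show ?thesis by (simp only: Aop_def J_def)
 qed
 show "holomorphic_smooth_O (%(l, \<nu>). Aop l \<nu> (f l))"
  unfolding holomorphic_smooth_O_def
 proof
  fix z :: "(complex \<times> complex) \<times> complex"
  (* The partial derivatives sought are directional derivatives of J, extended by zero to singular h. *)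
  define D where "D u h = (if invertible h then dird (u, 0) J (z, h) else 0)" for u and h :: "'n cor"
  have D: "D u \<in> smooth_GL" for u
  proof -
   have "smooth GL (D u)"
    by (rule smooth_cong[OF open_GL _ smooth_par_slice[OF smooth_dird[OF sJ, of "(u, 0)"], of z]]) (simp add: D_def)
   then show ?thesis by (simp add: smooth_GL_def smooth_def D_def)
  qed
  let ?e1 = "((1, 0), 0) :: (complex \<times> complex) \<times> complex" and ?e2 = "((0, 1), 0) :: (complex \<times> complex) \<times> complex"
   and ?e3 = "((0, 0), 1) :: (complex \<times> complex) \<times> complex"
  have dec: "dird (w, 0) J (z, h) = fst (fst w) * D ?e1 h + snd (fst w) * D ?e2 h + snd w * D ?e3 h" if h: "invertible h" for w h
  proof -
   have p: "(z, h) \<in> PS" using h by simp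
   have L: "linear (%v. dird v J (z, h))" by (rule has_derivative_linear[OF smooth_has_derivative[OF sJ p]])
   have "(w, 0 :: 'n cor) = (cscale (fst (fst w)) ?e1, 0) + (cscale (snd (fst w)) ?e2, 0) + (cscale (snd w) ?e3, 0)"
    by (simp add: cscale_def prod_eq_iff)
   then show ?thesis
    using h by (simp only: linear_add[OF L] clin_derivative[OF sJ cJ p] D_def if_True simp_thms)
  qed
  have "smooth_null (at 0) GL (%w h. ((%(l, \<nu>). Aop l \<nu> (f l)) (z + w) h - (%(l, \<nu>). Aop l \<nu> (f l)) z h
    - (fst (fst w) * D ?e1 h + snd (fst w) * D ?e2 h + snd w * D ?e3 h)) / of_real (norm w))"
  proof (rule smooth_null_cong[OF open_GL _ difference_quotient_null[OF sJ, of z]])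
   fix w and h :: "'n cor" assume "h \<in> GL"
   then have h: "invertible h" by simp
   show "(J (z + w, h) - J (z, h) - dird (w, 0) J (z, h)) / of_real (norm w) =
    ((%(l, \<nu>). Aop l \<nu> (f l)) (z + w) h - (%(l, \<nu>). Aop l \<nu> (f l)) z h
    - (fst (fst w) * D ?e1 h + snd (fst w) * D ?e2 h + snd w * D ?e3 h)) / of_real (norm w)"
   proof -
    have "(%(l, \<nu>). Aop l \<nu> (f l)) y h = J (y, h)" for y by (cases y) (simp add: A h)
    then show ?thesis by (simp only: dec[OF h])
   qed
  qed
  from smooth_limit_O_null[OF this]
  show "\<exists>d1\<in>smooth_GL. \<exists>d2\<in>smooth_GL. \<exists>d3\<in>smooth_GL. smooth_limit_O
     (%w h. ((%(l, \<nu>). Aop l \<nu> (f l)) (z + w) h - (%(l, \<nu>). Aop l \<nu> (f l)) z h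
         - (fst (fst w) * d1 h + snd (fst w) * d2 h + snd w * d3 h)) / of_real (norm w)) (%h. 0) (at 0)"
   using D by blast
 qed
qed

end

theorem proposition3p1:
 fixes \<xi>1 \<xi>2 \<eta> :: bit
 shows "\<exists>\<A> :: complex \<times> complex \<Rightarrow> complex \<Rightarrow>
      (real^('n::{finite,linorder} + 'n)^('n + 'n) \<Rightarrow> complex) \<Rightarrow>
      (real^('n corner)^('n corner) \<Rightarrow> complex).
     extends_normalized_A (\<xi>1, \<xi>2) \<eta> \<A> \<and>
     (\<forall>l1 l2 \<nu>. intertwining_operator (\<xi>1, \<xi>2) (l1, l2) (\<xi>2, \<eta>, \<xi>1) (l2, \<nu>, l1) (\<A> (l1, l2) \<nu>)) \<and>
     holomorphic_operator_family (\<xi>1, \<xi>2) \<A>"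
 using Aop_extends Aop_intertwining Aop_holomorphic by blast

end
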